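(* Let $0<s<\min(1,n/2)$, suppose $\Omega\subset\mathbb{R}^n$ is a domain bounded in one direction, and let $W\subset\Omega_e$ be a measurement set. Then there exist two different pairs $(\gamma_1,q_1)$ and $(\gamma_2,q_2)$ with $\gamma_1,\gamma_2\in L^\infty(\mathbb{R}^n)$, $m_{\gamma_1},m_{\gamma_2}\in H^{s,n/s}(\mathbb{R}^n)$, $q_1,q_2\in\mathscr{D}'(\mathbb{R}^n)$, satisfying (i) $\gamma_1,\gamma_2$ are uniformly elliptic with some common lower bound $\gamma_0>0$; (ii) $\gamma_1,\gamma_2$ are a.e. continuous in $W$; (iii) $q_1,q_2\in M_{\gamma_0/\delta_0,+}(H^s\to H^{-s})\cap L^p_{loc}(W)$ for some $\frac{n}{2s}<p\le\infty$; and $\Lambda_{\gamma_1,q_1}f|_W=\Lambda_{\gamma_2,q_2}f|_W$ for all $f\in C_c^\infty(W)$, but $q_1(x)\ne q_2(x)$ for all $x\in W$ (for suitable representatives of the functions $q_1|_W,q_2|_W\in L^p_{loc}(W)$).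
   Context: All functions are real-valued. $\Omega_e=\mathbb{R}^n\setminus\overline{\Omega}$; a measurement set is a nonempty open subset of $\Omega_e$. An open set $\Omega\subset\mathbb{R}^n$ is bounded in one direction if there are $1\le k\le n$, a bounded open $\omega\subset\mathbb{R}^k$ and a rigid motion $A(x)=Lx+x_0$ ($L$ a linear isometry) with $\Omega\subset A(\mathbb{R}^{n-k}\times\omega)$. Function spaces: $H^{s,p}(\mathbb{R}^n)=\{u\in\mathscr{S}'(\mathbb{R}^n): \langle D\rangle^s u\in L^p(\mathbb{R}^n)\}$ with norm $\|\langle D\rangle^su\|_{L^p}$, where $\langle D\rangle^s$ is the Fourier multiplier with symbol $(1+|\xi|^2)^{s/2}$; $H^s=H^{s,2}$; $\widetilde H^s(\Omega)$ is the closure of $C_c^\infty(\Omega)$ in $H^s(\mathbb{R}^n)$; $X=H^s(\mathbb{R}^n)/\widetilde H^s(\Omega)$ (a function is identified with its class). $(-\Delta)^s$ is the Fourier multiplier with symbol $|\xi|^{2s}$ and, for $0<s<1$, $C_{n,s}>0$ is the constant with $(-\Delta)^su(x)=C_{n,s}\,\mathrm{p.v.}\int\frac{u(x)-u(y)}{|x-y|^{n+2s}}dy$. Set $[u]_{H^s(\mathbb{R}^n)}^2=\frac{C_{n,s}}{2}\iint\frac{|u(x)-u(y)|^2}{|x-y|^{n+2s}}dxdy=\|(-\Delta)^{s/2}u\|_{L^2}^2$. Constants: $\delta_0=2\max(1,C_{opt})$, where $C_{opt}^{-1}=\inf_{0\ne u\in\widetilde H^s(\Omega)}[u]^2_{H^s(\mathbb{R}^n)}/\|u\|^2_{L^2(\mathbb{R}^n)}$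 (positive because $\Omega$ is bounded in one direction). Coefficients: $\gamma\in L^\infty(\mathbb{R}^n)$ is uniformly elliptic with lower bound $\gamma_0>0$ if $\gamma\ge\gamma_0$ a.e.; its background deviation is $m_\gamma=\gamma^{1/2}-1$. "A.e. continuous in $W$" means continuous at almost every point of $W$. Multipliers: $q\in\mathscr{D}'(\mathbb{R}^n)$ is in $M(H^s\to H^{-s})$ if $\|q\|_s=\sup\{|\langle q,uv\rangle|: u,v\in C_c^\infty(\mathbb{R}^n),\ \|u\|_{H^s}=\|v\|_{H^s}=1\}<\infty$; then $(u,v)\mapsto\langle q,uv\rangle$ extends uniquely to a bounded bilinear form on $H^s(\mathbb{R}^n)$, written $\langle qu,v\rangle$. $M_\delta(H^s\to H^{-s})=\{q\in M(H^s\to H^{-s}):\|q\|_s<\delta\}$, $M_+(H^s\to H^{-s})$ is the set of nonnegative distributions in $M(H^s\to H^{-s})$, and $M_{\delta,+}(H^s\to H^{-s})=M_\delta(H^s\to H^{-s})+M_+(H^s\to H^{-s})$. $q\in L^p_{loc}(W)$ means that the restriction of $q$ to $W$ is an $L^p_{loc}(W)$ function. Equation and DN map: $B_\gamma(u,v)=\frac{C_{n,s}}{2}\int_{\mathbb{R}^{2n}}\gamma^{1/2}(x)\gamma^{1/2}(y)\frac{(u(x)-u(y))(v(x)-v(y))}{|x-y|^{n+2s}}dxdy$ and $B_{\gamma,q}(u,v)=B_\gamma(u,v)+\langle qu,v\rangle$ for $u,v\in H^s(\mathbb{R}^n)$. For $f\in X$, $u_f\in H^s(\mathbb{R}^n)$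 denotes the unique function with $u_f-f\in\widetilde H^s(\Omega)$ and $B_{\gamma,q}(u_f,\varphi)=0$ for all $\varphi\in\widetilde H^s(\Omega)$ (i.e. the weak solution of $L^s_\gamma u+qu=0$ in $\Omega$, $u=f$ in $\Omega_e$). The exterior DN map $\Lambda_{\gamma,q}:X\to X^*$ is $\langle\Lambda_{\gamma,q}f,g\rangle=B_{\gamma,q}(u_f,g)$. The equality $\Lambda_{\gamma_1,q_1}f|_{W}=\Lambda_{\gamma_2,q_2}f|_{W}$ means $\langle\Lambda_{\gamma_1,q_1}f,g\rangle=\langle\Lambda_{\gamma_2,q_2}f,g\rangle$ for all $g\in C_c^\infty(W)$. *)

theory Defs
  imports "HOL-Analysis.Analysis"
begin

text \<open>
  Functions on $\mathbb{R}^n$ have type \<open>real^'n \<Rightarrow> real\<close> (complex-valued only for Schwartz functions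
  and the Fourier transform).  Elements of Lebesgue and Sobolev spaces are represented by Borel
  functions, not by classes: every almost-everywhere class contains a Borel function, and equality
  of such elements is equality almost everywhere.
\<close>

section \<open>Smooth functions, test functions, distributions\<close>

definition partial_deriv :: "'n::finite \<Rightarrow> (real^'n \<Rightarrow> 'b::real_normed_vector) \<Rightarrow> real^'n \<Rightarrow> 'b" where
  "partial_deriv i f x = frechet_derivative f (at x) (axis i 1)"

text \<open>Higher partial derivatives are indexed by lists of directions instead of multi-indices.\<close>

definition partial_derivs ::
  "'n::finite list \<Rightarrow> (real^'n \<Rightarrow> 'b::real_normed_vector) \<Rightarrow> real^'n \<Rightarrow> 'b" where
  "partial_derivs \<alpha> f = foldr partial_deriv \<alpha> f"

definition smooth :: "(real^'n::finite \<Rightarrow> 'b::real_normed_vector) \<Rightarrow> bool" where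
  "smooth f \<longleftrightarrow> (\<forall>\<alpha> x. partial_derivs \<alpha> f differentiable (at x))"

definition test_functions :: "(real^'n::finite) set \<Rightarrow> (real^'n \<Rightarrow> real) set" where
  "test_functions U = {\<phi>. smooth \<phi> \<and> compact (closure {x. \<phi> x \<noteq> 0}) \<and> closure {x. \<phi> x \<noteq> 0} \<subseteq> U}"

text \<open>
  A distribution is a functional whose values matter only on \<open>test_functions UNIV\<close>;
  two distributions are equal iff they agree there.
\<close>

definition distributions :: "((real^'n::finite \<Rightarrow> real) \<Rightarrow> real) set" where
  "distributions = {q.
     (\<forall>\<phi>\<in>test_functions UNIV. \<forall>\<psi>\<in>test_functions UNIV. q (\<lambda>x. \<phi> x + \<psi> x) = q \<phi> + q \<psi>) \<and>
     (\<forall>\<phi>\<in>test_functions UNIV. \<forall>c. q (\<lambda>x. c * \<phi> x) = c * q \<phi>) \<and>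
     (\<forall>K. compact K \<longrightarrow> (\<exists>N C. \<forall>\<phi>\<in>test_functions K.
        \<bar>q \<phi>\<bar> \<le> C * (\<Sum>\<alpha> | length \<alpha> \<le> N. SUP x. \<bar>partial_derivs \<alpha> \<phi> x\<bar>)))}"


section \<open>Lebesgue spaces\<close>

definition Lp :: "ereal \<Rightarrow> (real^'n::finite) set \<Rightarrow> (real^'n \<Rightarrow> real) set" where
  "Lp p A = {g. set_borel_measurable lborel A g \<and>
     (if p = \<infinity> then \<exists>C. AE x in lborel. x \<in> A \<longrightarrow> \<bar>g x\<bar> \<le> C
      else set_integrable lborel A (\<lambda>x. \<bar>g x\<bar> powr real_of_ereal p))}"

definition Lp_loc :: "ereal \<Rightarrow> (real^'n::finite) set \<Rightarrow> (real^'n \<Rightarrow> real) set" where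
  "Lp_loc p W = {g. \<forall>K. compact K \<and> K \<subseteq> W \<longrightarrow> g \<in> Lp p K}"

definition Lp_norm :: "real \<Rightarrow> (real^'n::finite \<Rightarrow> real) \<Rightarrow> real" where
  "Lp_norm p g = (\<integral>x. \<bar>g x\<bar> powr p \<partial>lborel) powr (1 / p)"

text \<open>The restriction of \<open>q\<close> to \<open>W\<close> is the function \<open>g\<close>.\<close>

definition represents_on ::
  "(real^'n::finite) set \<Rightarrow> (real^'n \<Rightarrow> real) \<Rightarrow> ((real^'n \<Rightarrow> real) \<Rightarrow> real) \<Rightarrow> bool" where
  "represents_on W g q \<longleftrightarrow> (\<forall>\<phi>\<in>test_functions W.
     integrable lborel (\<lambda>x. g x * \<phi> x) \<and> q \<phi> = (\<integral>x. g x * \<phi> x \<partial>lborel))"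


section \<open>Tempered distributions and Fourier multipliers\<close>

definition schwartz :: "(real^'n::finite \<Rightarrow> complex) set" where
  "schwartz = {\<phi>. smooth \<phi> \<and>
     (\<forall>\<alpha> k. bounded (range (\<lambda>x. (1 + norm x) ^ k *\<^sub>R partial_derivs \<alpha> \<phi> x)))}"

definition schwartz_seminorm :: "nat \<Rightarrow> (real^'n::finite \<Rightarrow> complex) \<Rightarrow> real" where
  "schwartz_seminorm N \<phi> =
     (\<Sum>\<alpha> | length \<alpha> \<le> N. SUP x. (1 + norm x) ^ N * cmod (partial_derivs \<alpha> \<phi> x))"

definition tempered :: "((real^'n::finite \<Rightarrow> complex) \<Rightarrow> complex) set" where
  "tempered = {T.
     (\<forall>\<phi>\<in>schwartz. \<forall>\<psi>\<in>schwartz. T (\<lambda>x. \<phi> x + \<psi> x) = T \<phi> + T \<psi>) \<and>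
     (\<forall>\<phi>\<in>schwartz. \<forall>c. T (\<lambda>x. c * \<phi> x) = c * T \<phi>) \<and>
     (\<exists>N C. \<forall>\<phi>\<in>schwartz. cmod (T \<phi>) \<le> C * schwartz_seminorm N \<phi>)}"

definition fourier :: "(real^'n::finite \<Rightarrow> complex) \<Rightarrow> real^'n \<Rightarrow> complex" where
  "fourier \<phi> \<xi> = (\<integral>x. exp (- (\<i> * complex_of_real (x \<bullet> \<xi>))) * \<phi> x \<partial>lborel)"

definition inverse_fourier :: "(real^'n::finite \<Rightarrow> complex) \<Rightarrow> real^'n \<Rightarrow> complex" where
  "inverse_fourier \<phi> x =
     (\<integral>\<xi>. exp (\<i> * complex_of_real (x \<bullet> \<xi>)) * \<phi> \<xi> \<partial>lborel) /\<^sub>R (2 * pi) ^ CARD('n)"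

text \<open>
  The Fourier transform, its inverse, and multiplication by a function, all extended to tempered
  distributions by duality (the transpose of each is itself).
\<close>

definition fourier_dist ::
  "((real^'n::finite \<Rightarrow> complex) \<Rightarrow> complex) \<Rightarrow> (real^'n \<Rightarrow> complex) \<Rightarrow> complex" where
  "fourier_dist T \<phi> = T (fourier \<phi>)"

definition inverse_fourier_dist ::
  "((real^'n::finite \<Rightarrow> complex) \<Rightarrow> complex) \<Rightarrow> (real^'n \<Rightarrow> complex) \<Rightarrow> complex" where
  "inverse_fourier_dist T \<phi> = T (inverse_fourier \<phi>)"

definition mult_dist :: "(real^'n::finite \<Rightarrow> real) \<Rightarrow>
    ((real^'n \<Rightarrow> complex) \<Rightarrow> complex) \<Rightarrow> (real^'n \<Rightarrow> complex) \<Rightarrow> complex" where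
  "mult_dist a T \<phi> = T (\<lambda>\<xi>. complex_of_real (a \<xi>) * \<phi> \<xi>)"

definition bessel_op :: "real \<Rightarrow>
    ((real^'n::finite \<Rightarrow> complex) \<Rightarrow> complex) \<Rightarrow> (real^'n \<Rightarrow> complex) \<Rightarrow> complex" where
  "bessel_op s T =
     inverse_fourier_dist (mult_dist (\<lambda>\<xi>. (1 + (norm \<xi>)\<^sup>2) powr (s / 2)) (fourier_dist T))"

definition function_dist :: "(real^'n::finite \<Rightarrow> real) \<Rightarrow> (real^'n \<Rightarrow> complex) \<Rightarrow> complex" where
  "function_dist u \<phi> = (\<integral>x. complex_of_real (u x) * \<phi> x \<partial>lborel)"


section \<open>Bessel potential spaces\<close>

definition bessel_potential_space ::
  "real \<Rightarrow> real \<Rightarrow> ((real^'n::finite \<Rightarrow> complex) \<Rightarrow> complex) set" where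
  "bessel_potential_space s p =
     {T\<in>tempered. \<exists>g\<in>Lp (ereal p) UNIV. \<forall>\<phi>\<in>schwartz. bessel_op s T \<phi> = function_dist g \<phi>}"

text \<open>
  The same space as a set of functions.  For \<open>s \<ge> 0\<close> nothing is lost, because $H^{s,p}$ is then
  contained in $L^p$.
\<close>

definition sobolev :: "real \<Rightarrow> real \<Rightarrow> (real^'n::finite \<Rightarrow> real) set" where
  "sobolev s p = {u\<in>borel_measurable lborel.
     (\<forall>\<phi>\<in>schwartz. integrable lborel (\<lambda>x. complex_of_real (u x) * \<phi> x)) \<and>
     function_dist u \<in> bessel_potential_space s p}"

text \<open>The $L^p$ function $\langle D\rangle^s u$; it is determined up to null sets.\<close>

definition bessel_deriv ::
  "real \<Rightarrow> real \<Rightarrow> (real^'n::finite \<Rightarrow> real) \<Rightarrow> real^'n \<Rightarrow> real" where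
  "bessel_deriv s p u = (SOME g. g \<in> Lp (ereal p) UNIV \<and>
     (\<forall>\<phi>\<in>schwartz. bessel_op s (function_dist u) \<phi> = function_dist g \<phi>))"

definition sobolev_norm :: "real \<Rightarrow> real \<Rightarrow> (real^'n::finite \<Rightarrow> real) \<Rightarrow> real" where
  "sobolev_norm s p u = Lp_norm p (bessel_deriv s p u)"

abbreviation Hs :: "real \<Rightarrow> (real^'n::finite \<Rightarrow> real) set" where
  "Hs s \<equiv> sobolev s 2"

abbreviation Hs_norm :: "real \<Rightarrow> (real^'n::finite \<Rightarrow> real) \<Rightarrow> real" where
  "Hs_norm s \<equiv> sobolev_norm s 2"

definition Hs_tilde :: "real \<Rightarrow> (real^'n::finite) set \<Rightarrow> (real^'n \<Rightarrow> real) set" where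
  "Hs_tilde s \<Omega> = {u\<in>Hs s. \<forall>\<epsilon>>0. \<exists>\<phi>\<in>test_functions \<Omega>. Hs_norm s (\<lambda>x. u x - \<phi> x) < \<epsilon>}"


section \<open>The fractional Laplacian and its constant\<close>

definition fractional_laplacian ::
  "real \<Rightarrow> (real^'n::finite \<Rightarrow> complex) \<Rightarrow> real^'n \<Rightarrow> complex" where
  "fractional_laplacian s u =
     inverse_fourier (\<lambda>\<xi>. complex_of_real (norm \<xi> powr (2 * s)) * fourier u \<xi>)"

text \<open>The constant $C_{n,s}$; the type argument carries the dimension.\<close>

definition frac_const :: "'n::finite itself \<Rightarrow> real \<Rightarrow> real" where
  "frac_const TYPE('n) s = (THE c. c > 0 \<and> (\<forall>u\<in>schwartz. \<forall>x::real^'n.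
     ((\<lambda>\<epsilon>. c *\<^sub>R (LINT y:{y. norm (x - y) > \<epsilon>}|lborel.
             (u x - u y) /\<^sub>R norm (x - y) powr (real CARD('n) + 2 * s)))
       \<longlongrightarrow> fractional_laplacian s u x) (at_right 0)))"


section \<open>Multipliers\<close>

definition multiplier_values ::
  "real \<Rightarrow> ((real^'n::finite \<Rightarrow> real) \<Rightarrow> real) \<Rightarrow> real set" where
  "multiplier_values s q = {\<bar>q (\<lambda>x. u x * v x)\<bar> | u v.
     u \<in> test_functions UNIV \<and> v \<in> test_functions UNIV \<and> Hs_norm s u = 1 \<and> Hs_norm s v = 1}"

definition multipliers :: "real \<Rightarrow> ((real^'n::finite \<Rightarrow> real) \<Rightarrow> real) set" where
  "multipliers s = {q\<in>distributions. bdd_above (multiplier_values s q)}"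

definition multiplier_norm :: "real \<Rightarrow> ((real^'n::finite \<Rightarrow> real) \<Rightarrow> real) \<Rightarrow> real" where
  "multiplier_norm s q = Sup (multiplier_values s q)"

definition small_multipliers :: "real \<Rightarrow> real \<Rightarrow> ((real^'n::finite \<Rightarrow> real) \<Rightarrow> real) set" where
  "small_multipliers \<delta> s = {q\<in>multipliers s. multiplier_norm s q < \<delta>}"

definition nonneg_multipliers :: "real \<Rightarrow> ((real^'n::finite \<Rightarrow> real) \<Rightarrow> real) set" where
  "nonneg_multipliers s = {q\<in>multipliers s. \<forall>\<phi>\<in>test_functions UNIV. (\<forall>x. \<phi> x \<ge> 0) \<longrightarrow> q \<phi> \<ge> 0}"

definition small_plus_nonneg_multipliers ::
  "real \<Rightarrow> real \<Rightarrow> ((real^'n::finite \<Rightarrow> real) \<Rightarrow> real) set" where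
  "small_plus_nonneg_multipliers \<delta> s =
     {q. \<exists>q'\<in>small_multipliers \<delta> s. \<exists>q''\<in>nonneg_multipliers s.
        \<forall>\<phi>\<in>test_functions UNIV. q \<phi> = q' \<phi> + q'' \<phi>}"

definition bounded_bilinear_on_Hs ::
  "real \<Rightarrow> ((real^'n::finite \<Rightarrow> real) \<Rightarrow> (real^'n \<Rightarrow> real) \<Rightarrow> real) \<Rightarrow> bool" where
  "bounded_bilinear_on_Hs s B \<longleftrightarrow>
     (\<forall>u\<in>Hs s. \<forall>v\<in>Hs s. \<forall>w\<in>Hs s. \<forall>c.
        B (\<lambda>x. u x + v x) w = B u w + B v w \<and> B (\<lambda>x. c * u x) w = c * B u w \<and>
        B w (\<lambda>x. u x + v x) = B w u + B w v \<and> B w (\<lambda>x. c * u x) = c * B w u) \<and>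
     (\<exists>C. \<forall>u\<in>Hs s. \<forall>v\<in>Hs s. \<bar>B u v\<bar> \<le> C * Hs_norm s u * Hs_norm s v)"

text \<open>
  The pairing $\langle qu,v\rangle$ for \<open>u\<close>, \<open>v\<close> in $H^s$.  For a multiplier \<open>q\<close> the extension
  chosen here is unique on \<open>Hs s\<close>; elsewhere its values are irrelevant.
\<close>

definition multiplier_form :: "real \<Rightarrow> ((real^'n::finite \<Rightarrow> real) \<Rightarrow> real) \<Rightarrow>
    (real^'n \<Rightarrow> real) \<Rightarrow> (real^'n \<Rightarrow> real) \<Rightarrow> real" where
  "multiplier_form s q = (SOME B. bounded_bilinear_on_Hs s B \<and>
     (\<forall>\<phi>\<in>test_functions UNIV. \<forall>\<psi>\<in>test_functions UNIV. B \<phi> \<psi> = q (\<lambda>x. \<phi> x * \<psi> x)))"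


section \<open>The conductivity equation and the exterior DN map\<close>

definition conductivity_form ::
  "real \<Rightarrow> (real^'n::finite \<Rightarrow> real) \<Rightarrow> (real^'n \<Rightarrow> real) \<Rightarrow> (real^'n \<Rightarrow> real) \<Rightarrow> real" where
  "conductivity_form s \<gamma> u v = frac_const TYPE('n) s / 2 *
     (\<integral>(x, y). sqrt (\<gamma> x) * sqrt (\<gamma> y) * ((u x - u y) * (v x - v y))
                / norm (x - y) powr (real CARD('n) + 2 * s) \<partial>(lborel \<Otimes>\<^sub>M lborel))"

definition full_form :: "real \<Rightarrow> (real^'n::finite \<Rightarrow> real) \<Rightarrow> ((real^'n \<Rightarrow> real) \<Rightarrow> real) \<Rightarrow>
    (real^'n \<Rightarrow> real) \<Rightarrow> (real^'n \<Rightarrow> real) \<Rightarrow> real" where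
  "full_form s \<gamma> q u v = conductivity_form s \<gamma> u v + multiplier_form s q u v"

definition weak_solution :: "real \<Rightarrow> (real^'n::finite) set \<Rightarrow> (real^'n \<Rightarrow> real) \<Rightarrow>
    ((real^'n \<Rightarrow> real) \<Rightarrow> real) \<Rightarrow> (real^'n \<Rightarrow> real) \<Rightarrow> (real^'n \<Rightarrow> real) \<Rightarrow> bool" where
  "weak_solution s \<Omega> \<gamma> q f u \<longleftrightarrow> u \<in> Hs s \<and> (\<lambda>x. u x - f x) \<in> Hs_tilde s \<Omega> \<and>
     (\<forall>\<phi>\<in>Hs_tilde s \<Omega>. full_form s \<gamma> q u \<phi> = 0)"

text \<open>
  \<open>dn_map s \<Omega> \<gamma> q f g\<close> is $\langle\Lambda_{\gamma,q}f,g\rangle$, with \<open>f\<close> and \<open>g\<close> representatives of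
  classes modulo \<open>Hs_tilde s \<Omega>\<close>.  The solution chosen is unique only up to null sets, which
  does not affect the value of the form.
\<close>

definition dn_map :: "real \<Rightarrow> (real^'n::finite) set \<Rightarrow> (real^'n \<Rightarrow> real) \<Rightarrow>
    ((real^'n \<Rightarrow> real) \<Rightarrow> real) \<Rightarrow> (real^'n \<Rightarrow> real) \<Rightarrow> (real^'n \<Rightarrow> real) \<Rightarrow> real" where
  "dn_map s \<Omega> \<gamma> q f g = full_form s \<gamma> q (SOME u. weak_solution s \<Omega> \<gamma> q f u) g"


section \<open>Domains, constants, coefficients\<close>

text \<open>
  The factor $\mathbb{R}^k$ containing $\omega$ is the coordinate subspace of the coordinates in a
  nonempty set \<open>K\<close>, with \<open>k = card K\<close>.  Which coordinates are used is immaterial, since the linear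
  isometry \<open>L\<close> may permute them.
\<close>

definition bounded_in_one_direction :: "(real^'n::finite) set \<Rightarrow> bool" where
  "bounded_in_one_direction \<Omega> \<longleftrightarrow>
     (\<exists>K \<omega> L x0. K \<noteq> {} \<and> bounded \<omega> \<and>
        openin (top_of_set {y::real^'n. \<forall>i. i \<notin> K \<longrightarrow> y $ i = 0}) \<omega> \<and>
        orthogonal_transformation L \<and>
        \<Omega> \<subseteq> (\<lambda>x. L x + x0) ` {x. (\<chi> i. if i \<in> K then x $ i else 0) \<in> \<omega>})"

definition measurement_set :: "(real^'n::finite) set \<Rightarrow> (real^'n) set \<Rightarrow> bool" where
  "measurement_set \<Omega> W \<longleftrightarrow> open W \<and> W \<noteq> {} \<and> W \<subseteq> - closure \<Omega>"

definition gagliardo_sq :: "real \<Rightarrow> (real^'n::finite \<Rightarrow> real) \<Rightarrow> real" where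
  "gagliardo_sq s u = frac_const TYPE('n) s / 2 *
     (\<integral>(x, y). \<bar>u x - u y\<bar>\<^sup>2 / norm (x - y) powr (real CARD('n) + 2 * s) \<partial>(lborel \<Otimes>\<^sub>M lborel))"

definition C_opt :: "real \<Rightarrow> (real^'n::finite) set \<Rightarrow> real" where
  "C_opt s \<Omega> = inverse (Inf {gagliardo_sq s u / (Lp_norm 2 u)\<^sup>2 | u.
     u \<in> Hs_tilde s \<Omega> \<and> \<not> (AE x in lborel. u x = 0)})"

definition delta0 :: "real \<Rightarrow> (real^'n::finite) set \<Rightarrow> real" where
  "delta0 s \<Omega> = 2 * max 1 (C_opt s \<Omega>)"

definition uniformly_elliptic :: "real \<Rightarrow> (real^'n::finite \<Rightarrow> real) \<Rightarrow> bool" where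
  "uniformly_elliptic \<gamma>0 \<gamma> \<longleftrightarrow> \<gamma>0 > 0 \<and> (AE x in lborel. \<gamma> x \<ge> \<gamma>0)"

definition background_deviation :: "(real^'n::finite \<Rightarrow> real) \<Rightarrow> real^'n \<Rightarrow> real" where
  "background_deviation \<gamma> x = sqrt (\<gamma> x) - 1"

definition ae_continuous_in :: "(real^'n::finite) set \<Rightarrow> (real^'n \<Rightarrow> real) \<Rightarrow> bool" where
  "ae_continuous_in W \<gamma> \<longleftrightarrow> (AE x in lborel. x \<in> W \<longrightarrow> isCont \<gamma> x)"

definition same_pair :: "(real^'n::finite \<Rightarrow> real) \<times> ((real^'n \<Rightarrow> real) \<Rightarrow> real) \<Rightarrow>
    (real^'n \<Rightarrow> real) \<times> ((real^'n \<Rightarrow> real) \<Rightarrow> real) \<Rightarrow> bool" where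
  "same_pair = (\<lambda>(\<gamma>1, q1) (\<gamma>2, q2). (AE x in lborel. \<gamma>1 x = \<gamma>2 x) \<and>
     (\<forall>\<phi>\<in>test_functions UNIV. q1 \<phi> = q2 \<phi>))"

end

theory Submission
  imports Defs "HOL-Probability.Characteristic_Functions" "HOL-Probability.Sinc_Integral"
begin

text \<open>
  With $a = \gamma^{1/2} = 1 + m$ the fractional Liouville identity
  $B_\gamma(u,\varphi) = \langle(-\Delta)^{s/2}(au),(-\Delta)^{s/2}(a\varphi)\rangle -
  \int a\,(-\Delta)^s m\;u\varphi$
  turns $L^s_\gamma u + qu = 0$ into a fractional Schroedinger equation for $au$.  One pair is
  $\gamma_1 = q_1 = 1$.  For the other one $m$ is a small nonnegative bump supported in \<open>\<Omega>\<close>, and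
  $q_2 = a^2 + a\,(-\Delta)^s m \ge 0$, so that the reduced equation is
  $(-\Delta)^s v + v = 0$ in both cases.  As $a = 1$ outside \<open>\<Omega>\<close>, the DN maps coincide, whereas on \<open>W\<close>,
  where $m$ vanishes, the nonlocality of $(-\Delta)^s$ gives $q_2 - 1 = (-\Delta)^s m < 0$.  The constant
  potential $1$ makes the reduced problem coercive, so no Poincare inequality is needed.
\<close>

section \<open>Smooth functions\<close>

text \<open>A reduced equation (-\<Delta>)^s v + V v = 0 corresponds to the potential a^2 V + a
  (-\<Delta>)^s m. The choice V = 1 also lets a^2 dominate a (-\<Delta>)^s m once the bump is scaled
  down, so both potentials are bounded and nonnegative and belong to the required class with small
  part 0. One obstacle is that the data are given by choice operators: the constant C_{n,s}, the
  function <D>^s u, the extension of a multiplier and the weak solution are picked by THE or SOME,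
  so existence and independence of the choice must be settled before anything can be computed. The
  other is that H^s is given by the Fourier transform and the form by a double integral. On test
  functions, Plancherel and the symbol of the singular kernel connect the two; the rest follows by
  passing to limits. The argument therefore runs in \<open>Hs_tilde s UNIV\<close>, the closure of
  the test functions, which contains f, g and every weak solution u, because u - f lies in
  \<open>Hs_tilde s \<Omega>\<close>.\<close>

lemma partial_derivs_Nil [simp]: "partial_derivs [] f = f"
  by (simp add: partial_derivs_def)

lemma partial_derivs_Cons [simp]: "partial_derivs (i # \<alpha>) f = partial_deriv i (partial_derivs \<alpha> f)"
  by (simp add: partial_derivs_def)

text \<open>Peels off the innermost derivative. \<open>partial_derivs\<close> recurses from the
  outside, while smoothness of a derivative concerns the derivatives taken after a first
  one.\<close>

lemma partial_derivs_snoc: "partial_derivs (\<alpha> @ [i]) f = partial_derivs \<alpha> (partial_deriv i f)"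
  by (simp add: partial_derivs_def)

lemma smooth_differentiable: "smooth f \<Longrightarrow> f differentiable (at x)"
  unfolding smooth_def by (metis partial_derivs_Nil)

lemma smooth_partial_deriv: "smooth f \<Longrightarrow> smooth (partial_deriv i f)"
  unfolding smooth_def by (metis partial_derivs_snoc)

lemma smooth_partial_derivs: "smooth f \<Longrightarrow> smooth (partial_derivs \<alpha> f)"
  by (induction \<alpha>) (auto intro: smooth_partial_deriv)

lemma smooth_continuous_on: "smooth f \<Longrightarrow> continuous_on A f"
  by (meson continuous_at_imp_continuous_on differentiable_imp_continuous_within smooth_differentiable)

lemma smooth_borel_measurable [measurable_dest]:
  "smooth f \<Longrightarrow> f \<in> borel_measurable borel"
  by (simp add: borel_measurable_continuous_onI smooth_continuous_on)

section \<open>Rules for first partial derivatives\<close>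

lemma partial_deriv_eq:
  "(f has_derivative D) (at x) \<Longrightarrow> partial_deriv i f x = D (axis i 1)"
  unfolding partial_deriv_def using frechet_derivative_at by metis

lemma differentiable_has_derivative_partial:
  "f differentiable (at x) \<Longrightarrow> \<exists>D. (f has_derivative D) (at x) \<and> (\<forall>i. D (axis i 1) = partial_deriv i f x)"
  by (metis frechet_derivative_works partial_deriv_def)

lemma partial_deriv_add:
  assumes "\<And>x. f differentiable (at x)" "\<And>x. g differentiable (at x)"
  shows "partial_deriv i (\<lambda>x. f x + g x) = (\<lambda>x. partial_deriv i f x + partial_deriv i g x)"
proof
  fix x
  from differentiable_has_derivative_partial[OF assms(1)] differentiable_has_derivative_partial[OF assms(2)]
  obtain D E where D: "(f has_derivative D) (at x)" "(g has_derivative E) (at x)"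
    and E: "D (axis i 1) = partial_deriv i f x" "E (axis i 1) = partial_deriv i g x"
    by blast
  show "partial_deriv i (\<lambda>x. f x + g x) x = partial_deriv i f x + partial_deriv i g x"
    using partial_deriv_eq[OF has_derivative_add[OF D], of i] E by simp
qed

lemma partial_deriv_mult:
  fixes f g :: "real^'n::finite \<Rightarrow> 'b::real_normed_algebra"
  assumes "\<And>x. f differentiable (at x)" "\<And>x. g differentiable (at x)"
  shows "partial_deriv i (\<lambda>x. f x * g x) = (\<lambda>x. f x * partial_deriv i g x + partial_deriv i f x * g x)"
proof
  fix x
  from differentiable_has_derivative_partial[OF assms(1)] differentiable_has_derivative_partial[OF assms(2)]
  obtain D E where D: "(f has_derivative D) (at x)" "(g has_derivative E) (at x)"
    and E: "D (axis i 1) = partial_deriv i f x" "E (axis i 1) = partial_deriv i g x"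
    by blast
  show "partial_deriv i (\<lambda>x. f x * g x) x = f x * partial_deriv i g x + partial_deriv i f x * g x"
    using partial_deriv_eq[OF has_derivative_mult[OF D], of i] E by simp
qed

lemma partial_deriv_bounded_linear:
  assumes "bounded_linear L" "\<And>x. f differentiable (at x)"
  shows "partial_deriv i (\<lambda>x. L (f x)) = (\<lambda>x. L (partial_deriv i f x))"
proof
  fix x
  from differentiable_has_derivative_partial[OF assms(2)]
  obtain D where D: "(f has_derivative D) (at x)" "D (axis i 1) = partial_deriv i f x"
    by blast
  show "partial_deriv i (\<lambda>x. L (f x)) x = L (partial_deriv i f x)"
    using partial_deriv_eq[OF bounded_linear.has_derivative[OF assms(1) D(1)], of i] D(2) by simp
qed

lemma differentiable_bounded_linear:
  "bounded_linear L \<Longrightarrow> f differentiable (at x) \<Longrightarrow> (\<lambda>x. L (f x)) differentiable (at x)"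
  unfolding differentiable_def using bounded_linear.has_derivative by blast

lemma partial_deriv_const: "partial_deriv i (\<lambda>x. c) = (\<lambda>x. 0)"
  by (rule ext, rule trans[OF partial_deriv_eq[OF has_derivative_const]]) simp

lemma partial_deriv_nth:
  "partial_deriv i (\<lambda>x::real^'n::finite. x $ j) = (\<lambda>x. axis i 1 $ j)"
  by (rule ext, rule partial_deriv_eq) (rule bounded_linear.has_derivative[OF bounded_linear_vec_nth has_derivative_ident])

lemma partial_deriv_chain_real:
  fixes g :: "real^'n::finite \<Rightarrow> real"
  assumes "\<And>x. (h has_real_derivative h' (g x)) (at (g x))" "\<And>x. g differentiable (at x)"
  shows "partial_deriv i (\<lambda>x. h (g x)) = (\<lambda>x. h' (g x) * partial_deriv i g x)"
    and "(\<lambda>x. h (g x)) differentiable (at x)"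
proof -
  have *: "\<exists>D. (g has_derivative D) (at x) \<and> D (axis i 1) = partial_deriv i g x \<and>
     ((\<lambda>x. h (g x)) has_derivative (\<lambda>v. D v * h' (g x))) (at x)" for x
  proof -
    obtain D where D: "(g has_derivative D) (at x)" "D (axis i 1) = partial_deriv i g x"
      using differentiable_has_derivative_partial assms(2) by blast
    have "((\<lambda>x. h (g x)) has_derivative (\<lambda>v. h' (g x) * D v)) (at x)"
      using has_derivative_compose[OF D(1) assms(1)[unfolded has_field_derivative_def]] by simp
    then show ?thesis using D by (auto simp: mult.commute)
  qed
  show "partial_deriv i (\<lambda>x. h (g x)) = (\<lambda>x. h' (g x) * partial_deriv i g x)"
    using * partial_deriv_eq by (metis mult.commute)
  show "(\<lambda>x. h (g x)) differentiable (at x)"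
    using * differentiable_def by blast
qed

text \<open>
  The coinduction rule for smoothness works up to finite sums, since the product and chain rules
  leave a set of generators only up to such sums.
\<close>

inductive_set plus_closure :: "('a \<Rightarrow> 'b::plus) set \<Rightarrow> ('a \<Rightarrow> 'b) set" for S where
  base: "f \<in> S \<Longrightarrow> f \<in> plus_closure S"
| add: "f \<in> plus_closure S \<Longrightarrow> g \<in> plus_closure S \<Longrightarrow> (\<lambda>x. f x + g x) \<in> plus_closure S"

lemma partial_derivs_in_plus_closure:
  assumes diff: "\<And>g x. g \<in> S \<Longrightarrow> g differentiable (at x)"
    and step: "\<And>g i. g \<in> S \<Longrightarrow> partial_deriv i g \<in> plus_closure S"
    and "f \<in> plus_closure S"
  shows "partial_derivs \<alpha> f \<in> plus_closure S" "f differentiable (at x)"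
proof -
  have d: "g differentiable (at x)" if "g \<in> plus_closure S" for g x
    using that by induction (auto intro: diff)
  show "f differentiable (at x)" using d assms(3) .
  have s: "partial_deriv i g \<in> plus_closure S" if "g \<in> plus_closure S" for g i
    using that
  proof induction
    case (base f) then show ?case using step by blast
  next
    case (add f g)
    then show ?case
      using partial_deriv_add[of f g i] d by (auto intro: plus_closure.add)
  qed
  show "partial_derivs \<alpha> f \<in> plus_closure S"
    by (induction \<alpha>) (auto intro: assms s)
qed

lemma smooth_coinduct:
  assumes "\<And>g x. g \<in> S \<Longrightarrow> g differentiable (at x)"
    and "\<And>g i. g \<in> S \<Longrightarrow> partial_deriv i g \<in> plus_closure S"
    and "f \<in> S"
  shows "smooth f"
  unfolding smooth_def
  using partial_derivs_in_plus_closure[OF assms(1,2)] assms(3) by (metis plus_closure.base)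

section \<open>Closure properties of smooth functions\<close>

lemma smooth_const [simp]: "smooth (\<lambda>x. c)"
  by (rule smooth_coinduct[where S="range (\<lambda>c x. c)"])
    (auto simp: partial_deriv_const intro!: plus_closure.base)

lemma smooth_nth [simp]: "smooth (\<lambda>x::real^'n::finite. x $ j)"
proof (rule smooth_coinduct[where S="insert (\<lambda>x. x $ j) (range (\<lambda>c x. c))"])
  fix g :: "real^'n \<Rightarrow> real" and x assume "g \<in> insert (\<lambda>x. x $ j) (range (\<lambda>c x. c))"
  then show "g differentiable (at x)"
    using differentiable_bounded_linear[OF bounded_linear_vec_nth, of "\<lambda>x. x"] by auto
qed (auto simp: partial_deriv_const partial_deriv_nth intro!: plus_closure.base)

lemma smooth_add:
  assumes "smooth f" "smooth g" shows "smooth (\<lambda>x. f x + g x)"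
proof (rule smooth_coinduct[where S="{\<lambda>x. f x + g x | f g. smooth f \<and> smooth g}"])
  fix h i assume "h \<in> {\<lambda>x. f x + g x | f g. smooth f \<and> smooth g}"
  then obtain f g where "h = (\<lambda>x. f x + g x)" "smooth f" "smooth g" by auto
  then have "partial_deriv i h = (\<lambda>x. partial_deriv i f x + partial_deriv i g x)"
      "smooth (partial_deriv i f)" "smooth (partial_deriv i g)"
    by (auto simp: partial_deriv_add smooth_differentiable smooth_partial_deriv)
  then show "partial_deriv i h \<in> plus_closure {\<lambda>x. f x + g x | f g. smooth f \<and> smooth g}"
    by (intro plus_closure.base) blast
qed (use assms smooth_differentiable in \<open>auto intro!: differentiable_add\<close>)

lemma smooth_mult:
  fixes f g :: "real^'n::finite \<Rightarrow> 'b::real_normed_algebra"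
  assumes "smooth f" "smooth g" shows "smooth (\<lambda>x. f x * g x)"
proof (rule smooth_coinduct[where S="{\<lambda>x. f x * g x | f g. smooth f \<and> smooth g}"])
  fix h :: "real^'n \<Rightarrow> 'b" and i
  assume "h \<in> {\<lambda>x. f x * g x | f g. smooth f \<and> smooth g}"
  then obtain f g where *: "h = (\<lambda>x. f x * g x)" "smooth f" "smooth g" by auto
  then have h: "partial_deriv i h = (\<lambda>x. f x * partial_deriv i g x + partial_deriv i f x * g x)"
    by (auto simp: partial_deriv_mult smooth_differentiable)
  show "partial_deriv i h \<in> plus_closure {\<lambda>x. f x * g x | f g. smooth f \<and> smooth g}"
    unfolding h
    by (intro plus_closure.add plus_closure.base) (use * smooth_partial_deriv in blast)+
qed (use assms smooth_differentiable in \<open>auto intro!: differentiable_mult\<close>)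

lemma smooth_bounded_linear:
  assumes "bounded_linear L" "smooth f" shows "smooth (\<lambda>x. L (f x))"
proof (rule smooth_coinduct[where S="{\<lambda>x. L (f x) | f. smooth f}"])
  fix h i assume "h \<in> {\<lambda>x. L (f x) | f. smooth f}"
  then obtain f where "h = (\<lambda>x. L (f x))" "smooth f" by auto
  then have "partial_deriv i h = (\<lambda>x. L (partial_deriv i f x))" "smooth (partial_deriv i f)"
    by (auto simp: partial_deriv_bounded_linear assms smooth_differentiable smooth_partial_deriv)
  then show "partial_deriv i h \<in> plus_closure {\<lambda>x. L (f x) | f. smooth f}"
    by (intro plus_closure.base) blast
qed (use assms in \<open>auto intro: differentiable_bounded_linear smooth_differentiable\<close>)

lemma smooth_uminus: "smooth f \<Longrightarrow> smooth (\<lambda>x. - f x)"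
  by (rule smooth_bounded_linear[OF bounded_linear_minus[OF bounded_linear_ident]])

lemma smooth_diff: "smooth f \<Longrightarrow> smooth g \<Longrightarrow> smooth (\<lambda>x. f x - g x)"
  using smooth_add[OF _ smooth_uminus, of f g] by simp

lemma smooth_sum: "(\<And>i. i \<in> I \<Longrightarrow> smooth (f i)) \<Longrightarrow> smooth (\<lambda>x. \<Sum>i\<in>I. f i x)"
  by (induction I rule: infinite_finite_induct) (auto intro: smooth_add)

lemma smooth_of_real: "smooth f \<Longrightarrow> smooth (\<lambda>x. complex_of_real (f x))"
  by (rule smooth_bounded_linear[OF bounded_linear_of_real])

lemma power2_norm_vec: "(norm (x::real^'n::finite))\<^sup>2 = (\<Sum>i\<in>UNIV. (x $ i)\<^sup>2)"
  by (simp only: power2_norm_eq_inner inner_vec_def) (simp add: power2_eq_square)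

text \<open>By the product and chain rules a derivative of D k (g x) * h x is a sum of two terms of
  the same shape: either h is differentiated, or k goes up by one and the derivative of g is
  absorbed into h. The D k have to be derivatives of one another only along the values of g, which
  admits outer functions such as 1/t on positive arguments.\<close>

lemma smooth_compose:
  fixes g :: "real^'n::finite \<Rightarrow> real"
  assumes D: "\<And>k x. (D k has_real_derivative D (Suc k) (g x)) (at (g x))" and g: "smooth g"
  shows "smooth (\<lambda>x. D k (g x))"
proof (rule smooth_coinduct[where S="{\<lambda>x. D k (g x) * h x | k h. smooth h}"])
  fix f :: "real^'n \<Rightarrow> real" and x i
  assume "f \<in> {\<lambda>x. D k (g x) * h x | k h. smooth h}"
  then obtain k h where *: "f = (\<lambda>x. D k (g x) * h x)" "smooth h" by auto
  note ch = partial_deriv_chain_real[of "D k" "D (Suc k)" g, OF D smooth_differentiable[OF g]]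
  show "f differentiable (at x)"
    unfolding * by (intro differentiable_mult ch(2) smooth_differentiable *)
  have h: "partial_deriv i f = (\<lambda>x. D k (g x) * partial_deriv i h x
       + D (Suc k) (g x) * (partial_deriv i g x * h x))"
    unfolding * using * by (subst partial_deriv_mult)
      (auto simp: ch smooth_differentiable mult.assoc)
  have S: "(\<lambda>x. D k (g x) * h x) \<in> {\<lambda>x. D k (g x) * h x | k h. smooth h}" if "smooth h" for k h
    by (rule CollectI, rule exI[of _ k], rule exI[of _ h]) (simp add: that)
  show "partial_deriv i f \<in> plus_closure {\<lambda>x. D k (g x) * h x | k h. smooth h}"
    unfolding h
    by (intro plus_closure.add plus_closure.base S smooth_mult smooth_partial_deriv g *)
next
  show "(\<lambda>x. D k (g x)) \<in> {\<lambda>x. D k (g x) * h x | k h. smooth h}"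
    by (rule CollectI, rule exI[of _ k], rule exI[of _ "\<lambda>x. 1"]) simp
qed

lemma smooth_inverse:
  fixes g :: "real^'n::finite \<Rightarrow> real"
  assumes "smooth g" "\<And>x. g x > 0"
  shows "smooth (\<lambda>x. inverse (g x))"
proof -
  \<comment> \<open>The k-th derivative of 1/t.\<close>
  define D where "D k t = (-1)^k * fact k * inverse (t::real) ^ Suc k" for k t
  have "(D k has_real_derivative D (Suc k) (g x)) (at (g x))" for k x
  proof -
    have "g x \<noteq> 0" using assms(2)[of x] by simp
    from DERIV_cmult[OF DERIV_power_Suc[OF DERIV_inverse[OF this]], of "(-1)^k * fact k" k]
    show ?thesis unfolding D_def
      by (rule DERIV_cong) (simp add: algebra_simps)
  qed
  from smooth_compose[of D g 0, OF this assms(1)] show ?thesis by (simp add: D_def)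
qed

section \<open>Test functions\<close>

lemma test_functionsD:
  assumes "\<phi> \<in> test_functions U"
  shows "smooth \<phi>" "compact (closure {x. \<phi> x \<noteq> 0})" "closure {x. \<phi> x \<noteq> 0} \<subseteq> U"
  using assms by (auto simp: test_functions_def)

lemma test_functions_eq_0: "\<phi> \<in> test_functions U \<Longrightarrow> x \<notin> U \<Longrightarrow> \<phi> x = 0"
  using closure_subset[of "{x. \<phi> x \<noteq> 0}"] by (auto simp: test_functions_def)

lemma test_functionsI:
  assumes "smooth \<phi>" "compact K" "K \<subseteq> U" "\<And>x. x \<notin> K \<Longrightarrow> \<phi> x = 0"
  shows "\<phi> \<in> test_functions U"
proof -
  have "closure {x. \<phi> x \<noteq> 0} \<subseteq> K"
    using assms by (intro closure_minimal compact_imp_closed) auto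
  then show ?thesis
    using assms compact_Int_closed[OF \<open>compact K\<close> closed_closure, of "{x. \<phi> x \<noteq> 0}"]
    by (auto simp: test_functions_def Int_absorb1 Int_absorb2)
qed

lemma test_functions_mono: "U \<subseteq> V \<Longrightarrow> test_functions U \<subseteq> test_functions V"
  by (auto simp: test_functions_def)

lemma test_functions_UNIV: "\<phi> \<in> test_functions U \<Longrightarrow> \<phi> \<in> test_functions UNIV"
  using test_functions_mono by blast

lemma test_functions_add:
  assumes "\<phi> \<in> test_functions U" "\<psi> \<in> test_functions U"
  shows "(\<lambda>x. \<phi> x + \<psi> x) \<in> test_functions U"
proof (rule test_functionsI)
  let ?K = "closure {x. \<phi> x \<noteq> 0} \<union> closure {x. \<psi> x \<noteq> 0}"
  show "compact ?K" "?K \<subseteq> U"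
    using assms by (auto simp: test_functions_def)
  show "smooth (\<lambda>x. \<phi> x + \<psi> x)" using assms by (auto simp: test_functions_def intro: smooth_add)
  show "\<phi> x + \<psi> x = 0" if "x \<notin> ?K" for x
    using that closure_subset[of "{x. \<phi> x \<noteq> 0}"] closure_subset[of "{x. \<psi> x \<noteq> 0}"]
    by (metis (mono_tags, lifting) UnCI add.left_neutral mem_Collect_eq subsetD)
qed

lemma test_functions_mult:
  assumes "\<phi> \<in> test_functions U" "smooth a"
  shows "(\<lambda>x. a x * \<phi> x) \<in> test_functions U"
proof (rule test_functionsI)
  let ?K = "closure {x. \<phi> x \<noteq> 0}"
  show "compact ?K" "?K \<subseteq> U"
    using assms by (auto simp: test_functions_def)
  show "smooth (\<lambda>x. a x * \<phi> x)" using assms by (auto simp: test_functions_def intro: smooth_mult)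
  show "a x * \<phi> x = 0" if "x \<notin> ?K" for x
    using that closure_subset[of "{x. \<phi> x \<noteq> 0}"] by auto
qed

lemma test_functions_cmult: "\<phi> \<in> test_functions U \<Longrightarrow> (\<lambda>x. c * \<phi> x) \<in> test_functions U"
  by (rule test_functions_mult) auto

lemma test_functions_diff:
  assumes "\<phi> \<in> test_functions U" "\<psi> \<in> test_functions U"
  shows "(\<lambda>x. \<phi> x - \<psi> x) \<in> test_functions U"
  using test_functions_add[OF assms(1) test_functions_cmult[OF assms(2), of "-1"]] by simp

section \<open>Bump functions\<close>

text \<open>Differentiating p(1/t) e^(-1/t) gives (1/t)^2 (p(1/t) - p'(1/t)) e^(-1/t). The
  polynomials are in y = 1/t, and \<open>[:0,0,1:]\<close> is y^2.\<close>

fun flat_poly :: "nat \<Rightarrow> real poly" where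
  "flat_poly 0 = 1"
| "flat_poly (Suc k) = [:0,0,1:] * (flat_poly k - pderiv (flat_poly k))"

text \<open>The derivatives of $e^{-1/t}$, extended by \<open>0\<close> to $t \le 0$.\<close>

definition flat_exp :: "nat \<Rightarrow> real \<Rightarrow> real" where
  "flat_exp k t = (if t > 0 then poly (flat_poly k) (1 / t) * exp (- (1 / t)) else 0)"

lemma poly_exp_tendsto_0: "((\<lambda>y::real. poly p y * exp (- y)) \<longlongrightarrow> 0) at_top"
proof (induction p)
  case 0 then show ?case by simp
next
  case (pCons a p)
  have "((\<lambda>y. y * (poly p y * exp (- y))) \<longlongrightarrow> 0) at_top"
  proof -
    have "((\<lambda>y. poly q y * exp (- y)) \<longlongrightarrow> 0) at_top" for q :: "real poly"
    proof -
      have "((\<lambda>y. \<Sum>i\<le>degree q. coeff q i * (y ^ i / exp y)) \<longlongrightarrow> (\<Sum>i\<le>degree q. coeff q i * 0)) at_top"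
        by (intro tendsto_sum tendsto_mult tendsto_const tendsto_power_div_exp_0)
      then show ?thesis
        by (simp add: poly_altdef sum_distrib_right exp_minus divide_inverse mult.assoc)
    qed
    from this[of "pCons 0 p"] show ?thesis by (simp add: mult.assoc)
  qed
  moreover have "((\<lambda>y::real. exp (- y)) \<longlongrightarrow> 0) at_top"
    using tendsto_power_div_exp_0[of 0] by (simp add: exp_minus divide_inverse)
  ultimately have "((\<lambda>y. a * exp (-y) + y * (poly p y * exp (- y))) \<longlongrightarrow> a * 0 + 0) at_top"
    by (intro tendsto_intros)
  then show ?case by (simp add: algebra_simps)
qed

lemma flat_exp_has_derivative: "(flat_exp k has_real_derivative flat_exp (Suc k) t) (at t)"
proof -
  consider "t > 0" | "t < 0" | "t = 0" by linarith
  then show ?thesis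
  proof cases
    case 1
    have "((\<lambda>t. poly (flat_poly k) (1 / t) * exp (- (1 / t))) has_real_derivative flat_exp (Suc k) t) (at t)"
      unfolding flat_exp_def using 1
      by (auto intro!: derivative_eq_intros DERIV_chain2[OF poly_DERIV] simp: field_simps power2_eq_square)
    then show ?thesis
      by (rule DERIV_cong_ev[THEN iffD1, OF refl _ refl, rotated])
        (use 1 in \<open>auto simp: flat_exp_def eventually_nhds intro!: exI[of _ "{0<..}"]\<close>)
  next
    case 2
    have "((\<lambda>t. 0) has_real_derivative flat_exp (Suc k) t) (at t)"
      using 2 by (auto simp: flat_exp_def)
    then show ?thesis
      by (rule DERIV_cong_ev[THEN iffD1, OF refl _ refl, rotated])
        (use 2 in \<open>auto simp: flat_exp_def eventually_nhds intro!: exI[of _ "{..<0}"]\<close>)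
  next
    case 3
    have "((\<lambda>h. flat_exp k h / h) \<longlongrightarrow> 0) (at_right 0)"
    proof -
      \<comment> \<open>The difference quotient at 0 from the right is y p(y) e^(-y) with y = 1/h,
        and y tends to infinity.\<close>
      have "((\<lambda>y. poly ([:0,1:] * flat_poly k) y * exp (- y)) \<longlongrightarrow> 0) at_top"
        by (rule poly_exp_tendsto_0)
      from filterlim_compose[OF this filterlim_inverse_at_top_right]
      have "((\<lambda>h. poly ([:0,1:] * flat_poly k) (inverse h) * exp (- inverse h)) \<longlongrightarrow> 0) (at_right 0)" .
      then show ?thesis
        by (rule Lim_transform_eventually)
          (auto simp: flat_exp_def eventually_at_right_less field_simps eventually_at_filter)
    qed
    moreover have "((\<lambda>h. flat_exp k h / h) \<longlongrightarrow> 0) (at_left 0)"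
      by (rule Lim_transform_eventually[OF tendsto_const])
        (auto simp: flat_exp_def eventually_at_filter)
    ultimately have "((\<lambda>h. flat_exp k h / h) \<longlongrightarrow> 0) (at 0)"
      by (simp add: filterlim_split_at)
    then show ?thesis using 3 by (simp add: DERIV_def flat_exp_def)
  qed
qed

text \<open>The squared norm keeps the argument polynomial, hence smooth at the centre as well. For
  r \<ge> 0 the function is positive exactly on the open ball of radius r about c.\<close>

definition bump :: "real^'n::finite \<Rightarrow> real \<Rightarrow> real^'n \<Rightarrow> real" where
  "bump c r x = flat_exp 0 (r\<^sup>2 - (norm (x - c))\<^sup>2)"

lemma bump_pos: "norm (x - c) < r \<Longrightarrow> bump c r x > 0"
  by (simp add: bump_def flat_exp_def power_strict_mono)

lemma bump_nonneg: "bump c r x \<ge> 0"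
  by (simp add: bump_def flat_exp_def)

lemma bump_eq_0: "norm (x - c) \<ge> r \<Longrightarrow> r \<ge> 0 \<Longrightarrow> bump c r x = 0"
  using power_mono[of r "norm (x - c)" 2] by (simp add: bump_def flat_exp_def not_less)

lemma smooth_bump: "smooth (bump c r)"
proof -
  have "smooth (\<lambda>x. r\<^sup>2 - (\<Sum>i\<in>UNIV. (x $ i - c $ i) * (x $ i - c $ i)))"
    by (intro smooth_diff smooth_sum smooth_mult smooth_const smooth_nth)
  then have "smooth (\<lambda>x. r\<^sup>2 - (norm (x - c))\<^sup>2)"
    by (simp only: power2_norm_vec) (simp add: power2_eq_square)
  from smooth_compose[where D=flat_exp and k=0, OF flat_exp_has_derivative this]
  show ?thesis by (simp add: bump_def[abs_def])
qed

lemma bump_test_function: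
  assumes "cball c r \<subseteq> U" "r \<ge> 0" shows "bump c r \<in> test_functions U"
  by (rule test_functionsI[where K="cball c r"])
    (use assms in \<open>auto simp: smooth_bump dist_norm norm_minus_commute intro!: bump_eq_0\<close>)

section \<open>Schwartz functions\<close>

lemma schwartz_smooth: "\<phi> \<in> schwartz \<Longrightarrow> smooth \<phi>"
  by (simp add: schwartz_def)

lemma schwartz_bound:
  fixes \<phi> :: "real^'n::finite \<Rightarrow> complex"
  assumes "\<phi> \<in> schwartz"
  obtains C where "C \<ge> 0" "\<And>x. (1 + norm x) ^ k * cmod (\<phi> x) \<le> C"
proof -
  have "bounded (range (\<lambda>x. (1 + norm x) ^ k *\<^sub>R partial_derivs [] \<phi> x))"
    using assms unfolding schwartz_def by blast
  then obtain C where "\<And>x. norm ((1 + norm x) ^ k *\<^sub>R \<phi> x) \<le> C"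
    unfolding bounded_iff by auto
  then have C: "\<And>x. (1 + norm x) ^ k * cmod (\<phi> x) \<le> C" by simp
  have "0 \<le> (1 + norm (0::real^'n)) ^ k * cmod (\<phi> 0)" by simp
  then show ?thesis using that C order_trans by blast
qed

text \<open>Every iterated derivative of a generator is a finite sum of generators, so decay has to
  be checked for the generators only and not for their derivatives.\<close>

lemma schwartz_coinduct:
  fixes S :: "(real^'n::finite \<Rightarrow> complex) set"
  assumes diff: "\<And>g x. g \<in> S \<Longrightarrow> g differentiable (at x)"
    and step: "\<And>g i. g \<in> S \<Longrightarrow> partial_deriv i g \<in> plus_closure S"
    and bd: "\<And>g k. g \<in> S \<Longrightarrow> \<exists>C. \<forall>x. (1 + norm x) ^ k * cmod (g x) \<le> C"
    and "f \<in> S"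
  shows "f \<in> schwartz"
proof -
  have *: "\<exists>C. \<forall>x. (1 + norm x) ^ k * cmod (g x) \<le> C" if "g \<in> plus_closure S" for g k
    using that
  proof induction
    case (base f) then show ?case using bd by blast
  next
    case (add f g)
    then obtain A B where "\<forall>x. (1 + norm x) ^ k * cmod (f x) \<le> A" "\<forall>x. (1 + norm x) ^ k * cmod (g x) \<le> B"
      by blast
    moreover have "(1 + norm x) ^ k * cmod (f x + g x) \<le> (1 + norm x) ^ k * cmod (f x) + (1 + norm x) ^ k * cmod (g x)" for x
      by (metis distrib_left mult_left_mono norm_ge_zero add_nonneg_nonneg norm_triangle_ineq zero_le_one zero_le_power)
    ultimately have "(1 + norm x) ^ k * cmod (f x + g x) \<le> A + B" for x
      by (smt (verit))
    then show ?case by blast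
  qed
  have f: "f \<in> plus_closure S" using assms(4) by (rule plus_closure.base)
  show ?thesis
    unfolding schwartz_def bounded_iff
    using smooth_coinduct[OF diff step assms(4)]
      *[OF partial_derivs_in_plus_closure(1)[OF diff step f]]
    by auto
qed

lemma schwartz_partial_deriv: "\<phi> \<in> schwartz \<Longrightarrow> partial_deriv i \<phi> \<in> schwartz"
  unfolding schwartz_def by (auto simp: smooth_partial_deriv simp flip: partial_derivs_snoc)

lemma schwartz_partial_derivs: "\<phi> \<in> schwartz \<Longrightarrow> partial_derivs \<alpha> \<phi> \<in> schwartz"
  by (induction \<alpha>) (auto intro: schwartz_partial_deriv)

lemma schwartz_bounded_linear:
  fixes \<phi> :: "real^'n::finite \<Rightarrow> complex"
  assumes L: "bounded_linear L" and "\<phi> \<in> schwartz" shows "(\<lambda>x. L (\<phi> x)) \<in> schwartz"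
proof (rule schwartz_coinduct[where S="{\<lambda>x. L (f x) | f. f \<in> schwartz}"])
  fix h :: "real^'n \<Rightarrow> complex" and i x k assume "h \<in> {\<lambda>x. L (f x) | f. f \<in> schwartz}"
  then obtain f where *: "h = (\<lambda>x. L (f x))" "f \<in> schwartz" by auto
  then have "partial_deriv i h = (\<lambda>x. L (partial_deriv i f x))" "partial_deriv i f \<in> schwartz"
    by (auto simp: partial_deriv_bounded_linear assms schwartz_smooth smooth_differentiable schwartz_partial_deriv)
  then show "partial_deriv i h \<in> plus_closure {\<lambda>x. L (f x) | f. f \<in> schwartz}"
    by (intro plus_closure.base) blast
  show "h differentiable (at x)"
    using * L differentiable_bounded_linear schwartz_smooth smooth_differentiable by blast
  obtain C where C: "\<And>x. (1 + norm x) ^ k * cmod (f x) \<le> C" using schwartz_bound[OF *(2)] by metis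
  obtain B where B: "B > 0" "\<And>y. norm (L y) \<le> norm y * B" using bounded_linear.pos_bounded[OF L] by metis
  have "(1 + norm x) ^ k * cmod (h x) \<le> C * B" for x
  proof -
    have "(1 + norm x) ^ k * cmod (h x) \<le> (1 + norm x) ^ k * (norm (f x) * B)"
      unfolding * by (intro mult_left_mono B) auto
    also have "\<dots> \<le> C * B" using C[of x] B by (simp add: mult.assoc[symmetric] mult_right_mono)
    finally show ?thesis .
  qed
  then show "\<exists>C. \<forall>x. (1 + norm x) ^ k * cmod (h x) \<le> C" by blast
qed (use assms in auto)

lemma schwartz_cmult: "\<phi> \<in> schwartz \<Longrightarrow> (\<lambda>x. c * \<phi> x) \<in> schwartz"
  by (rule schwartz_bounded_linear[OF bounded_linear_mult_right])

lemma schwartz_cnj: "\<phi> \<in> schwartz \<Longrightarrow> (\<lambda>x. cnj (\<phi> x)) \<in> schwartz"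
  by (rule schwartz_bounded_linear[OF bounded_linear_cnj])

lemma schwartz_add:
  assumes "\<phi> \<in> schwartz" "\<psi> \<in> schwartz" shows "(\<lambda>x. \<phi> x + \<psi> x) \<in> schwartz"
proof -
  have A: "partial_derivs \<alpha> (\<lambda>x. \<phi> x + \<psi> x) = (\<lambda>x. partial_derivs \<alpha> \<phi> x + partial_derivs \<alpha> \<psi> x)" for \<alpha>
    by (induction \<alpha>)
      (auto simp: partial_deriv_add smooth_differentiable smooth_partial_derivs schwartz_smooth assms)
  show ?thesis
    using assms unfolding schwartz_def
    by (auto simp: A scaleR_add_right intro!: smooth_add bounded_plus_comp)
qed

lemma schwartz_diff: "\<phi> \<in> schwartz \<Longrightarrow> \<psi> \<in> schwartz \<Longrightarrow> (\<lambda>x. \<phi> x - \<psi> x) \<in> schwartz"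
  using schwartz_add[OF _ schwartz_cmult, of \<phi> \<psi> "-1"] by simp

lemma schwartz_mult_nth:
  fixes \<phi> :: "real^'n::finite \<Rightarrow> complex"
  assumes "\<phi> \<in> schwartz" shows "(\<lambda>x. complex_of_real (x $ j) * \<phi> x) \<in> schwartz"
\<comment> \<open>Differentiating the factor \<open>x $ j\<close> leaves a plain Schwartz function,
  so the generators include \<open>schwartz\<close> itself.\<close>
proof (rule schwartz_coinduct[where S="{\<lambda>x. complex_of_real (x $ j) * f x | f. f \<in> schwartz} \<union> schwartz"])
  let ?S = "{\<lambda>x. complex_of_real (x $ j) * f x | f. f \<in> schwartz} \<union> schwartz"
  fix h :: "real^'n \<Rightarrow> complex" and i x k assume h: "h \<in> ?S"
  show "h differentiable (at x)"
    using h by (auto intro!: smooth_differentiable smooth_mult smooth_of_real dest: schwartz_smooth)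
  show "partial_deriv i h \<in> plus_closure ?S"
  proof (cases "h \<in> schwartz")
    case True then show ?thesis by (intro plus_closure.base) (auto intro: schwartz_partial_deriv)
  next
    case False
    then obtain f where *: "h = (\<lambda>x. complex_of_real (x $ j) * f x)" "f \<in> schwartz" using h by auto
    have "partial_deriv i h = (\<lambda>x. complex_of_real (x $ j) * partial_deriv i f x + of_real (axis i 1 $ j) * f x)"
      unfolding *(1)
        partial_deriv_mult[OF smooth_differentiable[OF smooth_of_real[OF smooth_nth]]
          smooth_differentiable[OF schwartz_smooth[OF *(2)]]]
        partial_deriv_bounded_linear[OF bounded_linear_of_real smooth_differentiable[OF smooth_nth]]
        partial_deriv_nth
      by simp
    then show ?thesis
      using * schwartz_partial_deriv[OF *(2)] schwartz_cmult[OF *(2)]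
      by (auto intro!: plus_closure.add intro: plus_closure.base)
  qed
  show "\<exists>C. \<forall>x. (1 + norm x) ^ k * cmod (h x) \<le> C"
  proof (cases "h \<in> schwartz")
    case True then show ?thesis using schwartz_bound by metis
  next
    case False
    then obtain f where *: "h = (\<lambda>x. complex_of_real (x $ j) * f x)" "f \<in> schwartz" using h by auto
    obtain C where C: "\<And>x. (1 + norm x) ^ Suc k * cmod (f x) \<le> C" using schwartz_bound[OF *(2)] by metis
    have "(1 + norm x) ^ k * cmod (h x) \<le> C" for x
    proof -
      have "\<bar>x $ j\<bar> \<le> 1 + norm x" using component_le_norm_cart[of x j] by simp
      then have "(1 + norm x) ^ k * cmod (h x) \<le> (1 + norm x) ^ k * ((1 + norm x) * cmod (f x))"
        unfolding * by (auto simp: norm_mult intro!: mult_left_mono mult_right_mono)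
      also have "\<dots> \<le> C" using C[of x] by (simp add: ac_simps)
      finally show ?thesis .
    qed
    then show ?thesis by blast
  qed
qed (use assms in auto)

section \<open>Multiplication by powers of 1 + |x|^2\<close>

lemma one_plus_norm_sq_pos [simp]: "1 + (norm x)\<^sup>2 > 0"
  by (simp add: add_pos_nonneg)

lemma smooth_one_plus_norm_sq: "smooth (\<lambda>x::real^'n::finite. 1 + (norm x)\<^sup>2)"
  unfolding power2_norm_vec unfolding power2_eq_square
  by (intro smooth_add smooth_sum smooth_mult smooth_const smooth_nth)

lemma partial_deriv_norm_sq:
  "partial_deriv i (\<lambda>x::real^'n::finite. 1 + (norm x)\<^sup>2) = (\<lambda>x. 2 * x $ i)"
proof
  fix x :: "real^'n"
  have "((\<lambda>x. 1 + x \<bullet> x) has_derivative (\<lambda>v. x \<bullet> v + v \<bullet> x)) (at x)"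
    by (auto intro!: derivative_eq_intros)
  from partial_deriv_eq[OF this, of i]
  show "partial_deriv i (\<lambda>x. 1 + (norm x)\<^sup>2) x = 2 * x $ i"
    by (simp add: power2_norm_eq_inner inner_axis inner_axis')
qed

lemma partial_deriv_bessel_weight:
  "partial_deriv i (\<lambda>x::real^'n::finite. (1 + (norm x)\<^sup>2) powr r)
     = (\<lambda>x. 2 * r * x $ i * (1 + (norm x)\<^sup>2) powr (r - 1))"
  and differentiable_bessel_weight: "(\<lambda>x::real^'n::finite. (1 + (norm x)\<^sup>2) powr r) differentiable (at x)"
proof -
  have d: "((\<lambda>t. t powr r) has_real_derivative r * (1 + (norm x)\<^sup>2) powr (r - 1)) (at (1 + (norm x)\<^sup>2))" for x :: "real^'n"
    by (rule has_real_derivative_powr) simp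
  note c = partial_deriv_chain_real[of "\<lambda>t. t powr r" "\<lambda>t. r * t powr (r - 1)" "\<lambda>x. 1 + (norm x)\<^sup>2",
      OF d smooth_differentiable[OF smooth_one_plus_norm_sq]]
  show "partial_deriv i (\<lambda>x::real^'n. (1 + (norm x)\<^sup>2) powr r)
     = (\<lambda>x. 2 * r * x $ i * (1 + (norm x)\<^sup>2) powr (r - 1))"
    unfolding c(1) partial_deriv_norm_sq by (simp add: fun_eq_iff)
  show "(\<lambda>x::real^'n. (1 + (norm x)\<^sup>2) powr r) differentiable (at x)" by (rule c(2))
qed

lemma bessel_weight_le: "(1 + (norm x)\<^sup>2) powr r \<le> (1 + norm x) ^ nat \<lceil>2 * \<bar>r\<bar>\<rceil>"
proof -
  have "(1 + (norm x)\<^sup>2) powr r \<le> (1 + (norm x)\<^sup>2) powr \<bar>r\<bar>"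
    by (rule powr_mono) auto
  also have "\<dots> \<le> ((1 + norm x)\<^sup>2) powr \<bar>r\<bar>"
    by (rule powr_mono2) (auto simp: power2_eq_square algebra_simps)
  also have "\<dots> = (1 + norm x) powr (2 * \<bar>r\<bar>)"
    by (simp add: powr_powr[symmetric] powr_numeral add_pos_nonneg)
  also have "\<dots> \<le> (1 + norm x) powr (real (nat \<lceil>2 * \<bar>r\<bar>\<rceil>))"
    by (rule powr_mono) (linarith, simp)
  also have "\<dots> = (1 + norm x) ^ nat \<lceil>2 * \<bar>r\<bar>\<rceil>"
    by (rule powr_realpow) (simp add: add_pos_nonneg)
  finally show ?thesis .
qed

text \<open>A derivative falling on the weight lowers its exponent by one and produces a factor x_i,
  which \<open>schwartz_mult_nth\<close> absorbs into the Schwartz factor. The generators therefore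
  range over all exponents r.\<close>

lemma schwartz_mult_bessel_weight:
  fixes \<phi> :: "real^'n::finite \<Rightarrow> complex"
  assumes "\<phi> \<in> schwartz" shows "(\<lambda>x. complex_of_real ((1 + (norm x)\<^sup>2) powr r) * \<phi> x) \<in> schwartz"
proof (rule schwartz_coinduct[where S="{\<lambda>x. complex_of_real ((1 + (norm x)\<^sup>2) powr r) * f x | r f. f \<in> schwartz}"])
  let ?S = "{\<lambda>x. complex_of_real ((1 + (norm x)\<^sup>2) powr r) * f x | r f. f \<in> schwartz}"
  fix h :: "real^'n \<Rightarrow> complex" and i x k assume h: "h \<in> ?S"
  then obtain r f where *: "h = (\<lambda>x. complex_of_real ((1 + (norm x)\<^sup>2) powr r) * f x)" "f \<in> schwartz" by auto
  note d = differentiable_bounded_linear[OF bounded_linear_of_real differentiable_bessel_weight]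
     and df = smooth_differentiable[OF schwartz_smooth[OF *(2)]]
  show "h differentiable (at x)"
    unfolding * by (intro differentiable_mult d df)
  have "partial_deriv i h = (\<lambda>x. complex_of_real ((1 + (norm x)\<^sup>2) powr r) * partial_deriv i f x
      + complex_of_real ((1 + (norm x)\<^sup>2) powr (r - 1)) * ((2 * r) * (of_real (x $ i) * f x)))"
    unfolding * partial_deriv_mult[OF d df]
    by (simp add: partial_deriv_bounded_linear[OF bounded_linear_of_real differentiable_bessel_weight]
        partial_deriv_bessel_weight fun_eq_iff)
  moreover have S: "(\<lambda>x. complex_of_real ((1 + (norm x)\<^sup>2) powr r) * f x) \<in> ?S" if "f \<in> schwartz" for r f
    using that by blast
  note S[OF schwartz_partial_deriv[OF *(2)], of r i]
    S[OF schwartz_cmult[OF schwartz_mult_nth[OF *(2)]], of "r - 1" "2 * of_real r" i]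
  ultimately show "partial_deriv i h \<in> plus_closure ?S"
    by (simp only: plus_closure.add plus_closure.base of_real_mult of_real_numeral)
  obtain C where C: "\<And>x. (1 + norm x) ^ (k + nat \<lceil>2 * \<bar>r\<bar>\<rceil>) * cmod (f x) \<le> C"
    using schwartz_bound[OF *(2)] by metis
  have "(1 + norm x) ^ k * cmod (h x) \<le> C" for x
  proof -
    have "(1 + norm x) ^ k * cmod (h x) \<le> (1 + norm x) ^ k * ((1 + norm x) ^ nat \<lceil>2 * \<bar>r\<bar>\<rceil> * cmod (f x))"
      unfolding * by (auto simp: norm_mult intro!: mult_left_mono mult_right_mono bessel_weight_le)
    also have "\<dots> \<le> C" using C[of x] by (simp add: power_add ac_simps)
    finally show ?thesis .
  qed
  then show "\<exists>C. \<forall>x. (1 + norm x) ^ k * cmod (h x) \<le> C" by blast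
qed (use assms in auto)

section \<open>Affine substitutions and compact support\<close>

lemma partial_deriv_affine:
  fixes f :: "real^'n::finite \<Rightarrow> 'b::real_normed_vector"
  assumes "\<And>x. f differentiable (at x)"
  shows "partial_deriv i (\<lambda>x. f (c *\<^sub>R x + z)) = (\<lambda>x. c *\<^sub>R partial_deriv i f (c *\<^sub>R x + z))"
    and "(\<lambda>x. f (c *\<^sub>R x + z)) differentiable (at x)"
proof -
  have *: "\<exists>D. (f has_derivative D) (at (c *\<^sub>R x + z)) \<and> D (axis i 1) = partial_deriv i f (c *\<^sub>R x + z) \<and>
     ((\<lambda>x. f (c *\<^sub>R x + z)) has_derivative (\<lambda>v. c *\<^sub>R D v)) (at x)" for x
  proof -
    obtain D where D: "(f has_derivative D) (at (c *\<^sub>R x + z))" "D (axis i 1) = partial_deriv i f (c *\<^sub>R x + z)"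
      using differentiable_has_derivative_partial assms by blast
    have "((\<lambda>x. c *\<^sub>R x + z) has_derivative (\<lambda>v. c *\<^sub>R v)) (at x)"
      by (auto intro!: derivative_eq_intros)
    from has_derivative_compose[OF this D(1)]
    have "((\<lambda>x. f (c *\<^sub>R x + z)) has_derivative (\<lambda>v. D (c *\<^sub>R v))) (at x)" .
    then show ?thesis using D has_derivative_linear[OF D(1)] by (auto simp: linear_cmul)
  qed
  show "partial_deriv i (\<lambda>x. f (c *\<^sub>R x + z)) = (\<lambda>x. c *\<^sub>R partial_deriv i f (c *\<^sub>R x + z))"
    using * partial_deriv_eq by (metis (no_types, lifting))
  show "(\<lambda>x. f (c *\<^sub>R x + z)) differentiable (at x)"
    using * differentiable_def by blast
qed

text \<open>One statement for translations (c = 1) and the reflection (c = -1, z = 0). Decay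
  survives by 1 + |x| \<le> (1 + |z|)(1 + |cx + z|), which uses |c| = 1.\<close>

lemma schwartz_affine:
  fixes \<phi> :: "real^'n::finite \<Rightarrow> complex"
  assumes "\<phi> \<in> schwartz" and c: "\<bar>c\<bar> = 1"
  shows "(\<lambda>x. \<phi> (c *\<^sub>R x + z)) \<in> schwartz"
proof (rule schwartz_coinduct[where S="{\<lambda>x. f (c *\<^sub>R x + z) | f. f \<in> schwartz}"])
  let ?S = "{\<lambda>x. f (c *\<^sub>R x + z) | f. f \<in> schwartz}"
  fix h :: "real^'n \<Rightarrow> complex" and i x k assume h: "h \<in> ?S"
  then obtain f where *: "h = (\<lambda>x. f (c *\<^sub>R x + z))" "f \<in> schwartz" by auto
  note d = partial_deriv_affine[OF smooth_differentiable[OF schwartz_smooth[OF *(2)]]]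
  show "h differentiable (at x)" unfolding * by (rule d(2))
  have "partial_deriv i h = (\<lambda>x. (\<lambda>y. of_real c * partial_deriv i f y) (c *\<^sub>R x + z))"
    unfolding * d(1) by (simp add: scaleR_conv_of_real)
  then show "partial_deriv i h \<in> plus_closure ?S"
    using schwartz_cmult[OF schwartz_partial_deriv[OF *(2)], of "of_real c" i]
    by (auto intro!: plus_closure.base exI[of _ "\<lambda>y. of_real c * partial_deriv i f y"])
  obtain C where C: "\<And>x. (1 + norm x) ^ k * cmod (f x) \<le> C"
    using schwartz_bound[OF *(2)] by metis
  have "(1 + norm x) ^ k * cmod (h x) \<le> (1 + norm z) ^ k * C" for x
  proof -
    have "norm x = norm (c *\<^sub>R x)" using c by simp
    also have "\<dots> \<le> norm (c *\<^sub>R x + z) + norm z"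
      using norm_triangle_ineq4[of "c *\<^sub>R x + z" z] by simp
    finally have "norm x \<le> norm (c *\<^sub>R x + z) + norm z" .
    moreover have "0 \<le> norm z * norm (c *\<^sub>R x + z)" by simp
    ultimately have "1 + norm x \<le> (1 + norm z) * (1 + norm (c *\<^sub>R x + z))"
      unfolding distrib_left distrib_right by linarith
    then have "(1 + norm x) ^ k \<le> (1 + norm z) ^ k * (1 + norm (c *\<^sub>R x + z)) ^ k"
      by (metis power_mono power_mult_distrib add_nonneg_nonneg norm_ge_zero zero_le_one)
    then have "(1 + norm x) ^ k * cmod (h x) \<le> (1 + norm z) ^ k * (1 + norm (c *\<^sub>R x + z)) ^ k * cmod (h x)"
      by (rule mult_right_mono) simp
    also have "\<dots> \<le> (1 + norm z) ^ k * C"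
      unfolding * mult.assoc by (intro mult_left_mono C) simp
    finally show ?thesis .
  qed
  then show "\<exists>C. \<forall>x. (1 + norm x) ^ k * cmod (h x) \<le> C" by blast
qed (use assms in auto)

lemma schwartz_translate: "\<phi> \<in> schwartz \<Longrightarrow> (\<lambda>x. \<phi> (x + z)) \<in> schwartz"
  using schwartz_affine[of \<phi> 1 z] by simp

lemma schwartz_reflect: "\<phi> \<in> schwartz \<Longrightarrow> (\<lambda>x. \<phi> (- x)) \<in> schwartz"
  using schwartz_affine[of \<phi> "-1" 0] by simp

text \<open>The complement of K is open, so derivatives vanish there too and the smooth functions
  vanishing off K are closed under differentiation. Decay is then boundedness on a compact
  set.\<close>

lemma smooth_compact_support_schwartz:
  fixes \<phi> :: "real^'n::finite \<Rightarrow> complex"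
  assumes "smooth \<phi>" "compact K" "\<And>x. x \<notin> K \<Longrightarrow> \<phi> x = 0"
  shows "\<phi> \<in> schwartz"
proof (rule schwartz_coinduct[where S="{f. smooth f \<and> (\<forall>x. x \<notin> K \<longrightarrow> f x = 0)}"])
  fix h :: "real^'n \<Rightarrow> complex" and i x k assume h: "h \<in> {f. smooth f \<and> (\<forall>x. x \<notin> K \<longrightarrow> f x = 0)}"
  show "h differentiable (at x)" using h smooth_differentiable by blast
  have "partial_deriv i h x = 0" if "x \<notin> K" for x
  proof -
    have o: "open (- K)" using compact_imp_closed[OF assms(2)] by auto
    have "(h has_derivative (\<lambda>v. 0)) (at x)"
      by (rule has_derivative_transform_within_open[OF has_derivative_const[of 0] o]) (use that h in auto)
    then show ?thesis using partial_deriv_eq by metis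
  qed
  then show "partial_deriv i h \<in> plus_closure {f. smooth f \<and> (\<forall>x. x \<notin> K \<longrightarrow> f x = 0)}"
    using h smooth_partial_deriv by (auto intro: plus_closure.base)
  have "continuous_on K (\<lambda>x. (1 + norm x) ^ k * cmod (h x))"
    using h smooth_continuous_on by (auto intro!: continuous_intros)
  then have "bounded ((\<lambda>x. (1 + norm x) ^ k * cmod (h x)) ` K)"
    using assms(2) compact_continuous_image compact_imp_bounded by blast
  then obtain C where C: "\<And>x. x \<in> K \<Longrightarrow> \<bar>(1 + norm x) ^ k * cmod (h x)\<bar> \<le> C"
    unfolding bounded_iff by auto
  have "(1 + norm x) ^ k * cmod (h x) \<le> max C 0" for x
  proof (cases "x \<in> K")
    case True then show ?thesis using C[of x] by linarith
  next
    case False then show ?thesis using h by simp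
  qed
  then show "\<exists>C. \<forall>x. (1 + norm x) ^ k * cmod (h x) \<le> C" by blast
qed (use assms in auto)

lemma test_function_schwartz:
  assumes "\<phi> \<in> test_functions U" shows "(\<lambda>x. complex_of_real (\<phi> x)) \<in> schwartz"
proof (rule smooth_compact_support_schwartz)
  show "smooth (\<lambda>x. complex_of_real (\<phi> x))" using assms by (auto simp: test_functions_def smooth_of_real)
  show "compact (closure {x. \<phi> x \<noteq> 0})" using assms by (auto simp: test_functions_def)
  show "complex_of_real (\<phi> x) = 0" if "x \<notin> closure {x. \<phi> x \<noteq> 0}" for x
    using that closure_subset[of "{x. \<phi> x \<noteq> 0}"] by auto
qed

section \<open>Integration on $\mathbb{R}^n$\<close>

lemma integral_lborel_affine:
  fixes f :: "'a::euclidean_space \<Rightarrow> 'b::{banach,second_countable_topology}"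
  assumes [measurable]: "f \<in> borel_measurable borel" and c: "c \<noteq> 0"
  shows "(\<integral>x. f (t + c *\<^sub>R x) \<partial>lborel) = (\<integral>x. f x \<partial>lborel) /\<^sub>R \<bar>c\<bar> ^ DIM('a)"
    and "integrable lborel (\<lambda>x. f (t + c *\<^sub>R x)) \<longleftrightarrow> integrable lborel f"
proof -
  have *: "(lborel :: 'a measure) = density (distr lborel borel (\<lambda>x. t + c *\<^sub>R x)) (\<lambda>_. ennreal (\<bar>c\<bar> ^ DIM('a)))"
    using lborel_affine[OF c, of t] by simp
  have "(\<integral>x. f x \<partial>lborel) = \<bar>c\<bar> ^ DIM('a) *\<^sub>R (\<integral>x. f (t + c *\<^sub>R x) \<partial>lborel)"
    by (subst *) (simp add: integral_density integral_distr)
  then show "(\<integral>x. f (t + c *\<^sub>R x) \<partial>lborel) = (\<integral>x. f x \<partial>lborel) /\<^sub>R \<bar>c\<bar> ^ DIM('a)"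
    using c by simp
  have "integrable lborel f \<longleftrightarrow> integrable (density (distr lborel borel (\<lambda>x. t + c *\<^sub>R x)) (\<lambda>_. ennreal (\<bar>c\<bar> ^ DIM('a)))) f"
    by (subst *) simp
  also have "\<dots> \<longleftrightarrow> integrable lborel (\<lambda>x. f (t + c *\<^sub>R x))"
  proof -
    have "integrable lborel (\<lambda>x. f (t + c *\<^sub>R x))"
      if "integrable lborel (\<lambda>x. \<bar>c\<bar> ^ DIM('a) *\<^sub>R f (t + c *\<^sub>R x))"
      using integrable_scaleR_right[OF that, of "inverse (\<bar>c\<bar> ^ DIM('a))"] c by simp
    then show ?thesis
      by (auto simp: integrable_density integrable_distr_eq intro!: integrable_scaleR_right)
  qed
  finally show "integrable lborel (\<lambda>x. f (t + c *\<^sub>R x)) \<longleftrightarrow> integrable lborel f" ..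
qed

lemma integral_lborel_translate:
  fixes f :: "'a::euclidean_space \<Rightarrow> 'b::{banach,second_countable_topology}"
  assumes "f \<in> borel_measurable borel"
  shows "(\<integral>x. f (x + t) \<partial>lborel) = (\<integral>x. f x \<partial>lborel)"
    and "integrable lborel (\<lambda>x. f (x + t)) \<longleftrightarrow> integrable lborel f"
  using integral_lborel_affine[OF assms, of 1 t] by (auto simp: add.commute)

lemma integral_lborel_reflect:
  fixes f :: "'a::euclidean_space \<Rightarrow> 'b::{banach,second_countable_topology}"
  assumes "f \<in> borel_measurable borel"
  shows "(\<integral>x. f (- x) \<partial>lborel) = (\<integral>x. f x \<partial>lborel)"
    and "integrable lborel (\<lambda>x. f (- x)) \<longleftrightarrow> integrable lborel f"
  using integral_lborel_affine[OF assms, of "-1" 0] by auto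

lemma nn_integral_lborel_translate:
  fixes f :: "'a::euclidean_space \<Rightarrow> ennreal"
  assumes [measurable]: "f \<in> borel_measurable borel"
  shows "(\<integral>\<^sup>+x. f (x + t) \<partial>lborel) = (\<integral>\<^sup>+x. f x \<partial>lborel)"
proof -
  have "(\<integral>\<^sup>+x. f x \<partial>lborel) = (\<integral>\<^sup>+x. f x \<partial>(distr lborel borel ((+) t)))"
    by (simp add: lborel_distr_plus)
  also have "\<dots> = (\<integral>\<^sup>+x. f (x + t) \<partial>lborel)"
    by (subst nn_integral_distr) (auto simp: add.commute)
  finally show ?thesis ..
qed

lemma nn_integral_lborel_scale:
  fixes f :: "'a::euclidean_space \<Rightarrow> ennreal"
  assumes [measurable]: "f \<in> borel_measurable borel" and c: "c > 0"
  shows "(\<integral>\<^sup>+x. f x \<partial>lborel) = ennreal (c ^ DIM('a)) * (\<integral>\<^sup>+x. f (c *\<^sub>R x) \<partial>lborel)"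
proof -
  have "(\<integral>\<^sup>+x. f x \<partial>lborel) = (\<integral>\<^sup>+x. f x \<partial>(density (distr lborel borel (\<lambda>x. 0 + c *\<^sub>R x)) (\<lambda>_. ennreal (c ^ DIM('a)))))"
    using lborel_affine[of c "0::'a"] c by simp
  also have "\<dots> = ennreal (c ^ DIM('a)) * (\<integral>\<^sup>+x. f (c *\<^sub>R x) \<partial>lborel)"
    by (simp add: nn_integral_density nn_integral_distr nn_integral_cmult)
  finally show ?thesis .
qed

lemma integrable_pair_mult:
  fixes f g :: "_ \<Rightarrow> 'b::{real_normed_algebra,banach,second_countable_topology}"
  assumes f: "integrable lborel f" and g: "integrable lborel g"
  shows "integrable (lborel \<Otimes>\<^sub>M lborel) (\<lambda>(x::'a::euclidean_space, y::'c::euclidean_space). f x * g y)"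
proof -
  have [measurable]: "f \<in> borel_measurable borel" "g \<in> borel_measurable borel"
    using f g by (auto dest: borel_measurable_integrable)
  have "(\<integral>\<^sup>+z. norm (f (fst z) * g (snd z)) \<partial>(lborel \<Otimes>\<^sub>M lborel))
      \<le> (\<integral>\<^sup>+z. ennreal (norm (f (fst z))) * ennreal (norm (g (snd z))) \<partial>(lborel \<Otimes>\<^sub>M lborel))"
    by (intro nn_integral_mono) (simp add: norm_mult_ineq ennreal_leI flip: ennreal_mult)
  also have "\<dots> = (\<integral>\<^sup>+x. \<integral>\<^sup>+y. ennreal (norm (f x)) * ennreal (norm (g y)) \<partial>lborel \<partial>lborel)"
    by (subst lborel.nn_integral_fst[symmetric]) (auto intro!: nn_integral_cong)
  also have "\<dots> = (\<integral>\<^sup>+x. norm (f x) \<partial>lborel) * (\<integral>\<^sup>+y. norm (g y) \<partial>lborel)"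
    by (simp add: nn_integral_cmult nn_integral_multc)
  also have "\<dots> < \<infinity>"
    using f g by (auto simp: integrable_iff_bounded ennreal_mult_less_top)
  finally have "(\<integral>\<^sup>+z. norm (f (fst z) * g (snd z)) \<partial>(lborel \<Otimes>\<^sub>M lborel)) < \<infinity>" .
  then show ?thesis
    unfolding integrable_iff_bounded case_prod_beta by simp
qed

section \<open>Integrability of Schwartz functions\<close>

lemma integrable_inverse_one_plus_sq: "integrable lborel (\<lambda>x::real. inverse (1 + x\<^sup>2))"
  using integrable_inverse_1_plus_square
  by (simp add: set_integrable_def einterval_def)

text \<open>Each factor 1 + x_b^2 is at most (1 + |x|)^2, so with the exponent 2n the weight lies
  below the product of the n functions 1/(1 + x_b^2), whose integral factors into one-dimensional
  ones.\<close>

lemma integrable_rapid_weight: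
  "integrable lborel (\<lambda>x::real^'n::finite. inverse ((1 + norm x) ^ (2 * CARD('n))))"
proof -
  have "(\<integral>\<^sup>+x. ennreal (inverse ((1 + norm x) ^ (2 * CARD('n)))) \<partial>(lborel :: (real^'n) measure))
     \<le> (\<integral>\<^sup>+x. (\<Prod>b\<in>Basis. ennreal (inverse (1 + (x \<bullet> b)\<^sup>2))) \<partial>(lborel :: (real^'n) measure))"
  proof (intro nn_integral_mono)
    fix x :: "real^'n"
    have "(\<Prod>b\<in>Basis. 1 + (x \<bullet> b)\<^sup>2) \<le> (\<Prod>b\<in>(Basis :: (real^'n) set). (1 + norm x)\<^sup>2)"
    proof (intro prod_mono conjI)
      fix b :: "real^'n" assume "b \<in> Basis"
      then have "(x \<bullet> b)\<^sup>2 \<le> (norm x)\<^sup>2"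
        using Basis_le_norm by (simp add: abs_le_square_iff[symmetric])
      then show "1 + (x \<bullet> b)\<^sup>2 \<le> (1 + norm x)\<^sup>2"
        unfolding power2_sum using norm_ge_zero[of x] by (simp only: power_one)
    qed (simp add: add_nonneg_nonneg)
    also have "\<dots> = (1 + norm x) ^ (2 * CARD('n))"
      by (simp add: power_mult)
    finally have "inverse ((1 + norm x) ^ (2 * CARD('n))) \<le> inverse (\<Prod>b\<in>Basis. 1 + (x \<bullet> b)\<^sup>2)"
      by (rule le_imp_inverse_le) (intro prod_pos, simp add: add_pos_nonneg)
    also have "\<dots> = (\<Prod>b\<in>Basis. inverse (1 + (x \<bullet> b)\<^sup>2))"
      by (simp add: prod_inversef[symmetric])
    finally show "ennreal (inverse ((1 + norm x) ^ (2 * CARD('n)))) \<le> (\<Prod>b\<in>Basis. ennreal (inverse (1 + (x \<bullet> b)\<^sup>2)))"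
      by (simp add: prod_ennreal ennreal_leI)
  qed
  also have "\<dots> = (\<Prod>b\<in>(Basis :: (real^'n) set). \<integral>\<^sup>+x. ennreal (inverse (1 + x\<^sup>2)) \<partial>lborel)"
    by (rule nn_integral_lborel_prod) auto
  also have "\<dots> < \<infinity>"
  proof -
    have "(\<integral>\<^sup>+x. ennreal (inverse (1 + x\<^sup>2)) \<partial>(lborel :: real measure)) < \<infinity>"
      using integrable_inverse_one_plus_sq by (simp add: integrable_iff_bounded)
    then show ?thesis by (simp add: less_top[symmetric] ennreal_prod_eq_top power_eq_top_ennreal)
  qed
  finally show ?thesis
    unfolding integrable_iff_bounded by simp
qed

lemma schwartz_rapid_bound:
  fixes \<phi> :: "real^'n::finite \<Rightarrow> complex"
  assumes "\<phi> \<in> schwartz"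
  obtains C where "C \<ge> 0" "\<And>x. norm x ^ k * cmod (\<phi> x) \<le> C * inverse ((1 + norm x) ^ (2 * CARD('n)))"
proof -
  obtain C where C: "C \<ge> 0" "\<And>x. (1 + norm x) ^ (k + 2 * CARD('n)) * cmod (\<phi> x) \<le> C"
    using schwartz_bound[OF assms] by metis
  have "norm x ^ k * cmod (\<phi> x) \<le> C * inverse ((1 + norm x) ^ (2 * CARD('n)))" for x
  proof -
    have "norm x ^ k * cmod (\<phi> x) * (1 + norm x) ^ (2 * CARD('n))
        \<le> (1 + norm x) ^ k * cmod (\<phi> x) * (1 + norm x) ^ (2 * CARD('n))"
      by (intro mult_right_mono power_mono) auto
    also have "\<dots> \<le> C" using C(2)[of x] by (simp add: power_add ac_simps)
    finally have "norm x ^ k * cmod (\<phi> x) * (1 + norm x) ^ (2 * CARD('n)) \<le> C" .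
    then show ?thesis
      by (simp add: divide_inverse[symmetric] pos_le_divide_eq add_pos_nonneg)
  qed
  then show ?thesis using that C(1) by blast
qed

lemma schwartz_measurable [measurable_dest]: "\<phi> \<in> schwartz \<Longrightarrow> \<phi> \<in> borel_measurable borel"
  by (intro smooth_borel_measurable schwartz_smooth)

lemma schwartz_integrable_moment:
  fixes \<phi> :: "real^'n::finite \<Rightarrow> complex"
  assumes "\<phi> \<in> schwartz" shows "integrable lborel (\<lambda>x. norm x ^ k * cmod (\<phi> x))"
proof -
  have [measurable]: "\<phi> \<in> borel_measurable borel" using assms by (rule schwartz_measurable)
  obtain C where C: "C \<ge> 0" "\<And>x. norm x ^ k * cmod (\<phi> x) \<le> C * inverse ((1 + norm x) ^ (2 * CARD('n)))"
    using schwartz_rapid_bound[OF assms] by metis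
  show ?thesis
    by (rule Bochner_Integration.integrable_bound[OF integrable_mult_right[OF integrable_rapid_weight, of C]])
      (use C in auto)
qed

lemma schwartz_integrable:
  fixes \<phi> :: "real^'n::finite \<Rightarrow> complex"
  assumes "\<phi> \<in> schwartz" shows "integrable lborel \<phi>"
  by (rule Bochner_Integration.integrable_bound[OF schwartz_integrable_moment[OF assms, of 0]])
    (use assms schwartz_measurable in auto)

lemma schwartz_bounded:
  assumes "\<phi> \<in> schwartz" obtains C where "C \<ge> 0" "\<And>x. cmod (\<phi> x) \<le> C"
  using schwartz_bound[OF assms, of 0] by auto

lemma integrable_bounded_mult:
  fixes f g :: "'a \<Rightarrow> 'b::{real_normed_algebra,banach,second_countable_topology}"
  assumes f: "integrable M f" and [measurable]: "g \<in> borel_measurable M" and C: "\<And>x. norm (g x) \<le> C"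
  shows "integrable M (\<lambda>x. g x * f x)"
proof (rule Bochner_Integration.integrable_bound[OF integrable_mult_right[OF integrable_norm[OF f], of C]])
  show "(\<lambda>x. g x * f x) \<in> borel_measurable M" using f by measurable
  have "norm (g x * f x) \<le> C * norm (f x)" for x
    by (rule order_trans[OF norm_mult_ineq mult_right_mono]) (auto simp: C)
  then show "AE x in M. norm (g x * f x) \<le> norm (C * norm (f x))"
    by (auto intro!: AE_I2 order_trans[OF _ abs_ge_self])
qed

section \<open>The Fourier transform of Schwartz functions\<close>

lemma norm_character [simp]: "cmod (exp (- (\<i> * complex_of_real t))) = 1" "cmod (exp (\<i> * complex_of_real t)) = 1"
  by (simp_all add: norm_exp_eq_Re)

lemma fourier_integrable:
  fixes \<phi> :: "real^'n::finite \<Rightarrow> complex"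
  assumes "integrable lborel \<phi>"
  shows "integrable lborel (\<lambda>x. exp (- (\<i> * complex_of_real (x \<bullet> \<xi>))) * \<phi> x)"
  by (rule integrable_bounded_mult[OF assms, where C=1]) auto

lemma fourier_add:
  fixes \<phi> \<psi> :: "real^'n::finite \<Rightarrow> complex"
  assumes "integrable lborel \<phi>" "integrable lborel \<psi>"
  shows "fourier (\<lambda>x. \<phi> x + \<psi> x) \<xi> = fourier \<phi> \<xi> + fourier \<psi> \<xi>"
  unfolding fourier_def distrib_left
  by (intro Bochner_Integration.integral_add fourier_integrable assms)

lemma fourier_cmult:
  fixes \<phi> :: "real^'n::finite \<Rightarrow> complex"
  shows "fourier (\<lambda>x. c * \<phi> x) \<xi> = c * fourier \<phi> \<xi>"
proof -
  have "fourier (\<lambda>x. c * \<phi> x) \<xi> = (\<integral>x. c * (exp (- (\<i> * complex_of_real (x \<bullet> \<xi>))) * \<phi> x) \<partial>lborel)"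
    unfolding fourier_def by (intro Bochner_Integration.integral_cong) auto
  then show ?thesis by (simp add: fourier_def)
qed

lemma norm_fourier_le:
  fixes \<phi> :: "real^'n::finite \<Rightarrow> complex"
  shows "cmod (fourier \<phi> \<xi>) \<le> (\<integral>x. cmod (\<phi> x) \<partial>lborel)"
proof -
  have "cmod (fourier \<phi> \<xi>) \<le> (\<integral>x. cmod (exp (- (\<i> * complex_of_real (x \<bullet> \<xi>))) * \<phi> x) \<partial>lborel)"
    unfolding fourier_def by (rule integral_norm_bound)
  then show ?thesis by (simp add: norm_mult)
qed

text \<open>The derivative of the modulated function contains both terms of the rule for the
  transform of a derivative. As the modulated function is again Schwartz, the integral of this
  derivative vanishes, and the rule follows.\<close>

lemma schwartz_modulate:
  fixes \<phi> :: "real^'n::finite \<Rightarrow> complex"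
  assumes "\<phi> \<in> schwartz"
  shows "(\<lambda>x. exp (- (\<i> * complex_of_real (x \<bullet> \<xi>))) * \<phi> x) \<in> schwartz" (is ?thesis1)
    and "partial_deriv i (\<lambda>x. exp (- (\<i> * complex_of_real (x \<bullet> \<xi>))) * \<phi> x) =
      (\<lambda>x. exp (- (\<i> * complex_of_real (x \<bullet> \<xi>))) * (partial_deriv i \<phi> x - \<i> * complex_of_real (\<xi> $ i) * \<phi> x))"
proof -
  let ?e = "\<lambda>x. exp (- (\<i> * complex_of_real (x \<bullet> \<xi>)))"
  have de: "(?e has_derivative (\<lambda>v. - \<i> * complex_of_real (v \<bullet> \<xi>) * ?e x)) (at x)" for x
  proof -
    have "((\<lambda>x. - (\<i> * complex_of_real (x \<bullet> \<xi>))) has_derivative (\<lambda>v. - \<i> * complex_of_real (v \<bullet> \<xi>))) (at x)"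
      by (auto intro!: derivative_eq_intros)
    from has_derivative_compose[OF this DERIV_exp[unfolded has_field_derivative_def]]
    show ?thesis by (simp add: mult.commute)
  qed
  have pe: "partial_deriv i ?e = (\<lambda>x. - \<i> * complex_of_real (\<xi> $ i) * ?e x)" for i
    by (rule ext, rule partial_deriv_eq[OF de, THEN trans]) (simp add: inner_axis')
  have diff: "?e differentiable (at x)" for x using de differentiable_def by blast
  have pd: "partial_deriv i (\<lambda>x. ?e x * f x) = (\<lambda>x. ?e x * (partial_deriv i f x - \<i> * complex_of_real (\<xi> $ i) * f x))"
    if "f \<in> schwartz" for f i
    unfolding partial_deriv_mult[OF diff smooth_differentiable[OF schwartz_smooth[OF that]]] pe
    by (simp add: fun_eq_iff algebra_simps)
  show "partial_deriv i (\<lambda>x. exp (- (\<i> * complex_of_real (x \<bullet> \<xi>))) * \<phi> x) =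
      (\<lambda>x. exp (- (\<i> * complex_of_real (x \<bullet> \<xi>))) * (partial_deriv i \<phi> x - \<i> * complex_of_real (\<xi> $ i) * \<phi> x))"
    by (rule pd[OF assms])
  show ?thesis1
  proof (rule schwartz_coinduct[where S="{\<lambda>x. ?e x * f x | f. f \<in> schwartz}"])
    fix h :: "real^'n \<Rightarrow> complex" and i x k assume "h \<in> {\<lambda>x. ?e x * f x | f. f \<in> schwartz}"
    then obtain f where *: "h = (\<lambda>x. ?e x * f x)" "f \<in> schwartz" by auto
    show "h differentiable (at x)"
      unfolding * by (intro differentiable_mult diff smooth_differentiable schwartz_smooth *)
    show "partial_deriv i h \<in> plus_closure {\<lambda>x. ?e x * f x | f. f \<in> schwartz}"
      unfolding * pd[OF *(2)]
      using schwartz_diff[OF schwartz_partial_deriv[OF *(2), of i] schwartz_cmult[OF *(2), of "\<i> * complex_of_real (\<xi> $ i)"]]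
      by (intro plus_closure.base CollectI exI[of _ "\<lambda>x. partial_deriv i f x - \<i> * complex_of_real (\<xi> $ i) * f x"]) simp
    show "\<exists>C. \<forall>x. (1 + norm x) ^ k * cmod (h x) \<le> C"
      using schwartz_bound[OF *(2)] unfolding * by (simp add: norm_mult) metis
  qed (use assms in auto)
qed

section \<open>The Fourier transform and derivatives\<close>

lemma one_plus_le_twice: "(a::real) \<le> b + c \<Longrightarrow> c \<le> 1 \<Longrightarrow> 0 \<le> b \<Longrightarrow> 1 + a \<le> 2 * (1 + b)"
  by simp

text \<open>A difference quotient integrates to 0 by translation invariance, and dominated
  convergence carries this over to the derivative.\<close>

lemma integral_partial_deriv_schwartz:
  fixes \<phi> :: "real^'n::finite \<Rightarrow> complex"
  assumes \<phi>: "\<phi> \<in> schwartz"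
  shows "(\<integral>x. partial_deriv i \<phi> x \<partial>lborel) = 0"
proof -
  let ?a = "axis i 1 :: real^'n"
  define t where "t n = 1 / (real n + 1)" for n :: nat
  have t: "t n > 0" "t n \<le> 1" "t \<longlonglongrightarrow> 0" for n
    unfolding t_def using LIMSEQ_inverse_real_of_nat by (auto simp: inverse_eq_divide add.commute)
  have [measurable]: "\<phi> \<in> borel_measurable borel" "partial_deriv i \<phi> \<in> borel_measurable borel"
    using \<phi> schwartz_partial_deriv schwartz_measurable by auto
  have der: "((\<lambda>s. \<phi> (x + s *\<^sub>R ?a)) has_vector_derivative partial_deriv i \<phi> (x + s *\<^sub>R ?a)) (at s within A)" for x s A
  proof -
    obtain D where D: "(\<phi> has_derivative D) (at (x + s *\<^sub>R ?a))" "D ?a = partial_deriv i \<phi> (x + s *\<^sub>R ?a)"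
      using differentiable_has_derivative_partial[OF smooth_differentiable[OF schwartz_smooth[OF \<phi>]]] by blast
    have "((\<lambda>s. x + s *\<^sub>R ?a) has_derivative (\<lambda>h. h *\<^sub>R ?a)) (at s within A)"
      by (auto intro!: derivative_eq_intros)
    from has_derivative_compose[OF this D(1)]
    show ?thesis
      unfolding has_vector_derivative_def
      using linear_cmul[OF has_derivative_linear[OF D(1)]] D(2) by simp
  qed
  let ?q = "\<lambda>n x. (\<phi> (x + t n *\<^sub>R ?a) - \<phi> x) /\<^sub>R t n"
  obtain C where C: "C \<ge> 0" "\<And>x. cmod (partial_deriv i \<phi> x) \<le> C * inverse ((1 + norm x) ^ (2 * CARD('n)))"
    using schwartz_rapid_bound[OF schwartz_partial_deriv[OF \<phi>], of 0] by (metis mult_1 power_0)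
  \<comment> \<open>A common majorant of the difference quotients: the mean value theorem moves the
    point by at most 1, which changes 1 + |x| by a factor of at most 2.\<close>
  define w where "w x = C * 2 ^ (2 * CARD('n)) * inverse ((1 + norm x) ^ (2 * CARD('n)))" for x :: "real^'n"
  have bound: "cmod (?q n x) \<le> w x" for n x
  proof -
    have "norm (\<phi> (x + t n *\<^sub>R ?a) - \<phi> (x + 0 *\<^sub>R ?a)) \<le> w x * norm (t n - 0)"
    proof (rule differentiable_bound[where S="{0..t n}" and f'="\<lambda>s h. h *\<^sub>R partial_deriv i \<phi> (x + s *\<^sub>R ?a)"])
      show "((\<lambda>s. \<phi> (x + s *\<^sub>R ?a)) has_derivative (\<lambda>h. h *\<^sub>R partial_deriv i \<phi> (x + s *\<^sub>R ?a))) (at s within {0..t n})" for s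
        using der[unfolded has_vector_derivative_def] .
      show "onorm (\<lambda>h. h *\<^sub>R partial_deriv i \<phi> (x + s *\<^sub>R ?a)) \<le> w x" if s: "s \<in> {0..t n}" for s
      proof (rule onorm_le)
        fix h :: real
        have "norm x \<le> norm (x + s *\<^sub>R ?a) + norm (s *\<^sub>R ?a)"
          using norm_triangle_ineq4[of "x + s *\<^sub>R ?a" "s *\<^sub>R ?a"] by simp
        moreover have "norm (s *\<^sub>R ?a) \<le> 1" using s t(2)[of n] by simp
        ultimately have "1 + norm x \<le> 2 * (1 + norm (x + s *\<^sub>R ?a))"
          using one_plus_le_twice norm_ge_zero by blast
        then have "(1 + norm x) ^ (2 * CARD('n)) \<le> 2 ^ (2 * CARD('n)) * (1 + norm (x + s *\<^sub>R ?a)) ^ (2 * CARD('n))"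
          by (subst power_mult_distrib[symmetric], intro power_mono) auto
        then have "inverse ((1 + norm (x + s *\<^sub>R ?a)) ^ (2 * CARD('n))) \<le> 2 ^ (2 * CARD('n)) * inverse ((1 + norm x) ^ (2 * CARD('n)))"
          by (simp add: divide_simps add_pos_nonneg)
        then have "C * inverse ((1 + norm (x + s *\<^sub>R ?a)) ^ (2 * CARD('n))) \<le> w x"
          unfolding w_def mult.assoc by (intro mult_left_mono C)
        then have "cmod (partial_deriv i \<phi> (x + s *\<^sub>R ?a)) \<le> w x"
          using C(2) order_trans by blast
        from mult_left_mono[OF this, of "\<bar>h\<bar>"]
        show "norm (h *\<^sub>R partial_deriv i \<phi> (x + s *\<^sub>R ?a)) \<le> w x * norm h"
          by (simp add: mult.commute)
      qed
    qed (use t(1)[of n] in auto)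
    moreover have "cmod (?q n x) = cmod (\<phi> (x + t n *\<^sub>R ?a) - \<phi> x) / t n"
      using t(1)[of n] by (simp add: divide_inverse mult.commute)
    ultimately show ?thesis using t(1)[of n] by (simp add: pos_divide_le_eq)
  qed
  have "(\<lambda>n. \<integral>x. ?q n x \<partial>lborel) \<longlonglongrightarrow> (\<integral>x. partial_deriv i \<phi> x \<partial>lborel)"
  proof (rule integral_dominated_convergence[where w=w])
    show "integrable lborel w"
      unfolding w_def[abs_def] by (intro integrable_mult_right integrable_rapid_weight)
    show "AE x in lborel. (\<lambda>n. ?q n x) \<longlonglongrightarrow> partial_deriv i \<phi> x"
    proof (intro AE_I2)
      fix x
      have "((\<lambda>h. (\<phi> (x + h *\<^sub>R ?a) - \<phi> x) /\<^sub>R h) \<longlongrightarrow> partial_deriv i \<phi> x) (at 0)"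
      proof -
        let ?d = "partial_deriv i \<phi> x"
        have "((\<lambda>h. norm (\<phi> (x + h *\<^sub>R ?a) - \<phi> x - h *\<^sub>R ?d) / norm h) \<longlongrightarrow> 0) (at 0)"
          using der[of x 0 UNIV] by (simp add: has_vector_derivative_def has_derivative_at)
        then have "((\<lambda>h. norm ((\<phi> (x + h *\<^sub>R ?a) - \<phi> x) /\<^sub>R h - ?d)) \<longlongrightarrow> 0) (at 0)"
        proof (rule Lim_transform_eventually)
          have "norm ((\<phi> (x + h *\<^sub>R ?a) - \<phi> x) /\<^sub>R h - ?d) = norm (\<phi> (x + h *\<^sub>R ?a) - \<phi> x - h *\<^sub>R ?d) / norm h"
            if "h \<noteq> 0" for h
          proof -
            have "(\<phi> (x + h *\<^sub>R ?a) - \<phi> x) /\<^sub>R h - ?d = (\<phi> (x + h *\<^sub>R ?a) - \<phi> x - h *\<^sub>R ?d) /\<^sub>R h"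
              using that by (simp add: scaleR_diff_right)
            then show ?thesis by (simp add: divide_inverse mult.commute)
          qed
          then show "\<forall>\<^sub>F h in at 0. norm (\<phi> (x + h *\<^sub>R ?a) - \<phi> x - h *\<^sub>R ?d) / norm h = norm ((\<phi> (x + h *\<^sub>R ?a) - \<phi> x) /\<^sub>R h - ?d)"
            by (auto simp: eventually_at_filter)
        qed
        then show ?thesis
          using LIM_zero_cancel tendsto_norm_zero_iff by blast
      qed
      moreover have "filterlim t (at 0) sequentially"
        using t by (auto simp: filterlim_at less_imp_neq[symmetric] intro!: always_eventually)
      ultimately show "(\<lambda>n. ?q n x) \<longlonglongrightarrow> partial_deriv i \<phi> x"
        by (rule filterlim_compose)
    qed
  qed (use bound in auto)
  moreover have "(\<integral>x. ?q n x \<partial>lborel) = 0" for n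
    using integral_lborel_translate[of \<phi> "t n *\<^sub>R ?a"] schwartz_integrable[OF \<phi>]
    by (simp add: Bochner_Integration.integral_diff)
  ultimately have "(\<lambda>n. 0) \<longlonglongrightarrow> (\<integral>x. partial_deriv i \<phi> x \<partial>lborel)"
    by (simp only:)
  then show ?thesis by (simp add: LIMSEQ_const_iff)
qed

lemma fourier_partial_deriv:
  fixes \<phi> :: "real^'n::finite \<Rightarrow> complex"
  assumes \<phi>: "\<phi> \<in> schwartz"
  shows "fourier (partial_deriv i \<phi>) \<xi> = \<i> * complex_of_real (\<xi> $ i) * fourier \<phi> \<xi>"
proof -
  let ?e = "\<lambda>x. exp (- (\<i> * complex_of_real (x \<bullet> \<xi>)))"
  have "0 = (\<integral>x. ?e x * partial_deriv i \<phi> x - \<i> * complex_of_real (\<xi> $ i) * (?e x * \<phi> x) \<partial>lborel)"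
    using integral_partial_deriv_schwartz[OF schwartz_modulate(1)[OF \<phi>], of i \<xi>]
    unfolding schwartz_modulate(2)[OF \<phi>] by (simp add: algebra_simps)
  also have "\<dots> = fourier (partial_deriv i \<phi>) \<xi> - \<i> * complex_of_real (\<xi> $ i) * fourier \<phi> \<xi>"
    unfolding fourier_def
    by (subst Bochner_Integration.integral_diff)
      (simp_all add: fourier_integrable schwartz_integrable schwartz_partial_deriv \<phi>)
  finally show ?thesis by simp
qed

text \<open>The remainder e^(-i x.h) - 1 + i x.h is at most |x.h|^2, so the error is at most |h|^2
  times the second moment of \<phi>.\<close>

lemma fourier_has_derivative:
  fixes \<phi> :: "real^'n::finite \<Rightarrow> complex"
  assumes \<phi>: "\<phi> \<in> schwartz"
  shows "(fourier \<phi> has_derivative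
    (\<lambda>h. \<integral>x. - \<i> * complex_of_real (x \<bullet> h) * (exp (- (\<i> * complex_of_real (x \<bullet> \<xi>))) * \<phi> x) \<partial>lborel)) (at \<xi>)"
proof -
  let ?e = "\<lambda>\<xi> x. exp (- (\<i> * complex_of_real (x \<bullet> \<xi>))) :: complex"
  let ?D = "\<lambda>h. \<integral>x. - \<i> * complex_of_real (x \<bullet> h) * (?e \<xi> x * \<phi> x) \<partial>lborel"
  have [measurable]: "\<phi> \<in> borel_measurable borel" using \<phi> by (rule schwartz_measurable)
  have bd: "\<bar>x \<bullet> h\<bar> \<le> norm x * norm h" for x h :: "real^'n" by (rule Cauchy_Schwarz_ineq2)
  have intD: "integrable lborel (\<lambda>x. - \<i> * complex_of_real (x \<bullet> h) * (?e \<xi> x * \<phi> x))" for h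
  proof (rule Bochner_Integration.integrable_bound[OF integrable_mult_left[OF schwartz_integrable_moment[OF \<phi>, of 1], of "norm h"]])
    have "\<bar>x \<bullet> h\<bar> * cmod (\<phi> x) \<le> norm x * norm h * cmod (\<phi> x)" for x
      by (rule mult_right_mono[OF bd]) simp
    then show "AE x in lborel. norm (- \<i> * complex_of_real (x \<bullet> h) * (?e \<xi> x * \<phi> x)) \<le> norm (norm x ^ 1 * cmod (\<phi> x) * norm h)"
      by (intro AE_I2) (simp add: norm_mult ac_simps)
  qed simp
  have "bounded_linear ?D"
  proof (rule bounded_linear_intro)
    show "?D (g + h) = ?D g + ?D h" for g h
      unfolding Bochner_Integration.integral_add[OF intD intD, symmetric]
      by (intro Bochner_Integration.integral_cong) (auto simp: inner_add_right algebra_simps)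
    show "?D (c *\<^sub>R h) = c *\<^sub>R ?D h" for c h
      unfolding integral_scaleR_right[symmetric]
      by (intro Bochner_Integration.integral_cong) (auto simp: inner_scaleR_right scaleR_conv_of_real[where 'a=complex] algebra_simps)
    show "norm (?D h) \<le> norm h * (\<integral>x. norm x ^ 1 * cmod (\<phi> x) \<partial>lborel)" for h
    proof -
      have "norm (?D h) \<le> (\<integral>x. norm (- \<i> * complex_of_real (x \<bullet> h) * (?e \<xi> x * \<phi> x)) \<partial>lborel)"
        by (rule integral_norm_bound)
      also have "\<dots> \<le> (\<integral>x. norm h * (norm x ^ 1 * cmod (\<phi> x)) \<partial>lborel)"
      proof (rule integral_mono)
        show "integrable lborel (\<lambda>x. norm (- \<i> * complex_of_real (x \<bullet> h) * (?e \<xi> x * \<phi> x)))"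
          using intD by (rule integrable_norm)
        show "integrable lborel (\<lambda>x. norm h * (norm x ^ 1 * cmod (\<phi> x)))"
          by (intro integrable_mult_right schwartz_integrable_moment \<phi>)
        show "norm (- \<i> * complex_of_real (x \<bullet> h) * (?e \<xi> x * \<phi> x)) \<le> norm h * (norm x ^ 1 * cmod (\<phi> x))" for x
          using mult_right_mono[OF bd[of x h], of "cmod (\<phi> x)"] by (simp add: norm_mult ac_simps)
      qed
      finally show ?thesis by simp
    qed
  qed
  moreover have "((\<lambda>h. norm (fourier \<phi> (\<xi> + h) - fourier \<phi> \<xi> - ?D h) / norm h) \<longlongrightarrow> 0) (at 0)"
  proof -
    let ?C = "\<integral>x. norm x ^ 2 * cmod (\<phi> x) \<partial>lborel"
    have le: "norm (fourier \<phi> (\<xi> + h) - fourier \<phi> \<xi> - ?D h) \<le> (norm h)\<^sup>2 * ?C" for h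
    proof -
      have E: "fourier \<phi> (\<xi> + h) - fourier \<phi> \<xi> - ?D h =
          (\<integral>x. ?e (\<xi> + h) x * \<phi> x - ?e \<xi> x * \<phi> x - (- \<i> * complex_of_real (x \<bullet> h) * (?e \<xi> x * \<phi> x)) \<partial>lborel)"
        unfolding fourier_def using fourier_integrable[OF schwartz_integrable[OF \<phi>]] intD
        by (simp only: Bochner_Integration.integral_diff Bochner_Integration.integrable_diff)
      have "norm (fourier \<phi> (\<xi> + h) - fourier \<phi> \<xi> - ?D h) \<le> (\<integral>x. norm (?e (\<xi> + h) x * \<phi> x - ?e \<xi> x * \<phi> x - (- \<i> * complex_of_real (x \<bullet> h) * (?e \<xi> x * \<phi> x))) \<partial>lborel)"
        unfolding E by (rule integral_norm_bound)
      also have "\<dots> \<le> (\<integral>x. (norm h)\<^sup>2 * (norm x ^ 2 * cmod (\<phi> x)) \<partial>lborel)"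
      proof (rule integral_mono)
        show "integrable lborel (\<lambda>x. norm (?e (\<xi> + h) x * \<phi> x - ?e \<xi> x * \<phi> x - (- \<i> * complex_of_real (x \<bullet> h) * (?e \<xi> x * \<phi> x))))"
          using fourier_integrable[OF schwartz_integrable[OF \<phi>]] intD
          by (intro integrable_norm Bochner_Integration.integrable_diff)
        show "integrable lborel (\<lambda>x. (norm h)\<^sup>2 * (norm x ^ 2 * cmod (\<phi> x)))"
          by (intro integrable_mult_right schwartz_integrable_moment \<phi>)
        fix x :: "real^'n"
        let ?t = "- (x \<bullet> h)"
        have "?e (\<xi> + h) x = ?e \<xi> x * iexp ?t"
          by (simp add: inner_add_right exp_add[symmetric] algebra_simps)
        then have "?e (\<xi> + h) x * \<phi> x - ?e \<xi> x * \<phi> x - (- \<i> * complex_of_real (x \<bullet> h) * (?e \<xi> x * \<phi> x))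
           = ?e \<xi> x * \<phi> x * (iexp ?t - (\<Sum>k\<le>1. (\<i> * ?t)^k / fact k))"
          by (simp add: algebra_simps)
        then have "norm (?e (\<xi> + h) x * \<phi> x - ?e \<xi> x * \<phi> x - (- \<i> * complex_of_real (x \<bullet> h) * (?e \<xi> x * \<phi> x)))
           = cmod (\<phi> x) * cmod (iexp ?t - (\<Sum>k\<le>1. (\<i> * ?t)^k / fact k))"
          by (simp add: norm_mult)
        also have "\<dots> \<le> cmod (\<phi> x) * (\<bar>?t\<bar> ^ Suc 1 / fact (Suc 1))"
          by (intro mult_left_mono iexp_approx1) auto
        also have "\<dots> \<le> cmod (\<phi> x) * (norm x * norm h)\<^sup>2"
        proof (rule mult_left_mono)
          have "\<bar>x \<bullet> h\<bar>\<^sup>2 \<le> (norm x * norm h)\<^sup>2" by (rule power_mono[OF bd]) simp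
          moreover have "B / 2 \<le> B" if "0 \<le> B" for B :: real using that by simp
          from this[OF zero_le_power2, of "\<bar>x \<bullet> h\<bar>"]
          have "\<bar>?t\<bar> ^ Suc 1 / fact (Suc 1) \<le> \<bar>x \<bullet> h\<bar>\<^sup>2"
            by (simp add: numeral_2_eq_2)
          ultimately show "\<bar>?t\<bar> ^ Suc 1 / fact (Suc 1) \<le> (norm x * norm h)\<^sup>2"
            by (rule order_trans[rotated])
        qed simp
        finally show "norm (?e (\<xi> + h) x * \<phi> x - ?e \<xi> x * \<phi> x - (- \<i> * complex_of_real (x \<bullet> h) * (?e \<xi> x * \<phi> x)))
           \<le> (norm h)\<^sup>2 * (norm x ^ 2 * cmod (\<phi> x))"
          by (simp add: power_mult_distrib ac_simps)
      qed
      finally show ?thesis by simp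
    qed
    have lim: "((\<lambda>h::real^'n. norm h * ?C) \<longlongrightarrow> 0) (at 0)"
      by (auto intro!: tendsto_eq_intros)
    show ?thesis
    proof (rule tendsto_sandwich[OF _ _ tendsto_const lim])
      show "\<forall>\<^sub>F h in at 0. norm (fourier \<phi> (\<xi> + h) - fourier \<phi> \<xi> - ?D h) / norm h \<le> norm h * ?C"
        unfolding eventually_at_filter
        using le by (auto intro!: always_eventually simp: divide_simps power2_eq_square ac_simps)
    qed auto
  qed
  ultimately show ?thesis by (simp add: has_derivative_at)
qed

lemma partial_deriv_fourier:
  fixes \<phi> :: "real^'n::finite \<Rightarrow> complex"
  assumes \<phi>: "\<phi> \<in> schwartz"
  shows "partial_deriv i (fourier \<phi>) = fourier (\<lambda>x. - \<i> * (complex_of_real (x $ i) * \<phi> x))"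
  by (rule ext, rule partial_deriv_eq[OF fourier_has_derivative[OF \<phi>], THEN trans])
    (simp add: fourier_def inner_axis algebra_simps)

text \<open>A further factor 1 + |\<xi>| is bounded by 1 plus the sum of the |\<xi>_i|, and \<xi>_i
  times the transform is, up to a unit, the transform of a partial derivative. The induction
  therefore treats all Schwartz functions at once.\<close>

lemma fourier_decay:
  fixes \<phi> :: "real^'n::finite \<Rightarrow> complex"
  assumes "\<phi> \<in> schwartz"
  shows "\<exists>C. \<forall>\<xi>. (1 + norm \<xi>) ^ k * cmod (fourier \<phi> \<xi>) \<le> C"
  using assms
proof (induction k arbitrary: \<phi>)
  case 0
  then show ?case using norm_fourier_le by auto
next
  case (Suc k)
  from Suc.IH[OF Suc.prems] obtain A where A: "\<And>\<xi>. (1 + norm \<xi>) ^ k * cmod (fourier \<phi> \<xi>) \<le> A" by blast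
  have "\<forall>i. \<exists>C. \<forall>\<xi>. (1 + norm \<xi>) ^ k * cmod (fourier (partial_deriv i \<phi>) \<xi>) \<le> C"
    using Suc.IH[OF schwartz_partial_deriv[OF Suc.prems]] by blast
  then obtain B where B: "\<And>i \<xi>. (1 + norm \<xi>) ^ k * cmod (fourier (partial_deriv i \<phi>) \<xi>) \<le> B i" by metis
  have "(1 + norm \<xi>) ^ Suc k * cmod (fourier \<phi> \<xi>) \<le> A + (\<Sum>i\<in>UNIV. B i)" for \<xi>
  proof -
    have "(1 + norm \<xi>) * cmod (fourier \<phi> \<xi>) \<le> (1 + (\<Sum>i\<in>UNIV. \<bar>\<xi> $ i\<bar>)) * cmod (fourier \<phi> \<xi>)"
      by (intro mult_right_mono add_left_mono norm_le_l1_cart) auto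
    also have "\<dots> = cmod (fourier \<phi> \<xi>) + (\<Sum>i\<in>UNIV. cmod (fourier (partial_deriv i \<phi>) \<xi>))"
      by (simp add: fourier_partial_deriv[OF Suc.prems] norm_mult distrib_right sum_distrib_right)
    finally have "(1 + norm \<xi>) ^ k * ((1 + norm \<xi>) * cmod (fourier \<phi> \<xi>))
       \<le> (1 + norm \<xi>) ^ k * (cmod (fourier \<phi> \<xi>) + (\<Sum>i\<in>UNIV. cmod (fourier (partial_deriv i \<phi>) \<xi>)))"
      by (rule mult_left_mono) simp
    also have "\<dots> \<le> A + (\<Sum>i\<in>UNIV. B i)"
      unfolding distrib_left sum_distrib_left by (intro add_mono A sum_mono B)
    finally show ?thesis by (simp add: ac_simps)
  qed
  then show ?case by blast
qed

lemma schwartz_fourier: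
  fixes \<phi> :: "real^'n::finite \<Rightarrow> complex"
  assumes "\<phi> \<in> schwartz" shows "fourier \<phi> \<in> schwartz"
proof (rule schwartz_coinduct[where S="fourier ` schwartz"])
  fix h :: "real^'n \<Rightarrow> complex" and i x k assume "h \<in> fourier ` schwartz"
  then obtain f where *: "h = fourier f" "f \<in> schwartz" by auto
  show "h differentiable (at x)"
    using fourier_has_derivative[OF *(2)] * differentiable_def by blast
  show "partial_deriv i h \<in> plus_closure (fourier ` schwartz)"
    unfolding * partial_deriv_fourier[OF *(2)]
    by (intro plus_closure.base imageI schwartz_cmult schwartz_mult_nth *)
  show "\<exists>C. \<forall>x. (1 + norm x) ^ k * cmod (h x) \<le> C"
    unfolding * by (rule fourier_decay[OF *(2)])
qed (use assms in auto)

lemma inverse_fourier_eq: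
  fixes \<phi> :: "real^'n::finite \<Rightarrow> complex"
  shows "inverse_fourier \<phi> x = fourier \<phi> (- x) /\<^sub>R (2 * pi) ^ CARD('n)"
  unfolding inverse_fourier_def fourier_def by (simp add: inner_commute)

lemma schwartz_inverse_fourier:
  fixes \<phi> :: "real^'n::finite \<Rightarrow> complex"
  assumes "\<phi> \<in> schwartz" shows "inverse_fourier \<phi> \<in> schwartz"
proof -
  have "inverse_fourier \<phi> = (\<lambda>x. of_real (1 / (2 * pi) ^ CARD('n)) * fourier \<phi> (- x))"
    by (simp add: fun_eq_iff inverse_fourier_eq scaleR_conv_of_real divide_inverse)
  then show ?thesis
    by (simp only: schwartz_cmult schwartz_reflect schwartz_fourier assms)
qed

text \<open>Fubini for e^(-i x.\<xi>) \<phi>(x) \<psi>(\<xi>), majorized by |\<phi>(x)|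
  |\<psi>(\<xi>)|.\<close>

lemma fourier_duality:
  fixes \<phi> \<psi> :: "real^'n::finite \<Rightarrow> complex"
  assumes "integrable lborel \<phi>" "integrable lborel \<psi>"
  shows "(\<integral>\<xi>. fourier \<phi> \<xi> * \<psi> \<xi> \<partial>lborel) = (\<integral>x. \<phi> x * fourier \<psi> x \<partial>lborel)"
proof -
  have [measurable]: "\<phi> \<in> borel_measurable borel" "\<psi> \<in> borel_measurable borel"
    using assms by (auto dest: borel_measurable_integrable)
  have "integrable (lborel \<Otimes>\<^sub>M lborel) (\<lambda>z. exp (- (\<i> * complex_of_real (fst z \<bullet> snd z))) * (case z of (x, \<xi>) \<Rightarrow> \<phi> x * \<psi> \<xi>))"
    by (rule integrable_bounded_mult[OF integrable_pair_mult[OF assms], where C=1]) auto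
  then have "integrable (lborel \<Otimes>\<^sub>M lborel) (\<lambda>(x, \<xi>). exp (- (\<i> * complex_of_real (x \<bullet> \<xi>))) * (\<phi> x * \<psi> \<xi>))"
    by (simp add: case_prod_beta')
  from lborel_pair.Fubini_integral[OF this]
  have "(\<integral>\<xi>. (\<integral>x. exp (- (\<i> * complex_of_real (x \<bullet> \<xi>))) * \<phi> x * \<psi> \<xi> \<partial>lborel) \<partial>lborel)
      = (\<integral>x. (\<integral>\<xi>. \<phi> x * (exp (- (\<i> * complex_of_real (\<xi> \<bullet> x))) * \<psi> \<xi>) \<partial>lborel) \<partial>lborel)"
    by (simp add: ac_simps inner_commute)
  then show ?thesis unfolding fourier_def by simp
qed

section \<open>Gaussians and Fourier inversion\<close>

lemma integral_lborel_prod: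
  fixes f :: "'a::euclidean_space \<Rightarrow> real \<Rightarrow> complex"
  assumes "\<And>b. b \<in> Basis \<Longrightarrow> integrable lborel (f b)"
  shows "(\<integral>x. (\<Prod>b\<in>Basis. f b (x \<bullet> b)) \<partial>lborel) = (\<Prod>b\<in>Basis. \<integral>x. f b x \<partial>lborel)"
proof -
  have [measurable]: "f b \<in> borel_measurable borel" if "b \<in> Basis" for b
    using assms[OF that] by (auto dest: borel_measurable_integrable)
  interpret product_sigma_finite "\<lambda>b::'a. lborel :: real measure" by standard
  have "(\<integral>x. (\<Prod>b\<in>Basis. f b (x \<bullet> b)) \<partial>lborel)
     = (\<integral>x. (\<Prod>b\<in>Basis. f b ((\<Sum>c\<in>Basis. x c *\<^sub>R c) \<bullet> b)) \<partial>(\<Pi>\<^sub>M b\<in>(Basis::'a set). lborel))"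
    by (subst lborel_eq) (simp add: integral_distr)
  also have "\<dots> = (\<integral>x. (\<Prod>b\<in>Basis. f b (x b)) \<partial>(\<Pi>\<^sub>M b\<in>(Basis::'a set). lborel))"
    by (intro Bochner_Integration.integral_cong prod.cong) auto
  also have "\<dots> = (\<Prod>b\<in>Basis. \<integral>x. f b x \<partial>lborel)"
    by (rule product_integral_prod) (use assms in auto)
  finally show ?thesis .
qed

text \<open>Read off from the characteristic function of the standard normal distribution.\<close>

lemma fourier_gaussian_1:
  "integrable lborel (\<lambda>x. iexp (t * x) * complex_of_real (exp (- (x\<^sup>2) / 2)))"
  "(\<integral>x. iexp (t * x) * complex_of_real (exp (- (x\<^sup>2) / 2)) \<partial>lborel) = complex_of_real (sqrt (2 * pi) * exp (- (t\<^sup>2) / 2))"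
proof -
  have "integrable lborel std_normal_density"
    by (rule integrable_normal_density) simp
  then have "integrable lborel (\<lambda>x. complex_of_real (sqrt (2 * pi) * std_normal_density x))"
    by (intro integrable_of_real integrable_mult_right)
  then have i: "integrable lborel (\<lambda>x. complex_of_real (exp (- (x\<^sup>2) / 2)))"
    by (simp add: std_normal_density_def)
  show "integrable lborel (\<lambda>x. iexp (t * x) * complex_of_real (exp (- (x\<^sup>2) / 2)))"
    by (rule integrable_bounded_mult[OF i, where C=1]) auto
  have "complex_of_real (exp (- (t\<^sup>2) / 2)) = char std_normal_distribution t"
    by (simp add: char_std_normal_distribution)
  also have "\<dots> = (\<integral>x. std_normal_density x *\<^sub>R iexp (t * x) \<partial>lborel)"
    unfolding char_def by (subst integral_density) (auto intro!: AE_I2 normal_density_nonneg)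
  also have "\<dots> = (\<integral>x. of_real (1 / sqrt (2 * pi)) * (iexp (t * x) * complex_of_real (exp (- (x\<^sup>2) / 2))) \<partial>lborel)"
    by (intro Bochner_Integration.integral_cong) (auto simp: std_normal_density_def scaleR_conv_of_real)
  also have "\<dots> = of_real (1 / sqrt (2 * pi)) * (\<integral>x. iexp (t * x) * complex_of_real (exp (- (x\<^sup>2) / 2)) \<partial>lborel)"
    by simp
  finally show "(\<integral>x. iexp (t * x) * complex_of_real (exp (- (x\<^sup>2) / 2)) \<partial>lborel) = complex_of_real (sqrt (2 * pi) * exp (- (t\<^sup>2) / 2))"
    by (simp add: field_simps)
qed

definition gaussian :: "real^'n::finite \<Rightarrow> complex" where
  "gaussian x = complex_of_real (exp (- ((norm x)\<^sup>2) / 2))"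

lemma fourier_gaussian:
  fixes \<xi> :: "real^'n::finite"
  shows
  "fourier gaussian \<xi> = complex_of_real (sqrt (2 * pi) ^ CARD('n)) * gaussian \<xi>"
  and integrable_gaussian: "integrable lborel (gaussian :: real^'n \<Rightarrow> complex)"
proof -
  have G: "gaussian x = (\<Prod>b\<in>Basis. complex_of_real (exp (- ((x \<bullet> b)\<^sup>2) / 2)))" for x :: "real^'n"
  proof -
    have "(norm x)\<^sup>2 = (\<Sum>b\<in>Basis. (x \<bullet> b)\<^sup>2)"
      by (simp only: power2_norm_eq_inner euclidean_inner[of x x]) (simp add: power2_eq_square)
    then have "- ((norm x)\<^sup>2) / 2 = (\<Sum>b\<in>Basis. - ((x \<bullet> b)\<^sup>2) / 2)"
      by (simp add: sum_negf sum_divide_distrib)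
    then show ?thesis unfolding gaussian_def by (simp add: exp_sum)
  qed
  have E: "exp (- (\<i> * complex_of_real (x \<bullet> \<xi>))) = (\<Prod>b\<in>Basis. iexp (- (\<xi> \<bullet> b) * (x \<bullet> b)))" for x
    by (simp add: euclidean_inner[of x \<xi>] exp_sum[symmetric] sum_distrib_left sum_negf mult.commute)
  have "fourier gaussian \<xi> = (\<integral>x. (\<Prod>b\<in>Basis. iexp (- (\<xi> \<bullet> b) * (x \<bullet> b)) * complex_of_real (exp (- ((x \<bullet> b)\<^sup>2) / 2))) \<partial>lborel)"
    unfolding fourier_def E G by (simp add: prod.distrib)
  also have "\<dots> = (\<Prod>b\<in>(Basis :: (real^'n) set). complex_of_real (sqrt (2 * pi) * exp (- ((- (\<xi> \<bullet> b))\<^sup>2) / 2)))"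
    by (subst integral_lborel_prod) (simp_all only: fourier_gaussian_1)
  also have "\<dots> = complex_of_real (sqrt (2 * pi) ^ CARD('n)) * gaussian \<xi>"
    by (simp add: G prod.distrib)
  finally show "fourier gaussian \<xi> = complex_of_real (sqrt (2 * pi) ^ CARD('n)) * gaussian \<xi>" .
  have "(\<integral>\<^sup>+x. ennreal (cmod (gaussian x)) \<partial>(lborel :: (real^'n) measure))
      = (\<integral>\<^sup>+x. (\<Prod>b\<in>Basis. ennreal (exp (- ((x \<bullet> b)\<^sup>2) / 2))) \<partial>(lborel :: (real^'n) measure))"
    by (simp add: G prod_norm[symmetric] prod_ennreal)
  also have "\<dots> = (\<Prod>b\<in>(Basis :: (real^'n) set). \<integral>\<^sup>+x. ennreal (exp (- (x\<^sup>2) / 2)) \<partial>lborel)"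
    by (rule nn_integral_lborel_prod) auto
  also have "\<dots> < \<infinity>"
  proof -
    have "(\<integral>\<^sup>+x. ennreal (exp (- (x\<^sup>2) / 2)) \<partial>(lborel :: real measure)) < \<infinity>"
      using fourier_gaussian_1(1)[of 0] by (simp add: integrable_iff_bounded)
    then show ?thesis by (simp add: less_top[symmetric] power_eq_top_ennreal)
  qed
  finally show "integrable lborel (gaussian :: real^'n \<Rightarrow> complex)"
    unfolding integrable_iff_bounded by (simp add: gaussian_def[abs_def])
qed

text \<open>Fourier inversion at the origin. Pairing the transform of \<psi> with a dilated Gaussian
  G(e \<xi>) and moving the transform onto the Gaussian by duality gives sqrt(2 pi)^n times the
  integral of \<psi>(e z) G(z). Both sides converge as e tends to 0; the second factor sqrt(2 pi)^n
  is the total mass of the Gaussian.\<close>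

lemma integral_fourier:
  fixes \<psi> :: "real^'n::finite \<Rightarrow> complex"
  assumes \<psi>: "\<psi> \<in> schwartz"
  shows "(\<integral>\<xi>. fourier \<psi> \<xi> \<partial>lborel) = of_real ((2 * pi) ^ CARD('n)) * \<psi> 0"
proof -
  let ?c = "complex_of_real (sqrt (2 * pi) ^ CARD('n))"
  define e where "e k = 1 / (real k + 1)" for k :: nat
  have e: "e k > 0" "e \<longlonglongrightarrow> 0" for k
    unfolding e_def using LIMSEQ_inverse_real_of_nat by (auto simp: inverse_eq_divide add.commute)
  have [measurable]: "\<psi> \<in> borel_measurable borel" "fourier \<psi> \<in> borel_measurable borel"
    using \<psi> schwartz_fourier schwartz_measurable by auto
  have cg: "isCont (gaussian :: real^'n \<Rightarrow> complex) x" for x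
    unfolding gaussian_def by (intro continuous_intros) auto
  have gm[measurable]: "(gaussian :: real^'n \<Rightarrow> complex) \<in> borel_measurable borel"
    by (intro borel_measurable_continuous_onI continuous_at_imp_continuous_on ballI cg)
  have g1: "cmod (gaussian x) \<le> 1" for x :: "real^'n" by (simp add: gaussian_def)
  have scale: "fourier (\<lambda>x. gaussian (e k *\<^sub>R x)) y = ?c * gaussian (y /\<^sub>R e k) /\<^sub>R e k ^ CARD('n)" for k and y :: "real^'n"
  proof -
    let ?F = "\<lambda>u. exp (- (\<i> * complex_of_real (u \<bullet> (y /\<^sub>R e k)))) * gaussian u"
    have "fourier (\<lambda>x. gaussian (e k *\<^sub>R x)) y = (\<integral>x. ?F (0 + e k *\<^sub>R x) \<partial>lborel)"
    proof -
      have "(e k *\<^sub>R x) \<bullet> (y /\<^sub>R e k) = x \<bullet> y" for x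
        using e(1)[of k] by simp
      then show ?thesis by (simp only: fourier_def add_0)
    qed
    also have "\<dots> = (\<integral>x. ?F x \<partial>lborel) /\<^sub>R \<bar>e k\<bar> ^ CARD('n)"
      by (subst integral_lborel_affine) (use e(1)[of k] in auto)
    also have "(\<integral>x. ?F x \<partial>lborel) = ?c * gaussian (y /\<^sub>R e k)"
      by (simp only: fourier_def[symmetric] fourier_gaussian)
    finally show ?thesis using e(1)[of k] by simp
  qed
  have ig: "integrable lborel (\<lambda>x::real^'n. gaussian (e k *\<^sub>R x))" for k
    using integral_lborel_affine(2)[OF gm, of "e k" 0] integrable_gaussian e(1)[of k] by simp
  have eq: "(\<integral>\<xi>. fourier \<psi> \<xi> * gaussian (e k *\<^sub>R \<xi>) \<partial>lborel) = ?c * (\<integral>z. \<psi> (e k *\<^sub>R z) * gaussian z \<partial>lborel)" for k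
  proof -
    let ?H = "\<lambda>y. \<psi> y * gaussian (y /\<^sub>R e k)"
    have "(\<integral>\<xi>. fourier \<psi> \<xi> * gaussian (e k *\<^sub>R \<xi>) \<partial>lborel) = (\<integral>y. ?c * (?H y /\<^sub>R e k ^ CARD('n)) \<partial>lborel)"
      unfolding fourier_duality[OF schwartz_integrable[OF \<psi>] ig] scale
      by (intro Bochner_Integration.integral_cong) (auto simp: ac_simps)
    also have "\<dots> = ?c * ((\<integral>y. ?H y \<partial>lborel) /\<^sub>R \<bar>e k\<bar> ^ CARD('n))"
      using e(1)[of k] by (simp del: of_real_power)
    also have "(\<integral>y. ?H y \<partial>lborel) /\<^sub>R \<bar>e k\<bar> ^ CARD('n) = (\<integral>z. ?H (0 + e k *\<^sub>R z) \<partial>lborel)"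
      by (subst integral_lborel_affine) (use e(1)[of k] in auto)
    also have "\<dots> = (\<integral>z. \<psi> (e k *\<^sub>R z) * gaussian z \<partial>lborel)"
      using e(1)[of k] by simp
    finally show ?thesis .
  qed
  have ez: "(\<lambda>k. e k *\<^sub>R x) \<longlonglongrightarrow> 0" for x :: "real^'n"
    using tendsto_scaleR[OF e(2) tendsto_const, of x] by simp
  have "(\<lambda>k. \<integral>\<xi>. fourier \<psi> \<xi> * gaussian (e k *\<^sub>R \<xi>) \<partial>lborel) \<longlonglongrightarrow> (\<integral>\<xi>. fourier \<psi> \<xi> * gaussian (0 :: real^'n) \<partial>lborel)"
  proof (rule integral_dominated_convergence[where w="\<lambda>\<xi>. cmod (fourier \<psi> \<xi>)"])
    show "integrable lborel (\<lambda>\<xi>. cmod (fourier \<psi> \<xi>))"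
      by (intro integrable_norm schwartz_integrable schwartz_fourier \<psi>)
    show "AE \<xi> in lborel. (\<lambda>k. fourier \<psi> \<xi> * gaussian (e k *\<^sub>R \<xi>)) \<longlonglongrightarrow> fourier \<psi> \<xi> * gaussian (0::real^'n)"
      by (intro AE_I2 tendsto_mult tendsto_const isCont_tendsto_compose[OF cg ez])
    show "AE \<xi> in lborel. cmod (fourier \<psi> \<xi> * gaussian (e k *\<^sub>R \<xi>)) \<le> cmod (fourier \<psi> \<xi>)" for k
      by (intro AE_I2) (simp add: norm_mult mult_left_le g1)
  qed auto
  moreover have "(\<lambda>k. ?c * (\<integral>z. \<psi> (e k *\<^sub>R z) * gaussian z \<partial>lborel)) \<longlonglongrightarrow> ?c * (\<integral>z. \<psi> 0 * gaussian z \<partial>(lborel :: (real^'n) measure))"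
  proof (intro tendsto_mult tendsto_const)
    obtain C where C: "C \<ge> 0" "\<And>x. cmod (\<psi> x) \<le> C" using schwartz_bounded[OF \<psi>] by metis
    have cp: "isCont \<psi> x" for x
      using smooth_differentiable[OF schwartz_smooth[OF \<psi>]] differentiable_imp_continuous_within by blast
    show "(\<lambda>k. \<integral>z. \<psi> (e k *\<^sub>R z) * gaussian z \<partial>lborel) \<longlonglongrightarrow> (\<integral>z. \<psi> 0 * gaussian z \<partial>(lborel :: (real^'n) measure))"
    proof (rule integral_dominated_convergence[where w="\<lambda>z. C * cmod (gaussian z)"])
      show "integrable lborel (\<lambda>z. C * cmod (gaussian (z::real^'n)))"
        by (intro integrable_mult_right integrable_norm integrable_gaussian)
      show "AE z in lborel. (\<lambda>k. \<psi> (e k *\<^sub>R z) * gaussian z) \<longlonglongrightarrow> \<psi> 0 * gaussian (z::real^'n)"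
        by (intro AE_I2 tendsto_mult tendsto_const isCont_tendsto_compose[OF cp ez])
      show "AE z in lborel. cmod (\<psi> (e k *\<^sub>R z) * gaussian z) \<le> C * cmod (gaussian z)" for k
        by (intro AE_I2) (simp add: norm_mult mult_right_mono C)
    qed auto
  qed
  ultimately have A: "(\<integral>\<xi>. fourier \<psi> \<xi> * gaussian (0 :: real^'n) \<partial>lborel) = ?c * (\<integral>z. \<psi> 0 * gaussian z \<partial>(lborel :: (real^'n) measure))"
    unfolding eq using LIMSEQ_unique by blast
  have B: "(\<integral>z. gaussian z \<partial>(lborel :: (real^'n) measure)) = ?c"
  proof -
    have "fourier gaussian (0::real^'n) = ?c * gaussian (0::real^'n)" by (rule fourier_gaussian)
    then show ?thesis by (simp add: fourier_def gaussian_def)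
  qed
  have C: "?c * ?c = of_real ((2 * pi) ^ CARD('n))"
  proof -
    have "sqrt (2 * pi) ^ CARD('n) * sqrt (2 * pi) ^ CARD('n) = (sqrt (2 * pi) * sqrt (2 * pi)) ^ CARD('n)"
      by (rule power_mult_distrib[symmetric])
    then show ?thesis by (simp only: of_real_mult[symmetric] real_sqrt_mult_self) simp
  qed
  have D: "gaussian (0::real^'n) = 1" by (simp add: gaussian_def)
  have "(\<integral>\<xi>. fourier \<psi> \<xi> \<partial>lborel) = ?c * (\<psi> 0 * ?c)"
    using A unfolding D integral_mult_right_zero B mult_1_right .
  also have "\<dots> = (?c * ?c) * \<psi> 0"
    by (rule trans[OF mult.left_commute mult.commute])
  finally show ?thesis unfolding C .
qed

lemma fourier_translate:
  fixes \<phi> :: "real^'n::finite \<Rightarrow> complex"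
  assumes [measurable]: "\<phi> \<in> borel_measurable borel"
  shows "fourier (\<lambda>x. \<phi> (x + z)) \<xi> = exp (\<i> * complex_of_real (z \<bullet> \<xi>)) * fourier \<phi> \<xi>"
proof -
  let ?F = "\<lambda>x. exp (\<i> * complex_of_real (z \<bullet> \<xi>)) * (exp (- (\<i> * complex_of_real (x \<bullet> \<xi>))) * \<phi> x)"
  have "fourier (\<lambda>x. \<phi> (x + z)) \<xi> = (\<integral>x. ?F (x + z) \<partial>lborel)"
    unfolding fourier_def
  proof (rule Bochner_Integration.integral_cong[OF refl])
    fix x
    have "exp (\<i> * complex_of_real (z \<bullet> \<xi>)) * exp (- (\<i> * complex_of_real ((x + z) \<bullet> \<xi>)))
        = exp (- (\<i> * complex_of_real (x \<bullet> \<xi>)))"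
      by (simp add: exp_add[symmetric] inner_add_left algebra_simps)
    then show "exp (- (\<i> * complex_of_real (x \<bullet> \<xi>))) * \<phi> (x + z) = ?F (x + z)"
      by (simp only: mult.assoc[symmetric])
  qed
  also have "\<dots> = (\<integral>x. ?F x \<partial>lborel)"
    by (rule integral_lborel_translate) measurable
  finally show ?thesis by (simp add: fourier_def)
qed

text \<open>Inversion at x is inversion at the origin for the translate of \<phi> by x.\<close>

lemma inverse_fourier_fourier:
  fixes \<phi> :: "real^'n::finite \<Rightarrow> complex"
  assumes \<phi>: "\<phi> \<in> schwartz" shows "inverse_fourier (fourier \<phi>) = \<phi>"
proof
  fix x
  have "(\<integral>\<xi>. exp (\<i> * complex_of_real (x \<bullet> \<xi>)) * fourier \<phi> \<xi> \<partial>lborel) = of_real ((2 * pi) ^ CARD('n)) * \<phi> x"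
    using integral_fourier[OF schwartz_translate[OF \<phi>, of x]]
    by (simp add: fourier_translate[OF schwartz_measurable[OF \<phi>]] del: of_real_power)
  then have *: "(\<integral>\<xi>. exp (\<i> * complex_of_real (x \<bullet> \<xi>)) * fourier \<phi> \<xi> \<partial>lborel) = (2 * pi) ^ CARD('n) *\<^sub>R \<phi> x"
    by (simp only: scaleR_conv_of_real)
  have K: "(2 * pi) ^ CARD('n) \<noteq> 0" by simp
  show "inverse_fourier (fourier \<phi>) x = \<phi> x"
    unfolding inverse_fourier_def * scaleR_scaleR by (simp only: left_inverse[OF K] scaleR_one)
qed

lemma fourier_reflect:
  fixes \<phi> :: "real^'n::finite \<Rightarrow> complex"
  assumes [measurable]: "\<phi> \<in> borel_measurable borel"
  shows "fourier (\<lambda>x. \<phi> (- x)) \<xi> = fourier \<phi> (- \<xi>)"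
  unfolding fourier_def
  using integral_lborel_reflect(1)[of "\<lambda>x. exp (- (\<i> * complex_of_real (x \<bullet> (- \<xi>)))) * \<phi> x"]
  by simp

text \<open>Up to the constant, the inverse transform is the transform of the reflected function,
  which reduces this order of composition to the other one.\<close>

lemma fourier_inverse_fourier:
  fixes \<phi> :: "real^'n::finite \<Rightarrow> complex"
  assumes \<phi>: "\<phi> \<in> schwartz" shows "fourier (inverse_fourier \<phi>) = \<phi>"
proof
  fix \<xi>
  let ?k = "complex_of_real (1 / (2 * pi) ^ CARD('n))"
  have 1: "inverse_fourier \<phi> = (\<lambda>x. ?k * fourier (\<lambda>x. \<phi> (- x)) x)"
    by (simp add: fun_eq_iff inverse_fourier_eq scaleR_conv_of_real fourier_reflect schwartz_measurable[OF \<phi>] divide_inverse)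
  have "fourier (inverse_fourier \<phi>) \<xi> = ?k * fourier (fourier (\<lambda>x. \<phi> (- x))) \<xi>"
    unfolding 1 by (rule fourier_cmult)
  also have "\<dots> = inverse_fourier (fourier (\<lambda>x. \<phi> (- x))) (- \<xi>)"
    by (simp add: inverse_fourier_eq scaleR_conv_of_real divide_inverse)
  also have "\<dots> = \<phi> \<xi>"
    by (simp add: inverse_fourier_fourier schwartz_reflect \<phi>)
  finally show "fourier (inverse_fourier \<phi>) \<xi> = \<phi> \<xi>" .
qed

lemma cnj_fourier:
  fixes \<phi> :: "real^'n::finite \<Rightarrow> complex"
  shows "cnj (fourier \<phi> \<xi>) = fourier (\<lambda>x. cnj (\<phi> x)) (- \<xi>)"
  unfolding fourier_def
  by (subst Bochner_Integration.integral_cnj[symmetric], rule Bochner_Integration.integral_cong) (auto simp: exp_cnj)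

section \<open>Plancherel's identity\<close>

lemma integrable_schwartz_mult:
  fixes \<phi> \<psi> :: "real^'n::finite \<Rightarrow> complex"
  assumes "\<phi> \<in> schwartz" "\<psi> \<in> schwartz"
  shows "integrable lborel (\<lambda>x. \<phi> x * \<psi> x)"
proof -
  obtain C where "\<And>x. cmod (\<phi> x) \<le> C" using schwartz_bounded[OF assms(1)] by metis
  then show ?thesis
    using assms schwartz_measurable
    by (intro integrable_bounded_mult[where C=C] schwartz_integrable) auto
qed

lemma schwartz_square_integrable:
  fixes \<phi> :: "real^'n::finite \<Rightarrow> complex"
  assumes "\<phi> \<in> schwartz" shows "integrable lborel (\<lambda>x. (cmod (\<phi> x))\<^sup>2)"
proof -
  have "integrable lborel (\<lambda>x. cmod (\<phi> x * \<phi> x))"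
    by (intro integrable_norm integrable_schwartz_mult assms)
  then show ?thesis by (simp add: norm_mult power2_eq_square)
qed

text \<open>The conjugate of the transform of \<phi> is (2 pi)^n times the inverse transform of the
  conjugate of \<phi>. Duality moves the transform of \<phi> onto this function, where inversion
  cancels it.\<close>

lemma plancherel:
  fixes \<phi> :: "real^'n::finite \<Rightarrow> complex"
  assumes \<phi>: "\<phi> \<in> schwartz"
  shows "(\<integral>\<xi>. (cmod (fourier \<phi> \<xi>))\<^sup>2 \<partial>lborel) = (2 * pi) ^ CARD('n) * (\<integral>x. (cmod (\<phi> x))\<^sup>2 \<partial>lborel)"
proof -
  let ?k = "complex_of_real ((2 * pi) ^ CARD('n))"
  let ?\<chi> = "\<lambda>\<xi>. ?k * inverse_fourier (\<lambda>x. cnj (\<phi> x)) \<xi>"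
  have sc: "(\<lambda>x. cnj (\<phi> x)) \<in> schwartz" by (rule schwartz_cnj[OF \<phi>])
  have c: "cnj (fourier \<phi> \<xi>) = ?\<chi> \<xi>" for \<xi>
    by (simp add: cnj_fourier inverse_fourier_eq scaleR_conv_of_real field_simps)
  have "(\<integral>\<xi>. fourier \<phi> \<xi> * ?\<chi> \<xi> \<partial>lborel) = (\<integral>x. \<phi> x * fourier ?\<chi> x \<partial>lborel)"
    by (intro fourier_duality schwartz_integrable schwartz_cmult schwartz_inverse_fourier sc \<phi>)
  also have "\<dots> = ?k * (\<integral>x. \<phi> x * cnj (\<phi> x) \<partial>lborel)"
    unfolding fourier_cmult fourier_inverse_fourier[OF sc] mult.left_commute[of _ ?k]
    by (rule integral_mult_right_zero)
  finally have "(\<integral>\<xi>. complex_of_real ((cmod (fourier \<phi> \<xi>))\<^sup>2) \<partial>lborel) = ?k * (\<integral>x. complex_of_real ((cmod (\<phi> x))\<^sup>2) \<partial>lborel)"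
    unfolding c[symmetric] complex_norm_square .
  then have "complex_of_real (\<integral>\<xi>. (cmod (fourier \<phi> \<xi>))\<^sup>2 \<partial>lborel) = complex_of_real ((2 * pi) ^ CARD('n) * (\<integral>x. (cmod (\<phi> x))\<^sup>2 \<partial>lborel))"
    by (simp only: integral_complex_of_real of_real_mult)
  then show ?thesis unfolding of_real_eq_iff .
qed

section \<open>The singular kernel and the constant $C_{n,s}$\<close>

lemma AE_lborel_openD:
  fixes S :: "'a::euclidean_space set"
  assumes "AE x in lborel. P x" "open S" "S \<noteq> {}"
  shows "\<exists>x\<in>S. P x"
proof (rule ccontr)
  assume *: "\<not> (\<exists>x\<in>S. P x)"
  obtain N where N: "N \<in> null_sets lborel" "{x \<in> space lborel. \<not> P x} \<subseteq> N"
    using assms(1) by (auto simp: eventually_ae_filter)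
  have "S \<subseteq> N" using N(2) * by auto
  moreover have "negligible N"
    using N(1) by (simp add: negligible_iff_null_sets null_sets_completionI)
  ultimately show False
    using assms(2,3) negligible_subset open_not_negligible by blast
qed

lemma integral_pos_open:
  fixes f :: "'a::euclidean_space \<Rightarrow> real"
  assumes "integrable lborel f" "\<And>x. f x \<ge> 0" "open S" "S \<noteq> {}" "\<And>x. x \<in> S \<Longrightarrow> f x > 0"
  shows "(\<integral>x. f x \<partial>lborel) > 0"
proof (rule ccontr)
  assume "\<not> (\<integral>x. f x \<partial>lborel) > 0"
  moreover have "(\<integral>x. f x \<partial>lborel) \<ge> 0"
    using assms(2) by (intro Bochner_Integration.integral_nonneg) auto
  ultimately have "(\<integral>x. f x \<partial>lborel) = 0" by linarith
  then have "AE x in lborel. f x = 0"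
    using integral_nonneg_eq_0_iff_AE[OF assms(1)] assms(2) by simp
  then show False using AE_lborel_openD[of "\<lambda>x. f x = 0" S] assms(3-5) by force
qed

text \<open>
  Uniqueness of a translation invariant measure, specialised to the image of Lebesgue measure under
  \<open>T\<close>: integrating $1_B(x)\,1_A(Tz+x)$ over \<open>x\<close> and \<open>z\<close> in both orders, where \<open>B\<close> is the unit ball,
  shows that both measures agree on \<open>A\<close>.
\<close>

lemma lborel_distr_orthogonal:
  fixes T :: "'a::euclidean_space \<Rightarrow> 'a"
  assumes T: "orthogonal_transformation T"
  shows "distr lborel borel T = lborel"
proof (rule measure_eqI)
  have lin: "linear T" using T by (rule orthogonal_transformation_linear)
  have "continuous_on UNIV T"
    using lin by (simp add: linear_continuous_on linear_conv_bounded_linear[symmetric])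
  then have [measurable]: "T \<in> borel_measurable borel" by (rule borel_measurable_continuous_onI)
  obtain R where R: "\<And>x. T (R x) = x"
    using orthogonal_transformation_surj[OF T] by (metis surj_def)
  fix A :: "'a set" assume "A \<in> sets (distr lborel borel T)"
  then have [measurable]: "A \<in> sets borel" by simp
  let ?B = "ball (0::'a) 1"
  define f where "f = (indicator ?B :: 'a \<Rightarrow> ennreal)"
  define g where "g = (indicator A :: 'a \<Rightarrow> ennreal)"
  have [measurable]: "f \<in> borel_measurable borel" "g \<in> borel_measurable borel"
    unfolding f_def g_def by (auto intro!: borel_measurable_indicator)
  have fT: "f (T x) = f x" for x
    using orthogonal_transformation_norm[OF T, of x] by (simp add: f_def indicator_def)
  have "emeasure lborel ?B * emeasure (distr lborel borel T) A = (\<integral>\<^sup>+x. f x * (\<integral>\<^sup>+z. g (T z) \<partial>lborel) \<partial>lborel)"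
  proof -
    have "(\<integral>\<^sup>+z. g (T z) \<partial>lborel) = emeasure (distr lborel borel T) A"
      using nn_integral_distr[of T lborel borel g] by (simp add: g_def)
    moreover have "(\<integral>\<^sup>+x. f x * c \<partial>lborel) = emeasure lborel ?B * c" for c
    proof -
      have "(\<integral>\<^sup>+x. f x * c \<partial>lborel) = (\<integral>\<^sup>+x. f x \<partial>lborel) * c"
        by (rule nn_integral_multc) measurable
      then show ?thesis by (simp add: f_def)
    qed
    ultimately show ?thesis by simp
  qed
  also have "\<dots> = (\<integral>\<^sup>+x. (\<integral>\<^sup>+z. f x * g (T z + x) \<partial>lborel) \<partial>lborel)"
  proof (rule nn_integral_cong)
    fix x
    have "(\<integral>\<^sup>+z. g (T z) \<partial>lborel) = (\<integral>\<^sup>+z. g (T (z + R x)) \<partial>lborel)"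
      using nn_integral_lborel_translate[of "\<lambda>z. g (T z)" "R x"] by simp
    also have "\<dots> = (\<integral>\<^sup>+z. g (T z + x) \<partial>lborel)" by (simp add: linear_add[OF lin] R)
    finally show "f x * (\<integral>\<^sup>+z. g (T z) \<partial>lborel) = (\<integral>\<^sup>+z. f x * g (T z + x) \<partial>lborel)"
      by (simp add: nn_integral_cmult)
  qed
  also have "\<dots> = (\<integral>\<^sup>+z. (\<integral>\<^sup>+x. f x * g (T z + x) \<partial>lborel) \<partial>lborel)"
    by (rule lborel_pair.Fubini') measurable
  also have "\<dots> = (\<integral>\<^sup>+z. (\<integral>\<^sup>+x. f (x - T z) * g x \<partial>lborel) \<partial>lborel)"
  proof (rule nn_integral_cong)
    fix z
    show "(\<integral>\<^sup>+x. f x * g (T z + x) \<partial>lborel) = (\<integral>\<^sup>+x. f (x - T z) * g x \<partial>lborel)"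
      using nn_integral_lborel_translate[of "\<lambda>x. f (x - T z) * g x" "T z"] by (simp add: add.commute)
  qed
  also have "\<dots> = (\<integral>\<^sup>+x. (\<integral>\<^sup>+z. f (x - T z) * g x \<partial>lborel) \<partial>lborel)"
    by (rule lborel_pair.Fubini') measurable
  also have "\<dots> = (\<integral>\<^sup>+x. emeasure lborel ?B * g x \<partial>lborel)"
  proof (rule nn_integral_cong)
    fix x
    have "f (x - T z) = f (z - R x)" for z
    proof -
      have "x - T z = T (R x - z)" by (simp add: linear_diff[OF lin] R)
      then have "f (x - T z) = f (R x - z)" by (simp only: fT)
      then show ?thesis by (simp add: f_def indicator_def norm_minus_commute)
    qed
    then have "(\<integral>\<^sup>+z. f (x - T z) \<partial>lborel) = (\<integral>\<^sup>+z. f (z + - R x) \<partial>lborel)" by simp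
    also have "\<dots> = emeasure lborel ?B" by (subst nn_integral_lborel_translate) (measurable, simp add: f_def)
    finally show "(\<integral>\<^sup>+z. f (x - T z) * g x \<partial>lborel) = emeasure lborel ?B * g x"
      by (simp add: nn_integral_multc)
  qed
  also have "\<dots> = emeasure lborel ?B * emeasure lborel A"
    by (subst nn_integral_cmult) (measurable, simp add: g_def)
  finally have "emeasure lborel ?B * emeasure (distr lborel borel T) A = emeasure lborel ?B * emeasure lborel A" .
  moreover have "emeasure lborel ?B \<noteq> 0"
  proof
    assume "emeasure lborel ?B = 0"
    then have "negligible ?B"
      by (simp add: negligible_iff_null_sets null_sets_completionI null_setsI)
    then show False using open_not_negligible[of ?B] by simp
  qed
  moreover have "emeasure lborel ?B \<noteq> \<infinity>" using emeasure_lborel_ball_finite[of "0::'a" 1] by simp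
  ultimately show "emeasure (distr lborel borel T) A = emeasure lborel A"
    by (metis ennreal_mult_cancel_left infinity_ennreal_def)
qed simp

text \<open>The value at 0 is 0 by the convention for division by 0, so the diagonal contributes
  nothing to the double integrals.\<close>

definition frac_kernel :: "real \<Rightarrow> real^'n::finite \<Rightarrow> real" where
  "frac_kernel s z = 1 / norm z powr (real CARD('n) + 2 * s)"

lemma frac_kernel_measurable [measurable]: "frac_kernel s \<in> borel_measurable borel"
  unfolding frac_kernel_def[abs_def] by measurable

lemma frac_kernel_nonneg [simp]: "frac_kernel s z \<ge> 0"
  by (simp add: frac_kernel_def)

lemma frac_kernel_minus [simp]: "frac_kernel s (- z) = frac_kernel s z"
  by (simp add: frac_kernel_def)

lemma dyadic_scale:
  fixes x :: real
  assumes "1 \<le> x" shows "\<exists>k::nat. 2 ^ k \<le> x \<and> x < 2 * 2 ^ k"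
proof -
  obtain n where n: "x < 2 ^ n" using real_arch_pow[of 2 x] by auto
  define m where "m = (LEAST n. x < 2 ^ n)"
  have m: "x < 2 ^ m" unfolding m_def using n by (rule LeastI)
  moreover have "m \<noteq> 0" using m assms by (metis not_less power_0)
  then obtain k where k: "m = Suc k" using not0_implies_Suc by blast
  have "\<not> x < 2 ^ k" using not_less_Least[of k "\<lambda>n. x < 2 ^ n"] k m_def by simp
  ultimately show ?thesis using k by (auto simp: not_less)
qed

text \<open>
  Integrals of powers of the norm are summed over the shells $c^k \le |z| < 2c^k$, whose
  contributions form a geometric series.
\<close>

lemma nn_integral_shells_finite:
  fixes p c :: real
  assumes c: "c > 0" "c powr (real CARD('n) - p) < 1"
    and S: "\<And>z. z \<in> S \<Longrightarrow> \<exists>k::nat. c ^ k \<le> norm z \<and> norm z < 2 * c ^ k"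
  shows "(\<integral>\<^sup>+z. ennreal (indicator S z * norm z powr (- p)) \<partial>(lborel :: (real^'n::finite) measure)) < \<infinity>"
proof -
  define g where "g z = indicator {1..<2} (norm z) * norm z powr (- p)" for z :: "real^'n"
  have [measurable]: "g \<in> borel_measurable borel" unfolding g_def[abs_def] by measurable
  have gle: "ennreal (g z) \<le> ennreal (2 powr \<bar>p\<bar>) * indicator (cball 0 2) z" for z
  proof (cases "norm z \<in> {1..<2}")
    case True
    have "norm z powr (- p) \<le> norm z powr \<bar>p\<bar>" using True by (intro powr_mono) auto
    also have "\<dots> \<le> 2 powr \<bar>p\<bar>" using True by (intro powr_mono2) auto
    finally show ?thesis using True by (simp add: g_def ennreal_leI)
  qed (simp add: g_def)
  have "(\<integral>\<^sup>+z. ennreal (g z) \<partial>lborel) \<le> (\<integral>\<^sup>+z. ennreal (2 powr \<bar>p\<bar>) * indicator (cball 0 2) (z::real^'n) \<partial>lborel)"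
    by (intro nn_integral_mono gle)
  also have "\<dots> < \<infinity>"
    using emeasure_lborel_cball_finite[of "0::real^'n" 2] by (simp add: nn_integral_cmult_indicator ennreal_mult_less_top)
  finally have fin: "(\<integral>\<^sup>+z. ennreal (g z) \<partial>lborel) < \<infinity>" .
  \<comment> \<open>Ratio of the geometric series: scaling by c contributes c^n from Lebesgue
    measure and c^(-p) from the integrand.\<close>
  define r where "r = c powr (real CARD('n) - p)"
  define h where "h k z = ennreal ((c ^ k) powr (- p) * g ((1 / c ^ k) *\<^sub>R z))" for k :: nat and z
  have [measurable]: "h k \<in> borel_measurable borel" for k unfolding h_def[abs_def] by measurable
  have hk: "(\<integral>\<^sup>+z. h k z \<partial>lborel) = ennreal (r ^ k) * (\<integral>\<^sup>+z. ennreal (g z) \<partial>lborel)" for k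
  proof -
    have "(\<integral>\<^sup>+z. h k z \<partial>lborel) = ennreal ((c ^ k) ^ CARD('n)) * (\<integral>\<^sup>+z. h k (c ^ k *\<^sub>R z) \<partial>lborel)"
      using nn_integral_lborel_scale[of "h k" "c ^ k"] c(1) by simp
    also have "(\<integral>\<^sup>+z. h k (c ^ k *\<^sub>R z) \<partial>lborel) = ennreal ((c ^ k) powr (- p)) * (\<integral>\<^sup>+z. ennreal (g z) \<partial>lborel)"
      using c(1) by (simp add: h_def ennreal_mult' nn_integral_cmult)
    also have "ennreal ((c ^ k) ^ CARD('n)) * (ennreal ((c ^ k) powr (- p)) * (\<integral>\<^sup>+z. ennreal (g z) \<partial>lborel))
        = ennreal ((c ^ k) ^ CARD('n) * (c ^ k) powr (- p)) * (\<integral>\<^sup>+z. ennreal (g z) \<partial>lborel)"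
      using c(1) by (simp add: ennreal_mult' mult.assoc)
    also have "(c ^ k) ^ CARD('n) * (c ^ k) powr (- p) = r ^ k"
    proof -
      have "(c ^ k) ^ CARD('n) * (c ^ k) powr (- p) = (c ^ k) powr (real CARD('n) - p)"
        using c(1) by (simp add: powr_diff powr_minus powr_realpow divide_inverse)
      also have "\<dots> = r ^ k"
        using c(1) unfolding r_def by (simp add: powr_realpow[symmetric] powr_powr powr_power mult.commute)
      finally show ?thesis .
    qed
    finally show ?thesis .
  qed
  have "(\<integral>\<^sup>+z. ennreal (indicator S z * norm z powr (- p)) \<partial>lborel) \<le> (\<integral>\<^sup>+z. (\<Sum>k. h k z) \<partial>lborel)"
  proof (intro nn_integral_mono)
    fix z :: "real^'n"
    show "ennreal (indicator S z * norm z powr (- p)) \<le> (\<Sum>k. h k z)"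
    proof (cases "z \<in> S")
      case True
      then obtain k where k: "c ^ k \<le> norm z" "norm z < 2 * c ^ k" using S by blast
      have "ennreal (indicator S z * norm z powr (- p)) = h k z"
        using k c(1) True
        by (simp add: h_def g_def field_simps powr_divide powr_mult[symmetric])
      also have "\<dots> \<le> (\<Sum>k. h k z)"
        using sum_le_suminf[of "\<lambda>k. h k z" "{k}"] by simp
      finally show ?thesis .
    qed simp
  qed
  also have "\<dots> = (\<Sum>k. \<integral>\<^sup>+z. h k z \<partial>lborel)"
    by (rule nn_integral_suminf) measurable
  also have "\<dots> = (\<Sum>k. ennreal (r ^ k)) * (\<integral>\<^sup>+z. ennreal (g z) \<partial>lborel)"
    unfolding hk by (rule ennreal_suminf_multc)
  also have "(\<Sum>k. ennreal (r ^ k)) = ennreal (\<Sum>k. r ^ k)"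
    using c(2) by (intro suminf_ennreal2) (auto simp: r_def intro!: summable_geometric)
  also have "\<dots> * (\<integral>\<^sup>+z. ennreal (g z) \<partial>lborel) < \<infinity>"
    using fin by (simp add: ennreal_mult_less_top)
  finally show ?thesis .
qed

text \<open>At infinity the exponent n + 2s exceeds n because s > 0. Near 0 the factor |z|^2 lowers
  it to n + 2s - 2, which is below n because s < 1. The ratios of the two series of shells are
  2^(-2s) and (1/2)^(2 - 2s).\<close>

lemma integrable_frac_kernel_weight:
  assumes s: "0 < s" "s < 1"
  shows "integrable lborel (\<lambda>z::real^'n::finite. min 1 ((norm z)\<^sup>2) * frac_kernel s z)"
proof -
  let ?p = "real CARD('n) + 2 * s"
  have 1: "(\<integral>\<^sup>+z. ennreal (indicator {z. 1 \<le> norm z} z * norm z powr (- ?p)) \<partial>(lborel :: (real^'n) measure)) < \<infinity>"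
  proof (rule nn_integral_shells_finite[where c=2])
    show "2 powr (real CARD('n) - ?p) < 1" using s by (simp add: powr_less_one)
    fix z :: "real^'n" assume "z \<in> {z. 1 \<le> norm z}"
    then show "\<exists>k::nat. 2 ^ k \<le> norm z \<and> norm z < 2 * 2 ^ k"
      using dyadic_scale by simp
  qed simp
  have 2: "(\<integral>\<^sup>+z. ennreal (indicator {z. 0 < norm z \<and> norm z < 1} z * norm z powr (- (?p - 2))) \<partial>(lborel :: (real^'n) measure)) < \<infinity>"
  proof (rule nn_integral_shells_finite[where c="1/2"])
    show "(1/2) powr (real CARD('n) - (?p - 2)) < 1" using s by (simp add: powr01_less_one)
    fix z :: "real^'n" assume z: "z \<in> {z. 0 < norm z \<and> norm z < 1}"
    then have "1 \<le> inverse (norm z)" by (simp add: one_le_inverse)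
    then obtain k where "2 ^ k \<le> inverse (norm z)" "inverse (norm z) < 2 * 2 ^ k"
      using dyadic_scale by blast
    \<comment> \<open>Inversion exchanges the closed and the open end of a shell, so the sphere |z|
      = (1/2)^k is treated apart.\<close>
    then have "(1/2) ^ Suc k \<le> norm z \<and> norm z < 2 * (1/2) ^ Suc k \<or> norm z = (1/2) ^ k"
      using z by (auto simp: field_simps power_one_over)
    moreover have "(1/2) ^ k \<le> (1/2::real) ^ k \<and> (1/2) ^ k < 2 * (1/2::real) ^ k" by simp
    ultimately show "\<exists>k::nat. (1/2) ^ k \<le> norm z \<and> norm z < 2 * (1/2) ^ k" by metis
  qed simp
  have "(\<integral>\<^sup>+z. ennreal (min 1 ((norm z)\<^sup>2) * frac_kernel s z) \<partial>(lborel :: (real^'n) measure))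
    \<le> (\<integral>\<^sup>+z. ennreal (indicator {z. 1 \<le> norm z} z * norm z powr (- ?p))
       + ennreal (indicator {z. 0 < norm z \<and> norm z < 1} z * norm z powr (- (?p - 2))) \<partial>(lborel :: (real^'n) measure))"
  proof (intro nn_integral_mono)
    fix z :: "real^'n"
    consider "z = 0" | "0 < norm z" "norm z < 1" | "1 \<le> norm z" by force
    then show "ennreal (min 1 ((norm z)\<^sup>2) * frac_kernel s z) \<le> ennreal (indicator {z. 1 \<le> norm z} z * norm z powr (- ?p))
       + ennreal (indicator {z. 0 < norm z \<and> norm z < 1} z * norm z powr (- (?p - 2)))"
    proof cases
      case 2
      have "(norm z)\<^sup>2 * frac_kernel s z = norm z powr (2 - ?p)"
        using 2 by (simp only: powr_diff) (simp add: frac_kernel_def powr_numeral)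
      then show ?thesis using 2 power_le_one[of "norm z" 2] by (simp add: min_def)
    next
      case 3
      then show ?thesis using one_le_power[of "norm z" 2]
        by (simp only: powr_minus[of _ ?p]) (simp add: min_def frac_kernel_def divide_inverse)
    qed simp
  qed
  also have "\<dots> < \<infinity>"
    using 1 2 by (subst nn_integral_add) auto
  finally show ?thesis
    unfolding integrable_iff_bounded by (simp add: abs_mult)
qed

section \<open>The Fourier symbol of the singular kernel\<close>

text \<open>The Levy-Khintchine exponent of the kernel: integrating second differences against the
  kernel multiplies the Fourier transform by twice this function.\<close>

definition levy_symbol :: "real \<Rightarrow> real^'n::finite \<Rightarrow> real" where
  "levy_symbol s \<xi> = (\<integral>z. (1 - cos (z \<bullet> \<xi>)) * frac_kernel s z \<partial>lborel)"

text \<open>Combines the trivial bound 2 with a quadratic one. The right side separates z from \<xi>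
  and so provides product majorants for Fubini.\<close>

lemma one_minus_cos_le:
  fixes z \<xi> :: "real^'n::finite"
  shows "1 - cos (z \<bullet> \<xi>) \<le> 2 * (1 + (norm \<xi>)\<^sup>2) * min 1 ((norm z)\<^sup>2)"
proof -
  have "1 - cos (z \<bullet> \<xi>) \<le> 2" using cos_ge_minus_one[of "z \<bullet> \<xi>"] by linarith
  moreover have "1 - cos (z \<bullet> \<xi>) \<le> 2 * (norm \<xi>)\<^sup>2 * (norm z)\<^sup>2"
  proof -
    have "1 - cos (z \<bullet> \<xi>) = 2 * (sin ((z \<bullet> \<xi>) / 2))\<^sup>2"
      using cos_double_sin[of "(z \<bullet> \<xi>) / 2"] by simp
    also have "\<dots> \<le> 2 * ((z \<bullet> \<xi>) / 2)\<^sup>2"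
      using abs_sin_x_le_abs_x[of "(z \<bullet> \<xi>) / 2"] unfolding abs_le_square_iff by simp
    also have "\<dots> \<le> 2 * (z \<bullet> \<xi>)\<^sup>2" by (simp add: power_divide)
    also have "\<dots> \<le> 2 * (norm z * norm \<xi>)\<^sup>2"
      using Cauchy_Schwarz_ineq2[of z \<xi>] by (simp add: abs_le_square_iff[symmetric] abs_mult)
    finally show ?thesis by (simp add: power_mult_distrib ac_simps)
  qed
  ultimately show ?thesis
    by (simp add: min_def algebra_simps) (smt (verit) mult_nonneg_nonneg zero_le_power2)
qed

lemma integrable_levy:
  fixes \<xi> :: "real^'n::finite"
  assumes s: "0 < s" "s < 1"
  shows "integrable lborel (\<lambda>z. (1 - cos (z \<bullet> \<xi>)) * frac_kernel s z)"
proof (rule Bochner_Integration.integrable_bound[OF integrable_mult_right[OF integrable_frac_kernel_weight[OF s], of "2 * (1 + (norm \<xi>)\<^sup>2)"]])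
  show "AE z in lborel. norm ((1 - cos (z \<bullet> \<xi>)) * frac_kernel s z) \<le> norm (2 * (1 + (norm \<xi>)\<^sup>2) * (min 1 ((norm z)\<^sup>2) * frac_kernel s z))"
  proof (rule AE_I2)
    fix z :: "real^'n"
    have "\<bar>1 - cos (z \<bullet> \<xi>)\<bar> = 1 - cos (z \<bullet> \<xi>)" by simp
    then show "norm ((1 - cos (z \<bullet> \<xi>)) * frac_kernel s z) \<le> norm (2 * (1 + (norm \<xi>)\<^sup>2) * (min 1 ((norm z)\<^sup>2) * frac_kernel s z))"
      using mult_right_mono[OF one_minus_cos_le[of z \<xi>] frac_kernel_nonneg[of s z]]
      by (simp add: abs_mult mult.assoc)
  qed
qed measurable

lemma levy_symbol_nonneg: "levy_symbol s \<xi> \<ge> 0"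
  unfolding levy_symbol_def by (intro Bochner_Integration.integral_nonneg) auto

text \<open>Substitute T z for z: Lebesgue measure and the kernel are both invariant under
  orthogonal maps.\<close>

lemma levy_symbol_orthogonal:
  fixes T :: "real^'n::finite \<Rightarrow> real^'n"
  assumes T: "orthogonal_transformation T"
  shows "levy_symbol s (T \<xi>) = levy_symbol s \<xi>"
proof -
  have "continuous_on UNIV T"
    using T by (simp add: linear_continuous_on linear_conv_bounded_linear[symmetric] orthogonal_transformation_linear)
  then have [measurable]: "T \<in> borel_measurable borel" by (rule borel_measurable_continuous_onI)
  have "levy_symbol s (T \<xi>) = (\<integral>z. (1 - cos (z \<bullet> T \<xi>)) * frac_kernel s z \<partial>(distr lborel borel T))"
    by (simp add: levy_symbol_def lborel_distr_orthogonal[OF T])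
  also have "\<dots> = (\<integral>z. (1 - cos (T z \<bullet> T \<xi>)) * frac_kernel s (T z) \<partial>lborel)"
    by (rule integral_distr) measurable
  also have "\<dots> = levy_symbol s \<xi>"
  proof -
    have "T z \<bullet> T \<xi> = z \<bullet> \<xi>" "norm (T z) = norm z" for z
      using T by (auto simp: orthogonal_transformation_def orthogonal_transformation_norm)
    then show ?thesis by (simp add: levy_symbol_def frac_kernel_def)
  qed
  finally show ?thesis .
qed

text \<open>Under z \<mapsto> c z Lebesgue measure accounts for a factor c^n and the kernel for c^(n
  + 2s); their quotient is the degree of homogeneity 2s.\<close>

lemma levy_symbol_scale:
  fixes \<xi> :: "real^'n::finite"
  assumes c: "c > 0"
  shows "levy_symbol s (c *\<^sub>R \<xi>) = c powr (2 * s) * levy_symbol s \<xi>"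
proof -
  let ?F = "\<lambda>z. (1 - cos (z \<bullet> \<xi>)) * frac_kernel s z"
  have "(\<integral>z. ?F (0 + c *\<^sub>R z) \<partial>lborel) = (\<integral>z. ?F z \<partial>lborel) /\<^sub>R \<bar>c\<bar> ^ CARD('n)"
    by (subst integral_lborel_affine) (use c in auto)
  moreover have "?F (0 + c *\<^sub>R z) = (1 / c powr (real CARD('n) + 2 * s)) * ((1 - cos (z \<bullet> (c *\<^sub>R \<xi>))) * frac_kernel s z)" for z
    using c by (simp add: frac_kernel_def powr_mult)
  ultimately have "(\<integral>z. (1 / c powr (real CARD('n) + 2 * s)) * ((1 - cos (z \<bullet> (c *\<^sub>R \<xi>))) * frac_kernel s z) \<partial>lborel) = (\<integral>z. ?F z \<partial>lborel) / c ^ CARD('n)"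
    using c by (simp only: abs_of_pos) (simp add: divide_inverse)
  then have "(1 / c powr (real CARD('n) + 2 * s)) * levy_symbol s (c *\<^sub>R \<xi>) = levy_symbol s \<xi> / c ^ CARD('n)"
    unfolding levy_symbol_def integral_mult_right_zero .
  then have "levy_symbol s (c *\<^sub>R \<xi>) = c powr (real CARD('n) + 2 * s) / c ^ CARD('n) * levy_symbol s \<xi>"
    using c by (simp add: field_simps)
  then show ?thesis using c by (simp add: powr_add powr_realpow)
qed

text \<open>The value on the unit sphere, taken at a coordinate vector. \<open>SOME i. True\<close>
  merely names a coordinate; rotation invariance makes the choice immaterial.\<close>

definition levy_const :: "'n::finite itself \<Rightarrow> real \<Rightarrow> real" where
  "levy_const TYPE('n) s = levy_symbol s (axis (SOME i. True) 1 :: real^'n)"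

text \<open>A rotation takes the reference vector to the direction of \<xi>, and the dilation by
  |\<xi>| contributes |\<xi>|^(2s).\<close>

lemma levy_symbol_eq:
  fixes \<xi> :: "real^'n::finite"
  shows "levy_symbol s \<xi> = levy_const TYPE('n) s * norm \<xi> powr (2 * s)"
proof (cases "\<xi> = 0")
  case True then show ?thesis by (simp add: levy_symbol_def)
next
  case False
  let ?a = "axis (SOME i. True) 1 :: real^'n"
  obtain T where T: "orthogonal_transformation T" "T ?a = (1 / norm \<xi>) *\<^sub>R \<xi>"
    using orthogonal_transformation_exists[of ?a "(1 / norm \<xi>) *\<^sub>R \<xi>"] False by (auto simp: norm_axis_1)
  have "levy_symbol s \<xi> = levy_symbol s (norm \<xi> *\<^sub>R T ?a)" using False T by simp
  also have "\<dots> = norm \<xi> powr (2 * s) * levy_symbol s ?a"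
    using False by (simp add: levy_symbol_scale levy_symbol_orthogonal[OF T(1)])
  finally show ?thesis by (simp add: levy_const_def mult.commute)
qed

lemma levy_const_pos:
  assumes s: "0 < s" "s < 1" shows "levy_const TYPE('n::finite) s > 0"
proof -
  let ?a = "axis (SOME i. True) 1 :: real^'n"
  \<comment> \<open>An open slab on which the chosen coordinate lies between 0 and 2 < pi, so the
    cosine is strictly below 1.\<close>
  let ?S = "{z. 0 < z \<bullet> ?a} \<inter> {z. z \<bullet> ?a < 2}"
  have "(\<integral>z. (1 - cos (z \<bullet> ?a)) * frac_kernel s z \<partial>lborel) > 0"
  proof (rule integral_pos_open[where S="?S", OF integrable_levy[OF s]])
    show "open ?S" by (intro open_Int open_Collect_less continuous_intros)
    have "?a \<in> ?S" by (simp add: inner_axis_axis)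
    then show "?S \<noteq> {}" by blast
    fix z assume z: "z \<in> ?S"
    have "cos (z \<bullet> ?a) < cos 0" using z pi_gt3 by (intro cos_monotone_0_pi) auto
    moreover have "z \<noteq> 0" using z by auto
    ultimately show "0 < (1 - cos (z \<bullet> ?a)) * frac_kernel s z" by (simp add: frac_kernel_def)
  qed auto
  then show ?thesis by (simp add: levy_const_def levy_symbol_def)
qed

section \<open>Second differences and the principal value\<close>

text \<open>The sign makes the result positive at a strict maximum, in accordance with the
  nonnegative operator (-\<Delta>)^s. Writing \<open>u x + u x\<close> stays within abelian groups,
  so real and complex functions share the definition.\<close>

definition second_diff :: "('a::ab_group_add \<Rightarrow> 'b::ab_group_add) \<Rightarrow> 'a \<Rightarrow> 'a \<Rightarrow> 'b" where
  "second_diff u x z = u x + u x - u (x + z) - u (x - z)"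

text \<open>Shifts by z and -z multiply the transform by e^(i z.\<xi>) and e^(-i z.\<xi>), whose sum
  is 2 cos(z.\<xi>).\<close>

lemma second_diff_fourier:
  fixes u :: "real^'n::finite \<Rightarrow> complex"
  assumes u: "u \<in> schwartz"
  shows "second_diff u x z = (\<integral>\<xi>. of_real (2 * (1 - cos (z \<bullet> \<xi>))) * (exp (\<i> * complex_of_real (x \<bullet> \<xi>)) * fourier u \<xi>) \<partial>lborel) /\<^sub>R (2 * pi) ^ CARD('n)"
proof -
  define E where "E y \<xi> = exp (\<i> * complex_of_real (y \<bullet> \<xi>)) * fourier u \<xi>" for y \<xi>
  define K where "K = inverse ((2 * pi) ^ CARD('n))"
  have inv: "u y = K *\<^sub>R (\<integral>\<xi>. E y \<xi> \<partial>lborel)" for y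
    using fun_cong[OF inverse_fourier_fourier[OF u], of y] unfolding inverse_fourier_def E_def K_def by (rule sym)
  have i: "integrable lborel (E y)" for y
    unfolding E_def by (rule integrable_bounded_mult[OF schwartz_integrable[OF schwartz_fourier[OF u]], where C=1]) auto
  have "second_diff u x z = K *\<^sub>R (\<integral>\<xi>. E x \<xi> + E x \<xi> - E (x + z) \<xi> - E (x - z) \<xi> \<partial>lborel)"
    unfolding second_diff_def inv[of x] inv[of "x + z"] inv[of "x - z"]
    by (simp add: i scaleR_diff_right scaleR_add_right)
  also have "(\<lambda>\<xi>. E x \<xi> + E x \<xi> - E (x + z) \<xi> - E (x - z) \<xi>)
     = (\<lambda>\<xi>. of_real (2 * (1 - cos (z \<bullet> \<xi>))) * E x \<xi>)"
  proof
    fix \<xi>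
    have 1: "exp (\<i> * complex_of_real ((x + z) \<bullet> \<xi>)) = exp (\<i> * complex_of_real (x \<bullet> \<xi>)) * exp (\<i> * complex_of_real (z \<bullet> \<xi>))"
      "exp (\<i> * complex_of_real ((x - z) \<bullet> \<xi>)) = exp (\<i> * complex_of_real (x \<bullet> \<xi>)) * exp (- (\<i> * complex_of_real (z \<bullet> \<xi>)))"
      by (simp_all add: exp_add[symmetric] inner_add_left inner_diff_left algebra_simps)
    have 2: "exp (\<i> * complex_of_real (z \<bullet> \<xi>)) + exp (- (\<i> * complex_of_real (z \<bullet> \<xi>))) = of_real (2 * cos (z \<bullet> \<xi>))"
      by (simp add: cos_of_real[symmetric] cos_exp_eq)
    have 3: "complex_of_real (2 * (1 - cos (z \<bullet> \<xi>))) = 2 - (exp (\<i> * complex_of_real (z \<bullet> \<xi>)) + exp (- (\<i> * complex_of_real (z \<bullet> \<xi>))))"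
      unfolding 2 by simp
    have "e * f + e * f - (e * a) * f - (e * b) * f = (2 - (a + b)) * (e * f)" for e f a b :: complex
      by (simp add: algebra_simps)
    then show "E x \<xi> + E x \<xi> - E (x + z) \<xi> - E (x - z) \<xi> = of_real (2 * (1 - cos (z \<bullet> \<xi>))) * E x \<xi>"
      unfolding E_def 1 3 .
  qed
  finally show ?thesis by (simp only: E_def K_def)
qed

lemma integrable_fourier_weight:
  fixes u :: "real^'n::finite \<Rightarrow> complex"
  assumes u: "u \<in> schwartz"
  shows "integrable lborel (\<lambda>\<xi>. (1 + (norm \<xi>)\<^sup>2) * cmod (fourier u \<xi>))"
  using Bochner_Integration.integrable_add[OF schwartz_integrable_moment[OF schwartz_fourier[OF u], of 0]
      schwartz_integrable_moment[OF schwartz_fourier[OF u], of 2]]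
  by (simp add: distrib_right)

text \<open>The cancellation of first order terms shows up as 1 - cos under Fourier inversion, with
  a bound uniform in x. It makes the integral against the kernel converge absolutely.\<close>

lemma second_diff_bound:
  fixes u :: "real^'n::finite \<Rightarrow> complex"
  assumes u: "u \<in> schwartz"
  obtains C where "C \<ge> 0" "\<And>x z. cmod (second_diff u x z) \<le> C * min 1 ((norm z)\<^sup>2)"
proof -
  let ?I = "\<integral>\<xi>. (1 + (norm \<xi>)\<^sup>2) * cmod (fourier u \<xi>) \<partial>lborel"
  have [measurable]: "fourier u \<in> borel_measurable borel" by (intro schwartz_measurable schwartz_fourier u)
  define K where "K = (2 * pi) ^ CARD('n)"
  have K: "K > 0" by (simp add: K_def)
  have "cmod (second_diff u x z) \<le> 4 / K * ?I * min 1 ((norm z)\<^sup>2)" for x z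
  proof -
    let ?f = "\<lambda>\<xi>. of_real (2 * (1 - cos (z \<bullet> \<xi>))) * (exp (\<i> * complex_of_real (x \<bullet> \<xi>)) * fourier u \<xi>)"
    have "cmod (integral\<^sup>L lborel ?f) \<le> (\<integral>\<xi>. 4 * min 1 ((norm z)\<^sup>2) * ((1 + (norm \<xi>)\<^sup>2) * cmod (fourier u \<xi>)) \<partial>lborel)"
    proof (rule Bochner_Integration.integral_norm_bound_integral)
      show "integrable lborel (\<lambda>\<xi>. 4 * min 1 ((norm z)\<^sup>2) * ((1 + (norm \<xi>)\<^sup>2) * cmod (fourier u \<xi>)))"
        by (intro integrable_mult_right integrable_fourier_weight u)
      have le: "cmod (?f \<xi>) \<le> 4 * min 1 ((norm z)\<^sup>2) * ((1 + (norm \<xi>)\<^sup>2) * cmod (fourier u \<xi>))" for \<xi>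
      proof -
        have "cmod (?f \<xi>) = 2 * (1 - cos (z \<bullet> \<xi>)) * cmod (fourier u \<xi>)"
          by (simp add: norm_mult del: of_real_mult of_real_diff)
        also have "\<dots> \<le> 2 * (2 * (1 + (norm \<xi>)\<^sup>2) * min 1 ((norm z)\<^sup>2)) * cmod (fourier u \<xi>)"
          by (intro mult_right_mono mult_left_mono one_minus_cos_le) auto
        also have "\<dots> = 4 * min 1 ((norm z)\<^sup>2) * ((1 + (norm \<xi>)\<^sup>2) * cmod (fourier u \<xi>))" by simp
        finally show ?thesis .
      qed
      then show "cmod (?f \<xi>) \<le> 4 * min 1 ((norm z)\<^sup>2) * ((1 + (norm \<xi>)\<^sup>2) * cmod (fourier u \<xi>))" for \<xi> .
      show "integrable lborel ?f"
        by (rule Bochner_Integration.integrable_bound[OF integrable_mult_right[OF integrable_fourier_weight[OF u], of "4 * min 1 ((norm z)\<^sup>2)"]])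
          (use le in \<open>auto intro!: AE_I2 order_trans[OF _ abs_ge_self]\<close>)
    qed
    also have "\<dots> = 4 * min 1 ((norm z)\<^sup>2) * ?I" by simp
    finally have "cmod (integral\<^sup>L lborel ?f) \<le> 4 * min 1 ((norm z)\<^sup>2) * ?I" .
    moreover have "cmod (second_diff u x z) = cmod (integral\<^sup>L lborel ?f) / K"
      unfolding second_diff_fourier[OF u] K_def[symmetric] norm_scaleR using K by (simp add: divide_inverse mult.commute)
    ultimately show ?thesis using K by (simp add: field_simps)
  qed
  moreover have "4 / K * ?I \<ge> 0" using K by (auto intro!: mult_nonneg_nonneg Bochner_Integration.integral_nonneg)
  ultimately show ?thesis using that by blast
qed

lemma second_diff_measurable:
  fixes u :: "'a::euclidean_space \<Rightarrow> 'b::{real_normed_vector,second_countable_topology}"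
  assumes [measurable]: "u \<in> borel_measurable borel"
  shows "(\<lambda>z. second_diff u x z) \<in> borel_measurable borel"
    and "(\<lambda>p. second_diff u (fst p) (snd p)) \<in> borel_measurable (borel \<Otimes>\<^sub>M borel)"
  unfolding second_diff_def by measurable

lemma integrable_second_diff:
  fixes u :: "real^'n::finite \<Rightarrow> complex"
  assumes u: "u \<in> schwartz" and s: "0 < s" "s < 1"
  shows "integrable lborel (\<lambda>z. second_diff u x z * of_real (frac_kernel s z))"
proof -
  have [measurable]: "u \<in> borel_measurable borel" using u by (rule schwartz_measurable)
  note [measurable] = second_diff_measurable(1)
  obtain C where C: "C \<ge> 0" "\<And>x z. cmod (second_diff u x z) \<le> C * min 1 ((norm z)\<^sup>2)"
    using second_diff_bound[OF u] by metis
  show ?thesis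
  proof (rule Bochner_Integration.integrable_bound[OF integrable_mult_right[OF integrable_frac_kernel_weight[OF s], of C]])
    show "AE z in lborel. norm (second_diff u x z * of_real (frac_kernel s z)) \<le> norm (C * (min 1 ((norm z)\<^sup>2) * frac_kernel s z))"
    proof (rule AE_I2)
      fix z
      show "norm (second_diff u x z * of_real (frac_kernel s z)) \<le> norm (C * (min 1 ((norm z)\<^sup>2) * frac_kernel s z))"
        using mult_right_mono[OF C(2)[of x z] frac_kernel_nonneg[of s z]] C(1)
        by (simp add: norm_mult abs_mult mult.assoc)
    qed
  qed measurable
qed

text \<open>After Fourier inversion and Fubini the z-integral is the Levy symbol, a multiple of
  |\<xi>|^(2s).\<close>

lemma integral_second_diff:
  fixes u :: "real^'n::finite \<Rightarrow> complex"
  assumes u: "u \<in> schwartz" and s: "0 < s" "s < 1"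
  shows "(\<integral>z. second_diff u x z * of_real (frac_kernel s z) \<partial>lborel) = of_real (2 * levy_const TYPE('n) s) * fractional_laplacian s u x"
proof -
  have [measurable]: "fourier u \<in> borel_measurable borel" by (intro schwartz_measurable schwartz_fourier u)
  let ?E = "\<lambda>\<xi>. exp (\<i> * complex_of_real (x \<bullet> \<xi>)) * fourier u \<xi>"
  let ?g = "\<lambda>z \<xi>. of_real (2 * ((1 - cos (z \<bullet> \<xi>)) * frac_kernel s z)) * ?E \<xi>"
  have "integrable (lborel \<Otimes>\<^sub>M lborel) (\<lambda>(z, \<xi>). ?g z \<xi>)"
  proof (rule Bochner_Integration.integrable_bound[OF integrable_pair_mult[OF
        integrable_mult_right[OF integrable_frac_kernel_weight[OF s], of 4] integrable_fourier_weight[OF u]]])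
    show "AE p in lborel \<Otimes>\<^sub>M lborel. norm (case p of (z, \<xi>) \<Rightarrow> ?g z \<xi>) \<le>
        norm (case p of (z::real^'n, \<xi>) \<Rightarrow> (4 * (min 1 ((norm z)\<^sup>2) * frac_kernel s z)) * ((1 + (norm \<xi>)\<^sup>2) * cmod (fourier u \<xi>)))"
    proof (rule AE_I2, clarify)
      fix z \<xi> :: "real^'n"
      have "norm (?g z \<xi>) = 2 * ((1 - cos (z \<bullet> \<xi>)) * frac_kernel s z) * cmod (fourier u \<xi>)"
        by (simp add: norm_mult abs_mult del: of_real_mult of_real_diff)
      also have "\<dots> \<le> 2 * ((2 * (1 + (norm \<xi>)\<^sup>2) * min 1 ((norm z)\<^sup>2)) * frac_kernel s z) * cmod (fourier u \<xi>)"
        by (intro mult_right_mono mult_left_mono one_minus_cos_le) auto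
      also have "\<dots> = (4 * (min 1 ((norm z)\<^sup>2) * frac_kernel s z)) * ((1 + (norm \<xi>)\<^sup>2) * cmod (fourier u \<xi>))"
        by (simp add: ac_simps)
      finally show "norm (?g z \<xi>) \<le> norm ((4 * (min 1 ((norm z)\<^sup>2) * frac_kernel s z)) * ((1 + (norm \<xi>)\<^sup>2) * cmod (fourier u \<xi>)))"
        by simp
    qed
  qed measurable
  from lborel_pair.Fubini_integral[OF this]
  have F: "(\<integral>z. (\<integral>\<xi>. ?g z \<xi> \<partial>lborel) \<partial>lborel) = (\<integral>\<xi>. (\<integral>z. ?g z \<xi> \<partial>lborel) \<partial>lborel)" by (rule sym)
  have "second_diff u x z * of_real (frac_kernel s z) = (\<integral>\<xi>. ?g z \<xi> \<partial>lborel) /\<^sub>R (2 * pi) ^ CARD('n)" for z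
  proof -
    have "(\<integral>\<xi>. ?g z \<xi> \<partial>lborel) = (\<integral>\<xi>. of_real (frac_kernel s z) * (of_real (2 * (1 - cos (z \<bullet> \<xi>))) * ?E \<xi>) \<partial>lborel)"
      by (intro Bochner_Integration.integral_cong) auto
    also have "\<dots> = of_real (frac_kernel s z) * (\<integral>\<xi>. of_real (2 * (1 - cos (z \<bullet> \<xi>))) * ?E \<xi> \<partial>lborel)"
      by (rule integral_mult_right_zero)
    finally show ?thesis
      unfolding second_diff_fourier[OF u] by (simp only: mult_scaleR_left mult_scaleR_right mult.commute)
  qed
  then have "(\<integral>z. second_diff u x z * of_real (frac_kernel s z) \<partial>lborel) = (\<integral>z. (\<integral>\<xi>. ?g z \<xi> \<partial>lborel) \<partial>lborel) /\<^sub>R (2 * pi) ^ CARD('n)"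
    by (simp only: integral_scaleR_right)
  also have "(\<integral>z. (\<integral>\<xi>. ?g z \<xi> \<partial>lborel) \<partial>lborel) = (\<integral>\<xi>. of_real (2 * levy_const TYPE('n) s) * (exp (\<i> * complex_of_real (x \<bullet> \<xi>)) * (of_real (norm \<xi> powr (2 * s)) * fourier u \<xi>)) \<partial>lborel)"
    unfolding F
  proof (rule Bochner_Integration.integral_cong[OF refl])
    fix \<xi>
    have "(\<integral>z. ?g z \<xi> \<partial>lborel) = (\<integral>z. complex_of_real (2 * ((1 - cos (z \<bullet> \<xi>)) * frac_kernel s z)) \<partial>lborel) * ?E \<xi>"
      by (rule integral_mult_left_zero)
    also have "(\<integral>z. complex_of_real (2 * ((1 - cos (z \<bullet> \<xi>)) * frac_kernel s z)) \<partial>lborel) = of_real (2 * levy_symbol s \<xi>)"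
      unfolding integral_complex_of_real levy_symbol_def by simp
    finally show "(\<integral>z. ?g z \<xi> \<partial>lborel) = of_real (2 * levy_const TYPE('n) s) * (exp (\<i> * complex_of_real (x \<bullet> \<xi>)) * (of_real (norm \<xi> powr (2 * s)) * fourier u \<xi>))"
      unfolding levy_symbol_eq by (simp add: ac_simps)
  qed
  also have "\<dots> = of_real (2 * levy_const TYPE('n) s) * (\<integral>\<xi>. exp (\<i> * complex_of_real (x \<bullet> \<xi>)) * (of_real (norm \<xi> powr (2 * s)) * fourier u \<xi>) \<partial>lborel)"
    by (rule integral_mult_right_zero)
  finally show ?thesis
    unfolding fractional_laplacian_def inverse_fourier_def by (simp only: mult_scaleR_right)
qed

text \<open>The truncated region is symmetric under z \<mapsto> -z, so averaging the integral with
  its reflection replaces the first difference by half of the second difference.\<close>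

lemma truncated_integral:
  fixes u :: "real^'n::finite \<Rightarrow> complex"
  assumes u: "u \<in> schwartz" and s: "0 < s" "s < 1" and e: "e > 0"
  shows "(LINT y:{y. norm (x - y) > e}|lborel. (u x - u y) /\<^sub>R norm (x - y) powr (real CARD('n) + 2 * s))
    = (\<integral>z. indicator {z. norm z > e} z *\<^sub>R (second_diff u x z * of_real (frac_kernel s z)) \<partial>lborel) / 2"
proof -
  have [measurable]: "u \<in> borel_measurable borel" using u by (rule schwartz_measurable)
  let ?A = "\<lambda>z. indicator {z. norm z > e} z *\<^sub>R ((u x - u (x + z)) * of_real (frac_kernel s z))"
  have "(LINT y:{y. norm (x - y) > e}|lborel. (u x - u y) /\<^sub>R norm (x - y) powr (real CARD('n) + 2 * s))
     = (\<integral>y. ?A (- x + 1 *\<^sub>R y) \<partial>lborel)"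
    unfolding set_lebesgue_integral_def
    by (intro Bochner_Integration.integral_cong)
      (auto simp: frac_kernel_def norm_minus_commute scaleR_conv_of_real divide_inverse indicator_def mult.commute)
  also have "\<dots> = (\<integral>z. ?A z \<partial>lborel)"
    by (subst integral_lborel_affine) auto
  finally have 1: "(LINT y:{y. norm (x - y) > e}|lborel. (u x - u y) /\<^sub>R norm (x - y) powr (real CARD('n) + 2 * s)) = (\<integral>z. ?A z \<partial>lborel)" .
  obtain C where C: "C \<ge> 0" "\<And>x. cmod (u x) \<le> C" using schwartz_bounded[OF u] by metis
  \<comment> \<open>Outside the ball of radius e, 1 is at most max(1, 1/e^2) min(1, |z|^2), so a
    multiple of the weighted kernel majorizes the bare one.\<close>
  have int: "integrable lborel ?A"
  proof (rule Bochner_Integration.integrable_bound[OF integrable_mult_right[OF integrable_frac_kernel_weight[OF s], of "2 * C * max 1 (1 / e\<^sup>2)"]])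
    show "AE z in lborel. norm (?A z) \<le> norm (2 * C * max 1 (1 / e\<^sup>2) * (min 1 ((norm z)\<^sup>2) * frac_kernel s z))"
    proof (rule AE_I2)
      fix z :: "real^'n"
      show "norm (?A z) \<le> norm (2 * C * max 1 (1 / e\<^sup>2) * (min 1 ((norm z)\<^sup>2) * frac_kernel s z))"
      proof (cases "norm z > e")
        case True
        have "e\<^sup>2 \<le> (norm z)\<^sup>2" using True e by (intro power_mono) auto
        then have "1 \<le> 1 / e\<^sup>2 * (norm z)\<^sup>2" using e by (simp add: field_simps)
        also have "\<dots> \<le> max 1 (1 / e\<^sup>2) * (norm z)\<^sup>2" by (intro mult_right_mono) auto
        finally have *: "1 \<le> max 1 (1 / e\<^sup>2) * (norm z)\<^sup>2" .
        have "1 \<le> a * min 1 b" if "1 \<le> a * b" "1 \<le> a" for a b :: real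
          using that by (simp add: min_def)
        from this[OF *] have "1 \<le> max 1 (1 / e\<^sup>2) * min 1 ((norm z)\<^sup>2)" by simp
        then have "2 * C * 1 * frac_kernel s z \<le> 2 * C * (max 1 (1 / e\<^sup>2) * min 1 ((norm z)\<^sup>2)) * frac_kernel s z"
          using C(1) by (intro mult_right_mono mult_left_mono) auto
        moreover have "cmod (u x - u (x + z)) * frac_kernel s z \<le> (2 * C) * frac_kernel s z"
          using norm_triangle_ineq4[of "u x" "u (x + z)"] C(2)[of x] C(2)[of "x + z"] by (intro mult_right_mono) auto
        ultimately have "cmod (u x - u (x + z)) * frac_kernel s z \<le> 2 * C * max 1 (1 / e\<^sup>2) * (min 1 ((norm z)\<^sup>2) * frac_kernel s z)"
          by (simp only: mult.assoc mult_1_right mult_1_left)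
        then show ?thesis using True by (simp add: norm_mult)
      qed simp
    qed
  qed measurable
  have int': "integrable lborel (\<lambda>z. ?A (- z))"
    using int integral_lborel_reflect(2)[of ?A] by simp
  have "(\<integral>z. ?A z \<partial>lborel) + (\<integral>z. ?A z \<partial>lborel) = (\<integral>z. ?A z + ?A (- z) \<partial>lborel)"
    using integral_lborel_reflect(1)[of ?A] int int' by (simp only: Bochner_Integration.integral_add) simp
  also have "\<dots> = (\<integral>z. indicator {z. norm z > e} z *\<^sub>R (second_diff u x z * of_real (frac_kernel s z)) \<partial>lborel)"
    by (intro Bochner_Integration.integral_cong) (auto simp: second_diff_def indicator_def algebra_simps)
  finally have *: "(\<integral>z. ?A z \<partial>lborel) + (\<integral>z. ?A z \<partial>lborel) = (\<integral>z. indicator {z. norm z > e} z *\<^sub>R (second_diff u x z * of_real (frac_kernel s z)) \<partial>lborel)" .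
  have "a = b / 2" if "a + a = b" for a b :: complex using that by auto
  from this[OF *] show ?thesis unfolding 1 .
qed

text \<open>In symmetrized form the integrand is absolutely integrable, so shrinking the hole is
  dominated convergence.\<close>

lemma principal_value_tendsto:
  fixes u :: "real^'n::finite \<Rightarrow> complex"
  assumes u: "u \<in> schwartz" and s: "0 < s" "s < 1"
  shows "((\<lambda>\<epsilon>. LINT y:{y. norm (x - y) > \<epsilon>}|lborel. (u x - u y) /\<^sub>R norm (x - y) powr (real CARD('n) + 2 * s))
    \<longlongrightarrow> of_real (levy_const TYPE('n) s) * fractional_laplacian s u x) (at_right 0)"
  unfolding tendsto_at_iff_sequentially
proof (intro allI impI)
  fix X :: "nat \<Rightarrow> real" assume X: "\<forall>i. X i \<in> {0<..} - {0}" "X \<longlonglongrightarrow> 0"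
  have [measurable]: "u \<in> borel_measurable borel" using u by (rule schwartz_measurable)
  note [measurable] = second_diff_measurable(1)
  let ?f = "\<lambda>z. second_diff u x z * of_real (frac_kernel s z)"
  have "(\<lambda>i. \<integral>z. indicator {z. norm z > X i} z *\<^sub>R ?f z \<partial>lborel) \<longlonglongrightarrow> (\<integral>z. ?f z \<partial>lborel)"
  proof (rule integral_dominated_convergence[where w="\<lambda>z. norm (?f z)"])
    show "integrable lborel (\<lambda>z. norm (?f z))"
      by (intro integrable_norm integrable_second_diff u s)
    show "AE z in lborel. (\<lambda>i. indicator {z. norm z > X i} z *\<^sub>R ?f z) \<longlonglongrightarrow> ?f z"
    proof (rule AE_I2)
      fix z :: "real^'n"
      show "(\<lambda>i. indicator {z. norm z > X i} z *\<^sub>R ?f z) \<longlonglongrightarrow> ?f z"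
      proof (cases "z = 0")
        case False
        then have "\<forall>\<^sub>F i in sequentially. X i < norm z"
          using X(2) by (intro order_tendstoD(2)) auto
        then have "\<forall>\<^sub>F i in sequentially. ?f z = indicator {z. norm z > X i} z *\<^sub>R ?f z"
          by eventually_elim simp
        then show ?thesis by (rule Lim_transform_eventually[OF tendsto_const])
      qed (simp add: frac_kernel_def)
    qed
  qed (auto simp: indicator_def)
  then have "(\<lambda>i. (\<integral>z. indicator {z. norm z > X i} z *\<^sub>R ?f z \<partial>lborel) / 2) \<longlonglongrightarrow> (\<integral>z. ?f z \<partial>lborel) / 2"
    by (intro tendsto_divide tendsto_const) auto
  then show "((\<lambda>\<epsilon>. LINT y:{y. norm (x - y) > \<epsilon>}|lborel. (u x - u y) /\<^sub>R norm (x - y) powr (real CARD('n) + 2 * s)) \<circ> X)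
     \<longlonglongrightarrow> of_real (levy_const TYPE('n) s) * fractional_laplacian s u x"
    using X(1) by (simp add: comp_def truncated_integral[OF u s] integral_second_diff[OF u s])
qed

lemma second_diff_of_real: "second_diff (\<lambda>x. complex_of_real (u x)) x z = of_real (second_diff u x z)"
  by (simp add: second_diff_def)

lemma second_diff_bound_real:
  fixes u :: "real^'n::finite \<Rightarrow> real"
  assumes "u \<in> test_functions U"
  obtains C where "C \<ge> 0" "\<And>x z. \<bar>second_diff u x z\<bar> \<le> C * min 1 ((norm z)\<^sup>2)"
  using second_diff_bound[OF test_function_schwartz[OF assms]] unfolding second_diff_of_real norm_of_real by metis

lemma integrable_second_diff_real:
  fixes u :: "real^'n::finite \<Rightarrow> real"
  assumes u: "u \<in> test_functions U" and s: "0 < s" "s < 1"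
  shows "integrable lborel (\<lambda>z. second_diff u x z * frac_kernel s z)"
  using integrable_second_diff[OF test_function_schwartz[OF u] s, of x]
  unfolding second_diff_of_real of_real_mult[symmetric] by (simp only: complex_of_real_integrable_eq)

text \<open>At a zero x of a nonnegative function the second difference is -u(x + z) - u(x - z):
  never positive, and negative on the nonempty open set of z with u(x + z) > 0. Distant values of u
  thus force the sign at x.\<close>

lemma integral_second_diff_neg:
  fixes u :: "real^'n::finite \<Rightarrow> real"
  assumes u: "u \<in> test_functions U" and s: "0 < s" "s < 1"
    and nn: "\<And>y. u y \<ge> 0" and x: "u x = 0" and y: "u y > 0"
  shows "(\<integral>z. second_diff u x z * frac_kernel s z \<partial>lborel) < 0"
proof -
  let ?S = "(\<lambda>z. x + z) -` (u -` {0<..})"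
  have cu: "continuous_on UNIV u" using smooth_continuous_on[OF test_functionsD(1)[OF u]] .
  have "0 < (\<integral>z. - (second_diff u x z * frac_kernel s z) \<partial>lborel)"
  proof (rule integral_pos_open[where S="?S"])
    show "integrable lborel (\<lambda>z. - (second_diff u x z * frac_kernel s z))"
      using integrable_second_diff_real[OF u s] by (rule Bochner_Integration.integrable_minus)
    show "- (second_diff u x z * frac_kernel s z) \<ge> 0" for z
      using nn[of "x + z"] nn[of "x - z"] x by (simp add: second_diff_def mult_nonpos_nonneg)
    have "open (u -` {0<..})" using open_vimage[OF open_greaterThan cu] .
    then show "open ?S" by (rule open_vimage) (intro continuous_intros)
    have "y - x \<in> ?S" using y by simp
    then show "?S \<noteq> {}" by blast
    fix z assume z: "z \<in> ?S"
    then have "z \<noteq> 0" using x by auto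
    moreover have "second_diff u x z < 0"
      using z nn[of "x - z"] x by (simp add: second_diff_def)
    ultimately show "- (second_diff u x z * frac_kernel s z) > 0"
      by (simp add: frac_kernel_def mult_neg_pos divide_neg_pos)
  qed
  then show ?thesis by simp
qed

text \<open>\<open>frac_const\<close> is a definite description, so nothing is known of it before
  uniqueness. Two admissible constants can differ only if all fractional Laplacians vanish, and a
  bump evaluated outside its support excludes this. The value is 1 /
  \<open>levy_const\<close>.\<close>

lemma frac_const_pos:
  assumes s: "0 < s" "s < 1" shows "frac_const TYPE('n::finite) s > 0"
proof -
  let ?K = "levy_const TYPE('n) s"
  let ?I = "\<lambda>u (x::real^'n) \<epsilon>. LINT y:{y. norm (x - y) > \<epsilon>}|lborel. (u x - u y) /\<^sub>R norm (x - y) powr (real CARD('n) + 2 * s)"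
  let ?P = "\<lambda>c. c > 0 \<and> (\<forall>u\<in>schwartz. \<forall>x::real^'n. ((\<lambda>\<epsilon>. c *\<^sub>R ?I u x \<epsilon>) \<longlongrightarrow> fractional_laplacian s u x) (at_right 0))"
  have K: "?K > 0" using levy_const_pos[OF s] .
  have ex: "?P (1 / ?K)"
  proof (intro conjI ballI allI)
    fix u :: "real^'n \<Rightarrow> complex" and x :: "real^'n" assume u: "u \<in> schwartz"
    have "((\<lambda>\<epsilon>. (1 / ?K) *\<^sub>R ?I u x \<epsilon>) \<longlongrightarrow> (1 / ?K) *\<^sub>R (of_real ?K * fractional_laplacian s u x)) (at_right 0)"
      by (intro tendsto_scaleR tendsto_const principal_value_tendsto[OF u s])
    then show "((\<lambda>\<epsilon>. (1 / ?K) *\<^sub>R ?I u x \<epsilon>) \<longlongrightarrow> fractional_laplacian s u x) (at_right 0)"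
      using K by (simp add: scaleR_conv_of_real)
  qed (use K in simp)
  \<comment> \<open>Twice a unit vector, hence outside the unit ball that carries the bump.\<close>
  let ?a = "axis (SOME i. True) 2 :: real^'n"
  let ?u = "\<lambda>x. complex_of_real (bump (0::real^'n) 1 x)"
  have a: "norm ?a \<ge> 1"
    using component_le_norm_cart[of ?a "SOME i. True"] by (simp add: axis_def)
  have b: "bump (0::real^'n) 1 \<in> test_functions UNIV" by (rule bump_test_function) auto
  have u: "?u \<in> schwartz" using b by (rule test_function_schwartz)
  have F: "fractional_laplacian s ?u ?a \<noteq> 0"
  proof
    assume "fractional_laplacian s ?u ?a = 0"
    then have "(\<integral>z. complex_of_real (second_diff (bump 0 1) ?a z * frac_kernel s z) \<partial>lborel) = 0"
      using integral_second_diff[OF u s, of ?a] unfolding second_diff_of_real by simp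
    then have "(\<integral>z. second_diff (bump 0 1) ?a z * frac_kernel s z \<partial>lborel) = 0"
      unfolding integral_complex_of_real by simp
    moreover have "(\<integral>z. second_diff (bump 0 1) ?a z * frac_kernel s z \<partial>lborel) < 0"
      by (rule integral_second_diff_neg[OF b s, where y=0]) (use a in \<open>auto simp: bump_nonneg bump_pos intro!: bump_eq_0\<close>)
    ultimately show False by simp
  qed
  have "c = 1 / ?K" if "?P c" for c
  proof -
    have "((\<lambda>\<epsilon>. c *\<^sub>R ?I ?u ?a \<epsilon>) \<longlongrightarrow> fractional_laplacian s ?u ?a) (at_right 0)"
      by (rule that[THEN conjunct2, THEN bspec, OF u, THEN spec])
    moreover have "((\<lambda>\<epsilon>. c *\<^sub>R ?I ?u ?a \<epsilon>) \<longlongrightarrow> c *\<^sub>R (of_real ?K * fractional_laplacian s ?u ?a)) (at_right 0)"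
      by (intro tendsto_scaleR tendsto_const principal_value_tendsto[OF u s])
    ultimately have "fractional_laplacian s ?u ?a = c *\<^sub>R (of_real ?K * fractional_laplacian s ?u ?a)"
      by (rule tendsto_unique[OF trivial_limit_at_right_real])
    then have "fractional_laplacian s ?u ?a = of_real (c * ?K) * fractional_laplacian s ?u ?a"
      by (simp add: scaleR_conv_of_real)
    then have "complex_of_real (c * ?K) = 1" using F by simp
    then have "c * ?K = 1" using of_real_eq_1_iff by blast
    then show ?thesis using K by (simp add: field_simps)
  qed
  then have "frac_const TYPE('n) s = 1 / ?K"
    unfolding frac_const_def using ex by (intro the_equality) auto
  then show ?thesis using K by simp
qed

section \<open>Square integrable functions\<close>

text \<open>Stated for an arbitrary measure because it is applied on \<real>^n to functions and on
  \<real>^n \<times> \<real>^n to their weighted differences.\<close>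

definition l2 :: "'a measure \<Rightarrow> ('a \<Rightarrow> real) set" where
  "l2 M = {f \<in> borel_measurable M. integrable M (\<lambda>x. (f x)\<^sup>2)}"

definition l2_norm :: "'a measure \<Rightarrow> ('a \<Rightarrow> real) \<Rightarrow> real" where
  "l2_norm M f = sqrt (\<integral>x. (f x)\<^sup>2 \<partial>M)"

lemma l2I: "f \<in> borel_measurable M \<Longrightarrow> integrable M (\<lambda>x. (f x)\<^sup>2) \<Longrightarrow> f \<in> l2 M"
  by (simp add: l2_def)

lemma l2_measurable [measurable_dest]: "f \<in> l2 M \<Longrightarrow> f \<in> borel_measurable M"
  by (simp add: l2_def)

lemma l2_integrable_sq: "f \<in> l2 M \<Longrightarrow> integrable M (\<lambda>x. (f x)\<^sup>2)"
  by (simp add: l2_def)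

lemma l2_norm_nonneg [simp]: "l2_norm M f \<ge> 0"
  by (simp add: l2_norm_def)

lemma l2_norm_sq: "(l2_norm M f)\<^sup>2 = (\<integral>x. (f x)\<^sup>2 \<partial>M)"
  by (simp add: l2_norm_def)

lemma l2_norm_abs [simp]: "l2_norm M (\<lambda>x. \<bar>f x\<bar>) = l2_norm M f"
  by (simp add: l2_norm_def)

lemma l2_abs: "f \<in> l2 M \<Longrightarrow> (\<lambda>x. \<bar>f x\<bar>) \<in> l2 M"
  by (auto simp: l2_def)

lemma l2_cmult: "f \<in> l2 M \<Longrightarrow> (\<lambda>x. c * f x) \<in> l2 M"
  by (auto simp: l2_def power_mult_distrib)

lemma l2_norm_cmult: "l2_norm M (\<lambda>x. c * f x) = \<bar>c\<bar> * l2_norm M f"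
  by (simp add: l2_norm_def power_mult_distrib real_sqrt_mult)

lemma l2_bound:
  assumes "g \<in> l2 M" "f \<in> borel_measurable M" "AE x in M. \<bar>f x\<bar> \<le> \<bar>g x\<bar>"
  shows "f \<in> l2 M" "l2_norm M f \<le> l2_norm M g"
proof -
  have le: "AE x in M. (f x)\<^sup>2 \<le> (g x)\<^sup>2"
    using assms(3) by eventually_elim (simp add: abs_le_square_iff)
  have "integrable M (\<lambda>x. (f x)\<^sup>2)"
    by (rule Bochner_Integration.integrable_bound[OF l2_integrable_sq[OF assms(1)]]) (use assms(2) le in auto)
  then show f: "f \<in> l2 M" using assms(2) by (rule l2I[rotated])
  show "l2_norm M f \<le> l2_norm M g"
    unfolding l2_norm_def using f assms(1) le
    by (intro real_sqrt_le_mono integral_mono_AE l2_integrable_sq)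
qed

lemma l2_mult_integrable:
  assumes "f \<in> l2 M" "g \<in> l2 M" shows "integrable M (\<lambda>x. f x * g x)"
proof (rule Bochner_Integration.integrable_bound[OF Bochner_Integration.integrable_add[OF l2_integrable_sq[OF assms(1)] l2_integrable_sq[OF assms(2)]]])
  have "\<bar>a * b\<bar> \<le> a\<^sup>2 + b\<^sup>2" for a b :: real
  proof -
    have "2 * (\<bar>a\<bar> * \<bar>b\<bar>) \<le> a\<^sup>2 + b\<^sup>2"
      using sum_squares_bound[of "\<bar>a\<bar>" "\<bar>b\<bar>"] by (simp add: mult.assoc)
    moreover have "0 \<le> \<bar>a\<bar> * \<bar>b\<bar>" by simp
    ultimately show ?thesis unfolding abs_mult by linarith
  qed
  then show "AE x in M. norm (f x * g x) \<le> norm ((f x)\<^sup>2 + (g x)\<^sup>2)" by simp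
qed (use assms l2_measurable in measurable)

lemma l2_add:
  assumes "f \<in> l2 M" "g \<in> l2 M" shows "(\<lambda>x. f x + g x) \<in> l2 M"
proof (rule l2I)
  have "integrable M (\<lambda>x. (f x)\<^sup>2 + (g x)\<^sup>2 + 2 * (f x * g x))"
    by (intro Bochner_Integration.integrable_add integrable_mult_right l2_mult_integrable l2_integrable_sq assms)
  then show "integrable M (\<lambda>x. (f x + g x)\<^sup>2)" by (simp add: power2_sum mult.assoc)
qed (use assms l2_measurable in measurable)

lemma l2_diff: "f \<in> l2 M \<Longrightarrow> g \<in> l2 M \<Longrightarrow> (\<lambda>x. f x - g x) \<in> l2 M"
  using l2_add[OF _ l2_cmult[of g M "-1"]] by simp

text \<open>The integral of (f + t g)^2 is nonnegative for every t; the case of vanishing g needs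
  its own choice of t.\<close>

lemma l2_cauchy_schwarz:
  assumes f: "f \<in> l2 M" and g: "g \<in> l2 M"
  shows "\<bar>\<integral>x. f x * g x \<partial>M\<bar> \<le> l2_norm M f * l2_norm M g"
proof -
  let ?A = "\<integral>x. (f x)\<^sup>2 \<partial>M" and ?B = "\<integral>x. f x * g x \<partial>M" and ?C = "\<integral>x. (g x)\<^sup>2 \<partial>M"
  have q: "0 \<le> ?A + 2 * t * ?B + t\<^sup>2 * ?C" for t
  proof -
    have "0 \<le> (\<integral>x. (f x + t * g x)\<^sup>2 \<partial>M)" by (intro Bochner_Integration.integral_nonneg) auto
    also have "\<dots> = (\<integral>x. (f x)\<^sup>2 + (2 * t) * (f x * g x) + t\<^sup>2 * (g x)\<^sup>2 \<partial>M)"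
      by (simp add: power2_sum power_mult_distrib ac_simps)
    also have "\<dots> = ?A + 2 * t * ?B + t\<^sup>2 * ?C"
      using l2_mult_integrable[OF f g] l2_integrable_sq[OF f] l2_integrable_sq[OF g] by simp
    finally show ?thesis .
  qed
  have A: "?A \<ge> 0" and C: "?C \<ge> 0" by (auto intro!: Bochner_Integration.integral_nonneg)
  have "?B\<^sup>2 \<le> ?A * ?C"
  proof (cases "?C = 0")
    case True
    have "?B = 0"
    proof (rule ccontr)
      assume B: "?B \<noteq> 0"
      \<comment> \<open>With this t the quadratic expression takes the value -1.\<close>
      define t where "t = - (?A + 1) / (2 * ?B)"
      have "t * ?B = - (?A + 1) / 2" using B by (simp add: t_def)
      moreover have "0 \<le> ?A + 2 * (t * ?B)" using q[of t] True by (simp add: mult.assoc)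
      ultimately show False by simp
    qed
    then show ?thesis using True by simp
  next
    case False
    have "0 \<le> (?A + 2 * (- ?B / ?C) * ?B + (- ?B / ?C)\<^sup>2 * ?C) * ?C"
      by (rule mult_nonneg_nonneg[OF q C])
    also have "\<dots> = ?A * ?C - ?B\<^sup>2"
      using False by (simp add: field_simps power2_eq_square)
    finally show ?thesis by simp
  qed
  then have "\<bar>?B\<bar> \<le> sqrt (?A * ?C)"
    by (metis real_sqrt_abs real_sqrt_le_iff)
  then show ?thesis by (simp add: l2_norm_def real_sqrt_mult)
qed

lemma l2_triangle:
  assumes f: "f \<in> l2 M" and g: "g \<in> l2 M"
  shows "l2_norm M (\<lambda>x. f x + g x) \<le> l2_norm M f + l2_norm M g"
proof (rule power2_le_imp_le)
  have "(l2_norm M (\<lambda>x. f x + g x))\<^sup>2 = (\<integral>x. (f x)\<^sup>2 + (g x)\<^sup>2 + 2 * (f x * g x) \<partial>M)"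
    unfolding l2_norm_sq by (simp add: power2_sum mult.assoc)
  also have "\<dots> = (l2_norm M f)\<^sup>2 + (l2_norm M g)\<^sup>2 + 2 * (\<integral>x. f x * g x \<partial>M)"
    unfolding l2_norm_sq using l2_mult_integrable[OF f g] l2_integrable_sq[OF f] l2_integrable_sq[OF g] by simp
  also have "\<dots> \<le> (l2_norm M f + l2_norm M g)\<^sup>2"
    using l2_cauchy_schwarz[OF f g] by (simp add: power2_sum)
  finally show "(l2_norm M (\<lambda>x. f x + g x))\<^sup>2 \<le> (l2_norm M f + l2_norm M g)\<^sup>2" .
qed simp

lemma l2_norm_minus_commute: "l2_norm M (\<lambda>x. f x - g x) = l2_norm M (\<lambda>x. g x - f x)"
  by (simp add: l2_norm_def power2_commute)

lemma l2_triangle_diff: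
  assumes "f \<in> l2 M" "g \<in> l2 M" "h \<in> l2 M"
  shows "l2_norm M (\<lambda>x. f x - h x) \<le> l2_norm M (\<lambda>x. f x - g x) + l2_norm M (\<lambda>x. g x - h x)"
  using l2_triangle[OF l2_diff[OF assms(1,2)] l2_diff[OF assms(2,3)]] by simp

lemma l2_norm_diff_le:
  assumes "f \<in> l2 M" "g \<in> l2 M"
  shows "\<bar>l2_norm M f - l2_norm M g\<bar> \<le> l2_norm M (\<lambda>x. f x - g x)"
  using l2_triangle[OF l2_diff[OF assms] assms(2)]
    l2_triangle[OF l2_diff[OF assms(2,1)] assms(1)] l2_norm_minus_commute[of M f g] by simp

lemma l2_norm_tendsto:
  assumes "\<And>n. f n \<in> l2 M" "g \<in> l2 M" "(\<lambda>n. l2_norm M (\<lambda>x. f n x - g x)) \<longlonglongrightarrow> 0"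
  shows "(\<lambda>n. l2_norm M (f n)) \<longlonglongrightarrow> l2_norm M g"
proof (rule LIM_zero_cancel, rule tendsto_rabs_zero_cancel, rule tendsto_sandwich[OF _ _ tendsto_const assms(3)])
  show "\<forall>\<^sub>F n in sequentially. \<bar>l2_norm M (f n) - l2_norm M g\<bar> \<le> l2_norm M (\<lambda>x. f n x - g x)"
    by (intro always_eventually allI l2_norm_diff_le assms)
qed simp

lemma l2_inner_tendsto:
  assumes f: "\<And>n. f n \<in> l2 M" "f' \<in> l2 M" "(\<lambda>n. l2_norm M (\<lambda>x. f n x - f' x)) \<longlonglongrightarrow> 0"
    and g: "\<And>n. g n \<in> l2 M" "g' \<in> l2 M" "(\<lambda>n. l2_norm M (\<lambda>x. g n x - g' x)) \<longlonglongrightarrow> 0"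
  shows "(\<lambda>n. \<integral>x. f n x * g n x \<partial>M) \<longlonglongrightarrow> (\<integral>x. f' x * g' x \<partial>M)"
proof (rule LIM_zero_cancel, rule tendsto_rabs_zero_cancel)
  let ?b = "\<lambda>n. l2_norm M (\<lambda>x. f n x - f' x) * l2_norm M (g n) + l2_norm M f' * l2_norm M (\<lambda>x. g n x - g' x)"
  have lim: "?b \<longlonglongrightarrow> 0"
    using tendsto_add[OF tendsto_mult[OF f(3) l2_norm_tendsto[OF g]] tendsto_mult[OF tendsto_const[of "l2_norm M f'"] g(3)]] by simp
  show "(\<lambda>n. \<bar>(\<integral>x. f n x * g n x \<partial>M) - (\<integral>x. f' x * g' x \<partial>M)\<bar>) \<longlonglongrightarrow> 0"
  proof (rule tendsto_sandwich[OF _ _ tendsto_const lim])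
    show "\<forall>\<^sub>F n in sequentially. \<bar>(\<integral>x. f n x * g n x \<partial>M) - (\<integral>x. f' x * g' x \<partial>M)\<bar> \<le> ?b n"
    proof (intro always_eventually allI)
      fix n
      have "(\<integral>x. f n x * g n x \<partial>M) - (\<integral>x. f' x * g' x \<partial>M) = (\<integral>x. f n x * g n x - f' x * g' x \<partial>M)"
        by (intro Bochner_Integration.integral_diff[symmetric] l2_mult_integrable f g)
      also have "\<dots> = (\<integral>x. (f n x - f' x) * g n x + f' x * (g n x - g' x) \<partial>M)"
        by (simp add: algebra_simps)
      also have "\<dots> = (\<integral>x. (f n x - f' x) * g n x \<partial>M) + (\<integral>x. f' x * (g n x - g' x) \<partial>M)"
        by (intro Bochner_Integration.integral_add l2_mult_integrable l2_diff f g)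
      finally show "\<bar>(\<integral>x. f n x * g n x \<partial>M) - (\<integral>x. f' x * g' x \<partial>M)\<bar> \<le> ?b n"
        using l2_cauchy_schwarz[OF l2_diff[OF f(1)[of n] f(2)] g(1)[of n]]
          l2_cauchy_schwarz[OF f(2) l2_diff[OF g(1)[of n] g(2)]] by linarith
    qed
  qed simp
qed

text \<open>Fatou's lemma bounds the integral of g^2 before its integrability is known, so
  membership of g in \<open>l2 M\<close> comes out of the same estimate.\<close>

lemma l2_fatou:
  assumes f: "\<And>n. f n \<in> l2 M" "\<And>n. l2_norm M (f n) \<le> B"
    and [measurable]: "g \<in> borel_measurable M" and lim: "AE x in M. (\<lambda>n. f n x) \<longlonglongrightarrow> g x"
  shows "g \<in> l2 M" "l2_norm M g \<le> B"
proof -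
  have [measurable]: "f n \<in> borel_measurable M" for n using f(1) by (rule l2_measurable)
  have B: "B \<ge> 0" using f(2)[of 0] l2_norm_nonneg[of M "f 0"] by linarith
  have "(\<integral>\<^sup>+x. ennreal ((g x)\<^sup>2) \<partial>M) = (\<integral>\<^sup>+x. liminf (\<lambda>n. ennreal ((f n x)\<^sup>2)) \<partial>M)"
  proof (rule nn_integral_cong_AE)
    show "AE x in M. ennreal ((g x)\<^sup>2) = liminf (\<lambda>n. ennreal ((f n x)\<^sup>2))"
      using lim
    proof eventually_elim
      fix x assume "(\<lambda>n. f n x) \<longlonglongrightarrow> g x"
      then have "(\<lambda>n. ennreal ((f n x)\<^sup>2)) \<longlonglongrightarrow> ennreal ((g x)\<^sup>2)"
        by (intro tendsto_ennrealI tendsto_power)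
      then show "ennreal ((g x)\<^sup>2) = liminf (\<lambda>n. ennreal ((f n x)\<^sup>2))"
        by (intro lim_imp_Liminf[symmetric]) auto
    qed
  qed
  also have "\<dots> \<le> liminf (\<lambda>n. \<integral>\<^sup>+x. ennreal ((f n x)\<^sup>2) \<partial>M)"
    by (rule nn_integral_liminf) measurable
  also have "\<dots> \<le> ennreal (B\<^sup>2)"
  proof (rule Liminf_le)
    show "\<forall>\<^sub>F n in sequentially. (\<integral>\<^sup>+x. ennreal ((f n x)\<^sup>2) \<partial>M) \<le> ennreal (B\<^sup>2)"
    proof (intro always_eventually allI)
      fix n
      have "(\<integral>\<^sup>+x. ennreal ((f n x)\<^sup>2) \<partial>M) = ennreal ((l2_norm M (f n))\<^sup>2)"
        unfolding l2_norm_sq by (rule nn_integral_eq_integral) (use l2_integrable_sq[OF f(1)] in auto)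
      also have "\<dots> \<le> ennreal (B\<^sup>2)" using f(2)[of n] by (intro ennreal_leI power_mono) auto
      finally show "(\<integral>\<^sup>+x. ennreal ((f n x)\<^sup>2) \<partial>M) \<le> ennreal (B\<^sup>2)" .
    qed
  qed simp
  finally have le: "(\<integral>\<^sup>+x. ennreal ((g x)\<^sup>2) \<partial>M) \<le> ennreal (B\<^sup>2)" .
  then have int: "integrable M (\<lambda>x. (g x)\<^sup>2)"
    unfolding integrable_iff_bounded using order_le_less_trans[OF le ennreal_less_top] by simp
  then show "g \<in> l2 M" by (intro l2I) auto
  have "(\<integral>\<^sup>+x. ennreal ((g x)\<^sup>2) \<partial>M) = ennreal ((l2_norm M g)\<^sup>2)"
    unfolding l2_norm_sq by (rule nn_integral_eq_integral) (use int in auto)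
  then have "(l2_norm M g)\<^sup>2 \<le> B\<^sup>2" using le by (simp add: ennreal_le_iff)
  then show "l2_norm M g \<le> B" using B by (rule power2_le_imp_le)
qed

section \<open>Almost everywhere convergence and completeness in L^2\<close>

lemma l2_norm_eq_0:
  assumes "f \<in> l2 M" "l2_norm M f = 0" shows "AE x in M. f x = 0"
proof -
  have "(\<integral>x. (f x)\<^sup>2 \<partial>M) = 0" using assms(2) l2_norm_sq[of M f] by simp
  then have "AE x in M. (f x)\<^sup>2 = 0"
    using integral_nonneg_eq_0_iff_AE[OF l2_integrable_sq[OF assms(1)]] by simp
  then show ?thesis by simp
qed

lemma l2_AE_subseq:
  assumes "\<And>n. f n \<in> l2 M" "g \<in> l2 M" "(\<lambda>n. l2_norm M (\<lambda>x. f n x - g x)) \<longlonglongrightarrow> 0"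
  obtains r :: "nat \<Rightarrow> nat" where "strict_mono r" "AE x in M. (\<lambda>n. f (r n) x) \<longlonglongrightarrow> g x"
proof -
  have "(\<lambda>n. (l2_norm M (\<lambda>x. f n x - g x))\<^sup>2) \<longlonglongrightarrow> 0"
    using tendsto_power[OF assms(3), of 2] by simp
  then have "(\<lambda>n. \<integral>x. norm ((f n x - g x)\<^sup>2) \<partial>M) \<longlonglongrightarrow> 0"
    unfolding l2_norm_sq by simp
  from tendsto_L1_AE_subseq[OF l2_integrable_sq[OF l2_diff[OF assms(1,2)]] this]
  obtain r :: "nat \<Rightarrow> nat" where r: "strict_mono r" "AE x in M. (\<lambda>n. (f (r n) x - g x)\<^sup>2) \<longlonglongrightarrow> 0" by blast
  have "AE x in M. (\<lambda>n. f (r n) x) \<longlonglongrightarrow> g x"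
    using r(2)
  proof eventually_elim
    fix x assume "(\<lambda>n. (f (r n) x - g x)\<^sup>2) \<longlonglongrightarrow> 0"
    then have "(\<lambda>n. sqrt ((f (r n) x - g x)\<^sup>2)) \<longlonglongrightarrow> sqrt 0" by (rule tendsto_real_sqrt)
    then have "(\<lambda>n. \<bar>f (r n) x - g x\<bar>) \<longlonglongrightarrow> 0" by simp
    then show "(\<lambda>n. f (r n) x) \<longlonglongrightarrow> g x" by (rule LIM_zero_cancel[OF tendsto_rabs_zero_cancel])
  qed
  then show ?thesis using that r(1) by blast
qed

lemma summable_imp_convergent_telescope:
  fixes a :: "nat \<Rightarrow> real"
  assumes "summable (\<lambda>k. \<bar>a (Suc k) - a k\<bar>)" shows "convergent a"
proof -
  have "summable (\<lambda>k. a (Suc k) - a k)" using assms by (rule summable_rabs_cancel)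
  then have "convergent (\<lambda>n. \<Sum>k<n. a (Suc k) - a k)" by (simp add: summable_iff_convergent)
  then have "convergent (\<lambda>n. (\<Sum>k<n. a (Suc k) - a k) + a 0)" by (simp add: convergent_add_const_right_iff)
  then show ?thesis by (simp add: sum_lessThan_telescope)
qed

text \<open>Riesz-Fischer. A subsequence with increments below 2^(-k) converges almost everywhere;
  Fatou's lemma then bounds the distance from f n to the limit by the Cauchy tail, which gives
  convergence of the whole sequence.\<close>

lemma l2_complete:
  assumes f: "\<And>n. f n \<in> l2 M"
    and cauchy: "\<And>e. e > 0 \<Longrightarrow> \<exists>N. \<forall>m\<ge>N. \<forall>n\<ge>N. l2_norm M (\<lambda>x. f m x - f n x) < e"
  obtains g where "g \<in> l2 M" "(\<lambda>n. l2_norm M (\<lambda>x. f n x - g x)) \<longlonglongrightarrow> 0"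
proof -
  have [measurable]: "f n \<in> borel_measurable M" for n using f(1) by (rule l2_measurable)
  have "\<exists>N. \<forall>m\<ge>N. \<forall>n\<ge>N. l2_norm M (\<lambda>x. f m x - f n x) < (1/2)^k" for k :: nat
    by (rule cauchy) simp
  then obtain N where N: "\<And>k m n. m \<ge> N k \<Longrightarrow> n \<ge> N k \<Longrightarrow> l2_norm M (\<lambda>x. f m x - f n x) < (1/2)^k" by metis
  \<comment> \<open>Strictly increasing indices with r k \<ge> N k, so that consecutive terms are
    closer than 2^(-k).\<close>
  define r where "r = rec_nat (N 0) (\<lambda>k m. max (Suc m) (N (Suc k)))"
  have r0: "r 0 = N 0" and rS: "r (Suc k) = max (Suc (r k)) (N (Suc k))" for k by (simp_all add: r_def)
  have rN: "N k \<le> r k" for k by (cases k) (simp_all add: r0 rS)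
  have mono: "strict_mono r" unfolding strict_mono_Suc_iff by (simp add: rS less_max_iff_disj)
  define d where "d k x = f (r (Suc k)) x - f (r k) x" for k x
  have dl: "d k \<in> l2 M" for k unfolding d_def by (intro l2_diff f)
  have [measurable]: "d k \<in> borel_measurable M" for k using dl by (rule l2_measurable)
  \<comment> \<open>The rate 4^(-k) leaves room for the weight 2^k in the series below: it stays
    integrable, and its finiteness at x forces |d k x| to decay like 2^(-k/2).\<close>
  have dk: "(l2_norm M (d k))\<^sup>2 \<le> (1/4)^k" for k
  proof -
    have "r k \<le> r (Suc k)" using strict_mono_less_eq[OF mono] by simp
    then have "l2_norm M (d k) < (1/2)^k" unfolding d_def using rN[of k] by (intro N) auto
    then have "(l2_norm M (d k))\<^sup>2 \<le> ((1/2)^k)\<^sup>2" by (intro power_mono) auto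
    also have "((1/2)^k)\<^sup>2 = (1/4 :: real)^k" by (simp add: power2_eq_square power_mult_distrib[symmetric])
    finally show ?thesis .
  qed
  have "(\<integral>\<^sup>+x. (\<Sum>k. ennreal (2^k * (d k x)\<^sup>2)) \<partial>M) = (\<Sum>k. \<integral>\<^sup>+x. ennreal (2^k * (d k x)\<^sup>2) \<partial>M)"
    by (rule nn_integral_suminf) measurable
  also have "\<dots> \<le> (\<Sum>k. ennreal ((1/2)^k))"
  proof (intro suminf_le allI)
    fix k
    have "(\<integral>\<^sup>+x. ennreal (2^k * (d k x)\<^sup>2) \<partial>M) = ennreal (\<integral>x. 2^k * (d k x)\<^sup>2 \<partial>M)"
      by (rule nn_integral_eq_integral) (use l2_integrable_sq[OF dl] in auto)
    also have "(\<integral>x. 2^k * (d k x)\<^sup>2 \<partial>M) = 2^k * (l2_norm M (d k))\<^sup>2" by (simp add: l2_norm_sq)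
    also have "ennreal \<dots> \<le> ennreal (2^k * (1/4)^k)" by (intro ennreal_leI mult_left_mono dk) simp
    also have "2^k * (1/4)^k = (1/2 :: real)^k" by (simp add: power_mult_distrib[symmetric])
    finally show "(\<integral>\<^sup>+x. ennreal (2^k * (d k x)\<^sup>2) \<partial>M) \<le> ennreal ((1/2)^k)" .
  qed auto
  also have "\<dots> < \<infinity>"
    by (subst suminf_ennreal2) (auto intro!: summable_geometric)
  finally have "(\<integral>\<^sup>+x. (\<Sum>k. ennreal (2^k * (d k x)\<^sup>2)) \<partial>M) \<noteq> \<infinity>" by simp
  then have "AE x in M. (\<Sum>k. ennreal (2^k * (d k x)\<^sup>2)) \<noteq> \<infinity>"
    by (rule nn_integral_PInf_AE[rotated]) measurable
  then have conv: "AE x in M. convergent (\<lambda>k. f (r k) x)"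
  proof eventually_elim
    fix x assume fin: "(\<Sum>k. ennreal (2^k * (d k x)\<^sup>2)) \<noteq> \<infinity>"
    define S where "S = enn2real (\<Sum>k. ennreal (2^k * (d k x)\<^sup>2))"
    have "(\<Sum>k. ennreal (2^k * (d k x)\<^sup>2)) < top"
      using fin by (simp only: less_top infinity_ennreal_def)
    then have S: "S \<ge> 0" "(\<Sum>k. ennreal (2^k * (d k x)\<^sup>2)) = ennreal S"
      unfolding S_def by (simp_all only: enn2real_nonneg ennreal_enn2real)
    have dS: "\<bar>d k x\<bar> \<le> sqrt S * (sqrt (1/2))^k" for k
    proof -
      have "ennreal (2^k * (d k x)\<^sup>2) \<le> ennreal S"
        using sum_le_suminf[of "\<lambda>k. ennreal (2^k * (d k x)\<^sup>2)" "{k}"] S(2) by simp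
      then have "2^k * (d k x)\<^sup>2 \<le> S" using S(1) by (simp add: ennreal_le_iff)
      then have "(d k x)\<^sup>2 \<le> S * (1/2)^k" by (simp add: field_simps power_one_over)
      then have "sqrt ((d k x)\<^sup>2) \<le> sqrt (S * (1/2)^k)" by (rule real_sqrt_le_mono)
      moreover have "sqrt (S * (1/2)^k) = sqrt S * (sqrt (1/2))^k"
        by (simp only: real_sqrt_mult real_sqrt_power)
      ultimately show ?thesis by (simp only: real_sqrt_abs)
    qed
    have "summable (\<lambda>k. sqrt S * (sqrt (1/2))^k)"
      by (intro summable_mult summable_geometric) (simp add: real_sqrt_divide)
    then have "summable (\<lambda>k. \<bar>d k x\<bar>)"
      by (rule summable_comparison_test'[where N=0]) (use dS in simp)
    then show "convergent (\<lambda>k. f (r k) x)"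
      unfolding d_def by (rule summable_imp_convergent_telescope)
  qed
  define g where "g x = lim (\<lambda>k. f (r k) x)" for x
  have [measurable]: "g \<in> borel_measurable M" unfolding g_def[abs_def] by (rule borel_measurable_lim_metric) measurable
  have lim: "AE x in M. (\<lambda>k. f (r k) x) \<longlonglongrightarrow> g x"
    using conv by eventually_elim (simp add: g_def convergent_LIMSEQ_iff)
  have main: "(\<lambda>x. f n x - g x) \<in> l2 M \<and> l2_norm M (\<lambda>x. f n x - g x) \<le> (1/2)^k" if "n \<ge> N k" for n k
  proof -
    let ?h = "\<lambda>j x. f n x - f (r (j + k)) x"
    have "r (j + k) \<ge> N k" for j
      using rN[of k] strict_mono_less_eq[OF mono, of k "j + k"] by simp
    then have "l2_norm M (?h j) \<le> (1/2)^k" for j using N[OF that, of "r (j + k)"] by (simp add: less_imp_le)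
    moreover have "?h j \<in> l2 M" for j by (intro l2_diff f)
    moreover have "AE x in M. (\<lambda>j. ?h j x) \<longlonglongrightarrow> f n x - g x"
      using lim by eventually_elim (auto intro!: tendsto_diff LIMSEQ_ignore_initial_segment[of "\<lambda>k. f (r k) _"])
    ultimately show ?thesis
      using l2_fatou[of ?h M "(1/2)^k" "\<lambda>x. f n x - g x"] by simp
  qed
  have "g \<in> l2 M"
    using l2_diff[OF f[of "N 0"] conjunct1[OF main[of 0 "N 0"]]] by simp
  moreover have "(\<lambda>n. l2_norm M (\<lambda>x. f n x - g x)) \<longlonglongrightarrow> 0"
  proof (rule LIMSEQ_I)
    fix e :: real assume "e > 0"
    then obtain k where k: "(1/2)^k < e" using real_arch_pow_inv[of e "1/2"] by auto
    have "norm (l2_norm M (\<lambda>x. f n x - g x) - 0) < e" if "n \<ge> N k" for n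
      using main[OF that] k by simp
    then show "\<exists>no. \<forall>n\<ge>no. norm (l2_norm M (\<lambda>x. f n x - g x) - 0) < e" by blast
  qed
  ultimately show ?thesis using that by blast
qed

section \<open>Density of test functions\<close>

lemma smooth_ident: "smooth (\<lambda>x::real^'n::finite. x)"
proof (rule smooth_coinduct[where S="insert (\<lambda>x. x) (range (\<lambda>c x. c))"])
  have "partial_deriv i (\<lambda>x::real^'n. x) = (\<lambda>x. axis i 1)" for i
    by (rule ext, rule partial_deriv_eq[OF has_derivative_ident])
  then show "partial_deriv i g \<in> plus_closure (insert (\<lambda>x. x) (range (\<lambda>c x. c)))"
    if "g \<in> insert (\<lambda>x. x) (range (\<lambda>c x. c))" for i and g :: "real^'n \<Rightarrow> real^'n"
    using that by (auto simp: partial_deriv_const intro!: plus_closure.base)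
qed auto

lemma smooth_real_polynomial_function:
  fixes p :: "real^'n::finite \<Rightarrow> real"
  assumes "real_polynomial_function p" shows "smooth p"
  using assms
proof induction
  case (linear f)
  then show ?case using smooth_bounded_linear[OF linear smooth_ident] by simp
qed (auto intro: smooth_add smooth_mult)

lemma bump_le_1: "bump c r x \<le> 1"
  by (simp add: bump_def flat_exp_def)

text \<open>A positive continuous function has a positive minimum on a compact ball; for negative R
  there is no point to bound.\<close>

lemma bump_lower_bound:
  assumes "R < r" obtains \<beta> where "\<beta> > 0" "\<And>x::real^'n::finite. norm x \<le> R \<Longrightarrow> bump 0 r x \<ge> \<beta>"
proof (cases "R \<ge> 0")
  case True
  have "cball (0::real^'n) R \<noteq> {}" using True by simp
  from continuous_attains_inf[OF compact_cball this smooth_continuous_on[OF smooth_bump[of 0 r]]]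
  obtain y :: "real^'n" where y: "y \<in> cball 0 R" "\<forall>x\<in>cball (0::real^'n) R. bump 0 r y \<le> bump 0 r x"
    by blast
  show ?thesis
    by (rule that[of "bump 0 r y"]) (use y assms in \<open>auto intro!: bump_pos\<close>)
next
  case False
  then show ?thesis by (intro that[of 1]) (auto, smt (verit) norm_ge_zero)
qed

text \<open>Divide by a bump that is positive where h lives, approximate the quotient by a
  polynomial (Stone-Weierstrass) and multiply back: a polynomial times a bump is a test
  function.\<close>

lemma continuous_approx_test_function:
  fixes h :: "real^'n::finite \<Rightarrow> real"
  assumes h: "continuous_on UNIV h" "\<And>x. norm x > R \<Longrightarrow> h x = 0" and e: "e > 0" and R: "R \<ge> 0"
  obtains \<psi> where "\<psi> \<in> test_functions UNIV" "\<And>x. \<bar>\<psi> x - h x\<bar> \<le> e" "\<And>x. norm x > R + 1 \<Longrightarrow> \<psi> x = 0"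
proof -
  let ?b = "bump (0::real^'n) (R + 1)"
  obtain \<beta> where b: "\<beta> > 0" "\<And>x::real^'n. norm x \<le> R \<Longrightarrow> ?b x \<ge> \<beta>"
    using bump_lower_bound[of R "R + 1"] by auto
  \<comment> \<open>The maximum changes nothing on the ball of radius R, where the bump is at least
    \<beta>, and keeps the denominator away from 0 elsewhere, where h vanishes.\<close>
  define q where "q x = h x / max (?b x) \<beta>" for x
  have "continuous_on UNIV q"
    unfolding q_def using b(1) by (intro continuous_intros h smooth_continuous_on[OF smooth_bump]) (auto simp: max_def)
  then have "continuous_on (cball 0 (R + 1)) q" using continuous_on_subset by blast
  then obtain p where p: "real_polynomial_function p" "\<And>x. x \<in> cball 0 (R + 1) \<Longrightarrow> \<bar>q x - p x\<bar> < e"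
    using Stone_Weierstrass_real_polynomial_function[of "cball 0 (R + 1)" q e] e by auto
  have hq: "h x = ?b x * q x" for x
  proof (cases "norm x \<le> R")
    case True
    then have "max (?b x) \<beta> = ?b x" "?b x > 0" using b(1) b(2)[of x] by auto
    then show ?thesis by (simp add: q_def)
  qed (simp add: q_def h(2))
  have "?b \<in> test_functions UNIV" by (rule bump_test_function) (use R in auto)
  then have "(\<lambda>x. p x * ?b x) \<in> test_functions UNIV"
    by (rule test_functions_mult[OF _ smooth_real_polynomial_function[OF p(1)]])
  moreover have b0: "?b x = 0" if "norm x > R + 1" for x using that R by (intro bump_eq_0) auto
  moreover have "\<bar>p x * ?b x - h x\<bar> \<le> e" for x
  proof (cases "norm x > R + 1")
    case True then show ?thesis using b0[OF True] h(2)[of x] e by simp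
  next
    case False
    have "\<bar>p x * ?b x - h x\<bar> = ?b x * \<bar>q x - p x\<bar>"
    proof -
      have "p x * ?b x - h x = ?b x * - (q x - p x)" unfolding hq by (simp add: algebra_simps)
      then show ?thesis by (simp only: abs_mult abs_minus_cancel) (simp add: bump_nonneg)
    qed
    also have "\<dots> \<le> 1 * e"
      using p(2)[of x] False by (intro mult_mono bump_le_1) (auto simp: dist_norm)
    finally show ?thesis by simp
  qed
  ultimately show ?thesis using that[of "\<lambda>x. p x * ?b x"] by simp
qed

text \<open>Lebesgue measurability supplies continuous functions converging almost everywhere. They
  are clipped to [-N, N] and cut off, which enlarges the radius by 1; replacing them by test
  functions enlarges the radius by 1 more and the bound by at most 1.\<close>

lemma bounded_approx_test_functions:
  fixes u :: "real^'n::finite \<Rightarrow> real"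
  assumes [measurable]: "u \<in> borel_measurable borel" and N: "\<And>x. \<bar>u x\<bar> \<le> N"
    and R: "R \<ge> 0" "\<And>x. norm x > R \<Longrightarrow> u x = 0"
  obtains \<psi> where "\<And>k. \<psi> k \<in> test_functions UNIV" "\<And>k x. \<bar>\<psi> k x\<bar> \<le> (N + 1) * indicator (cball 0 (R + 2)) x"
    "AE x in lborel. (\<lambda>k. \<psi> k x) \<longlonglongrightarrow> u x"
proof -
  have N0: "N \<ge> 0" using N[of 0] by linarith
  have "u measurable_on UNIV"
    by (rule lebesgue_measurable_imp_measurable_on) (auto intro!: measurable_completion)
  then obtain Z g where Z: "negligible Z" and g: "\<And>n. continuous_on UNIV (g n)"
    and lim: "\<And>x. x \<notin> Z \<Longrightarrow> (\<lambda>n. g n x) \<longlonglongrightarrow> u x"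
    unfolding measurable_on_def by auto
  define h where "h n x = max 0 (min 1 (R + 1 - norm x)) * max (- N) (min N (g n x))" for n and x :: "real^'n"
  have hc: "continuous_on UNIV (h n)" for n
    unfolding h_def by (intro continuous_intros g)
  have h0: "h n x = 0" if "norm x > R + 1" for n x using that by (simp add: h_def)
  have hN: "\<bar>h n x\<bar> \<le> N" for n x
  proof -
    have "\<bar>h n x\<bar> \<le> 1 * N" unfolding h_def abs_mult by (rule mult_mono) (use N0 in auto)
    then show ?thesis by simp
  qed
  have hlim: "(\<lambda>n. h n x) \<longlonglongrightarrow> u x" if "x \<notin> Z" for x
  proof -
    have "(\<lambda>n. h n x) \<longlonglongrightarrow> max 0 (min 1 (R + 1 - norm x)) * max (- N) (min N (u x))"
      unfolding h_def by (intro tendsto_intros lim that)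
    also have "max (- N) (min N (u x)) = u x" using N[of x] by auto
    also have "max 0 (min 1 (R + 1 - norm x)) * u x = u x" using R(2)[of x] by (cases "norm x > R") auto
    finally show ?thesis .
  qed
  have "\<exists>\<psi>. \<psi> \<in> test_functions UNIV \<and> (\<forall>x. \<bar>\<psi> x - h n x\<bar> \<le> 1 / (real n + 1)) \<and> (\<forall>x. norm x > R + 2 \<longrightarrow> \<psi> x = 0)" for n
    using continuous_approx_test_function[OF hc[of n] h0, of "R + 1" "1 / (real n + 1)"] R(1)
    by (smt (verit) divide_pos_pos of_nat_0_le_iff)
  then obtain \<psi> where \<psi>: "\<And>n. \<psi> n \<in> test_functions UNIV" "\<And>n x. \<bar>\<psi> n x - h n x\<bar> \<le> 1 / (real n + 1)"
    "\<And>n x. norm x > R + 2 \<Longrightarrow> \<psi> n x = 0" by metis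
  have "\<bar>\<psi> k x\<bar> \<le> (N + 1) * indicator (cball 0 (R + 2)) x" for k x
  proof (cases "norm x > R + 2")
    case False
    have "1 / (real k + 1) \<le> 1" by simp
    then have "\<bar>\<psi> k x\<bar> \<le> N + 1" using \<psi>(2)[of k x] hN[of k x] by linarith
    then show ?thesis using False by simp
  qed (simp add: \<psi>(3))
  moreover have "AE x in lborel. (\<lambda>k. \<psi> k x) \<longlonglongrightarrow> u x"
  proof -
    have "(\<lambda>k. \<psi> k x) \<longlonglongrightarrow> u x" if "x \<notin> Z" for x
    proof -
      have "(\<lambda>k. \<psi> k x - h k x) \<longlonglongrightarrow> 0"
      proof (rule Lim_null_comparison)
        show "(\<lambda>k. 1 / (real k + 1)) \<longlonglongrightarrow> 0"
          using LIMSEQ_inverse_real_of_nat by (simp add: inverse_eq_divide add.commute)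
      qed (use \<psi>(2) in auto)
      from tendsto_add[OF this hlim[OF that]] show ?thesis by simp
    qed
    moreover have "AE x in lebesgue. x \<notin> Z"
      using Z by (simp add: negligible_iff_null_sets AE_not_in)
    ultimately have "AE x in lebesgue. (\<lambda>k. \<psi> k x) \<longlonglongrightarrow> u x" by (auto elim: eventually_mono)
    then show ?thesis by (simp add: AE_completion_iff)
  qed
  ultimately show ?thesis using that[of \<psi>] \<psi>(1) by blast
qed

text \<open>v is known to be integrable only against test functions. A bump that is bounded below on
  the ball of radius R turns |v| times this bump into the majorant for dominated
  convergence.\<close>

lemma integral_tendsto_bounded_support:
  fixes v :: "real^'n::finite \<Rightarrow> real"
  assumes [measurable]: "v \<in> borel_measurable borel" "u \<in> borel_measurable borel" "\<And>k. \<psi> k \<in> borel_measurable borel"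
    and v: "\<And>\<phi>. \<phi> \<in> test_functions UNIV \<Longrightarrow> integrable lborel (\<lambda>x. v x * \<phi> x)"
    and bd: "\<And>k x. \<bar>\<psi> k x\<bar> \<le> C * indicator (cball 0 R) x" and lim: "AE x in lborel. (\<lambda>k. \<psi> k x) \<longlonglongrightarrow> u x"
  shows "(\<lambda>k. \<integral>x. v x * \<psi> k x \<partial>lborel) \<longlonglongrightarrow> (\<integral>x. v x * u x \<partial>lborel)"
    and "integrable lborel (\<lambda>x. v x * u x)"
proof -
  let ?b = "bump (0::real^'n) (\<bar>R\<bar> + 1)"
  have "R < \<bar>R\<bar> + 1" by linarith
  then obtain \<beta> where b: "\<beta> > 0" "\<And>x::real^'n. norm x \<le> R \<Longrightarrow> ?b x \<ge> \<beta>"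
    by (rule bump_lower_bound) blast
  have "?b \<in> test_functions UNIV" by (rule bump_test_function) auto
  then have w: "integrable lborel (\<lambda>x. \<bar>C\<bar> / \<beta> * \<bar>v x * ?b x\<bar>)"
    by (intro integrable_mult_right integrable_abs v)
  have le: "norm (v x * \<psi> k x) \<le> \<bar>C\<bar> / \<beta> * \<bar>v x * ?b x\<bar>" for k x
  proof (cases "norm x \<le> R")
    case True
    then have "\<bar>\<psi> k x\<bar> \<le> \<bar>C\<bar>" using bd[of k x] by simp
    then have "\<bar>v x\<bar> * \<bar>\<psi> k x\<bar> \<le> \<bar>v x\<bar> * (\<bar>C\<bar> * (?b x / \<beta>))"
      using b True by (intro mult_left_mono order_trans[OF _ mult_left_mono[of 1 "?b x / \<beta>" "\<bar>C\<bar>"]]) auto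
    then show ?thesis using b(1) by (simp add: abs_mult bump_nonneg ac_simps)
  next
    case False
    then have "\<psi> k x = 0" using bd[of k x] by simp
    then show ?thesis using b(1) by (simp add: divide_nonneg_pos)
  qed
  have lim': "AE x in lborel. (\<lambda>k. v x * \<psi> k x) \<longlonglongrightarrow> v x * u x"
    using lim by eventually_elim (intro tendsto_mult tendsto_const)
  show "(\<lambda>k. \<integral>x. v x * \<psi> k x \<partial>lborel) \<longlonglongrightarrow> (\<integral>x. v x * u x \<partial>lborel)"
    by (rule integral_dominated_convergence[OF _ _ w lim']) (use le in auto)
  show "integrable lborel (\<lambda>x. v x * u x)"
    by (rule integrable_dominated_convergence[OF _ _ w lim']) (use le in auto)
qed

section \<open>Functions determined by their pairings with test functions\<close>

lemma test_function_measurable: "\<phi> \<in> test_functions U \<Longrightarrow> \<phi> \<in> borel_measurable borel"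
  by (intro smooth_borel_measurable test_functionsD)

text \<open>By bounded approximation the vanishing extends from test functions to the sign of v cut
  off to a ball, and this pairing is the integral of |v| over the ball.\<close>

lemma fundamental_lemma:
  fixes v :: "real^'n::finite \<Rightarrow> real"
  assumes [measurable]: "v \<in> borel_measurable borel"
    and v: "\<And>\<phi>. \<phi> \<in> test_functions UNIV \<Longrightarrow> integrable lborel (\<lambda>x. v x * \<phi> x)"
    and zero: "\<And>\<phi>. \<phi> \<in> test_functions UNIV \<Longrightarrow> (\<integral>x. v x * \<phi> x \<partial>lborel) = 0"
  shows "AE x in lborel. v x = 0"
proof -
  have "AE x in lborel. norm x \<le> real N \<longrightarrow> v x = 0" for N :: nat
  proof -
    define u where "u x = sgn (v x) * indicator {x. norm x \<le> real N} x" for x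
    have [measurable]: "u \<in> borel_measurable borel" unfolding u_def by measurable
    obtain \<psi> where \<psi>: "\<And>k. \<psi> k \<in> test_functions UNIV" "\<And>k x. \<bar>\<psi> k x\<bar> \<le> (1 + 1) * indicator (cball 0 (real N + 2)) x"
      "AE x in lborel. (\<lambda>k. \<psi> k x) \<longlonglongrightarrow> u x"
      by (rule bounded_approx_test_functions[of u 1 "real N"]) (auto simp: u_def abs_mult sgn_if indicator_def)
    note l = integral_tendsto_bounded_support[OF assms(1) _ _ v \<psi>(2,3)]
    have "(\<lambda>k. \<integral>x. v x * \<psi> k x \<partial>lborel) \<longlonglongrightarrow> (\<integral>x. v x * u x \<partial>lborel)"
      by (rule l) (auto intro: test_function_measurable[OF \<psi>(1)])
    then have z: "(\<integral>x. v x * u x \<partial>lborel) = 0" using zero[OF \<psi>(1)] by (simp add: LIMSEQ_const_iff)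
    have i: "integrable lborel (\<lambda>x. v x * u x)"
      by (rule l) (auto intro: test_function_measurable[OF \<psi>(1)])
    have nn: "v x * u x \<ge> 0" for x by (auto simp: u_def sgn_if indicator_def)
    have "AE x in lborel. v x * u x = 0"
      using integral_nonneg_eq_0_iff_AE[OF i] nn z by simp
    then show ?thesis by eventually_elim (auto simp: u_def sgn_if indicator_def split: if_splits)
  qed
  then have "AE x in lborel. \<forall>N::nat. norm x \<le> real N \<longrightarrow> v x = 0"
    unfolding AE_all_countable by blast
  then show ?thesis by eventually_elim (use real_arch_simple in blast)
qed

text \<open>Converse of the Cauchy-Schwarz inequality. Testing v against its own truncation u N
  bounds the norm of u N by B, and Fatou's lemma removes the truncation.\<close>

lemma l2_of_dual_bound:
  fixes v :: "real^'n::finite \<Rightarrow> real"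
  assumes [measurable]: "v \<in> borel_measurable borel" and B: "B \<ge> 0"
    and v: "\<And>\<phi>. \<phi> \<in> test_functions UNIV \<Longrightarrow> integrable lborel (\<lambda>x. v x * \<phi> x)"
    and bd: "\<And>\<phi>. \<phi> \<in> test_functions UNIV \<Longrightarrow> \<bar>\<integral>x. v x * \<phi> x \<partial>lborel\<bar> \<le> B * l2_norm lborel \<phi>"
  shows "v \<in> l2 lborel" "l2_norm lborel v \<le> B"
proof -
  define u where "u N x = v x * indicator {x. norm x \<le> real N \<and> \<bar>v x\<bar> \<le> real N} x" for N :: nat and x
  have [measurable]: "u N \<in> borel_measurable borel" for N unfolding u_def by measurable
  have main: "u N \<in> l2 lborel \<and> l2_norm lborel (u N) \<le> B" for N
  proof -
    obtain \<psi> where \<psi>: "\<And>k. \<psi> k \<in> test_functions UNIV"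
      "\<And>k x. \<bar>\<psi> k x\<bar> \<le> (real N + 1) * indicator (cball 0 (real N + 2)) x"
      "AE x in lborel. (\<lambda>k. \<psi> k x) \<longlonglongrightarrow> u N x"
      by (rule bounded_approx_test_functions[of "u N" "real N" "real N"]) (auto simp: u_def indicator_def)
    have [measurable]: "\<psi> k \<in> borel_measurable borel" for k by (rule test_function_measurable[OF \<psi>(1)])
    note l = integral_tendsto_bounded_support[OF assms(1) _ _ v \<psi>(2,3)]
    have 1: "(\<lambda>k. \<integral>x. v x * \<psi> k x \<partial>lborel) \<longlonglongrightarrow> (\<integral>x. v x * u N x \<partial>lborel)"
      by (rule l) auto
    have sq: "v x * u N x = (u N x)\<^sup>2" for x by (simp add: u_def indicator_def power2_eq_square)
    have "integrable lborel (\<lambda>x. v x * u N x)" by (rule l) auto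
    then have uN: "u N \<in> l2 lborel" unfolding sq by (intro l2I) auto
    have w: "integrable lborel (\<lambda>x::real^'n. (real N + 1)\<^sup>2 * indicator (cball 0 (real N + 2)) x)"
      by (intro integrable_mult_right integrable_real_indicator) (auto simp: emeasure_lborel_cball_finite[unfolded infinity_ennreal_def])
    have 2: "(\<lambda>k. \<integral>x. (\<psi> k x)\<^sup>2 \<partial>lborel) \<longlonglongrightarrow> (\<integral>x. (u N x)\<^sup>2 \<partial>lborel)"
    proof (rule integral_dominated_convergence[OF _ _ w])
      show "AE x in lborel. (\<lambda>k. (\<psi> k x)\<^sup>2) \<longlonglongrightarrow> (u N x)\<^sup>2"
        using \<psi>(3) by eventually_elim (intro tendsto_power)
      show "AE x in lborel. norm ((\<psi> k x)\<^sup>2) \<le> (real N + 1)\<^sup>2 * indicator (cball 0 (real N + 2)) x" for k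
      proof (rule AE_I2)
        fix x :: "real^'n"
        have "\<bar>\<psi> k x\<bar>\<^sup>2 \<le> ((real N + 1) * indicator (cball 0 (real N + 2)) x)\<^sup>2"
          by (rule power_mono[OF \<psi>(2)]) simp
        then show "norm ((\<psi> k x)\<^sup>2) \<le> (real N + 1)\<^sup>2 * indicator (cball 0 (real N + 2)) x"
          by (cases "norm x \<le> real N + 2") auto
      qed
    qed auto
    then have 3: "(\<lambda>k. B * l2_norm lborel (\<psi> k)) \<longlonglongrightarrow> B * l2_norm lborel (u N)"
      unfolding l2_norm_def by (intro tendsto_mult tendsto_const tendsto_real_sqrt)
    have "(\<integral>x. v x * u N x \<partial>lborel) \<le> B * l2_norm lborel (u N)"
      by (rule LIMSEQ_le[OF 1 3]) (use bd[OF \<psi>(1)] in \<open>auto intro!: exI[of _ 0] simp: abs_le_iff\<close>)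
    then have "(l2_norm lborel (u N))\<^sup>2 \<le> B * l2_norm lborel (u N)"
      unfolding sq l2_norm_sq .
    then have "l2_norm lborel (u N) \<le> B"
      using B l2_norm_nonneg[of lborel "u N"] by (cases "l2_norm lborel (u N) = 0") (auto simp: power2_eq_square)
    then show ?thesis using uN by blast
  qed
  have lim: "(\<lambda>N. u N x) \<longlonglongrightarrow> v x" for x
  proof -
    obtain M :: nat where M: "norm x + \<bar>v x\<bar> \<le> real M" using real_arch_simple by blast
    have "\<forall>\<^sub>F N in sequentially. v x = u N x"
      using eventually_ge_at_top[of M]
    proof eventually_elim
      case (elim N)
      have "norm x \<le> real N" "\<bar>v x\<bar> \<le> real N"
        using M elim norm_ge_zero[of x] abs_ge_zero[of "v x"] by linarith+
      then show ?case by (simp add: u_def)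
    qed
    then show ?thesis by (rule Lim_transform_eventually[OF tendsto_const])
  qed
  show "v \<in> l2 lborel" "l2_norm lborel v \<le> B"
    using l2_fatou[of u lborel B v] main lim by auto
qed

section \<open>The spaces $H^s$\<close>

text \<open>The transpose of <D>^s: \<open>bessel_op s T\<close> evaluates T at this function.
  Transform and inverse transform stand in reverse order because both act on T by duality.\<close>

definition bessel_fun :: "real \<Rightarrow> (real^'n::finite \<Rightarrow> complex) \<Rightarrow> real^'n \<Rightarrow> complex" where
  "bessel_fun s \<phi> = fourier (\<lambda>\<xi>. complex_of_real ((1 + (norm \<xi>)\<^sup>2) powr (s / 2)) * inverse_fourier \<phi> \<xi>)"

lemma bessel_op_eq: "bessel_op s T \<phi> = T (bessel_fun s \<phi>)"
  by (simp add: bessel_op_def inverse_fourier_dist_def mult_dist_def fourier_dist_def bessel_fun_def)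

lemma schwartz_bessel_fun: "\<phi> \<in> schwartz \<Longrightarrow> bessel_fun s \<phi> \<in> schwartz"
  unfolding bessel_fun_def by (intro schwartz_fourier schwartz_mult_bessel_weight schwartz_inverse_fourier)

lemma bessel_fun_inverse:
  assumes "\<phi> \<in> schwartz" shows "bessel_fun s (bessel_fun (- s) \<phi>) = \<phi>"
proof -
  have h: "(\<lambda>\<xi>. complex_of_real ((1 + (norm \<xi>)\<^sup>2) powr (- s / 2)) * inverse_fourier \<phi> \<xi>) \<in> schwartz"
    by (intro schwartz_mult_bessel_weight schwartz_inverse_fourier assms)
  have w: "complex_of_real ((1 + (norm \<xi>)\<^sup>2) powr (s / 2)) * (complex_of_real ((1 + (norm \<xi>)\<^sup>2) powr (- s / 2)) * z) = z"
    for \<xi> :: "real^'a" and z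
  proof -
    have "(1 + (norm \<xi>)\<^sup>2) powr (s / 2) * (1 + (norm \<xi>)\<^sup>2) powr (- s / 2) = (1 + (norm \<xi>)\<^sup>2) powr 0"
      unfolding powr_add[symmetric] by simp
    also have "\<dots> = 1" using less_imp_neq[OF one_plus_norm_sq_pos[of \<xi>]] by simp
    finally show ?thesis by (simp add: mult.assoc[symmetric] flip: of_real_mult)
  qed
  show ?thesis
    unfolding bessel_fun_def inverse_fourier_fourier[OF h] w
    by (rule fourier_inverse_fourier[OF assms])
qed

text \<open>The multiplier has exponent -s/2 \<le> 0 and base at least 1, so it is at most 1;
  Plancherel turns this into a bound of L^2 norms.\<close>

lemma bessel_fun_l2_le:
  fixes \<phi> :: "real^'n::finite \<Rightarrow> complex"
  assumes \<phi>: "\<phi> \<in> schwartz" and s: "s \<ge> 0"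
  shows "(\<integral>x. (cmod (bessel_fun (- s) \<phi> x))\<^sup>2 \<partial>lborel) \<le> (\<integral>x. (cmod (\<phi> x))\<^sup>2 \<partial>lborel)"
proof -
  let ?h = "\<lambda>\<xi>. complex_of_real ((1 + (norm \<xi>)\<^sup>2) powr (- s / 2)) * inverse_fourier \<phi> \<xi>"
  have i: "inverse_fourier \<phi> \<in> schwartz" by (rule schwartz_inverse_fourier[OF \<phi>])
  have h: "?h \<in> schwartz" by (intro schwartz_mult_bessel_weight i)
  have "(\<integral>x. (cmod (?h x))\<^sup>2 \<partial>lborel) \<le> (\<integral>x. (cmod (inverse_fourier \<phi> x))\<^sup>2 \<partial>lborel)"
  proof (rule integral_mono[OF schwartz_square_integrable[OF h] schwartz_square_integrable[OF i]])
    fix x :: "real^'n"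
    have "(1 + (norm x)\<^sup>2) powr (- s / 2) \<le> (1 + (norm x)\<^sup>2) powr 0"
      using s by (intro powr_mono) auto
    then have "(1 + (norm x)\<^sup>2) powr (- s / 2) \<le> 1" using less_imp_neq[OF one_plus_norm_sq_pos[of x]] by simp
    then show "(cmod (?h x))\<^sup>2 \<le> (cmod (inverse_fourier \<phi> x))\<^sup>2"
      by (intro power_mono) (auto simp: norm_mult mult_left_le_one_le)
  qed
  from mult_left_mono[OF this, of "(2 * pi) ^ CARD('n)"]
  show ?thesis
    using plancherel[OF h] plancherel[OF i] unfolding bessel_fun_def fourier_inverse_fourier[OF \<phi>]
    by simp
qed

section \<open>Square integrable functions as tempered distributions\<close>

lemma Lp_2_UNIV: "Lp (ereal 2) UNIV = l2 lborel"
  by (auto simp: Lp_def l2_def set_borel_measurable_def set_integrable_def powr_numeral)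

lemma Lp_norm_2: "Lp_norm 2 g = l2_norm lborel g"
  by (simp add: Lp_norm_def l2_norm_def powr_half_sqrt)

lemma l2_cmod_schwartz:
  fixes \<phi> :: "real^'n::finite \<Rightarrow> complex"
  assumes "\<phi> \<in> schwartz" shows "(\<lambda>x. cmod (\<phi> x)) \<in> l2 lborel"
  using schwartz_measurable[OF assms] schwartz_square_integrable[OF assms] by (intro l2I) auto

lemma function_dist_bound:
  fixes \<phi> :: "real^'n::finite \<Rightarrow> complex"
  assumes u: "u \<in> l2 lborel" and \<phi>: "\<phi> \<in> schwartz"
  shows "integrable lborel (\<lambda>x. complex_of_real (u x) * \<phi> x)"
    and "cmod (function_dist u \<phi>) \<le> l2_norm lborel u * l2_norm lborel (\<lambda>x. cmod (\<phi> x))"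
proof -
  have [measurable]: "u \<in> borel_measurable borel" "\<phi> \<in> borel_measurable borel"
    using l2_measurable[OF u] schwartz_measurable[OF \<phi>] by auto
  have i: "integrable lborel (\<lambda>x. \<bar>u x\<bar> * cmod (\<phi> x))"
    by (intro l2_mult_integrable l2_abs u l2_cmod_schwartz \<phi>)
  show "integrable lborel (\<lambda>x. complex_of_real (u x) * \<phi> x)"
    by (rule Bochner_Integration.integrable_bound[OF i]) (auto simp: norm_mult)
  have "cmod (function_dist u \<phi>) \<le> (\<integral>x. norm (complex_of_real (u x) * \<phi> x) \<partial>lborel)"
    unfolding function_dist_def by (rule integral_norm_bound)
  also have "\<dots> = (\<integral>x. \<bar>u x\<bar> * cmod (\<phi> x) \<partial>lborel)" by (simp add: norm_mult)
  also have "\<dots> \<le> l2_norm lborel u * l2_norm lborel (\<lambda>x. cmod (\<phi> x))"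
    using l2_cauchy_schwarz[OF l2_abs[OF u] l2_cmod_schwartz[OF \<phi>]] by simp
  finally show "cmod (function_dist u \<phi>) \<le> l2_norm lborel u * l2_norm lborel (\<lambda>x. cmod (\<phi> x))" .
qed

text \<open>The seminorm of order 2n controls \<phi> by a square integrable weight. This is the
  continuity estimate that makes L^2 functions tempered.\<close>

lemma l2_norm_le_seminorm:
  fixes \<phi> :: "real^'n::finite \<Rightarrow> complex"
  assumes \<phi>: "\<phi> \<in> schwartz"
  shows "l2_norm lborel (\<lambda>x. cmod (\<phi> x)) \<le>
    l2_norm lborel (\<lambda>x::real^'n. inverse ((1 + norm x) ^ (2 * CARD('n)))) * schwartz_seminorm (2 * CARD('n)) \<phi>"
proof -
  let ?N = "2 * CARD('n)" and ?w = "\<lambda>x::real^'n. inverse ((1 + norm x) ^ (2 * CARD('n)))"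
  have bdd: "bdd_above (range (\<lambda>x. (1 + norm x) ^ ?N * cmod (partial_derivs \<alpha> \<phi> x)))" for \<alpha>
    using schwartz_bound[OF schwartz_partial_derivs[OF \<phi>], of ?N \<alpha>] by (auto simp: bdd_above_def)
  have "(SUP x. (1 + norm x) ^ ?N * cmod (partial_derivs [] \<phi> x)) \<le> schwartz_seminorm ?N \<phi>"
    unfolding schwartz_seminorm_def
  proof (rule member_le_sum)
    show "finite {\<alpha> :: 'n list. length \<alpha> \<le> ?N}" using finite_lists_length_le[of "UNIV :: 'n set"] by simp
    show "0 \<le> (SUP x. (1 + norm x) ^ ?N * cmod (partial_derivs \<alpha> \<phi> x))" for \<alpha>
      by (rule order_trans[OF _ cSUP_upper[OF _ bdd, of 0]]) auto
  qed simp
  then have le: "(1 + norm x) ^ ?N * cmod (\<phi> x) \<le> schwartz_seminorm ?N \<phi>" for x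
    using cSUP_upper[OF UNIV_I bdd, of x "[]"] by simp
  have le': "cmod (\<phi> x) \<le> schwartz_seminorm ?N \<phi> * ?w x" for x
    using le[of x] by (simp add: divide_inverse[symmetric] pos_le_divide_eq add_pos_nonneg mult.commute)
  have w1: "?w x \<le> 1" "?w x \<ge> 0" for x by (auto simp: inverse_le_1_iff)
  have "integrable lborel (\<lambda>x. (?w x)\<^sup>2)"
    by (rule Bochner_Integration.integrable_bound[OF integrable_rapid_weight])
      (use w1 in \<open>auto simp: power2_eq_square mult_left_le\<close>)
  then have w: "?w \<in> l2 lborel" by (intro l2I) auto
  have "l2_norm lborel (\<lambda>x. cmod (\<phi> x)) \<le> l2_norm lborel (\<lambda>x. schwartz_seminorm ?N \<phi> * ?w x)"
    by (rule l2_bound(2)[OF l2_cmult[OF w]])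
      (use le' schwartz_measurable[OF \<phi>] in \<open>auto intro!: order_trans[OF _ abs_ge_self]\<close>)
  also have "\<dots> = \<bar>schwartz_seminorm ?N \<phi>\<bar> * l2_norm lborel ?w" by (rule l2_norm_cmult)
  also have "\<bar>schwartz_seminorm ?N \<phi>\<bar> = schwartz_seminorm ?N \<phi>"
    using le[of 0] by (smt (verit) norm_ge_zero mult_nonneg_nonneg zero_le_power)
  finally show ?thesis by (simp add: mult.commute)
qed

lemma function_dist_tempered:
  fixes u :: "real^'n::finite \<Rightarrow> real"
  assumes u: "u \<in> l2 lborel" shows "function_dist u \<in> tempered"
  unfolding tempered_def
proof (intro CollectI conjI ballI allI)
  fix \<phi> \<psi> :: "real^'n \<Rightarrow> complex" assume *: "\<phi> \<in> schwartz" "\<psi> \<in> schwartz"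
  show "function_dist u (\<lambda>x. \<phi> x + \<psi> x) = function_dist u \<phi> + function_dist u \<psi>"
    unfolding function_dist_def distrib_left
    by (intro Bochner_Integration.integral_add function_dist_bound(1) u *)
  show "function_dist u (\<lambda>x. c * \<phi> x) = c * function_dist u \<phi>" for c
    unfolding function_dist_def mult.left_commute[of _ c] by (rule integral_mult_right_zero)
next
  let ?w = "\<lambda>x::real^'n. inverse ((1 + norm x) ^ (2 * CARD('n)))"
  show "\<exists>N C. \<forall>\<phi>\<in>schwartz. cmod (function_dist u \<phi>) \<le> C * schwartz_seminorm N \<phi>"
  proof (intro exI ballI)
    fix \<phi> :: "real^'n \<Rightarrow> complex" assume \<phi>: "\<phi> \<in> schwartz"
    show "cmod (function_dist u \<phi>) \<le> (l2_norm lborel u * l2_norm lborel ?w) * schwartz_seminorm (2 * CARD('n)) \<phi>"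
      using order_trans[OF function_dist_bound(2)[OF u \<phi>] mult_left_mono[OF l2_norm_le_seminorm[OF \<phi>] l2_norm_nonneg[of lborel u]]]
      by (simp add: mult.assoc)
  qed
qed

text \<open>\<open>bessel_rel s u g\<close> states $\langle D\rangle^s u = g$ for square integrable \<open>u\<close> and \<open>g\<close>.\<close>

definition bessel_rel :: "real \<Rightarrow> (real^'n::finite \<Rightarrow> real) \<Rightarrow> (real^'n \<Rightarrow> real) \<Rightarrow> bool" where
  "bessel_rel s u g \<longleftrightarrow> u \<in> l2 lborel \<and> g \<in> l2 lborel \<and>
     (\<forall>\<phi>\<in>schwartz. function_dist u (bessel_fun s \<phi>) = function_dist g \<phi>)"

text \<open>Membership in \<open>sobolev\<close> says only that u is integrable against Schwartz
  functions. The pairing of u with \<psi> equals that of g with <D>^(-s) \<psi>, whose L^2 norm is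
  at most that of \<psi>; so u is bounded as a functional on L^2 and lies in L^2.\<close>

lemma bessel_dual_bound:
  fixes u :: "real^'n::finite \<Rightarrow> real"
  assumes s: "s \<ge> 0" and [measurable]: "u \<in> borel_measurable borel"
    and int: "\<And>\<phi>. \<phi> \<in> schwartz \<Longrightarrow> integrable lborel (\<lambda>x. complex_of_real (u x) * \<phi> x)"
    and g: "g \<in> l2 lborel"
    and eq: "\<And>\<phi>. \<phi> \<in> schwartz \<Longrightarrow> function_dist u (bessel_fun s \<phi>) = function_dist g \<phi>"
  shows "u \<in> l2 lborel" "l2_norm lborel u \<le> l2_norm lborel g"
proof -
  have i: "integrable lborel (\<lambda>x. u x * \<psi> x)" if "\<psi> \<in> test_functions UNIV" for \<psi>
    using int[OF test_function_schwartz[OF that]] unfolding of_real_mult[symmetric]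
    by (simp only: complex_of_real_integrable_eq)
  have b: "\<bar>\<integral>x. u x * \<psi> x \<partial>lborel\<bar> \<le> l2_norm lborel g * l2_norm lborel \<psi>" if \<psi>: "\<psi> \<in> test_functions UNIV" for \<psi>
  proof -
    let ?\<psi> = "\<lambda>x. complex_of_real (\<psi> x)"
    have s\<psi>: "?\<psi> \<in> schwartz" by (rule test_function_schwartz[OF \<psi>])
    have "\<bar>\<integral>x. u x * \<psi> x \<partial>lborel\<bar> = cmod (function_dist u ?\<psi>)"
      unfolding function_dist_def of_real_mult[symmetric] integral_complex_of_real by simp
    also have "function_dist u ?\<psi> = function_dist g (bessel_fun (- s) ?\<psi>)"
      using eq[OF schwartz_bessel_fun[OF s\<psi>], of "- s"] unfolding bessel_fun_inverse[OF s\<psi>] .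
    also have "cmod \<dots> \<le> l2_norm lborel g * l2_norm lborel (\<lambda>x. cmod (bessel_fun (- s) ?\<psi> x))"
      by (intro function_dist_bound g schwartz_bessel_fun s\<psi>)
    also have "\<dots> \<le> l2_norm lborel g * l2_norm lborel \<psi>"
      using bessel_fun_l2_le[OF s\<psi> s] by (intro mult_left_mono) (auto simp: l2_norm_def)
    finally show ?thesis .
  qed
  show "u \<in> l2 lborel" "l2_norm lborel u \<le> l2_norm lborel g"
    using l2_of_dual_bound[OF assms(2) l2_norm_nonneg i b] by auto
qed

lemma bessel_rel_norm_le:
  assumes "s \<ge> 0" "bessel_rel s u g" shows "l2_norm lborel u \<le> l2_norm lborel g"
  using assms function_dist_bound(1)
  by (intro bessel_dual_bound(2)[OF assms(1)]) (auto simp: bessel_rel_def dest: l2_measurable)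

text \<open>Replaces the distributional definition by the graph of <D>^s in L^2 \<times> L^2, the
  form in which H^s is handled from here on.\<close>

lemma Hs_iff:
  fixes u :: "real^'n::finite \<Rightarrow> real"
  assumes s: "s \<ge> 0" shows "u \<in> Hs s \<longleftrightarrow> (\<exists>g. bessel_rel s u g)"
proof
  assume "u \<in> Hs s"
  then obtain g where *: "u \<in> borel_measurable borel" "\<forall>\<phi>\<in>schwartz. integrable lborel (\<lambda>x. complex_of_real (u x) * \<phi> x)"
     "g \<in> l2 lborel" "\<forall>\<phi>\<in>schwartz. function_dist u (bessel_fun s \<phi>) = function_dist g \<phi>"
    unfolding sobolev_def bessel_potential_space_def bessel_op_eq Lp_2_UNIV by auto
  then have "u \<in> l2 lborel" using bessel_dual_bound(1)[OF s, of u g] by blast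
  then show "\<exists>g. bessel_rel s u g" using * by (auto simp: bessel_rel_def)
next
  assume "\<exists>g. bessel_rel s u g"
  then show "u \<in> Hs s"
    unfolding sobolev_def bessel_potential_space_def bessel_op_eq Lp_2_UNIV bessel_rel_def
    using function_dist_tempered function_dist_bound(1) l2_measurable by fastforce
qed

text \<open>Two candidates have the same pairing with every test function, so the fundamental lemma
  applies to their difference.\<close>

lemma bessel_rel_unique:
  fixes u :: "real^'n::finite \<Rightarrow> real"
  assumes "bessel_rel s u g" "bessel_rel s u h" shows "AE x in lborel. g x = h x"
proof -
  have g: "g \<in> l2 lborel" and h: "h \<in> l2 lborel" using assms by (auto simp: bessel_rel_def)
  have "AE x in lborel. g x - h x = 0"
  proof (rule fundamental_lemma)
    show "(\<lambda>x. g x - h x) \<in> borel_measurable borel" using l2_measurable[OF l2_diff[OF g h]] by simp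
    fix \<phi> :: "real^'n \<Rightarrow> real" assume "\<phi> \<in> test_functions UNIV"
    then have \<phi>: "(\<lambda>x. complex_of_real (\<phi> x)) \<in> schwartz" by (rule test_function_schwartz)
    have i: "integrable lborel (\<lambda>x. f x * \<phi> x)" if "f \<in> l2 lborel" for f
      using function_dist_bound(1)[OF that \<phi>] unfolding of_real_mult[symmetric]
      by (simp only: complex_of_real_integrable_eq)
    then show "integrable lborel (\<lambda>x. (g x - h x) * \<phi> x)" using l2_diff[OF g h] by blast
    have "function_dist g (\<lambda>x. complex_of_real (\<phi> x)) = function_dist h (\<lambda>x. complex_of_real (\<phi> x))"
      using assms \<phi> unfolding bessel_rel_def by metis
    then have "(\<integral>x. g x * \<phi> x \<partial>lborel) = (\<integral>x. h x * \<phi> x \<partial>lborel)"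
      unfolding function_dist_def of_real_mult[symmetric] integral_complex_of_real by simp
    then show "(\<integral>x. (g x - h x) * \<phi> x \<partial>lborel) = 0"
      unfolding left_diff_distrib Bochner_Integration.integral_diff[OF i[OF g] i[OF h]] by simp
  qed
  then show ?thesis by simp
qed

lemma l2_norm_cong_AE:
  assumes "f \<in> borel_measurable M" "g \<in> borel_measurable M" "AE x in M. f x = g x"
  shows "l2_norm M f = l2_norm M g"
  unfolding l2_norm_def using assms by (intro arg_cong[where f=sqrt] integral_cong_AE) auto

text \<open>\<open>bessel_deriv\<close> is an arbitrary representative of <D>^s u. Uniqueness almost
  everywhere lets the norm be computed from any other one.\<close>

lemma Hs_norm_eq:
  fixes u :: "real^'n::finite \<Rightarrow> real"
  assumes "bessel_rel s u g" shows "Hs_norm s u = l2_norm lborel g"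
proof -
  let ?P = "\<lambda>h. h \<in> Lp (ereal 2) UNIV \<and> (\<forall>\<phi>\<in>schwartz. bessel_op s (function_dist u) \<phi> = function_dist h \<phi>)"
  have "?P g" using assms by (auto simp: bessel_rel_def Lp_2_UNIV bessel_op_eq)
  then have "?P (bessel_deriv s 2 u)" unfolding bessel_deriv_def by (rule someI[of ?P g])
  then have b: "bessel_rel s u (bessel_deriv s 2 u)"
    using assms by (auto simp: bessel_rel_def Lp_2_UNIV bessel_op_eq)
  have "l2_norm lborel (bessel_deriv s 2 u) = l2_norm lborel g"
    using b assms bessel_rel_unique[OF b assms]
    by (intro l2_norm_cong_AE) (auto simp: bessel_rel_def dest: l2_measurable)
  then show ?thesis by (simp add: sobolev_norm_def Lp_norm_2)
qed

section \<open>Linearity and closedness of the Bessel operator\<close>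

lemma function_dist_add:
  assumes "u \<in> l2 lborel" "v \<in> l2 lborel" "\<phi> \<in> schwartz"
  shows "function_dist (\<lambda>x. u x + v x) \<phi> = function_dist u \<phi> + function_dist v \<phi>"
  unfolding function_dist_def of_real_add distrib_right
  by (intro Bochner_Integration.integral_add function_dist_bound(1) assms)

lemma function_dist_cmult: "function_dist (\<lambda>x. c * u x) \<phi> = complex_of_real c * function_dist u \<phi>"
  unfolding function_dist_def of_real_mult mult.assoc by (rule integral_mult_right_zero)

lemma bessel_rel_add:
  assumes "bessel_rel s u g" "bessel_rel s v h"
  shows "bessel_rel s (\<lambda>x. u x + v x) (\<lambda>x. g x + h x)"
  using assms unfolding bessel_rel_def by (auto simp: function_dist_add schwartz_bessel_fun intro!: l2_add)

lemma bessel_rel_cmult: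
  assumes "bessel_rel s u g" shows "bessel_rel s (\<lambda>x. c * u x) (\<lambda>x. c * g x)"
  using assms unfolding bessel_rel_def by (auto simp: function_dist_cmult intro!: l2_cmult)

lemma bessel_rel_diff:
  assumes "bessel_rel s u g" "bessel_rel s v h"
  shows "bessel_rel s (\<lambda>x. u x - v x) (\<lambda>x. g x - h x)"
  using bessel_rel_add[OF assms(1) bessel_rel_cmult[OF assms(2), of "-1"]] by simp

lemma function_dist_diff_le:
  fixes \<phi> :: "real^'n::finite \<Rightarrow> complex"
  assumes "u \<in> l2 lborel" "v \<in> l2 lborel" "\<phi> \<in> schwartz"
  shows "cmod (function_dist u \<phi> - function_dist v \<phi>) \<le> l2_norm lborel (\<lambda>x. u x - v x) * l2_norm lborel (\<lambda>x. cmod (\<phi> x))"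
proof -
  have "function_dist u \<phi> - function_dist v \<phi> = function_dist (\<lambda>x. u x - v x) \<phi>"
    using function_dist_add[OF assms(1) l2_cmult[OF assms(2)] assms(3), of "-1"] function_dist_cmult[of "-1" v \<phi>] by simp
  then show ?thesis using function_dist_bound(2)[OF l2_diff[OF assms(1,2)] assms(3)] by simp
qed

lemma function_dist_tendsto:
  fixes \<phi> :: "real^'n::finite \<Rightarrow> complex"
  assumes "\<And>n. u n \<in> l2 lborel" "v \<in> l2 lborel" "\<phi> \<in> schwartz" "(\<lambda>n. l2_norm lborel (\<lambda>x. u n x - v x)) \<longlonglongrightarrow> 0"
  shows "(\<lambda>n. function_dist (u n) \<phi>) \<longlonglongrightarrow> function_dist v \<phi>"
proof (rule LIM_zero_cancel, rule Lim_null_comparison)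
  show "\<forall>\<^sub>F n in sequentially. cmod (function_dist (u n) \<phi> - function_dist v \<phi>) \<le> l2_norm lborel (\<lambda>x. u n x - v x) * l2_norm lborel (\<lambda>x. cmod (\<phi> x))"
    by (intro always_eventually allI function_dist_diff_le assms)
  show "(\<lambda>n. l2_norm lborel (\<lambda>x. u n x - v x) * l2_norm lborel (\<lambda>x. cmod (\<phi> x))) \<longlonglongrightarrow> 0"
    using tendsto_mult[OF assms(4) tendsto_const] by simp
qed

text \<open>The graph of <D>^s is closed in L^2 \<times> L^2, since pairing with a fixed Schwartz
  function is continuous in L^2.\<close>

lemma bessel_rel_limit:
  assumes b: "\<And>n. bessel_rel s (u n) (g n)" and l: "v \<in> l2 lborel" "h \<in> l2 lborel"
    and lim: "(\<lambda>n. l2_norm lborel (\<lambda>x. u n x - v x)) \<longlonglongrightarrow> 0" "(\<lambda>n. l2_norm lborel (\<lambda>x. g n x - h x)) \<longlonglongrightarrow> 0"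
  shows "bessel_rel s v h"
  unfolding bessel_rel_def
proof (intro conjI ballI l)
  fix \<phi> :: "real^'a \<Rightarrow> complex" assume \<phi>: "\<phi> \<in> schwartz"
  have "(\<lambda>n. function_dist (u n) (bessel_fun s \<phi>)) \<longlonglongrightarrow> function_dist v (bessel_fun s \<phi>)"
    using b by (intro function_dist_tendsto l lim schwartz_bessel_fun \<phi>) (auto simp: bessel_rel_def)
  moreover have "(\<lambda>n. function_dist (g n) \<phi>) \<longlonglongrightarrow> function_dist h \<phi>"
    using b by (intro function_dist_tendsto l lim \<phi>) (auto simp: bessel_rel_def)
  moreover have "function_dist (u n) (bessel_fun s \<phi>) = function_dist (g n) \<phi>" for n
    using b[of n] \<phi> by (auto simp: bessel_rel_def)
  ultimately show "function_dist v (bessel_fun s \<phi>) = function_dist h \<phi>"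
    using LIMSEQ_unique by force
qed

lemma bessel_rel_cong_AE:
  fixes u :: "real^'n::finite \<Rightarrow> real"
  assumes b: "bessel_rel s u g" and [measurable]: "v \<in> borel_measurable borel" and ae: "AE x in lborel. v x = u x"
  shows "bessel_rel s v g"
proof -
  have u: "u \<in> l2 lborel" using b by (simp add: bessel_rel_def)
  have v: "v \<in> l2 lborel" by (rule l2_bound(1)[OF u]) (use ae in auto)
  have "function_dist v \<phi> = function_dist u \<phi>" if "\<phi> \<in> schwartz" for \<phi>
    unfolding function_dist_def
  proof (rule integral_cong_AE)
    show "AE x in lborel. complex_of_real (v x) * \<phi> x = complex_of_real (u x) * \<phi> x"
      using ae by eventually_elim simp
  qed (use function_dist_bound(1)[OF u that] function_dist_bound(1)[OF v that] in \<open>auto dest: borel_measurable_integrable\<close>)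
  then show ?thesis using b v by (simp add: bessel_rel_def schwartz_bessel_fun)
qed

section \<open>H^s as a complete seminormed space of functions\<close>

lemma Hs_l2: "s \<ge> 0 \<Longrightarrow> u \<in> Hs s \<Longrightarrow> u \<in> l2 lborel"
  unfolding Hs_iff by (auto simp: bessel_rel_def)

lemma l2_norm_le_Hs_norm: "s \<ge> 0 \<Longrightarrow> u \<in> Hs s \<Longrightarrow> l2_norm lborel u \<le> Hs_norm s u"
  unfolding Hs_iff using bessel_rel_norm_le Hs_norm_eq by metis

lemma Hs_norm_nonneg: "Hs_norm s u \<ge> 0"
  by (simp add: sobolev_norm_def Lp_norm_2)

lemma Hs_add: "s \<ge> 0 \<Longrightarrow> u \<in> Hs s \<Longrightarrow> v \<in> Hs s \<Longrightarrow> (\<lambda>x. u x + v x) \<in> Hs s"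
  unfolding Hs_iff using bessel_rel_add by blast

lemma Hs_cmult: "s \<ge> 0 \<Longrightarrow> u \<in> Hs s \<Longrightarrow> (\<lambda>x. c * u x) \<in> Hs s"
  unfolding Hs_iff using bessel_rel_cmult by blast

lemma Hs_diff: "s \<ge> 0 \<Longrightarrow> u \<in> Hs s \<Longrightarrow> v \<in> Hs s \<Longrightarrow> (\<lambda>x. u x - v x) \<in> Hs s"
  unfolding Hs_iff using bessel_rel_diff by blast

lemma Hs_norm_add:
  assumes "s \<ge> 0" "u \<in> Hs s" "v \<in> Hs s" shows "Hs_norm s (\<lambda>x. u x + v x) \<le> Hs_norm s u + Hs_norm s v"
proof -
  obtain g h where *: "bessel_rel s u g" "bessel_rel s v h" using assms by (auto simp: Hs_iff)
  then have "g \<in> l2 lborel" "h \<in> l2 lborel" by (auto simp: bessel_rel_def)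
  then show ?thesis
    unfolding Hs_norm_eq[OF *(1)] Hs_norm_eq[OF *(2)] Hs_norm_eq[OF bessel_rel_add[OF *]] by (rule l2_triangle)
qed

lemma Hs_norm_cmult:
  assumes "s \<ge> 0" "u \<in> Hs s" shows "Hs_norm s (\<lambda>x. c * u x) = \<bar>c\<bar> * Hs_norm s u"
proof -
  obtain g where *: "bessel_rel s u g" using assms by (auto simp: Hs_iff)
  show ?thesis unfolding Hs_norm_eq[OF *] Hs_norm_eq[OF bessel_rel_cmult[OF *]] by (rule l2_norm_cmult)
qed

lemma Hs_norm_minus_commute:
  assumes "s \<ge> 0" "u \<in> Hs s" "v \<in> Hs s" shows "Hs_norm s (\<lambda>x. u x - v x) = Hs_norm s (\<lambda>x. v x - u x)"
  using Hs_norm_cmult[OF assms(1) Hs_diff[OF assms(1,3,2)], of "-1"] by simp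

lemma Hs_norm_diff_triangle:
  assumes "s \<ge> 0" "u \<in> Hs s" "v \<in> Hs s" "w \<in> Hs s"
  shows "Hs_norm s (\<lambda>x. u x - w x) \<le> Hs_norm s (\<lambda>x. u x - v x) + Hs_norm s (\<lambda>x. v x - w x)"
  using Hs_norm_add[OF assms(1) Hs_diff[OF assms(1,2,3)] Hs_diff[OF assms(1,3,4)]] by simp

lemma Hs_cong_AE:
  assumes "s \<ge> 0" "u \<in> Hs s" "v \<in> borel_measurable borel" "AE x in lborel. v x = u x"
  shows "v \<in> Hs s" "Hs_norm s v = Hs_norm s u"
proof -
  obtain g where *: "bessel_rel s u g" using assms by (auto simp: Hs_iff)
  note ** = bessel_rel_cong_AE[OF * assms(3,4)]
  then show "v \<in> Hs s" using assms(1) Hs_iff by blast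
  show "Hs_norm s v = Hs_norm s u" unfolding Hs_norm_eq[OF *] Hs_norm_eq[OF **] ..
qed

text \<open>The functions and their images under <D>^s are both Cauchy in L^2, and the graph is
  closed.\<close>

lemma Hs_complete:
  fixes \<psi> :: "nat \<Rightarrow> real^'n::finite \<Rightarrow> real"
  assumes s: "s \<ge> 0" and \<psi>: "\<And>k. \<psi> k \<in> Hs s"
    and cauchy: "\<And>e. e > 0 \<Longrightarrow> \<exists>N. \<forall>m\<ge>N. \<forall>n\<ge>N. Hs_norm s (\<lambda>x. \<psi> m x - \<psi> n x) < e"
  obtains w where "w \<in> Hs s" "(\<lambda>k. Hs_norm s (\<lambda>x. \<psi> k x - w x)) \<longlonglongrightarrow> 0"
proof -
  have "\<forall>k. \<exists>g. bessel_rel s (\<psi> k) g" using \<psi> Hs_iff[OF s] by blast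
  then obtain g where g: "\<And>k. bessel_rel s (\<psi> k) (g k)" by metis
  have l: "\<psi> k \<in> l2 lborel" "g k \<in> l2 lborel" for k using g[of k] by (auto simp: bessel_rel_def)
  have n: "Hs_norm s (\<lambda>x. \<psi> m x - \<psi> n x) = l2_norm lborel (\<lambda>x. g m x - g n x)" for m n
    by (rule Hs_norm_eq[OF bessel_rel_diff[OF g g]])
  obtain h where h: "h \<in> l2 lborel" "(\<lambda>k. l2_norm lborel (\<lambda>x. g k x - h x)) \<longlonglongrightarrow> 0"
    using l2_complete[of g lborel] l cauchy unfolding n by blast
  have le: "l2_norm lborel (\<lambda>x. \<psi> m x - \<psi> n x) \<le> Hs_norm s (\<lambda>x. \<psi> m x - \<psi> n x)" for m n
    by (intro l2_norm_le_Hs_norm s Hs_diff \<psi>)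
  have "\<exists>N. \<forall>m\<ge>N. \<forall>n\<ge>N. l2_norm lborel (\<lambda>x. \<psi> m x - \<psi> n x) < e" if "e > 0" for e
    using cauchy[OF that] le by (meson order_le_less_trans)
  then obtain w where w: "w \<in> l2 lborel" "(\<lambda>k. l2_norm lborel (\<lambda>x. \<psi> k x - w x)) \<longlonglongrightarrow> 0"
    using l2_complete[of \<psi> lborel] l by blast
  have b: "bessel_rel s w h" by (rule bessel_rel_limit[OF g w(1) h(1) w(2) h(2)])
  then have "w \<in> Hs s" using Hs_iff[OF s] by blast
  moreover have "(\<lambda>k. Hs_norm s (\<lambda>x. \<psi> k x - w x)) \<longlonglongrightarrow> 0"
    using h(2) by (simp add: Hs_norm_eq[OF bessel_rel_diff[OF g b]])
  ultimately show ?thesis using that by blast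
qed

section \<open>Test functions in Sobolev spaces\<close>

definition bessel_transform :: "real \<Rightarrow> (real^'n::finite \<Rightarrow> real) \<Rightarrow> real^'n \<Rightarrow> complex" where
  "bessel_transform s u = inverse_fourier (\<lambda>\<xi>. complex_of_real ((1 + (norm \<xi>)\<^sup>2) powr (s / 2)) * fourier (\<lambda>x. complex_of_real (u x)) \<xi>)"

lemma bessel_transform_schwartz:
  "u \<in> test_functions U \<Longrightarrow> bessel_transform s u \<in> schwartz"
  unfolding bessel_transform_def
  by (intro schwartz_inverse_fourier schwartz_mult_bessel_weight schwartz_fourier test_function_schwartz)

lemma inverse_fourier_duality:
  fixes \<phi> \<psi> :: "real^'n::finite \<Rightarrow> complex"
  assumes "\<phi> \<in> schwartz" "\<psi> \<in> schwartz"
  shows "(\<integral>x. \<phi> x * inverse_fourier \<psi> x \<partial>lborel) = (\<integral>x. inverse_fourier \<phi> x * \<psi> x \<partial>lborel)"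
proof -
  have i: "inverse_fourier \<phi> \<in> schwartz" "inverse_fourier \<psi> \<in> schwartz"
    using assms by (auto intro: schwartz_inverse_fourier)
  show ?thesis
    using fourier_duality[OF schwartz_integrable[OF i(1)] schwartz_integrable[OF i(2)]]
    by (simp only: fourier_inverse_fourier[OF assms(1)] fourier_inverse_fourier[OF assms(2)])
qed

text \<open>The weight is even and u is real, so the function under the inverse transform takes
  conjugate values at \<xi> and -\<xi>. Real values are required because the derivative in the
  definition of the spaces is a real function.\<close>

lemma bessel_transform_real:
  fixes u :: "real^'n::finite \<Rightarrow> real"
  assumes u: "u \<in> test_functions U"
  shows "complex_of_real (Re (bessel_transform s u x)) = bessel_transform s u x"
proof -
  let ?u = "\<lambda>x. complex_of_real (u x)"
  let ?h = "\<lambda>\<xi>. complex_of_real ((1 + (norm \<xi>)\<^sup>2) powr (s / 2)) * fourier ?u \<xi>"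
  have su: "?u \<in> schwartz" by (rule test_function_schwartz[OF u])
  have h: "?h \<in> schwartz" by (intro schwartz_mult_bessel_weight schwartz_fourier su)
  have "cnj (fourier ?u \<xi>) = fourier ?u (- \<xi>)" for \<xi> unfolding cnj_fourier by simp
  then have hc: "(\<lambda>\<xi>. cnj (?h \<xi>)) = (\<lambda>\<xi>. ?h (- \<xi>))" by simp
  have "cnj (inverse_fourier ?h x) = fourier (\<lambda>\<xi>. cnj (?h \<xi>)) x /\<^sub>R (2 * pi) ^ CARD('n)"
    by (simp add: inverse_fourier_eq cnj_fourier)
  also have "\<dots> = inverse_fourier ?h x"
  proof -
    have "fourier (\<lambda>\<xi>. ?h (- \<xi>)) x = fourier ?h (- x)" by (rule fourier_reflect[OF schwartz_measurable[OF h]])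
    then show ?thesis unfolding hc inverse_fourier_eq by (simp only:)
  qed
  finally have "cnj (bessel_transform s u x) = bessel_transform s u x" by (simp add: bessel_transform_def)
  then show ?thesis by (metis Reals_cnj_iff of_real_Re)
qed

text \<open>Two dualities, one for the transform and one for its inverse, move the multiplier from
  \<phi> to u.\<close>

lemma test_function_bessel:
  fixes u :: "real^'n::finite \<Rightarrow> real"
  assumes u: "u \<in> test_functions U" and \<phi>: "\<phi> \<in> schwartz"
  shows "function_dist u (bessel_fun s \<phi>) = function_dist (\<lambda>x. Re (bessel_transform s u x)) \<phi>"
proof -
  let ?u = "\<lambda>x. complex_of_real (u x)"
  let ?w = "\<lambda>\<xi>. complex_of_real ((1 + (norm \<xi>)\<^sup>2) powr (s / 2))"
  have su: "?u \<in> schwartz" by (rule test_function_schwartz[OF u])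
  have h: "(\<lambda>\<xi>. ?w \<xi> * fourier ?u \<xi>) \<in> schwartz" by (intro schwartz_mult_bessel_weight schwartz_fourier su)
  have k: "(\<lambda>\<xi>. ?w \<xi> * inverse_fourier \<phi> \<xi>) \<in> schwartz" by (intro schwartz_mult_bessel_weight schwartz_inverse_fourier \<phi>)
  have "function_dist u (bessel_fun s \<phi>) = (\<integral>\<xi>. fourier ?u \<xi> * (?w \<xi> * inverse_fourier \<phi> \<xi>) \<partial>lborel)"
    unfolding function_dist_def bessel_fun_def
    by (rule fourier_duality[symmetric]) (intro schwartz_integrable su k)+
  also have "\<dots> = (\<integral>\<xi>. inverse_fourier \<phi> \<xi> * (?w \<xi> * fourier ?u \<xi>) \<partial>lborel)"
    by (intro Bochner_Integration.integral_cong) auto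
  also have "\<dots> = (\<integral>x. \<phi> x * bessel_transform s u x \<partial>lborel)"
    unfolding bessel_transform_def by (rule inverse_fourier_duality[OF \<phi> h, symmetric])
  finally show ?thesis
    unfolding function_dist_def bessel_transform_real[OF u] by (simp add: mult.commute)
qed

text \<open>Boundedness reduces the power p to the first power: |t|^p \<le> C^(p-1) |t|. With p =
  n/s this puts the background deviations into the required space.\<close>

lemma schwartz_Re_integrable_powr:
  fixes \<phi> :: "real^'n::finite \<Rightarrow> complex"
  assumes \<phi>: "\<phi> \<in> schwartz" and p: "p \<ge> 1"
  shows "integrable lborel (\<lambda>x. \<bar>Re (\<phi> x)\<bar> powr p)"
proof -
  have [measurable]: "\<phi> \<in> borel_measurable borel" by (rule schwartz_measurable[OF \<phi>])
  obtain C where C: "C \<ge> 0" "\<And>x. cmod (\<phi> x) \<le> C" using schwartz_bounded[OF \<phi>] by metis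
  have "\<bar>Re (\<phi> x)\<bar> powr p \<le> C powr (p - 1) * cmod (\<phi> x)" for x
  proof (cases "Re (\<phi> x) = 0")
    case False
    have "\<bar>Re (\<phi> x)\<bar> powr p = \<bar>Re (\<phi> x)\<bar> powr (p - 1) * \<bar>Re (\<phi> x)\<bar>"
      using False powr_add[of "\<bar>Re (\<phi> x)\<bar>" "p - 1" 1] by simp
    also have "\<dots> \<le> C powr (p - 1) * cmod (\<phi> x)"
      using p C(2)[of x] abs_Re_le_cmod[of "\<phi> x"] by (intro mult_mono powr_mono2) auto
    finally show ?thesis .
  qed (simp add: mult_nonneg_nonneg)
  then have le: "AE x in lborel. norm (\<bar>Re (\<phi> x)\<bar> powr p) \<le> norm (C powr (p - 1) * cmod (\<phi> x))"
    by (simp add: abs_mult)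
  have i: "integrable lborel (\<lambda>x. C powr (p - 1) * cmod (\<phi> x))"
    by (intro integrable_mult_right integrable_norm schwartz_integrable \<phi>)
  show ?thesis
    by (rule Bochner_Integration.integrable_bound[OF i _ le]) measurable
qed

lemma test_function_l2: "u \<in> test_functions U \<Longrightarrow> u \<in> l2 lborel"
  using l2_cmod_schwartz[OF test_function_schwartz, of u U] test_function_measurable[of u U]
  by (auto simp: l2_def)

lemma test_function_sobolev:
  fixes u :: "real^'n::finite \<Rightarrow> real"
  assumes u: "u \<in> test_functions U" and p: "p \<ge> 1"
  shows "u \<in> sobolev s p"
proof -
  let ?g = "\<lambda>x. Re (bessel_transform s u x)"
  have G: "bessel_transform s u \<in> schwartz" by (rule bessel_transform_schwartz[OF u])
  have [measurable]: "bessel_transform s u \<in> borel_measurable borel" by (rule schwartz_measurable[OF G])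
  have "?g \<in> Lp (ereal p) UNIV"
    using schwartz_Re_integrable_powr[OF G p] by (simp add: Lp_def set_borel_measurable_def set_integrable_def)
  then show ?thesis
    unfolding sobolev_def bessel_potential_space_def bessel_op_eq
    using test_function_bessel[OF u] function_dist_tempered[OF test_function_l2[OF u]]
      function_dist_bound(1)[OF test_function_l2[OF u]] test_function_measurable[OF u] by auto
qed

lemma test_function_bessel_rel:
  fixes u :: "real^'n::finite \<Rightarrow> real"
  assumes u: "u \<in> test_functions U"
  shows "bessel_rel s u (\<lambda>x. Re (bessel_transform s u x))"
proof -
  have G: "bessel_transform s u \<in> schwartz" by (rule bessel_transform_schwartz[OF u])
  have [measurable]: "bessel_transform s u \<in> borel_measurable borel" by (rule schwartz_measurable[OF G])
  have "(\<lambda>x. Re (bessel_transform s u x)) \<in> l2 lborel"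
    by (rule l2_bound(1)[OF l2_cmod_schwartz[OF G]]) (auto simp: abs_Re_le_cmod)
  then show ?thesis using test_function_bessel[OF u] test_function_l2[OF u] by (simp add: bessel_rel_def)
qed

lemma test_function_Hs: "s \<ge> 0 \<Longrightarrow> u \<in> test_functions U \<Longrightarrow> u \<in> Hs s"
  using test_function_bessel_rel Hs_iff by blast

lemma integrable_weight_fourier_sq:
  fixes \<phi> :: "real^'n::finite \<Rightarrow> complex"
  assumes "\<phi> \<in> schwartz"
  shows "integrable lborel (\<lambda>\<xi>. (1 + (norm \<xi>)\<^sup>2) powr s * (cmod (fourier \<phi> \<xi>))\<^sup>2)"
proof -
  have "((1 + (norm \<xi>)\<^sup>2) powr (s / 2))\<^sup>2 = (1 + (norm \<xi>)\<^sup>2) powr s" for \<xi> :: "real^'n"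
    by (simp add: power2_eq_square powr_add[symmetric])
  then show ?thesis
    using schwartz_square_integrable[OF schwartz_mult_bessel_weight[OF schwartz_fourier[OF assms], of "s / 2"]]
    by (simp add: norm_mult power_mult_distrib)
qed

lemma Hs_norm_test_function:
  fixes u :: "real^'n::finite \<Rightarrow> real"
  assumes u: "u \<in> test_functions U"
  shows "(Hs_norm s u)\<^sup>2 = (\<integral>\<xi>. (1 + (norm \<xi>)\<^sup>2) powr s * (cmod (fourier (\<lambda>x. complex_of_real (u x)) \<xi>))\<^sup>2 \<partial>lborel) / (2 * pi) ^ CARD('n)"
proof -
  let ?G = "bessel_transform s u" and ?F = "fourier (\<lambda>x. complex_of_real (u x))"
  have G: "?G \<in> schwartz" by (rule bessel_transform_schwartz[OF u])
  have h: "(\<lambda>\<xi>. complex_of_real ((1 + (norm \<xi>)\<^sup>2) powr (s / 2)) * ?F \<xi>) \<in> schwartz"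
    by (intro schwartz_mult_bessel_weight schwartz_fourier test_function_schwartz[OF u])
  have w: "((1 + (norm \<xi>)\<^sup>2) powr (s / 2))\<^sup>2 = (1 + (norm \<xi>)\<^sup>2) powr s" for \<xi> :: "real^'n"
    by (simp add: power2_eq_square powr_add[symmetric])
  have re: "\<bar>Re (?G x)\<bar> = cmod (?G x)" for x
    using bessel_transform_real[OF u, of s x] by (metis norm_of_real)
  have "(Re (?G x))\<^sup>2 = (cmod (?G x))\<^sup>2" for x
    unfolding re[of x, symmetric] by simp
  then have "(Hs_norm s u)\<^sup>2 = (\<integral>x. (cmod (?G x))\<^sup>2 \<partial>lborel)"
    unfolding Hs_norm_eq[OF test_function_bessel_rel[OF u]] l2_norm_sq by simp
  moreover have "(\<integral>\<xi>. (1 + (norm \<xi>)\<^sup>2) powr s * (cmod (?F \<xi>))\<^sup>2 \<partial>lborel) = (2 * pi) ^ CARD('n) * (\<integral>x. (cmod (?G x))\<^sup>2 \<partial>lborel)"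
    using plancherel[OF G] unfolding bessel_transform_def fourier_inverse_fourier[OF h]
    by (simp add: norm_mult power_mult_distrib w)
  ultimately show ?thesis by simp
qed

section \<open>The Gagliardo seminorm\<close>

abbreviation PP :: "((real^'n::finite) \<times> (real^'n)) measure" where
  "PP \<equiv> lborel \<Otimes>\<^sub>M lborel"

text \<open>The Gagliardo seminorm of \<open>u\<close> is, up to a constant, the \<open>L\<^sup>2\<close> norm of this function on $\mathbb{R}^{2n}$.\<close>

definition gag_diff :: "real \<Rightarrow> (real^'n::finite \<Rightarrow> real) \<Rightarrow> (real^'n) \<times> (real^'n) \<Rightarrow> real" where
  "gag_diff s u p = (u (fst p) - u (snd p)) * sqrt (frac_kernel s (fst p - snd p))"

lemma gag_diff_measurable [measurable]:
  assumes [measurable]: "u \<in> borel_measurable borel"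
  shows "gag_diff s u \<in> borel_measurable PP"
  unfolding gag_diff_def[abs_def] by measurable

text \<open>In the variable z = x - y the kernel depends on z alone, and the inner integral involves
  only a translate of the function and the function itself.\<close>

lemma nn_integral_PP_shift:
  fixes f :: "real^'n::finite \<Rightarrow> real^'n \<Rightarrow> ennreal"
  assumes [measurable]: "case_prod f \<in> borel_measurable PP"
  shows "(\<integral>\<^sup>+p. f (fst p) (snd p) \<partial>PP) = (\<integral>\<^sup>+z. \<integral>\<^sup>+x. f (x + z) x \<partial>lborel \<partial>lborel)"
proof -
  have m: "case_prod f \<in> borel_measurable (borel \<Otimes>\<^sub>M borel)" using assms by simp
  have m': "(\<lambda>(z, x). f (x + z) x) \<in> borel_measurable PP"
  proof -
    have "(\<lambda>q. case_prod f (snd q + fst q, snd q)) \<in> borel_measurable (borel \<Otimes>\<^sub>M borel :: ((real^'n) \<times> (real^'n)) measure)"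
      by (rule measurable_compose[OF _ m]) measurable
    then show ?thesis by (simp add: case_prod_beta')
  qed
  have "(\<integral>\<^sup>+p. f (fst p) (snd p) \<partial>PP) = (\<integral>\<^sup>+x. \<integral>\<^sup>+y. f y x \<partial>lborel \<partial>lborel)"
    using lborel_pair.nn_integral_snd[of "case_prod f"] by (simp add: case_prod_beta')
  also have "\<dots> = (\<integral>\<^sup>+x. \<integral>\<^sup>+z. f (x + z) x \<partial>lborel \<partial>lborel)"
  proof (rule nn_integral_cong)
    fix x :: "real^'n"
    have "(\<lambda>y. case_prod f (y, x)) \<in> borel_measurable borel"
      by (rule measurable_compose[OF _ m]) measurable
    then show "(\<integral>\<^sup>+y. f y x \<partial>lborel) = (\<integral>\<^sup>+z. f (x + z) x \<partial>lborel)"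
      using nn_integral_lborel_translate[of "\<lambda>y. f y x" x] by (simp add: add.commute)
  qed
  also have "\<dots> = (\<integral>\<^sup>+z. \<integral>\<^sup>+x. f (x + z) x \<partial>lborel \<partial>lborel)"
    using lborel_pair.Fubini'[of "\<lambda>z x. f (x + z) x"] m' by simp
  finally show ?thesis .
qed

lemma character_minus_1_sq: "(cmod (exp (\<i> * complex_of_real t) - 1))\<^sup>2 = 2 * (1 - cos t)"
proof -
  have "exp (\<i> * complex_of_real t) - 1 = Complex (cos t - 1) (sin t)"
    by (simp add: complex_eq_iff Re_exp Im_exp)
  then have "(cmod (exp (\<i> * complex_of_real t) - 1))\<^sup>2 = (cos t - 1)\<^sup>2 + (sin t)\<^sup>2"
    by (simp add: cmod_power2)
  also have "\<dots> = 2 * (1 - cos t)"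
    using sin_cos_squared_add[of t] by (simp add: power2_eq_square algebra_simps)
  finally show ?thesis .
qed

text \<open>Plancherel for u(. + z) - u, whose transform carries the factor e^(i z.\<xi>) - 1 of
  squared modulus 2 (1 - cos(z.\<xi>)).\<close>

lemma integral_translate_diff_sq:
  fixes u :: "real^'n::finite \<Rightarrow> real"
  assumes u: "u \<in> test_functions U"
  shows "(\<integral>\<^sup>+x. ennreal ((u (x + z) - u x)\<^sup>2) \<partial>lborel) =
    (\<integral>\<^sup>+\<xi>. ennreal (2 * (1 - cos (z \<bullet> \<xi>)) * (cmod (fourier (\<lambda>x. complex_of_real (u x)) \<xi>))\<^sup>2 / (2 * pi) ^ CARD('n)) \<partial>lborel)"
proof -
  let ?u = "\<lambda>x. complex_of_real (u x)"
  let ?d = "\<lambda>x. ?u (x + z) - ?u x"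
  have su: "?u \<in> schwartz" by (rule test_function_schwartz[OF u])
  have d: "?d \<in> schwartz" by (intro schwartz_diff schwartz_translate su)
  have sq: "(cmod (?d x))\<^sup>2 = (u (x + z) - u x)\<^sup>2" for x
    unfolding of_real_diff[symmetric] norm_of_real by simp
  have fd: "fourier ?d \<xi> = (exp (\<i> * complex_of_real (z \<bullet> \<xi>)) - 1) * fourier ?u \<xi>" for \<xi>
  proof -
    have "fourier ?d \<xi> = fourier (\<lambda>x. ?u (x + z) + (-1) * ?u x) \<xi>" by simp
    also have "\<dots> = fourier (\<lambda>x. ?u (x + z)) \<xi> + (-1) * fourier ?u \<xi>"
      using fourier_add[OF schwartz_integrable[OF schwartz_translate[OF su]] schwartz_integrable[OF schwartz_cmult[OF su, of "-1"]]]
      by (simp only: fourier_cmult)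
    finally show ?thesis unfolding fourier_translate[OF schwartz_measurable[OF su]] by (simp add: algebra_simps)
  qed
  have fsq: "(cmod (fourier ?d \<xi>))\<^sup>2 = 2 * (1 - cos (z \<bullet> \<xi>)) * (cmod (fourier ?u \<xi>))\<^sup>2" for \<xi>
    unfolding fd norm_mult power_mult_distrib character_minus_1_sq ..
  have "(\<integral>\<^sup>+x. ennreal ((u (x + z) - u x)\<^sup>2) \<partial>lborel) = ennreal (\<integral>x. (cmod (?d x))\<^sup>2 \<partial>lborel)"
    unfolding sq[symmetric] by (intro nn_integral_eq_integral schwartz_square_integrable d) auto
  also have "(\<integral>x. (cmod (?d x))\<^sup>2 \<partial>lborel) = (\<integral>\<xi>. (cmod (fourier ?d \<xi>))\<^sup>2 \<partial>lborel) / (2 * pi) ^ CARD('n)"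
    using plancherel[OF d] by simp
  also have "\<dots> = (\<integral>\<xi>. (cmod (fourier ?d \<xi>))\<^sup>2 / (2 * pi) ^ CARD('n) \<partial>lborel)"
    by simp
  also have "ennreal \<dots> = (\<integral>\<^sup>+\<xi>. ennreal ((cmod (fourier ?d \<xi>))\<^sup>2 / (2 * pi) ^ CARD('n)) \<partial>lborel)"
    using schwartz_square_integrable[OF schwartz_fourier[OF d]]
    by (intro nn_integral_eq_integral[symmetric] integrable_divide) auto
  finally show ?thesis unfolding fsq .
qed

section \<open>Comparison of the energy with the H^s norm on test functions\<close>

lemma norm_powr_le_weight:
  "s \<ge> 0 \<Longrightarrow> norm (\<xi>::real^'n::finite) powr (2 * s) \<le> (1 + (norm \<xi>)\<^sup>2) powr s"
proof -
  assume s: "s \<ge> 0"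
  have "norm \<xi> powr (2 * s) = ((norm \<xi>)\<^sup>2) powr s"
    by (cases "\<xi> = 0") (simp_all add: powr_powr[symmetric] powr_numeral)
  also have "\<dots> \<le> (1 + (norm \<xi>)\<^sup>2) powr s" using s by (intro powr_mono2) auto
  finally show ?thesis .
qed

text \<open>From 1 + t \<le> 2 max(1, t), together with 2^s \<le> 2 for s < 1.\<close>

lemma weight_le_norm_powr:
  assumes "0 < s" "s < 1"
  shows "(1 + (norm (\<xi>::real^'n::finite))\<^sup>2) powr s \<le> 2 * (1 + norm \<xi> powr (2 * s))"
proof -
  let ?t = "(norm \<xi>)\<^sup>2"
  have n: "norm \<xi> powr (2 * s) = ?t powr s"
    by (cases "\<xi> = 0") (simp_all add: powr_powr[symmetric] powr_numeral)
  have "(1 + ?t) powr s \<le> (2 * max 1 ?t) powr s" using assms by (intro powr_mono2) auto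
  also have "\<dots> = 2 powr s * (max 1 ?t) powr s" by (simp add: powr_mult)
  also have "\<dots> \<le> 2 * (1 + ?t powr s)"
  proof (rule mult_mono)
    show "2 powr s \<le> (2::real)" using powr_mono[of s 1 2] assms by simp
    show "(max 1 ?t) powr s \<le> 1 + ?t powr s" by (simp add: max_def)
  qed auto
  finally show ?thesis unfolding n .
qed

text \<open>Plancherel in x for each fixed shift z, then Tonelli; the remaining z-integral is the
  Levy symbol. Working with nonnegative integrals, the finite result also proves square
  integrability.\<close>

lemma gag_diff_test_function:
  fixes u :: "real^'n::finite \<Rightarrow> real"
  assumes u: "u \<in> test_functions U" and s: "0 < s" "s < 1"
  shows "gag_diff s u \<in> l2 PP"
    and "(l2_norm PP (gag_diff s u))\<^sup>2 = 2 * levy_const TYPE('n) s * (\<integral>\<xi>. norm \<xi> powr (2 * s) * (cmod (fourier (\<lambda>x. complex_of_real (u x)) \<xi>))\<^sup>2 \<partial>lborel) / (2 * pi) ^ CARD('n)"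
proof -
  let ?F = "fourier (\<lambda>x. complex_of_real (u x))" and ?K = "levy_const TYPE('n) s"
  define c where "c = 1 / (2 * pi) ^ CARD('n)"
  have c: "c > 0" by (simp add: c_def)
  have K: "?K > 0" by (rule levy_const_pos[OF s])
  have su: "(\<lambda>x. complex_of_real (u x)) \<in> schwartz" by (rule test_function_schwartz[OF u])
  have [measurable]: "u \<in> borel_measurable borel" "?F \<in> borel_measurable borel"
    using test_function_measurable[OF u] schwartz_measurable[OF schwartz_fourier[OF su]] by auto
  have "(\<integral>\<^sup>+p. ennreal ((gag_diff s u p)\<^sup>2) \<partial>PP) = (\<integral>\<^sup>+z. \<integral>\<^sup>+x. ennreal ((u (x + z) - u x)\<^sup>2 * frac_kernel s z) \<partial>lborel \<partial>lborel)"
    unfolding gag_diff_def power_mult_distrib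
    by (subst nn_integral_PP_shift[of "\<lambda>x y. ennreal ((u x - u y)\<^sup>2 * (sqrt (frac_kernel s (x - y)))\<^sup>2)"]) auto
  also have "\<dots> = (\<integral>\<^sup>+z. \<integral>\<^sup>+\<xi>. ennreal (2 * c * (cmod (?F \<xi>))\<^sup>2) * ennreal ((1 - cos (z \<bullet> \<xi>)) * frac_kernel s z) \<partial>lborel \<partial>lborel)"
  proof (rule nn_integral_cong)
    fix z :: "real^'n"
    have "(\<integral>\<^sup>+x. ennreal ((u (x + z) - u x)\<^sup>2 * frac_kernel s z) \<partial>lborel) = (\<integral>\<^sup>+x. ennreal ((u (x + z) - u x)\<^sup>2) \<partial>lborel) * ennreal (frac_kernel s z)"
      by (simp add: ennreal_mult nn_integral_multc)
    also have "\<dots> = (\<integral>\<^sup>+\<xi>. ennreal (2 * (1 - cos (z \<bullet> \<xi>)) * (cmod (?F \<xi>))\<^sup>2 / (2 * pi) ^ CARD('n)) * ennreal (frac_kernel s z) \<partial>lborel)"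
      unfolding integral_translate_diff_sq[OF u] by (rule nn_integral_multc[symmetric]) measurable
    also have "\<dots> = (\<integral>\<^sup>+\<xi>. ennreal (2 * c * (cmod (?F \<xi>))\<^sup>2) * ennreal ((1 - cos (z \<bullet> \<xi>)) * frac_kernel s z) \<partial>lborel)"
    proof (rule nn_integral_cong)
      fix \<xi> :: "real^'n"
      have "2 * (1 - cos (z \<bullet> \<xi>)) * (cmod (?F \<xi>))\<^sup>2 / (2 * pi) ^ CARD('n) * frac_kernel s z = 2 * c * (cmod (?F \<xi>))\<^sup>2 * ((1 - cos (z \<bullet> \<xi>)) * frac_kernel s z)"
        by (simp add: c_def)
      then show "ennreal (2 * (1 - cos (z \<bullet> \<xi>)) * (cmod (?F \<xi>))\<^sup>2 / (2 * pi) ^ CARD('n)) * ennreal (frac_kernel s z) = ennreal (2 * c * (cmod (?F \<xi>))\<^sup>2) * ennreal ((1 - cos (z \<bullet> \<xi>)) * frac_kernel s z)"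
        using c by (simp only: ennreal_mult'[symmetric] ennreal_mult''[symmetric] frac_kernel_nonneg zero_le_power2 mult_nonneg_nonneg less_imp_le zero_le_numeral)
    qed
    finally show "(\<integral>\<^sup>+x. ennreal ((u (x + z) - u x)\<^sup>2 * frac_kernel s z) \<partial>lborel) = (\<integral>\<^sup>+\<xi>. ennreal (2 * c * (cmod (?F \<xi>))\<^sup>2) * ennreal ((1 - cos (z \<bullet> \<xi>)) * frac_kernel s z) \<partial>lborel)" .
  qed
  also have "\<dots> = (\<integral>\<^sup>+\<xi>. \<integral>\<^sup>+z. ennreal (2 * c * (cmod (?F \<xi>))\<^sup>2) * ennreal ((1 - cos (z \<bullet> \<xi>)) * frac_kernel s z) \<partial>lborel \<partial>lborel)"
    by (rule lborel_pair.Fubini') measurable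
  also have "\<dots> = (\<integral>\<^sup>+\<xi>. ennreal (2 * ?K * c * (norm \<xi> powr (2 * s) * (cmod (?F \<xi>))\<^sup>2)) \<partial>lborel)"
  proof (rule nn_integral_cong)
    fix \<xi> :: "real^'n"
    have "(\<integral>\<^sup>+z. ennreal ((1 - cos (z \<bullet> \<xi>)) * frac_kernel s z) \<partial>lborel) = ennreal (levy_symbol s \<xi>)"
      unfolding levy_symbol_def by (intro nn_integral_eq_integral integrable_levy s) auto
    then have "(\<integral>\<^sup>+z. ennreal (2 * c * (cmod (?F \<xi>))\<^sup>2) * ennreal ((1 - cos (z \<bullet> \<xi>)) * frac_kernel s z) \<partial>lborel) = ennreal (2 * c * (cmod (?F \<xi>))\<^sup>2) * ennreal (levy_symbol s \<xi>)"
      by (simp add: nn_integral_cmult)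
    also have "\<dots> = ennreal (2 * c * (cmod (?F \<xi>))\<^sup>2 * levy_symbol s \<xi>)"
      by (rule ennreal_mult''[symmetric]) (rule levy_symbol_nonneg)
    also have "2 * c * (cmod (?F \<xi>))\<^sup>2 * levy_symbol s \<xi> = 2 * ?K * c * (norm \<xi> powr (2 * s) * (cmod (?F \<xi>))\<^sup>2)"
      unfolding levy_symbol_eq by simp
    finally show "(\<integral>\<^sup>+z. ennreal (2 * c * (cmod (?F \<xi>))\<^sup>2) * ennreal ((1 - cos (z \<bullet> \<xi>)) * frac_kernel s z) \<partial>lborel) = ennreal (2 * ?K * c * (norm \<xi> powr (2 * s) * (cmod (?F \<xi>))\<^sup>2))" .
  qed
  also have "\<dots> = ennreal (\<integral>\<xi>. 2 * ?K * c * (norm \<xi> powr (2 * s) * (cmod (?F \<xi>))\<^sup>2) \<partial>lborel)"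
  proof (rule nn_integral_eq_integral)
    have "integrable lborel (\<lambda>\<xi>. norm \<xi> powr (2 * s) * (cmod (?F \<xi>))\<^sup>2)"
    proof (rule Bochner_Integration.integrable_bound[OF integrable_weight_fourier_sq[OF su, of s]])
      have "norm \<xi> powr (2 * s) \<le> (1 + (norm \<xi>)\<^sup>2) powr s" for \<xi> :: "real^'n"
        by (rule norm_powr_le_weight) (use s in simp)
      then show "AE \<xi> in lborel. norm (norm \<xi> powr (2 * s) * (cmod (?F \<xi>))\<^sup>2) \<le> norm ((1 + (norm \<xi>)\<^sup>2) powr s * (cmod (?F \<xi>))\<^sup>2)"
        by (intro AE_I2) (simp add: abs_mult mult_right_mono)
    qed measurable
    then show "integrable lborel (\<lambda>\<xi>. 2 * ?K * c * (norm \<xi> powr (2 * s) * (cmod (?F \<xi>))\<^sup>2))"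
      by (rule integrable_mult_right)
  qed (use K c in \<open>auto intro!: mult_nonneg_nonneg\<close>)
  finally have eq: "(\<integral>\<^sup>+p. ennreal ((gag_diff s u p)\<^sup>2) \<partial>PP) = ennreal (2 * ?K * c * (\<integral>\<xi>. norm \<xi> powr (2 * s) * (cmod (?F \<xi>))\<^sup>2 \<partial>lborel))"
    by simp
  have "integrable PP (\<lambda>p. (gag_diff s u p)\<^sup>2)"
    unfolding integrable_iff_bounded using eq by simp
  then show "gag_diff s u \<in> l2 PP" by (intro l2I) auto
  have "(\<integral>p. (gag_diff s u p)\<^sup>2 \<partial>PP) = 2 * ?K * c * (\<integral>\<xi>. norm \<xi> powr (2 * s) * (cmod (?F \<xi>))\<^sup>2 \<partial>lborel)"
    using eq K c by (subst integral_eq_nn_integral) (auto intro!: mult_nonneg_nonneg Bochner_Integration.integral_nonneg)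
  then show "(l2_norm PP (gag_diff s u))\<^sup>2 = 2 * ?K * (\<integral>\<xi>. norm \<xi> powr (2 * s) * (cmod (?F \<xi>))\<^sup>2 \<partial>lborel) / (2 * pi) ^ CARD('n)"
    unfolding l2_norm_sq by (simp add: c_def)
qed

lemma l2_norm_test_function:
  fixes u :: "real^'n::finite \<Rightarrow> real"
  assumes u: "u \<in> test_functions U"
  shows "(l2_norm lborel u)\<^sup>2 = (\<integral>\<xi>. (cmod (fourier (\<lambda>x. complex_of_real (u x)) \<xi>))\<^sup>2 \<partial>lborel) / (2 * pi) ^ CARD('n)"
  using plancherel[OF test_function_schwartz[OF u]] unfolding l2_norm_sq by simp

lemma integrable_norm_powr_fourier_sq:
  fixes \<phi> :: "real^'n::finite \<Rightarrow> complex"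
  assumes \<phi>: "\<phi> \<in> schwartz" and s: "s \<ge> 0"
  shows "integrable lborel (\<lambda>\<xi>. norm \<xi> powr (2 * s) * (cmod (fourier \<phi> \<xi>))\<^sup>2)"
proof (rule Bochner_Integration.integrable_bound[OF integrable_weight_fourier_sq[OF \<phi>, of s]])
  have [measurable]: "fourier \<phi> \<in> borel_measurable borel" by (intro schwartz_measurable schwartz_fourier \<phi>)
  show "(\<lambda>\<xi>. norm \<xi> powr (2 * s) * (cmod (fourier \<phi> \<xi>))\<^sup>2) \<in> borel_measurable lborel" by measurable
  show "AE \<xi> in lborel. norm (norm \<xi> powr (2 * s) * (cmod (fourier \<phi> \<xi>))\<^sup>2) \<le> norm ((1 + (norm \<xi>)\<^sup>2) powr s * (cmod (fourier \<phi> \<xi>))\<^sup>2)"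
    using norm_powr_le_weight[OF s, where 'n='n] by (intro AE_I2) (simp add: abs_mult mult_right_mono)
qed

lemma gag_diff_le_Hs_norm:
  fixes u :: "real^'n::finite \<Rightarrow> real"
  assumes u: "u \<in> test_functions U" and s: "0 < s" "s < 1"
  shows "l2_norm PP (gag_diff s u) \<le> sqrt (2 * levy_const TYPE('n) s) * Hs_norm s u"
proof (rule power2_le_imp_le)
  let ?F = "fourier (\<lambda>x. complex_of_real (u x))" and ?K = "levy_const TYPE('n) s"
  have K: "?K > 0" by (rule levy_const_pos[OF s])
  have su: "(\<lambda>x. complex_of_real (u x)) \<in> schwartz" by (rule test_function_schwartz[OF u])
  have "(\<integral>\<xi>. norm \<xi> powr (2 * s) * (cmod (?F \<xi>))\<^sup>2 \<partial>lborel) \<le> (\<integral>\<xi>. (1 + (norm \<xi>)\<^sup>2) powr s * (cmod (?F \<xi>))\<^sup>2 \<partial>lborel)"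
    using s norm_powr_le_weight[where 'n='n]
    by (intro integral_mono integrable_norm_powr_fourier_sq integrable_weight_fourier_sq su mult_right_mono) auto
  then show "(l2_norm PP (gag_diff s u))\<^sup>2 \<le> (sqrt (2 * ?K) * Hs_norm s u)\<^sup>2"
    unfolding gag_diff_test_function(2)[OF u s] power_mult_distrib Hs_norm_test_function[OF u]
    using K by (simp add: divide_right_mono mult_left_mono)
qed (use levy_const_pos[OF s, where 'n='n] Hs_norm_nonneg in \<open>auto intro!: mult_nonneg_nonneg\<close>)

text \<open>Coercivity, obtained from \<open>weight_le_norm_powr\<close> on the Fourier side. With
  \<open>gag_diff_le_Hs_norm\<close> and \<open>l2_norm_le_Hs_norm\<close> it makes the energy and
  the H^s norm equivalent on test functions.\<close>

lemma Hs_norm_le_energy: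
  fixes u :: "real^'n::finite \<Rightarrow> real"
  assumes u: "u \<in> test_functions U" and s: "0 < s" "s < 1"
  shows "(Hs_norm s u)\<^sup>2 \<le> 2 * (l2_norm lborel u)\<^sup>2 + (l2_norm PP (gag_diff s u))\<^sup>2 / levy_const TYPE('n) s"
proof -
  let ?F = "fourier (\<lambda>x. complex_of_real (u x))" and ?K = "levy_const TYPE('n) s"
  have K: "?K > 0" by (rule levy_const_pos[OF s])
  have su: "(\<lambda>x. complex_of_real (u x)) \<in> schwartz" by (rule test_function_schwartz[OF u])
  note i = schwartz_square_integrable[OF schwartz_fourier[OF su]] integrable_norm_powr_fourier_sq[OF su less_imp_le[OF s(1)]]
  have "(\<integral>\<xi>. (1 + (norm \<xi>)\<^sup>2) powr s * (cmod (?F \<xi>))\<^sup>2 \<partial>lborel)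
     \<le> (\<integral>\<xi>. 2 * (cmod (?F \<xi>))\<^sup>2 + 2 * (norm \<xi> powr (2 * s) * (cmod (?F \<xi>))\<^sup>2) \<partial>lborel)"
  proof (rule integral_mono)
    fix \<xi> :: "real^'n"
    show "(1 + (norm \<xi>)\<^sup>2) powr s * (cmod (?F \<xi>))\<^sup>2 \<le> 2 * (cmod (?F \<xi>))\<^sup>2 + 2 * (norm \<xi> powr (2 * s) * (cmod (?F \<xi>))\<^sup>2)"
      using mult_right_mono[OF weight_le_norm_powr[OF s, of \<xi>], of "(cmod (?F \<xi>))\<^sup>2"] by (simp add: algebra_simps)
  qed (intro integrable_weight_fourier_sq su Bochner_Integration.integrable_add integrable_mult_right i)+
  also have "\<dots> = 2 * (\<integral>\<xi>. (cmod (?F \<xi>))\<^sup>2 \<partial>lborel) + 2 * (\<integral>\<xi>. norm \<xi> powr (2 * s) * (cmod (?F \<xi>))\<^sup>2 \<partial>lborel)"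
    using i by simp
  finally have "(Hs_norm s u)\<^sup>2 \<le> (2 * (\<integral>\<xi>. (cmod (?F \<xi>))\<^sup>2 \<partial>lborel) + 2 * (\<integral>\<xi>. norm \<xi> powr (2 * s) * (cmod (?F \<xi>))\<^sup>2 \<partial>lborel)) / (2 * pi) ^ CARD('n)"
    unfolding Hs_norm_test_function[OF u] by (rule divide_right_mono) simp
  then show ?thesis
    unfolding l2_norm_test_function[OF u] gag_diff_test_function(2)[OF u s]
    using K by (simp add: add_divide_distrib)
qed

lemma gag_diff_add: "gag_diff s (\<lambda>x. u x + v x) = (\<lambda>p. gag_diff s u p + gag_diff s v p)"
  by (simp add: gag_diff_def fun_eq_iff algebra_simps)

lemma gag_diff_cmult: "gag_diff s (\<lambda>x. c * u x) = (\<lambda>p. c * gag_diff s u p)"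
  by (simp add: gag_diff_def fun_eq_iff algebra_simps)

lemma gag_diff_diff: "gag_diff s (\<lambda>x. u x - v x) = (\<lambda>p. gag_diff s u p - gag_diff s v p)"
  by (simp add: gag_diff_def fun_eq_iff algebra_simps)

text \<open>The two strips over a null set are null sets of the product.\<close>

lemma AE_PP:
  assumes "AE x in lborel. P x" shows "AE p in PP. P (fst p) \<and> P (snd p)"
proof -
  obtain N where N: "{x \<in> space lborel. \<not> P x} \<subseteq> N" "N \<in> null_sets lborel"
    using assms by (auto simp: eventually_ae_filter)
  have [measurable]: "N \<in> sets borel" using N(2) by auto
  have e: "emeasure PP (A \<times> B) = emeasure lborel A * emeasure lborel B"
    if "A \<in> sets borel" "B \<in> sets borel" for A B :: "(real^'n) set"
    using that by (intro lborel.emeasure_pair_measure_Times) auto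
  have "N \<times> UNIV \<in> null_sets PP" "UNIV \<times> N \<in> null_sets PP"
    using N(2) by (auto intro!: null_setsI simp: e)
  then have "AE p in PP. p \<notin> N \<times> UNIV" "AE p in PP. p \<notin> UNIV \<times> N"
    by (auto intro: AE_not_in)
  then show ?thesis by eventually_elim (use N(1) in auto)
qed

section \<open>The spaces $\widetilde H^s(\Omega)$\<close>

lemma Hs_tilde_Hs: "u \<in> Hs_tilde s \<Omega> \<Longrightarrow> u \<in> Hs s"
  by (simp add: Hs_tilde_def)

lemma Hs_tilde_mono: "\<Omega> \<subseteq> \<Omega>' \<Longrightarrow> Hs_tilde s \<Omega> \<subseteq> Hs_tilde s \<Omega>'"
  using test_functions_mono unfolding Hs_tilde_def by blast

lemma Hs_tilde_UNIV: "u \<in> Hs_tilde s \<Omega> \<Longrightarrow> u \<in> Hs_tilde s UNIV"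
  using Hs_tilde_mono by blast

lemma Hs_tilde_seq:
  assumes "u \<in> Hs_tilde s \<Omega>"
  obtains \<phi> where "\<And>k. \<phi> k \<in> test_functions \<Omega>" "(\<lambda>k::nat. Hs_norm s (\<lambda>x. u x - \<phi> k x)) \<longlonglongrightarrow> 0"
proof -
  have "\<forall>k::nat. \<exists>\<phi>\<in>test_functions \<Omega>. Hs_norm s (\<lambda>x. u x - \<phi> x) < 1 / (real k + 1)"
    using assms unfolding Hs_tilde_def by auto
  then obtain \<phi> where \<phi>: "\<And>k. \<phi> k \<in> test_functions \<Omega>" "\<And>k. Hs_norm s (\<lambda>x. u x - \<phi> k x) < 1 / (real k + 1)" by metis
  have "(\<lambda>k. Hs_norm s (\<lambda>x. u x - \<phi> k x)) \<longlonglongrightarrow> 0"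
  proof (rule Lim_null_comparison)
    show "\<forall>\<^sub>F k in sequentially. norm (Hs_norm s (\<lambda>x. u x - \<phi> k x)) \<le> 1 / (real k + 1)"
      using less_imp_le[OF \<phi>(2)] by (intro always_eventually allI) (simp add: Hs_norm_nonneg)
    show "(\<lambda>k. 1 / (real k + 1)) \<longlonglongrightarrow> 0"
      using LIMSEQ_inverse_real_of_nat by (simp add: inverse_eq_divide add.commute)
  qed
  then show ?thesis using that \<phi>(1) by blast
qed

lemma Hs_tildeI_seq:
  assumes "u \<in> Hs s" "\<And>k. \<phi> k \<in> test_functions \<Omega>" "(\<lambda>k::nat. Hs_norm s (\<lambda>x. u x - \<phi> k x)) \<longlonglongrightarrow> 0"
  shows "u \<in> Hs_tilde s \<Omega>"
  unfolding Hs_tilde_def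
proof (intro CollectI conjI allI impI assms(1))
  fix e :: real assume "e > 0"
  then have "\<forall>\<^sub>F k in sequentially. Hs_norm s (\<lambda>x. u x - \<phi> k x) < e"
    using assms(3) by (rule order_tendstoD(2)[rotated])
  then show "\<exists>\<phi>\<in>test_functions \<Omega>. Hs_norm s (\<lambda>x. u x - \<phi> x) < e"
    using assms(2) by (auto simp: eventually_sequentially)
qed

lemma test_function_Hs_tilde:
  assumes "s \<ge> 0" "u \<in> test_functions \<Omega>" shows "u \<in> Hs_tilde s \<Omega>"
proof (rule Hs_tildeI_seq[where \<phi>="\<lambda>k. u"])
  show "u \<in> Hs s" by (rule test_function_Hs[OF assms])
  then have "Hs_norm s (\<lambda>x. u x - u x) = 0"
    using Hs_norm_cmult[OF assms(1), of u 0] by simp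
  then show "(\<lambda>k. Hs_norm s (\<lambda>x. u x - u x)) \<longlonglongrightarrow> 0" by simp
qed (use assms in simp)

lemma Hs_tilde_add:
  assumes s: "s \<ge> 0" and u: "u \<in> Hs_tilde s \<Omega>" and v: "v \<in> Hs_tilde s \<Omega>"
  shows "(\<lambda>x. u x + v x) \<in> Hs_tilde s \<Omega>"
proof -
  obtain \<phi> where \<phi>: "\<And>k. \<phi> k \<in> test_functions \<Omega>" "(\<lambda>k::nat. Hs_norm s (\<lambda>x. u x - \<phi> k x)) \<longlonglongrightarrow> 0"
    by (rule Hs_tilde_seq[OF u]) blast
  obtain \<psi> where \<psi>: "\<And>k. \<psi> k \<in> test_functions \<Omega>" "(\<lambda>k::nat. Hs_norm s (\<lambda>x. v x - \<psi> k x)) \<longlonglongrightarrow> 0"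
    by (rule Hs_tilde_seq[OF v]) blast
  note * = \<phi> \<psi>
  note H = Hs_tilde_Hs[OF u] Hs_tilde_Hs[OF v] test_function_Hs[OF s *(1)] test_function_Hs[OF s *(3)]
  show ?thesis
  proof (rule Hs_tildeI_seq[where \<phi>="\<lambda>k x. \<phi> k x + \<psi> k x"])
    show "(\<lambda>x. u x + v x) \<in> Hs s" by (intro Hs_add s H)
    show "(\<lambda>x. \<phi> k x + \<psi> k x) \<in> test_functions \<Omega>" for k by (intro test_functions_add *)
    show "(\<lambda>k. Hs_norm s (\<lambda>x. u x + v x - (\<phi> k x + \<psi> k x))) \<longlonglongrightarrow> 0"
    proof (rule Lim_null_comparison)
      show "(\<lambda>k. Hs_norm s (\<lambda>x. u x - \<phi> k x) + Hs_norm s (\<lambda>x. v x - \<psi> k x)) \<longlonglongrightarrow> 0"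
        using tendsto_add[OF *(2,4)] by simp
      have "Hs_norm s (\<lambda>x. u x + v x - (\<phi> k x + \<psi> k x)) \<le> Hs_norm s (\<lambda>x. u x - \<phi> k x) + Hs_norm s (\<lambda>x. v x - \<psi> k x)" for k
        using Hs_norm_add[OF s Hs_diff[OF s H(1) H(3)] Hs_diff[OF s H(2) H(4)], of k k] by (simp add: algebra_simps)
      then show "\<forall>\<^sub>F k in sequentially. norm (Hs_norm s (\<lambda>x. u x + v x - (\<phi> k x + \<psi> k x))) \<le> Hs_norm s (\<lambda>x. u x - \<phi> k x) + Hs_norm s (\<lambda>x. v x - \<psi> k x)"
        by (intro always_eventually allI) (simp add: Hs_norm_nonneg)
    qed
  qed
qed

lemma Hs_tilde_cmult:
  assumes s: "s \<ge> 0" and u: "u \<in> Hs_tilde s \<Omega>"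
  shows "(\<lambda>x. c * u x) \<in> Hs_tilde s \<Omega>"
proof -
  obtain \<phi> where *: "\<And>k. \<phi> k \<in> test_functions \<Omega>" "(\<lambda>k::nat. Hs_norm s (\<lambda>x. u x - \<phi> k x)) \<longlonglongrightarrow> 0"
    using Hs_tilde_seq[OF u] by metis
  note H = Hs_tilde_Hs[OF u] test_function_Hs[OF s *(1)]
  show ?thesis
  proof (rule Hs_tildeI_seq[where \<phi>="\<lambda>k x. c * \<phi> k x"])
    show "(\<lambda>x. c * u x) \<in> Hs s" by (intro Hs_cmult s H)
    show "(\<lambda>x. c * \<phi> k x) \<in> test_functions \<Omega>" for k by (intro test_functions_cmult *)
    have "Hs_norm s (\<lambda>x. c * u x - c * \<phi> k x) = \<bar>c\<bar> * Hs_norm s (\<lambda>x. u x - \<phi> k x)" for k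
      using Hs_norm_cmult[OF s Hs_diff[OF s H], of c k] by (simp add: right_diff_distrib)
    then show "(\<lambda>k. Hs_norm s (\<lambda>x. c * u x - c * \<phi> k x)) \<longlonglongrightarrow> 0"
      using tendsto_mult[OF tendsto_const[of "\<bar>c\<bar>"] *(2)] by simp
  qed
qed

lemma Hs_tilde_diff:
  assumes "s \<ge> 0" "u \<in> Hs_tilde s \<Omega>" "v \<in> Hs_tilde s \<Omega>"
  shows "(\<lambda>x. u x - v x) \<in> Hs_tilde s \<Omega>"
  using Hs_tilde_add[OF assms(1,2) Hs_tilde_cmult[OF assms(1,3), of "-1"]] by simp

lemma Hs_tilde_l2: "s \<ge> 0 \<Longrightarrow> u \<in> Hs_tilde s \<Omega> \<Longrightarrow> u \<in> l2 lborel"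
  using Hs_l2 Hs_tilde_Hs by blast

lemma Hs_tilde_borel: "s \<ge> 0 \<Longrightarrow> u \<in> Hs_tilde s \<Omega> \<Longrightarrow> u \<in> borel_measurable borel"
  using l2_measurable[OF Hs_tilde_l2] by simp

text \<open>The bound for test functions passes to limits by Fatou's lemma, along a subsequence
  converging almost everywhere on \<real>^n and hence, for differences, on the product. The norms of
  the approximants are controlled by that of u only up to e, which is removed at the end.\<close>

lemma Hs_tilde_gag_diff:
  fixes u :: "real^'n::finite \<Rightarrow> real"
  assumes u: "u \<in> Hs_tilde s \<Omega>" and s: "0 < s" "s < 1"
  shows "gag_diff s u \<in> l2 PP"
    and "l2_norm PP (gag_diff s u) \<le> sqrt (2 * levy_const TYPE('n) s) * Hs_norm s u"
proof -
  let ?K = "sqrt (2 * levy_const TYPE('n) s)"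
  have s0: "s \<ge> 0" using s by simp
  have K: "?K \<ge> 0" using levy_const_pos[OF s, where 'n='n] by simp
  have [measurable]: "u \<in> borel_measurable borel" by (rule Hs_tilde_borel[OF s0 u])
  have uH: "u \<in> Hs s" by (rule Hs_tilde_Hs[OF u])
  obtain \<phi> where \<phi>: "\<And>k. \<phi> k \<in> test_functions \<Omega>" "(\<lambda>k::nat. Hs_norm s (\<lambda>x. u x - \<phi> k x)) \<longlonglongrightarrow> 0"
    using Hs_tilde_seq[OF u] by metis
  note H = test_function_Hs[OF s0 \<phi>(1)]
  have "(\<lambda>k. l2_norm lborel (\<lambda>x. \<phi> k x - u x)) \<longlonglongrightarrow> 0"
  proof (rule Lim_null_comparison[OF _ \<phi>(2)])
    show "\<forall>\<^sub>F k in sequentially. norm (l2_norm lborel (\<lambda>x. \<phi> k x - u x)) \<le> Hs_norm s (\<lambda>x. u x - \<phi> k x)"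
      using l2_norm_le_Hs_norm[OF s0 Hs_diff[OF s0 uH H]] l2_norm_minus_commute[of lborel u]
      by (auto intro!: always_eventually)
  qed
  then obtain r :: "nat \<Rightarrow> nat" where r: "strict_mono r" "AE x in lborel. (\<lambda>n. \<phi> (r n) x) \<longlonglongrightarrow> u x"
    using l2_AE_subseq[of \<phi> lborel u] test_function_l2[OF \<phi>(1)] Hs_l2[OF s0 uH] by blast
  have lim: "AE p in PP. (\<lambda>n. gag_diff s (\<phi> (r n)) p) \<longlonglongrightarrow> gag_diff s u p"
    using AE_PP[OF r(2)] by eventually_elim (auto simp: gag_diff_def intro!: tendsto_intros)
  have main: "gag_diff s u \<in> l2 PP \<and> l2_norm PP (gag_diff s u) \<le> ?K * (Hs_norm s u + e)" if e: "e > 0" for e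
  proof -
    have "\<forall>\<^sub>F k in sequentially. Hs_norm s (\<lambda>x. u x - \<phi> k x) < e"
      using \<phi>(2) e by (rule order_tendstoD(2))
    then obtain N where N: "\<And>k. k \<ge> N \<Longrightarrow> Hs_norm s (\<lambda>x. u x - \<phi> k x) < e" by (auto simp: eventually_sequentially)
    have b: "l2_norm PP (gag_diff s (\<phi> (r (n + N)))) \<le> ?K * (Hs_norm s u + e)" for n
    proof -
      have "r (n + N) \<ge> N" using seq_suble[OF r(1), of "n + N"] by simp
      then have lt: "Hs_norm s (\<lambda>x. u x - \<phi> (r (n + N)) x) < e" by (rule N)
      have "Hs_norm s (\<phi> (r (n + N))) = Hs_norm s (\<lambda>x. u x + (\<phi> (r (n + N)) x - u x))" by simp
      also have "\<dots> \<le> Hs_norm s u + Hs_norm s (\<lambda>x. \<phi> (r (n + N)) x - u x)"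
        by (intro Hs_norm_add Hs_diff s0 uH H)
      also have "Hs_norm s (\<lambda>x. \<phi> (r (n + N)) x - u x) = Hs_norm s (\<lambda>x. u x - \<phi> (r (n + N)) x)"
        by (intro Hs_norm_minus_commute s0 uH H)
      finally have "Hs_norm s (\<phi> (r (n + N))) \<le> Hs_norm s u + e" using lt by simp
      from mult_left_mono[OF this K] show ?thesis
        using gag_diff_le_Hs_norm[OF \<phi>(1)[of "r (n + N)"] s] by linarith
    qed
    have lim': "AE p in PP. (\<lambda>n. gag_diff s (\<phi> (r (n + N))) p) \<longlonglongrightarrow> gag_diff s u p"
      using lim by eventually_elim (rule LIMSEQ_ignore_initial_segment)
    have g: "gag_diff s (\<phi> (r (n + N))) \<in> l2 PP" for n by (rule gag_diff_test_function(1)[OF \<phi>(1) s])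
    note F = l2_fatou[where f="\<lambda>n. gag_diff s (\<phi> (r (n + N)))", OF g b _ lim']
    show ?thesis by (intro conjI F) measurable
  qed
  show "gag_diff s u \<in> l2 PP" using main[of 1] by simp
  show "l2_norm PP (gag_diff s u) \<le> ?K * Hs_norm s u"
  proof (rule field_le_epsilon)
    fix e :: real assume e: "e > 0"
    have "k * (e / (k + 1)) \<le> e" if "k \<ge> 0" for k using that e by (simp add: field_simps)
    from this[OF K] have "?K * (e / (?K + 1)) \<le> e" .
    moreover have "l2_norm PP (gag_diff s u) \<le> ?K * (Hs_norm s u + e / (?K + 1))"
      using main[of "e / (?K + 1)"] K e by simp
    ultimately show "l2_norm PP (gag_diff s u) \<le> ?K * Hs_norm s u + e"
      unfolding distrib_left by linarith
  qed
qed

text \<open>For \<open>0 < s < 1\<close> this is convergence in $H^s$ on limits of test functions.\<close>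

definition energy_tendsto :: "real \<Rightarrow> (nat \<Rightarrow> real^'n::finite \<Rightarrow> real) \<Rightarrow> (real^'n \<Rightarrow> real) \<Rightarrow> bool" where
  "energy_tendsto s \<phi> u \<longleftrightarrow> (\<lambda>k. l2_norm lborel (\<lambda>x. \<phi> k x - u x)) \<longlonglongrightarrow> 0 \<and>
     (\<lambda>k. l2_norm PP (\<lambda>p. gag_diff s (\<phi> k) p - gag_diff s u p)) \<longlonglongrightarrow> 0"

lemma Hs_tendsto_energy:
  fixes u :: "real^'n::finite \<Rightarrow> real"
  assumes u: "u \<in> Hs_tilde s \<Omega>" and s: "0 < s" "s < 1" and \<phi>: "\<And>k. \<phi> k \<in> test_functions \<Omega>"
    and lim: "(\<lambda>k. Hs_norm s (\<lambda>x. u x - \<phi> k x)) \<longlonglongrightarrow> 0"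
  shows "energy_tendsto s \<phi> u"
proof -
  let ?K = "sqrt (2 * levy_const TYPE('n) s)"
  have s0: "s \<ge> 0" using s by simp
  have d: "(\<lambda>x. u x - \<phi> k x) \<in> Hs_tilde s \<Omega>" for k
    by (intro Hs_tilde_diff s0 u test_function_Hs_tilde \<phi>)
  have "(\<lambda>k. l2_norm lborel (\<lambda>x. \<phi> k x - u x)) \<longlonglongrightarrow> 0"
    using l2_norm_le_Hs_norm[OF s0 Hs_tilde_Hs[OF d]] l2_norm_minus_commute[of lborel u]
    by (intro Lim_null_comparison[OF _ lim] always_eventually) auto
  moreover have "(\<lambda>k. l2_norm PP (\<lambda>p. gag_diff s (\<phi> k) p - gag_diff s u p)) \<longlonglongrightarrow> 0"
  proof (rule Lim_null_comparison)
    show "(\<lambda>k. ?K * Hs_norm s (\<lambda>x. u x - \<phi> k x)) \<longlonglongrightarrow> 0"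
      using tendsto_mult[OF tendsto_const[of ?K] lim] by simp
    show "\<forall>\<^sub>F k in sequentially. norm (l2_norm PP (\<lambda>p. gag_diff s (\<phi> k) p - gag_diff s u p)) \<le> ?K * Hs_norm s (\<lambda>x. u x - \<phi> k x)"
      using Hs_tilde_gag_diff(2)[OF d s] l2_norm_minus_commute[of PP "gag_diff s u"]
      unfolding gag_diff_diff by (intro always_eventually) auto
  qed
  ultimately show ?thesis by (simp add: energy_tendsto_def)
qed

lemma Hs_tilde_energy_seq:
  fixes u :: "real^'n::finite \<Rightarrow> real"
  assumes u: "u \<in> Hs_tilde s \<Omega>" and s: "0 < s" "s < 1"
  obtains \<phi> where "\<And>k. \<phi> k \<in> test_functions \<Omega>" "energy_tendsto s \<phi> u"
  using Hs_tilde_seq[OF u] Hs_tendsto_energy[OF u s] by metis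

section \<open>Multiplication by smooth functions\<close>

text \<open>The minimum records boundedness and Lipschitz continuity of the increments in one
  constant; its square is integrable against the kernel, which is what multiplication on functions
  of finite energy requires.\<close>

definition smooth_multiplier :: "(real^'n::finite \<Rightarrow> real) \<Rightarrow> real \<Rightarrow> real \<Rightarrow> bool" where
  "smooth_multiplier b B L \<longleftrightarrow> smooth b \<and> (\<forall>x. \<bar>b x\<bar> \<le> B) \<and> (\<forall>x y. \<bar>b x - b y\<bar> \<le> L * min 1 (norm (x - y)))"

lemma test_function_bounded:
  fixes u :: "real^'n::finite \<Rightarrow> real"
  assumes "u \<in> test_functions U" obtains B where "B \<ge> 0" "\<And>x. \<bar>u x\<bar> \<le> B"
  using schwartz_bounded[OF test_function_schwartz[OF assms]] by auto

text \<open>Under Fourier inversion an increment carries the factor e^(i (x - y).\<xi>) - 1, which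
  is at most 2 min(1, |x - y|)(1 + |\<xi>|), and the transform has a finite first moment.\<close>

lemma test_function_lipschitz:
  fixes u :: "real^'n::finite \<Rightarrow> real"
  assumes u: "u \<in> test_functions U"
  obtains L where "L \<ge> 0" "\<And>x y. \<bar>u x - u y\<bar> \<le> L * min 1 (norm (x - y))"
proof -
  let ?u = "\<lambda>x. complex_of_real (u x)"
  have su: "?u \<in> schwartz" by (rule test_function_schwartz[OF u])
  have sF: "fourier ?u \<in> schwartz" by (rule schwartz_fourier[OF su])
  let ?I = "\<integral>\<xi>. cmod (fourier ?u \<xi>) * (1 + norm \<xi>) \<partial>lborel"
  define c where "c = inverse ((2 * pi) ^ CARD('n))"
  have c: "c > 0" by (simp add: c_def)
  have iF: "integrable lborel (\<lambda>\<xi>. cmod (fourier ?u \<xi>) * (1 + norm \<xi>))"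
    using Bochner_Integration.integrable_add[OF schwartz_integrable_moment[OF sF, of 0] schwartz_integrable_moment[OF sF, of 1]]
    by (simp add: algebra_simps)
  have inv: "?u y = c *\<^sub>R (\<integral>\<xi>. exp (\<i> * complex_of_real (y \<bullet> \<xi>)) * fourier ?u \<xi> \<partial>lborel)" for y
    using fun_cong[OF inverse_fourier_fourier[OF su], of y] unfolding inverse_fourier_def c_def by (rule sym)
  have i: "integrable lborel (\<lambda>\<xi>. exp (\<i> * complex_of_real (y \<bullet> \<xi>)) * fourier ?u \<xi>)" for y
    by (rule integrable_bounded_mult[OF schwartz_integrable[OF sF], where C=1]) auto
  have "\<bar>u x - u y\<bar> \<le> (2 * c * ?I) * min 1 (norm (x - y))" for x y
  proof -
    let ?f = "\<lambda>\<xi>. exp (\<i> * complex_of_real (x \<bullet> \<xi>)) * fourier ?u \<xi> - exp (\<i> * complex_of_real (y \<bullet> \<xi>)) * fourier ?u \<xi>"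
    have uf: "?u x - ?u y = c *\<^sub>R (\<integral>\<xi>. ?f \<xi> \<partial>lborel)"
      unfolding inv[of x] inv[of y] scaleR_diff_right[symmetric]
      by (subst Bochner_Integration.integral_diff[OF i i]) rule
    have "\<bar>u x - u y\<bar> = cmod (?u x - ?u y)" unfolding of_real_diff[symmetric] norm_of_real ..
    also have "\<dots> = c * cmod (\<integral>\<xi>. ?f \<xi> \<partial>lborel)" unfolding uf norm_scaleR using c by simp
    also have "cmod (\<integral>\<xi>. ?f \<xi> \<partial>lborel) \<le> (\<integral>\<xi>. 2 * min 1 (norm (x - y)) * (cmod (fourier ?u \<xi>) * (1 + norm \<xi>)) \<partial>lborel)"
    proof (rule Bochner_Integration.integral_norm_bound_integral)
      show "integrable lborel ?f" by (intro Bochner_Integration.integrable_diff i)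
      show "integrable lborel (\<lambda>\<xi>. 2 * min 1 (norm (x - y)) * (cmod (fourier ?u \<xi>) * (1 + norm \<xi>)))"
        by (intro integrable_mult_right iF)
      fix \<xi> :: "real^'n"
      let ?t = "(x - y) \<bullet> \<xi>"
      have "exp (\<i> * complex_of_real (x \<bullet> \<xi>)) = exp (\<i> * complex_of_real (y \<bullet> \<xi>)) * exp (\<i> * complex_of_real ?t)"
        by (simp add: exp_add[symmetric] inner_diff_left algebra_simps)
      then have "?f \<xi> = exp (\<i> * complex_of_real (y \<bullet> \<xi>)) * (exp (\<i> * complex_of_real ?t) - 1) * fourier ?u \<xi>"
        by (simp add: algebra_simps)
      then have "cmod (?f \<xi>) = cmod (exp (\<i> * complex_of_real ?t) - 1) * cmod (fourier ?u \<xi>)"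
        by (simp add: norm_mult)
      also have "cmod (exp (\<i> * complex_of_real ?t) - 1) \<le> 2 * (min 1 (norm (x - y)) * (1 + norm \<xi>))"
      proof (rule power2_le_imp_le)
        have "2 * (1 - cos ?t) \<le> 4 * ((1 + (norm \<xi>)\<^sup>2) * min 1 ((norm (x - y))\<^sup>2))"
        proof -
          have "2 * a \<le> 4 * b" if "a \<le> 2 * b" for a b :: real using that by simp
          then show ?thesis using one_minus_cos_le[of "x - y" \<xi>, unfolded mult.assoc] by blast
        qed
        also have "(1 + (norm \<xi>)\<^sup>2) * min 1 ((norm (x - y))\<^sup>2) \<le> (1 + norm \<xi>)\<^sup>2 * (min 1 (norm (x - y)))\<^sup>2"
        proof (rule mult_mono)
          show "1 + (norm \<xi>)\<^sup>2 \<le> (1 + norm \<xi>)\<^sup>2" unfolding power2_sum using norm_ge_zero[of \<xi>] by simp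
          show "min 1 ((norm (x - y))\<^sup>2) \<le> (min 1 (norm (x - y)))\<^sup>2" by (simp add: min_def)
        qed auto
        finally show "(cmod (exp (\<i> * complex_of_real ?t) - 1))\<^sup>2 \<le> (2 * (min 1 (norm (x - y)) * (1 + norm \<xi>)))\<^sup>2"
          unfolding character_minus_1_sq power_mult_distrib by (simp add: mult.commute)
      qed (auto intro!: mult_nonneg_nonneg)
      finally show "cmod (?f \<xi>) \<le> 2 * min 1 (norm (x - y)) * (cmod (fourier ?u \<xi>) * (1 + norm \<xi>))"
        by (simp add: mult_right_mono ac_simps)
    qed
    also have "\<dots> = 2 * min 1 (norm (x - y)) * ?I" by simp
    finally show ?thesis using c by (simp add: ac_simps)
  qed
  moreover have "2 * c * ?I \<ge> 0"
    using c by (intro mult_nonneg_nonneg Bochner_Integration.integral_nonneg) auto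
  ultimately show ?thesis using that by blast
qed

text \<open>Leibniz rule for differences: b(x)u(x) - b(y)u(y) = b(x)(u(x) - u(y)) + (b(x) -
  b(y))u(y). The first part costs B times the energy norm. In the second the integral over x - y
  separates from u and is finite by \<open>integrable_frac_kernel_weight\<close>.\<close>

lemma gag_diff_mult:
  fixes b u :: "real^'n::finite \<Rightarrow> real"
  assumes b: "smooth_multiplier b B L" and s: "0 < s" "s < 1"
    and u: "u \<in> l2 lborel" and gu: "gag_diff s u \<in> l2 PP"
  shows "(\<lambda>x. b x * u x) \<in> l2 lborel" "l2_norm lborel (\<lambda>x. b x * u x) \<le> B * l2_norm lborel u"
    and "gag_diff s (\<lambda>x. b x * u x) \<in> l2 PP"
    and "l2_norm PP (gag_diff s (\<lambda>x. b x * u x)) \<le> B * l2_norm PP (gag_diff s u)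
      + L * sqrt (\<integral>z. min 1 ((norm z)\<^sup>2) * frac_kernel s z \<partial>(lborel :: (real^'n) measure)) * l2_norm lborel u"
proof -
  let ?I = "\<integral>z. min 1 ((norm z)\<^sup>2) * frac_kernel s z \<partial>(lborel :: (real^'n) measure)"
  have bB: "\<And>x. \<bar>b x\<bar> \<le> B" and bL: "\<And>x y. \<bar>b x - b y\<bar> \<le> L * min 1 (norm (x - y))"
    using b by (auto simp: smooth_multiplier_def)
  have B: "B \<ge> 0" using bB[of 0] by linarith
  \<comment> \<open>Two points at distance 1 show that L is nonnegative.\<close>
  have "0 \<le> L * min 1 (norm ((axis (SOME i. True) 1 :: real^'n) - 0))"
    using bL[of "axis (SOME i. True) 1" 0] by linarith
  then have L: "L \<ge> 0" by (simp add: norm_axis_1)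
  have [measurable]: "b \<in> borel_measurable borel" "u \<in> borel_measurable borel"
    using b l2_measurable[OF u] by (auto simp: smooth_multiplier_def smooth_borel_measurable)
  have bdd: "\<bar>b x * t\<bar> \<le> \<bar>B * t\<bar>" for x t
    using mult_right_mono[OF bB[of x], of "\<bar>t\<bar>"] B by (simp add: abs_mult)
  show "(\<lambda>x. b x * u x) \<in> l2 lborel"
    by (rule l2_bound(1)[OF l2_cmult[OF u, of B]]) (auto simp: bdd)
  show "l2_norm lborel (\<lambda>x. b x * u x) \<le> B * l2_norm lborel u"
    using l2_bound(2)[OF l2_cmult[OF u, of B], of "\<lambda>x. b x * u x"] bdd B by (simp add: l2_norm_cmult)
  let ?h1 = "\<lambda>p. b (fst p) * gag_diff s u p"
  let ?h2 = "\<lambda>p. (b (fst p) - b (snd p)) * u (snd p) * sqrt (frac_kernel s (fst p - snd p))"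
  have eq: "gag_diff s (\<lambda>x. b x * u x) = (\<lambda>p. ?h1 p + ?h2 p)"
    by (simp add: gag_diff_def fun_eq_iff algebra_simps)
  have h1: "?h1 \<in> l2 PP" "l2_norm PP ?h1 \<le> B * l2_norm PP (gag_diff s u)"
    using l2_bound[OF l2_cmult[OF gu, of B], of ?h1] bdd B by (auto simp: l2_norm_cmult)
  have iW: "integrable lborel (\<lambda>z. min 1 ((norm z)\<^sup>2) * frac_kernel s (z :: real^'n))"
    by (rule integrable_frac_kernel_weight[OF s])
  have I: "?I \<ge> 0" by (intro Bochner_Integration.integral_nonneg) auto
  have "(\<integral>\<^sup>+p. ennreal ((?h2 p)\<^sup>2) \<partial>PP) \<le> (\<integral>\<^sup>+p. ennreal (L\<^sup>2 * (min 1 ((norm (fst p - snd p))\<^sup>2) * frac_kernel s (fst p - snd p)) * (u (snd p))\<^sup>2) \<partial>PP)"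
  proof (intro nn_integral_mono ennreal_leI)
    fix p :: "(real^'n) \<times> (real^'n)"
    have "\<bar>b (fst p) - b (snd p)\<bar>\<^sup>2 \<le> (L * min 1 (norm (fst p - snd p)))\<^sup>2"
      by (rule power_mono[OF bL]) simp
    also have "\<dots> = L\<^sup>2 * min 1 ((norm (fst p - snd p))\<^sup>2)"
    proof -
      have "(min 1 t)\<^sup>2 = min 1 (t\<^sup>2)" if "t \<ge> 0" for t :: real
        using that power_le_one[of t 2] one_le_power[of t 2] by (cases "t \<le> 1") (auto simp: min_def)
      then show ?thesis by (simp add: power_mult_distrib)
    qed
    finally have "(b (fst p) - b (snd p))\<^sup>2 * ((u (snd p))\<^sup>2 * frac_kernel s (fst p - snd p)) \<le> L\<^sup>2 * min 1 ((norm (fst p - snd p))\<^sup>2) * ((u (snd p))\<^sup>2 * frac_kernel s (fst p - snd p))"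
      by (intro mult_right_mono) auto
    then show "(?h2 p)\<^sup>2 \<le> L\<^sup>2 * (min 1 ((norm (fst p - snd p))\<^sup>2) * frac_kernel s (fst p - snd p)) * (u (snd p))\<^sup>2"
      by (simp add: power_mult_distrib ac_simps)
  qed
  also have "\<dots> = (\<integral>\<^sup>+z. \<integral>\<^sup>+x. ennreal (L\<^sup>2 * (min 1 ((norm z)\<^sup>2) * frac_kernel s z) * (u x)\<^sup>2) \<partial>lborel \<partial>(lborel :: (real^'n) measure))"
    by (subst nn_integral_PP_shift[of "\<lambda>x y. ennreal (L\<^sup>2 * (min 1 ((norm (x - y))\<^sup>2) * frac_kernel s (x - y)) * (u y)\<^sup>2)"]) auto
  also have "\<dots> = (\<integral>\<^sup>+z. ennreal (min 1 ((norm z)\<^sup>2) * frac_kernel s z) * ennreal (L\<^sup>2 * (l2_norm lborel u)\<^sup>2) \<partial>(lborel :: (real^'n) measure))"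
  proof (rule nn_integral_cong)
    fix z :: "real^'n"
    have "(\<integral>\<^sup>+x. ennreal (L\<^sup>2 * (min 1 ((norm z)\<^sup>2) * frac_kernel s z) * (u x)\<^sup>2) \<partial>lborel)
       = ennreal (\<integral>x. L\<^sup>2 * (min 1 ((norm z)\<^sup>2) * frac_kernel s z) * (u x)\<^sup>2 \<partial>lborel)"
      by (intro nn_integral_eq_integral integrable_mult_right l2_integrable_sq u) auto
    also have "\<dots> = ennreal ((min 1 ((norm z)\<^sup>2) * frac_kernel s z) * (L\<^sup>2 * (l2_norm lborel u)\<^sup>2))"
      by (simp add: l2_norm_sq ac_simps)
    finally show "(\<integral>\<^sup>+x. ennreal (L\<^sup>2 * (min 1 ((norm z)\<^sup>2) * frac_kernel s z) * (u x)\<^sup>2) \<partial>lborel)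
       = ennreal (min 1 ((norm z)\<^sup>2) * frac_kernel s z) * ennreal (L\<^sup>2 * (l2_norm lborel u)\<^sup>2)"
      by (simp add: ennreal_mult)
  qed
  also have "\<dots> = ennreal ?I * ennreal (L\<^sup>2 * (l2_norm lborel u)\<^sup>2)"
    by (simp add: nn_integral_multc nn_integral_eq_integral[OF iW])
  also have "\<dots> = ennreal ((L * sqrt ?I * l2_norm lborel u)\<^sup>2)"
    using I by (simp add: ennreal_mult[symmetric] power_mult_distrib ac_simps)
  finally have le: "(\<integral>\<^sup>+p. ennreal ((?h2 p)\<^sup>2) \<partial>PP) \<le> ennreal ((L * sqrt ?I * l2_norm lborel u)\<^sup>2)" .
  have m2: "?h2 \<in> borel_measurable PP" by measurable
  have i2: "integrable PP (\<lambda>p. (?h2 p)\<^sup>2)"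
    unfolding integrable_iff_bounded using m2 order_le_less_trans[OF le ennreal_less_top] by simp
  then have h2: "?h2 \<in> l2 PP" using m2 by (intro l2I)
  have "(l2_norm PP ?h2)\<^sup>2 \<le> (L * sqrt ?I * l2_norm lborel u)\<^sup>2"
    using le nn_integral_eq_integral[OF i2] unfolding l2_norm_sq by (simp add: ennreal_le_iff)
  then have n2: "l2_norm PP ?h2 \<le> L * sqrt ?I * l2_norm lborel u"
    by (rule power2_le_imp_le) (use L I in auto)
  show "gag_diff s (\<lambda>x. b x * u x) \<in> l2 PP" unfolding eq by (intro l2_add h1 h2)
  show "l2_norm PP (gag_diff s (\<lambda>x. b x * u x)) \<le> B * l2_norm PP (gag_diff s u) + L * sqrt ?I * l2_norm lborel u"
    unfolding eq using l2_triangle[OF h1(1) h2] h1(2) n2 by linarith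
qed

text \<open>The estimates of \<open>gag_diff_mult\<close> are linear in the function, so they apply
  to \<phi> k - u.\<close>

lemma energy_tendsto_mult:
  fixes b u :: "real^'n::finite \<Rightarrow> real"
  assumes b: "smooth_multiplier b B L" and s: "0 < s" "s < 1"
    and \<phi>: "\<And>k. \<phi> k \<in> l2 lborel" "\<And>k. gag_diff s (\<phi> k) \<in> l2 PP"
    and u: "u \<in> l2 lborel" "gag_diff s u \<in> l2 PP" and lim: "energy_tendsto s \<phi> u"
  shows "energy_tendsto s (\<lambda>k x. b x * \<phi> k x) (\<lambda>x. b x * u x)"
proof -
  let ?I = "\<integral>z. min 1 ((norm z)\<^sup>2) * frac_kernel s z \<partial>(lborel :: (real^'n) measure)"
  have d: "(\<lambda>x. \<phi> k x - u x) \<in> l2 lborel" "gag_diff s (\<lambda>x. \<phi> k x - u x) \<in> l2 PP" for k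
    unfolding gag_diff_diff by (intro l2_diff \<phi> u)+
  note m = gag_diff_mult[OF b s d]
  have e: "(\<lambda>x. b x * \<phi> k x - b x * u x) = (\<lambda>x. b x * (\<phi> k x - u x))" for k
    by (simp add: algebra_simps)
  have l: "(\<lambda>k. l2_norm lborel (\<lambda>x. \<phi> k x - u x)) \<longlonglongrightarrow> 0" "(\<lambda>k. l2_norm PP (gag_diff s (\<lambda>x. \<phi> k x - u x))) \<longlonglongrightarrow> 0"
    using lim unfolding energy_tendsto_def gag_diff_diff by auto
  have "(\<lambda>k. l2_norm lborel (\<lambda>x. b x * \<phi> k x - b x * u x)) \<longlonglongrightarrow> 0"
    unfolding e
  proof (rule Lim_null_comparison)
    show "\<forall>\<^sub>F k in sequentially. norm (l2_norm lborel (\<lambda>x. b x * (\<phi> k x - u x))) \<le> B * l2_norm lborel (\<lambda>x. \<phi> k x - u x)"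
      using m(2) by (intro always_eventually) auto
    show "(\<lambda>k. B * l2_norm lborel (\<lambda>x. \<phi> k x - u x)) \<longlonglongrightarrow> 0"
      using tendsto_mult[OF tendsto_const[of B] l(1)] by simp
  qed
  moreover have "(\<lambda>k. l2_norm PP (gag_diff s (\<lambda>x. b x * \<phi> k x - b x * u x))) \<longlonglongrightarrow> 0"
    unfolding e
  proof (rule Lim_null_comparison)
    show "\<forall>\<^sub>F k in sequentially. norm (l2_norm PP (gag_diff s (\<lambda>x. b x * (\<phi> k x - u x)))) \<le> B * l2_norm PP (gag_diff s (\<lambda>x. \<phi> k x - u x)) + L * sqrt ?I * l2_norm lborel (\<lambda>x. \<phi> k x - u x)"
      using m(4) by (intro always_eventually) auto
    show "(\<lambda>k. B * l2_norm PP (gag_diff s (\<lambda>x. \<phi> k x - u x)) + L * sqrt ?I * l2_norm lborel (\<lambda>x. \<phi> k x - u x)) \<longlonglongrightarrow> 0"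
      using tendsto_add[OF tendsto_mult[OF tendsto_const[of B] l(2)] tendsto_mult[OF tendsto_const[of "L * sqrt ?I"] l(1)]] by simp
  qed
  ultimately show ?thesis unfolding energy_tendsto_def gag_diff_diff by simp
qed

text \<open>The product estimate is available for the energy; the equivalence of energy and H^s norm
  on test functions carries it over to H^s.\<close>

lemma Hs_norm_mult_le:
  fixes b :: "real^'n::finite \<Rightarrow> real"
  assumes b: "smooth_multiplier b B L" and s: "0 < s" "s < 1"
  obtains C where "C \<ge> 0" "\<And>u U. u \<in> test_functions U \<Longrightarrow> Hs_norm s (\<lambda>x. b x * u x) \<le> C * Hs_norm s u"
proof -
  let ?K = "levy_const TYPE('n) s"
  let ?M = "L * sqrt (\<integral>z. min 1 ((norm z)\<^sup>2) * frac_kernel s z \<partial>(lborel :: (real^'n) measure))"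
  define C where "C = 2 * B\<^sup>2 + (B * sqrt (2 * ?K) + ?M)\<^sup>2 / ?K"
  have K: "?K > 0" by (rule levy_const_pos[OF s])
  have C: "C \<ge> 0" using K by (simp add: C_def)
  have s0: "s \<ge> 0" using s by simp
  have sb: "smooth b" and bB: "\<And>x. \<bar>b x\<bar> \<le> B" and bL: "\<And>x y. \<bar>b x - b y\<bar> \<le> L * min 1 (norm (x - y))"
    using b by (auto simp: smooth_multiplier_def)
  have B: "B \<ge> 0" using bB[of 0] by linarith
  have "0 \<le> L * min 1 (norm ((axis (SOME i. True) 1 :: real^'n) - 0))"
    using bL[of "axis (SOME i. True) 1" 0] by linarith
  then have M: "?M \<ge> 0" by (simp add: norm_axis_1 Bochner_Integration.integral_nonneg)
  have "Hs_norm s (\<lambda>x. b x * u x) \<le> sqrt C * Hs_norm s u" if u: "u \<in> test_functions U" for u U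
  proof (rule power2_le_imp_le)
    let ?n = "Hs_norm s u"
    have n: "?n \<ge> 0" by (rule Hs_norm_nonneg)
    note m = gag_diff_mult[OF b s test_function_l2[OF u] gag_diff_test_function(1)[OF u s]]
    have u1: "l2_norm lborel u \<le> ?n" by (rule l2_norm_le_Hs_norm[OF s0 test_function_Hs[OF s0 u]])
    have "l2_norm lborel (\<lambda>x. b x * u x) \<le> B * ?n"
      using m(2) mult_left_mono[OF u1 B] by linarith
    then have 1: "(l2_norm lborel (\<lambda>x. b x * u x))\<^sup>2 \<le> (B * ?n)\<^sup>2" by (intro power_mono) auto
    have "l2_norm PP (gag_diff s (\<lambda>x. b x * u x)) \<le> B * (sqrt (2 * ?K) * ?n) + ?M * ?n"
      using m(4) mult_left_mono[OF u1 M] mult_left_mono[OF gag_diff_le_Hs_norm[OF u s] B] by linarith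
    then have 2: "(l2_norm PP (gag_diff s (\<lambda>x. b x * u x)))\<^sup>2 \<le> ((B * sqrt (2 * ?K) + ?M) * ?n)\<^sup>2"
      by (intro power_mono) (auto simp: algebra_simps)
    have "(Hs_norm s (\<lambda>x. b x * u x))\<^sup>2 \<le> 2 * (l2_norm lborel (\<lambda>x. b x * u x))\<^sup>2 + (l2_norm PP (gag_diff s (\<lambda>x. b x * u x)))\<^sup>2 / ?K"
      by (rule Hs_norm_le_energy[OF test_functions_mult[OF u sb] s])
    also have "\<dots> \<le> 2 * (B * ?n)\<^sup>2 + ((B * sqrt (2 * ?K) + ?M) * ?n)\<^sup>2 / ?K"
      using 1 2 K by (intro add_mono divide_right_mono mult_left_mono) auto
    also have "\<dots> = C * ?n\<^sup>2" unfolding C_def power_mult_distrib by (simp add: distrib_right)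
    also have "\<dots> = (sqrt C * ?n)\<^sup>2" using C by (simp add: power_mult_distrib)
    finally show "(Hs_norm s (\<lambda>x. b x * u x))\<^sup>2 \<le> (sqrt C * ?n)\<^sup>2" .
  qed (intro mult_nonneg_nonneg real_sqrt_ge_zero C Hs_norm_nonneg)
  then show ?thesis using that[of "sqrt C"] C by simp
qed

text \<open>The products b \<phi>_k with the approximants are Cauchy in H^s. Their limit agrees with
  b u almost everywhere, because both are L^2 limits of the same sequence.\<close>

lemma Hs_tilde_mult:
  fixes b u :: "real^'n::finite \<Rightarrow> real"
  assumes b: "smooth_multiplier b B L" and s: "0 < s" "s < 1" and u: "u \<in> Hs_tilde s \<Omega>"
  shows "(\<lambda>x. b x * u x) \<in> Hs_tilde s \<Omega>"
proof -
  have s0: "s \<ge> 0" using s by simp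
  have sb: "smooth b" and bB: "\<And>x. \<bar>b x\<bar> \<le> B" using b by (auto simp: smooth_multiplier_def)
  have [measurable]: "b \<in> borel_measurable borel" "u \<in> borel_measurable borel"
    using smooth_borel_measurable[OF sb] Hs_tilde_borel[OF s0 u] by auto
  obtain \<phi> where \<phi>: "\<And>k. \<phi> k \<in> test_functions \<Omega>" "(\<lambda>k::nat. Hs_norm s (\<lambda>x. u x - \<phi> k x)) \<longlonglongrightarrow> 0"
    using Hs_tilde_seq[OF u] by metis
  note H = test_function_Hs[OF s0 \<phi>(1)]
  have uH: "u \<in> Hs s" by (rule Hs_tilde_Hs[OF u])
  let ?\<psi> = "\<lambda>k x. b x * \<phi> k x"
  have \<psi>: "?\<psi> k \<in> test_functions \<Omega>" for k by (rule test_functions_mult[OF \<phi>(1) sb])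
  note H\<psi> = test_function_Hs[OF s0 \<psi>]
  obtain C where C: "C \<ge> 0" "\<And>u U. u \<in> test_functions U \<Longrightarrow> Hs_norm s (\<lambda>x. b x * u x) \<le> C * Hs_norm s u"
    using Hs_norm_mult_le[OF b s] by metis
  have "\<exists>N. \<forall>m\<ge>N. \<forall>n\<ge>N. Hs_norm s (\<lambda>x. ?\<psi> m x - ?\<psi> n x) < e" if e: "e > 0" for e
  proof -
    have "e / (2 * (C + 1)) > 0" using e C by simp
    then have "\<forall>\<^sub>F k in sequentially. Hs_norm s (\<lambda>x. u x - \<phi> k x) < e / (2 * (C + 1))"
      using \<phi>(2) by (rule order_tendstoD(2)[rotated])
    then obtain N where N: "\<And>k. k \<ge> N \<Longrightarrow> Hs_norm s (\<lambda>x. u x - \<phi> k x) < e / (2 * (C + 1))" by (auto simp: eventually_sequentially)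
    have "Hs_norm s (\<lambda>x. ?\<psi> m x - ?\<psi> n x) < e" if "m \<ge> N" "n \<ge> N" for m n
    proof -
      have "Hs_norm s (\<lambda>x. ?\<psi> m x - ?\<psi> n x) = Hs_norm s (\<lambda>x. b x * (\<phi> m x - \<phi> n x))"
        by (simp add: right_diff_distrib)
      also have "\<dots> \<le> C * Hs_norm s (\<lambda>x. \<phi> m x - \<phi> n x)"
        by (rule C(2)[OF test_functions_diff[OF \<phi>(1) \<phi>(1)]])
      also have "\<dots> \<le> (C + 1) * Hs_norm s (\<lambda>x. \<phi> m x - \<phi> n x)"
        by (intro mult_right_mono Hs_norm_nonneg) simp
      also have "\<dots> < (C + 1) * (e / (2 * (C + 1)) + e / (2 * (C + 1)))"
      proof (rule mult_strict_left_mono)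
        show "Hs_norm s (\<lambda>x. \<phi> m x - \<phi> n x) < e / (2 * (C + 1)) + e / (2 * (C + 1))"
          using Hs_norm_diff_triangle[OF s0 H[of m] uH H[of n]] Hs_norm_minus_commute[OF s0 H[of m] uH]
            N[OF that(1)] N[OF that(2)] by linarith
      qed (use C in simp)
      also have "\<dots> = e"
      proof -
        have "t * (e / (2 * t) + e / (2 * t)) = e" if "t > 0" for t using that by (simp add: field_simps)
        from this[of "C + 1"] show ?thesis using C(1) by simp
      qed
      finally show ?thesis .
    qed
    then show ?thesis by blast
  qed
  then obtain w where w: "w \<in> Hs s" "(\<lambda>k. Hs_norm s (\<lambda>x. ?\<psi> k x - w x)) \<longlonglongrightarrow> 0"
    using Hs_complete[of s ?\<psi>] s0 H\<psi> by blast
  have uL: "u \<in> l2 lborel" and wL: "w \<in> l2 lborel" using Hs_l2[OF s0] uH w(1) by auto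
  have buL: "(\<lambda>x. b x * u x) \<in> l2 lborel"
    by (rule gag_diff_mult(1)[OF b s uL Hs_tilde_gag_diff(1)[OF u s]])
  have "l2_norm lborel (\<lambda>x. b x * u x - w x) \<le> B * Hs_norm s (\<lambda>x. u x - \<phi> k x) + Hs_norm s (\<lambda>x. ?\<psi> k x - w x)" for k
  proof -
    have d: "(\<lambda>x. u x - \<phi> k x) \<in> Hs_tilde s \<Omega>" by (intro Hs_tilde_diff s0 u test_function_Hs_tilde \<phi>)
    have "l2_norm lborel (\<lambda>x. b x * u x - ?\<psi> k x) = l2_norm lborel (\<lambda>x. b x * (u x - \<phi> k x))" by (simp add: right_diff_distrib)
    also have "\<dots> \<le> B * l2_norm lborel (\<lambda>x. u x - \<phi> k x)"
      by (rule gag_diff_mult(2)[OF b s Hs_tilde_l2[OF s0 d] Hs_tilde_gag_diff(1)[OF d s]])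
    also have "\<dots> \<le> B * Hs_norm s (\<lambda>x. u x - \<phi> k x)"
      using bB[of 0] by (intro mult_left_mono l2_norm_le_Hs_norm s0 Hs_tilde_Hs[OF d]) linarith
    finally show ?thesis
      using l2_triangle_diff[OF buL test_function_l2[OF \<psi>[of k]] wL]
        l2_norm_le_Hs_norm[OF s0 Hs_diff[OF s0 H\<psi>[of k] w(1)]] by linarith
  qed
  moreover have "(\<lambda>k. B * Hs_norm s (\<lambda>x. u x - \<phi> k x) + Hs_norm s (\<lambda>x. ?\<psi> k x - w x)) \<longlonglongrightarrow> 0"
    using tendsto_add[OF tendsto_mult[OF tendsto_const[of B] \<phi>(2)] w(2)] by simp
  ultimately have "l2_norm lborel (\<lambda>x. b x * u x - w x) \<le> 0"
    by (intro LIMSEQ_le_const) auto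
  then have "l2_norm lborel (\<lambda>x. b x * u x - w x) = 0" using l2_norm_nonneg by (intro antisym) auto
  from l2_norm_eq_0[OF l2_diff[OF buL wL] this]
  have ae: "AE x in lborel. b x * u x = w x" by simp
  show ?thesis
  proof (rule Hs_tildeI_seq[where \<phi>="?\<psi>"])
    show "(\<lambda>x. b x * u x) \<in> Hs s" by (rule Hs_cong_AE(1)[OF s0 w(1) _ ae]) measurable
    have "Hs_norm s (\<lambda>x. b x * u x - ?\<psi> k x) = Hs_norm s (\<lambda>x. w x - ?\<psi> k x)" for k
    proof (rule Hs_cong_AE(2)[OF s0 Hs_diff[OF s0 w(1) H\<psi>]])
      have [measurable]: "\<phi> k \<in> borel_measurable borel" by (rule test_function_measurable[OF \<phi>(1)])
      show "(\<lambda>x. b x * u x - ?\<psi> k x) \<in> borel_measurable borel" by measurable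
      show "AE x in lborel. b x * u x - ?\<psi> k x = w x - ?\<psi> k x" using ae by eventually_elim simp
    qed
    then show "(\<lambda>k. Hs_norm s (\<lambda>x. b x * u x - ?\<psi> k x)) \<longlonglongrightarrow> 0"
      using w(2) Hs_norm_minus_commute[OF s0 w(1) H\<psi>] by simp
  qed (rule \<psi>)
qed

section \<open>Bilinear forms\<close>

text \<open>The bilinear form of the reduced equation (-\<Delta>)^s v + v = 0. It is positive
  definite up to null sets, so it serves as an inner product.\<close>

definition energy_form :: "real \<Rightarrow> (real^'n::finite \<Rightarrow> real) \<Rightarrow> (real^'n \<Rightarrow> real) \<Rightarrow> real" where
  "energy_form s u v = frac_const TYPE('n) s / 2 * (\<integral>p. gag_diff s u p * gag_diff s v p \<partial>PP) + (\<integral>x. u x * v x \<partial>lborel)"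

text \<open>Here both integrals in \<open>energy_form\<close> converge absolutely, so the form may
  be expanded by bilinearity.\<close>

definition finite_energy :: "real \<Rightarrow> (real^'n::finite \<Rightarrow> real) set" where
  "finite_energy s = {u \<in> l2 lborel. gag_diff s u \<in> l2 PP}"

lemma Hs_tilde_finite_energy: "u \<in> Hs_tilde s \<Omega> \<Longrightarrow> 0 < s \<Longrightarrow> s < 1 \<Longrightarrow> u \<in> finite_energy s"
  by (auto simp: finite_energy_def intro: Hs_tilde_gag_diff(1) Hs_tilde_l2 less_imp_le)

lemma test_function_finite_energy: "u \<in> test_functions U \<Longrightarrow> 0 < s \<Longrightarrow> s < 1 \<Longrightarrow> u \<in> finite_energy s"
  using gag_diff_test_function(1) test_function_l2 by (auto simp: finite_energy_def)

lemma finite_energy_add: "u \<in> finite_energy s \<Longrightarrow> v \<in> finite_energy s \<Longrightarrow> (\<lambda>x. u x + v x) \<in> finite_energy s"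
  by (auto simp: finite_energy_def gag_diff_add intro: l2_add)

lemma finite_energy_cmult: "u \<in> finite_energy s \<Longrightarrow> (\<lambda>x. c * u x) \<in> finite_energy s"
  by (auto simp: finite_energy_def gag_diff_cmult intro: l2_cmult)

lemma finite_energy_diff: "u \<in> finite_energy s \<Longrightarrow> v \<in> finite_energy s \<Longrightarrow> (\<lambda>x. u x - v x) \<in> finite_energy s"
  by (auto simp: finite_energy_def gag_diff_diff intro: l2_diff)

lemma finite_energy_mult:
  "smooth_multiplier b B L \<Longrightarrow> 0 < s \<Longrightarrow> s < 1 \<Longrightarrow> u \<in> finite_energy s \<Longrightarrow> (\<lambda>x. b x * u x) \<in> finite_energy s"
  using gag_diff_mult(1,3) by (auto simp: finite_energy_def)

lemma energy_form_commute: "energy_form s u v = energy_form s v u"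
  by (simp add: energy_form_def mult.commute)

lemma energy_form_add:
  assumes "u \<in> finite_energy s" "v \<in> finite_energy s" "w \<in> finite_energy s"
  shows "energy_form s (\<lambda>x. u x + v x) w = energy_form s u w + energy_form s v w"
  using assms unfolding energy_form_def gag_diff_add distrib_right finite_energy_def
  by (simp add: l2_mult_integrable algebra_simps)

lemma energy_form_cmult: "energy_form s (\<lambda>x. c * u x) w = c * energy_form s u w"
  unfolding energy_form_def gag_diff_cmult mult.assoc by (simp add: algebra_simps)

lemma energy_form_diff:
  assumes "u \<in> finite_energy s" "v \<in> finite_energy s" "w \<in> finite_energy s"
  shows "energy_form s (\<lambda>x. u x - v x) w = energy_form s u w - energy_form s v w"
  using energy_form_add[OF assms(1) finite_energy_cmult[OF assms(2), of "-1"] assms(3)] energy_form_cmult[of s "-1" v w]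
  by simp

lemma energy_form_square:
  fixes u :: "real^'n::finite \<Rightarrow> real"
  shows "energy_form s u u = frac_const TYPE('n) s / 2 * (l2_norm PP (gag_diff s u))\<^sup>2 + (l2_norm lborel u)\<^sup>2"
  unfolding energy_form_def l2_norm_sq by (simp add: power2_eq_square)

lemma energy_form_nonneg:
  fixes u :: "real^'n::finite \<Rightarrow> real"
  assumes "0 < s" "s < 1" shows "energy_form s u u \<ge> 0"
  unfolding energy_form_square using frac_const_pos[OF assms, where 'n='n] by (auto intro!: add_nonneg_nonneg mult_nonneg_nonneg)

lemma energy_form_tendsto:
  assumes "\<And>k. \<phi> k \<in> finite_energy s" "u \<in> finite_energy s" "energy_tendsto s \<phi> u"
    and "\<And>k. \<psi> k \<in> finite_energy s" "v \<in> finite_energy s" "energy_tendsto s \<psi> v"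
  shows "(\<lambda>k. energy_form s (\<phi> k) (\<psi> k)) \<longlonglongrightarrow> energy_form s u v"
  unfolding energy_form_def using assms unfolding energy_tendsto_def finite_energy_def
  by (intro tendsto_add tendsto_mult tendsto_const l2_inner_tendsto) auto

lemma energy_tendsto_const: "u \<in> finite_energy s \<Longrightarrow> energy_tendsto s (\<lambda>k. u) u"
  by (simp add: energy_tendsto_def l2_norm_def)

lemma energy_tendsto_add_const: "energy_tendsto s \<phi> u \<Longrightarrow> energy_tendsto s (\<lambda>k x. f x + \<phi> k x) (\<lambda>x. f x + u x)"
  by (simp add: energy_tendsto_def gag_diff_add)

text \<open>A vector of length 0 is orthogonal to everything, by Cauchy-Schwarz in each of the two
  integrals. As v ranges over all functions of finite energy, it may be an exterior test
  function.\<close>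

lemma energy_form_eq_0:
  assumes s: "0 < s" "s < 1" and u: "u \<in> finite_energy s" "energy_form s u u = 0" and v: "v \<in> finite_energy s"
  shows "energy_form s u v = 0"
proof -
  have C: "frac_const TYPE('a) s > 0" by (rule frac_const_pos[OF s])
  have "frac_const TYPE('a) s / 2 * (l2_norm PP (gag_diff s u))\<^sup>2 \<ge> 0" "(l2_norm lborel u)\<^sup>2 \<ge> 0"
    using C by auto
  then have "frac_const TYPE('a) s / 2 * (l2_norm PP (gag_diff s u))\<^sup>2 = 0" "(l2_norm lborel u)\<^sup>2 = 0"
    using u(2) unfolding energy_form_square by linarith+
  then have "l2_norm PP (gag_diff s u) = 0" "l2_norm lborel u = 0" using C by auto
  then show ?thesis
    using l2_cauchy_schwarz[of "gag_diff s u" PP "gag_diff s v"] l2_cauchy_schwarz[of u lborel v] u(1) v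
    by (simp add: energy_form_def finite_energy_def)
qed

section \<open>Conductivity forms and multiplier forms\<close>

text \<open>Splitting the kernel into two square roots turns the form into an L^2 pairing on the
  product, with the conductivity as a weight on one factor.\<close>

lemma conductivity_form_eq:
  fixes u v :: "real^'n::finite \<Rightarrow> real"
  shows "conductivity_form s \<gamma> u v = frac_const TYPE('n) s / 2 *
    (\<integral>p. (sqrt (\<gamma> (fst p)) * sqrt (\<gamma> (snd p)) * gag_diff s u p) * gag_diff s v p \<partial>PP)"
proof -
  have *: "sqrt (\<gamma> x) * sqrt (\<gamma> y) * ((u x - u y) * (v x - v y)) / norm (x - y) powr (real CARD('n) + 2 * s)
     = (sqrt (\<gamma> x) * sqrt (\<gamma> y) * gag_diff s u (x, y)) * gag_diff s v (x, y)" for x y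
  proof -
    have "sqrt (frac_kernel s (x - y)) * sqrt (frac_kernel s (x - y)) = frac_kernel s (x - y)" by simp
    moreover have "(a * r) * (b * r) = a * b * (r * r)" for a b r :: real by simp
    ultimately have "gag_diff s u (x, y) * gag_diff s v (x, y) = (u x - u y) * (v x - v y) * frac_kernel s (x - y)"
      unfolding gag_diff_def fst_conv snd_conv by (simp only:)
    then show ?thesis by (simp add: mult.assoc frac_kernel_def)
  qed
  show ?thesis
    unfolding conductivity_form_def
    by (intro arg_cong2[where f="(*)"] refl Bochner_Integration.integral_cong) (auto simp: *)
qed

definition bounded_dist :: "(real^'n::finite \<Rightarrow> real) \<Rightarrow> (real^'n \<Rightarrow> real) \<Rightarrow> real" where
  "bounded_dist q \<phi> = (\<integral>x. q x * \<phi> x \<partial>lborel)"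

lemma l2_bounded_mult:
  assumes "q \<in> borel_measurable M" "\<And>x. \<bar>q x\<bar> \<le> Q" "u \<in> l2 M"
  shows "(\<lambda>x. q x * u x) \<in> l2 M" "l2_norm M (\<lambda>x. q x * u x) \<le> Q * l2_norm M u"
proof -
  have Q: "Q \<ge> 0" using assms(2)[of undefined] by linarith
  have b: "\<bar>q x * u x\<bar> \<le> \<bar>Q * u x\<bar>" for x
    using mult_right_mono[OF assms(2)[of x], of "\<bar>u x\<bar>"] Q by (simp add: abs_mult)
  show "(\<lambda>x. q x * u x) \<in> l2 M"
    by (rule l2_bound(1)[OF l2_cmult[OF assms(3), of Q]]) (use b assms(1) l2_measurable[OF assms(3)] in auto)
  have "l2_norm M (\<lambda>x. q x * u x) \<le> l2_norm M (\<lambda>x. Q * u x)"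
    by (rule l2_bound(2)[OF l2_cmult[OF assms(3), of Q]]) (use b assms(1) l2_measurable[OF assms(3)] in auto)
  then show "l2_norm M (\<lambda>x. q x * u x) \<le> Q * l2_norm M u" using Q by (simp add: l2_norm_cmult)
qed

text \<open>Provides the witness for the choice in \<open>multiplier_form\<close>. Boundedness comes
  from Cauchy-Schwarz, since L^2 norms are at most H^s norms.\<close>

lemma bounded_form_bilinear:
  fixes q :: "real^'n::finite \<Rightarrow> real"
  assumes q: "q \<in> borel_measurable borel" "\<And>x. \<bar>q x\<bar> \<le> Q" and s: "s \<ge> 0"
  shows "bounded_bilinear_on_Hs s (\<lambda>u v. \<integral>x. q x * u x * v x \<partial>lborel)"
proof -
  have qm: "q \<in> borel_measurable lborel" using q(1) by simp
  have Q: "Q \<ge> 0" using q(2)[of 0] by linarith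
  have i: "integrable lborel (\<lambda>x. q x * u x * v x)" if "u \<in> Hs s" "v \<in> Hs s" for u v
    by (intro l2_mult_integrable l2_bounded_mult(1)[OF qm q(2)] Hs_l2[OF s] that)
  show ?thesis
    unfolding bounded_bilinear_on_Hs_def
  proof (intro conjI ballI allI exI)
    fix u v w :: "real^'n \<Rightarrow> real" and c assume *: "u \<in> Hs s" "v \<in> Hs s" "w \<in> Hs s"
    have "(\<integral>x. q x * (u x + v x) * w x \<partial>lborel) = (\<integral>x. q x * u x * w x + q x * v x * w x \<partial>lborel)"
      by (simp add: algebra_simps)
    then show "(\<integral>x. q x * (u x + v x) * w x \<partial>lborel) = (\<integral>x. q x * u x * w x \<partial>lborel) + (\<integral>x. q x * v x * w x \<partial>lborel)"
      using i * by simp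
    have "(\<integral>x. q x * w x * (u x + v x) \<partial>lborel) = (\<integral>x. q x * w x * u x + q x * w x * v x \<partial>lborel)"
      by (simp add: algebra_simps)
    then show "(\<integral>x. q x * w x * (u x + v x) \<partial>lborel) = (\<integral>x. q x * w x * u x \<partial>lborel) + (\<integral>x. q x * w x * v x \<partial>lborel)"
      using i * by simp
    have "(\<integral>x. q x * (c * u x) * w x \<partial>lborel) = (\<integral>x. c * (q x * u x * w x) \<partial>lborel)"
      by (simp add: ac_simps)
    then show "(\<integral>x. q x * (c * u x) * w x \<partial>lborel) = c * (\<integral>x. q x * u x * w x \<partial>lborel)" by simp
    have "(\<integral>x. q x * w x * (c * u x) \<partial>lborel) = (\<integral>x. c * (q x * w x * u x) \<partial>lborel)"
      by (simp add: ac_simps)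
    then show "(\<integral>x. q x * w x * (c * u x) \<partial>lborel) = c * (\<integral>x. q x * w x * u x \<partial>lborel)" by simp
  next
    fix u v :: "real^'n \<Rightarrow> real" assume *: "u \<in> Hs s" "v \<in> Hs s"
    note l = Hs_l2[OF s *(1)] Hs_l2[OF s *(2)]
    have "\<bar>\<integral>x. q x * u x * v x \<partial>lborel\<bar> \<le> l2_norm lborel (\<lambda>x. q x * u x) * l2_norm lborel v"
      by (intro l2_cauchy_schwarz l2_bounded_mult(1)[OF qm q(2)] l)
    also have "\<dots> \<le> (Q * Hs_norm s u) * Hs_norm s v"
    proof (rule mult_mono)
      have "Q * l2_norm lborel u \<le> Q * Hs_norm s u"
        by (intro mult_left_mono l2_norm_le_Hs_norm s * Q)
      then show "l2_norm lborel (\<lambda>x. q x * u x) \<le> Q * Hs_norm s u"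
        using l2_bounded_mult(2)[OF qm q(2) l(1)] by linarith
      show "l2_norm lborel v \<le> Hs_norm s v" by (intro l2_norm_le_Hs_norm s *)
    qed (auto intro!: mult_nonneg_nonneg Q Hs_norm_nonneg)
    finally show "\<bar>\<integral>x. q x * u x * v x \<partial>lborel\<bar> \<le> Q * Hs_norm s u * Hs_norm s v" .
  qed
qed

text \<open>B(u, v) - B(\<phi>, \<psi>) = B(u - \<phi>, v) + B(\<phi>, v - \<psi>), and the norms of
  the \<phi> k stay bounded.\<close>

lemma bounded_bilinear_on_Hs_tendsto:
  fixes u v :: "real^'n::finite \<Rightarrow> real"
  assumes B: "bounded_bilinear_on_Hs s B" and s: "s \<ge> 0" and uv: "u \<in> Hs s" "v \<in> Hs s"
    and \<phi>: "\<And>k. \<phi> k \<in> Hs s" "(\<lambda>k. Hs_norm s (\<lambda>x. u x - \<phi> k x)) \<longlonglongrightarrow> 0"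
    and \<psi>: "\<And>k. \<psi> k \<in> Hs s" "(\<lambda>k. Hs_norm s (\<lambda>x. v x - \<psi> k x)) \<longlonglongrightarrow> 0"
  shows "(\<lambda>k. B (\<phi> k) (\<psi> k)) \<longlonglongrightarrow> B u v"
proof -
  from B obtain C where C: "\<And>u v. u \<in> Hs s \<Longrightarrow> v \<in> Hs s \<Longrightarrow> \<bar>B u v\<bar> \<le> C * Hs_norm s u * Hs_norm s v"
    unfolding bounded_bilinear_on_Hs_def by blast
  have add: "B (\<lambda>x. u x + v x) w = B u w + B v w" "B w (\<lambda>x. u x + v x) = B w u + B w v"
    "B (\<lambda>x. c * u x) w = c * B u w" "B w (\<lambda>x. c * u x) = c * B w u"
    if "u \<in> Hs s" "v \<in> Hs s" "w \<in> Hs s" for u v w c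
    using B that unfolding bounded_bilinear_on_Hs_def by blast+
  have diff: "B (\<lambda>x. u x - v x) w = B u w - B v w" "B w (\<lambda>x. u x - v x) = B w u - B w v"
    if uvw: "u \<in> Hs s" "v \<in> Hs s" "w \<in> Hs s" for u v w
    using add(1,2)[OF uvw(1) Hs_cmult[OF s uvw(2), of "-1"] uvw(3)] add(3,4)[OF uvw(2,2,3), of "-1"] by simp_all
  have "(\<lambda>k. B u v - B (\<phi> k) (\<psi> k)) \<longlonglongrightarrow> 0"
  proof (rule Lim_null_comparison)
    let ?b = "\<lambda>k. \<bar>C\<bar> * (Hs_norm s (\<lambda>x. u x - \<phi> k x) * Hs_norm s v + (Hs_norm s u + Hs_norm s (\<lambda>x. u x - \<phi> k x)) * Hs_norm s (\<lambda>x. v x - \<psi> k x))"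
    show "?b \<longlonglongrightarrow> 0"
      by (rule tendsto_eq_intros \<phi>(2) \<psi>(2) refl)+ simp
    show "\<forall>\<^sub>F k in sequentially. norm (B u v - B (\<phi> k) (\<psi> k)) \<le> ?b k"
    proof (intro always_eventually allI)
      fix k
      have "Hs_norm s (\<phi> k) = Hs_norm s (\<lambda>x. u x + (\<phi> k x - u x))" by simp
      also have "\<dots> \<le> Hs_norm s u + Hs_norm s (\<lambda>x. \<phi> k x - u x)"
        by (intro Hs_norm_add Hs_diff s uv \<phi>)
      finally have n: "Hs_norm s (\<phi> k) \<le> Hs_norm s u + Hs_norm s (\<lambda>x. u x - \<phi> k x)"
        using Hs_norm_minus_commute[OF s uv(1) \<phi>(1)] by simp
      have A: "\<bar>B f g\<bar> \<le> \<bar>C\<bar> * (Hs_norm s f * Hs_norm s g)" if "f \<in> Hs s" "g \<in> Hs s" for f g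
        using C[OF that] mult_right_mono[OF abs_ge_self[of C], of "Hs_norm s f * Hs_norm s g"]
        by (simp add: Hs_norm_nonneg mult.assoc)
      have "B u v - B (\<phi> k) (\<psi> k) = B (\<lambda>x. u x - \<phi> k x) v + B (\<phi> k) (\<lambda>x. v x - \<psi> k x)"
        using diff(1)[OF uv(1) \<phi>(1) uv(2)] diff(2)[OF uv(2) \<psi>(1) \<phi>(1)] by simp
      then have "norm (B u v - B (\<phi> k) (\<psi> k)) \<le> \<bar>C\<bar> * (Hs_norm s (\<lambda>x. u x - \<phi> k x) * Hs_norm s v) + \<bar>C\<bar> * (Hs_norm s (\<phi> k) * Hs_norm s (\<lambda>x. v x - \<psi> k x))"
        using A[OF Hs_diff[OF s uv(1) \<phi>(1)] uv(2), of k] A[OF \<phi>(1) Hs_diff[OF s uv(2) \<psi>(1)], of k k] by simp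
      also have "\<bar>C\<bar> * (Hs_norm s (\<phi> k) * Hs_norm s (\<lambda>x. v x - \<psi> k x)) \<le> \<bar>C\<bar> * ((Hs_norm s u + Hs_norm s (\<lambda>x. u x - \<phi> k x)) * Hs_norm s (\<lambda>x. v x - \<psi> k x))"
        by (intro mult_left_mono mult_right_mono n Hs_norm_nonneg) auto
      finally show "norm (B u v - B (\<phi> k) (\<psi> k)) \<le> ?b k" by (simp add: distrib_left)
    qed
  qed
  from tendsto_diff[OF tendsto_const[of "B u v"] this] show ?thesis by simp
qed

text \<open>The chosen extension and integration against q are both bounded bilinear forms and agree
  on pairs of test functions, hence by continuity on the closure of the test functions.\<close>

lemma multiplier_form_bounded:
  fixes q u v :: "real^'n::finite \<Rightarrow> real"
  assumes q: "q \<in> borel_measurable borel" "\<And>x. \<bar>q x\<bar> \<le> Q" and s: "s \<ge> 0"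
    and u: "u \<in> Hs_tilde s UNIV" and v: "v \<in> Hs_tilde s UNIV"
  shows "multiplier_form s (bounded_dist q) u v = (\<integral>x. q x * u x * v x \<partial>lborel)"
proof -
  let ?I = "\<lambda>u v. \<integral>x. q x * u x * v x \<partial>lborel"
  let ?P = "\<lambda>B. bounded_bilinear_on_Hs s B \<and>
     (\<forall>\<phi>\<in>test_functions UNIV. \<forall>\<psi>\<in>test_functions UNIV. B \<phi> \<psi> = bounded_dist q (\<lambda>x. \<phi> x * \<psi> x))"
  have I: "?P ?I" using bounded_form_bilinear[OF q s] by (simp add: bounded_dist_def mult.assoc)
  then have F: "?P (multiplier_form s (bounded_dist q))" unfolding multiplier_form_def by (rule someI[of ?P ?I])
  obtain \<phi> where \<phi>: "\<And>k. \<phi> k \<in> test_functions UNIV" "(\<lambda>k::nat. Hs_norm s (\<lambda>x. u x - \<phi> k x)) \<longlonglongrightarrow> 0"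
    by (rule Hs_tilde_seq[OF u]) blast
  obtain \<psi> where \<psi>: "\<And>k. \<psi> k \<in> test_functions UNIV" "(\<lambda>k::nat. Hs_norm s (\<lambda>x. v x - \<psi> k x)) \<longlonglongrightarrow> 0"
    by (rule Hs_tilde_seq[OF v]) blast
  note lim = bounded_bilinear_on_Hs_tendsto[OF _ s Hs_tilde_Hs[OF u] Hs_tilde_Hs[OF v]
      test_function_Hs[OF s \<phi>(1)] \<phi>(2) test_function_Hs[OF s \<psi>(1)] \<psi>(2)]
  have "(\<lambda>k. multiplier_form s (bounded_dist q) (\<phi> k) (\<psi> k)) \<longlonglongrightarrow> multiplier_form s (bounded_dist q) u v"
    using F by (intro lim) simp
  moreover have "(\<lambda>k. ?I (\<phi> k) (\<psi> k)) \<longlonglongrightarrow> ?I u v"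
    using I by (intro lim) simp
  moreover have "multiplier_form s (bounded_dist q) (\<phi> k) (\<psi> k) = ?I (\<phi> k) (\<psi> k)" for k
    by (rule trans[OF F[THEN conjunct2, rule_format, OF \<phi>(1) \<psi>(1)] I[THEN conjunct2, rule_format, OF \<phi>(1) \<psi>(1), symmetric]])
  ultimately show ?thesis using LIMSEQ_unique by force
qed

section \<open>The fractional Liouville reduction\<close>

text \<open>For a test function m this is (2 / C_{n,s}) (-\<Delta>)^s m, by
  \<open>integral_second_diff\<close> and the value 1 / \<open>levy_const\<close> of C_{n,s}; it
  appears here as an absolutely convergent real integral.\<close>

definition second_diff_integral :: "real \<Rightarrow> (real^'n::finite \<Rightarrow> real) \<Rightarrow> real^'n \<Rightarrow> real" where
  "second_diff_integral s m x = (\<integral>z. second_diff m x z * frac_kernel s z \<partial>lborel)"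

lemma second_diff_integral_measurable [measurable]:
  fixes m :: "real^'n::finite \<Rightarrow> real"
  assumes "m \<in> borel_measurable borel"
  shows "second_diff_integral s m \<in> borel_measurable borel"
proof -
  note [measurable] = second_diff_measurable(2)[OF assms]
  have "(\<lambda>p. second_diff m (fst p) (snd p) * frac_kernel s (snd p)) \<in> borel_measurable (borel \<Otimes>\<^sub>M lborel)"
    by measurable
  then have "(\<lambda>(x, z). second_diff m x z * frac_kernel s z) \<in> borel_measurable (borel \<Otimes>\<^sub>M lborel)"
    by (simp add: case_prod_beta')
  then show ?thesis
    unfolding second_diff_integral_def[abs_def] by (rule lborel.borel_measurable_lebesgue_integral)
qed

text \<open>The quadratic bound on second differences is uniform in x.\<close>

lemma second_diff_integral_bounded:
  fixes m :: "real^'n::finite \<Rightarrow> real"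
  assumes m: "m \<in> test_functions U" and s: "0 < s" "s < 1"
  obtains D where "D \<ge> 0" "\<And>x. \<bar>second_diff_integral s m x\<bar> \<le> D"
proof -
  obtain C where C: "C \<ge> 0" "\<And>x z. \<bar>second_diff m x z\<bar> \<le> C * min 1 ((norm z)\<^sup>2)"
    using second_diff_bound_real[OF m] by metis
  let ?D = "\<integral>z. C * (min 1 ((norm z)\<^sup>2) * frac_kernel s z) \<partial>(lborel :: (real^'n) measure)"
  have "\<bar>second_diff_integral s m x\<bar> \<le> ?D" for x
  proof -
    have "norm (second_diff_integral s m x) \<le> ?D"
      unfolding second_diff_integral_def
    proof (rule Bochner_Integration.integral_norm_bound_integral)
      show "integrable lborel (\<lambda>z. second_diff m x z * frac_kernel s z)" by (rule integrable_second_diff_real[OF m s])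
      show "integrable lborel (\<lambda>z::real^'n. C * (min 1 ((norm z)\<^sup>2) * frac_kernel s z))"
        by (intro integrable_mult_right integrable_frac_kernel_weight s)
      show "norm (second_diff m x z * frac_kernel s z) \<le> C * (min 1 ((norm z)\<^sup>2) * frac_kernel s z)" for z
        using mult_right_mono[OF C(2)[of x z] frac_kernel_nonneg[of s z]] by (simp add: abs_mult mult.assoc)
    qed
    then show ?thesis by simp
  qed
  moreover have "?D \<ge> 0" using C(1) by (intro Bochner_Integration.integral_nonneg) auto
  ultimately show ?thesis using that by blast
qed

section \<open>Moving differences from one factor to the other\<close>

lemma integrable_test_mult:
  fixes m h :: "real^'n::finite \<Rightarrow> real"
  assumes "m \<in> test_functions U" "h \<in> test_functions V"
  shows "integrable lborel (\<lambda>x. m (x + y) * h (x + z))"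
proof -
  have "(\<lambda>x. f (x + y)) \<in> l2 lborel" if "f \<in> test_functions V" for f :: "real^'n \<Rightarrow> real" and y V
  proof -
    have [measurable]: "f \<in> borel_measurable borel" by (rule test_function_measurable[OF that])
    have "integrable lborel (\<lambda>x. (f (x + y))\<^sup>2)"
      using integral_lborel_translate(2)[of "\<lambda>x. (f x)\<^sup>2" y] l2_integrable_sq[OF test_function_l2[OF that]] by simp
    then show ?thesis by (intro l2I) auto
  qed
  then show ?thesis using assms by (intro l2_mult_integrable) auto
qed

text \<open>Summation by parts: expanding the product and translating the variable moves both
  differences onto m.\<close>

lemma integral_diff_mult_diff:
  fixes m h :: "real^'n::finite \<Rightarrow> real"
  assumes m: "m \<in> test_functions U" and h: "h \<in> test_functions V"
  shows "(\<integral>x. (m (x + z) - m x) * (h (x + z) - h x) \<partial>lborel) = (\<integral>x. second_diff m x z * h x \<partial>lborel)"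
proof -
  have [measurable]: "m \<in> borel_measurable borel" "h \<in> borel_measurable borel"
    using m h test_function_measurable by auto
  note i = integrable_test_mult[OF m h]
  have i': "integrable lborel (\<lambda>x. m (x + z) * h (x + z))" "integrable lborel (\<lambda>x. m x * h x)"
     "integrable lborel (\<lambda>x. m (x + z) * h x)" "integrable lborel (\<lambda>x. m x * h (x + z))" "integrable lborel (\<lambda>x. m (x - z) * h x)"
    using i[of z z] i[of 0 0] i[of z 0] i[of 0 z] i[of "- z" 0] by auto
  have t1: "(\<integral>x. m (x + z) * h (x + z) \<partial>lborel) = (\<integral>x. m x * h x \<partial>lborel)"
    using integral_lborel_translate(1)[of "\<lambda>x. m x * h x" z] by simp
  have t2: "(\<integral>x. m x * h (x + z) \<partial>lborel) = (\<integral>x. m (x - z) * h x \<partial>lborel)"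
    using integral_lborel_translate(1)[of "\<lambda>x. m (x - z) * h x" z] by simp
  have "(\<integral>x. (m (x + z) - m x) * (h (x + z) - h x) \<partial>lborel)
     = (\<integral>x. m (x + z) * h (x + z) - m (x + z) * h x - (m x * h (x + z) - m x * h x) \<partial>lborel)"
    by (simp add: algebra_simps)
  also have "\<dots> = (\<integral>x. m x * h x \<partial>lborel) - (\<integral>x. m (x + z) * h x \<partial>lborel) - ((\<integral>x. m (x - z) * h x \<partial>lborel) - (\<integral>x. m x * h x \<partial>lborel))"
    using i' t1 t2 by simp
  also have "\<dots> = (\<integral>x. m x * h x + m x * h x - m (x + z) * h x - m (x - z) * h x \<partial>lborel)"
  proof -
    have "(\<integral>x. m x * h x + m x * h x - m (x + z) * h x - m (x - z) * h x \<partial>lborel)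
       = (\<integral>x. m x * h x \<partial>lborel) + (\<integral>x. m x * h x \<partial>lborel) - (\<integral>x. m (x + z) * h x \<partial>lborel) - (\<integral>x. m (x - z) * h x \<partial>lborel)"
      by (simp only: Bochner_Integration.integral_diff Bochner_Integration.integral_add
          Bochner_Integration.integrable_diff Bochner_Integration.integrable_add i')
    then show ?thesis by linarith
  qed
  also have "\<dots> = (\<integral>x. second_diff m x z * h x \<partial>lborel)"
    by (simp add: second_diff_def algebra_simps)
  finally show ?thesis .
qed

text \<open>The weak form of (-\<Delta>)^s m: for each shift z the difference is moved off h, after
  which the z-integral may be taken first. Fubini is applied once to the product of first
  differences, integrable by finite energy, and once to the second difference, integrable by its
  quadratic bound.\<close>

lemma gag_inner_second_diff:
  fixes m h :: "real^'n::finite \<Rightarrow> real"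
  assumes m: "m \<in> test_functions U" and h: "h \<in> test_functions V" and s: "0 < s" "s < 1"
  shows "(\<integral>p. gag_diff s m p * gag_diff s h p \<partial>PP) = (\<integral>x. second_diff_integral s m x * h x \<partial>lborel)"
proof -
  have [measurable]: "m \<in> borel_measurable borel" "h \<in> borel_measurable borel"
    using m h test_function_measurable by auto
  define F where "F x y = (m x - m y) * (h x - h y) * frac_kernel s (x - y)" for x y
  have Feq: "gag_diff s m p * gag_diff s h p = F (fst p) (snd p)" for p
  proof -
    have "sqrt (frac_kernel s (fst p - snd p)) * sqrt (frac_kernel s (fst p - snd p)) = frac_kernel s (fst p - snd p)" by simp
    moreover have "(a * r) * (b * r) = a * b * (r * r)" for a b r :: real by simp
    ultimately show ?thesis unfolding gag_diff_def F_def by (simp only:)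
  qed
  have Fm: "(\<lambda>p. F (fst p) (snd p)) \<in> borel_measurable PP" unfolding F_def by measurable
  have iF: "integrable PP (\<lambda>p. F (fst p) (snd p))"
    unfolding Feq[symmetric] by (intro l2_mult_integrable gag_diff_test_function(1)[OF m s] gag_diff_test_function(1)[OF h s])
  define G where "G z x = (m (x + z) - m x) * (h (x + z) - h x) * frac_kernel s z" for z x
  have FG: "F (x + z) x = G z x" for x z by (simp add: F_def G_def)
  have Gm: "(\<lambda>p. G (fst p) (snd p)) \<in> borel_measurable PP" unfolding G_def by measurable
  have "(\<integral>\<^sup>+p. ennreal (norm (G (fst p) (snd p))) \<partial>PP) = (\<integral>\<^sup>+z. \<integral>\<^sup>+x. ennreal (norm (G z x)) \<partial>lborel \<partial>lborel)"
    using lborel.nn_integral_fst[of "\<lambda>p. ennreal (norm (G (fst p) (snd p)))" lborel] Gm by simp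
  also have "\<dots> = (\<integral>\<^sup>+p. ennreal (norm (F (fst p) (snd p))) \<partial>PP)"
    using nn_integral_PP_shift[of "\<lambda>x y. ennreal (norm (F x y))"] Fm by (simp add: case_prod_beta' FG)
  also have "\<dots> < \<infinity>" using iF by (simp add: integrable_iff_bounded)
  finally have iG: "integrable PP (\<lambda>p. G (fst p) (snd p))"
    unfolding integrable_iff_bounded using Gm by simp
  have iF': "integrable PP (case_prod F)" and iG': "integrable PP (case_prod G)"
    using iF iG by (simp_all add: case_prod_beta')
  have "(\<integral>p. gag_diff s m p * gag_diff s h p \<partial>PP) = (\<integral>y. (\<integral>x. F x y \<partial>lborel) \<partial>lborel)"
    unfolding Feq using lborel_pair.integral_snd[OF iF'] by (simp add: case_prod_beta')
  also have "\<dots> = (\<integral>y. (\<integral>z. G z y \<partial>lborel) \<partial>lborel)"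
  proof (rule Bochner_Integration.integral_cong[OF refl])
    fix y
    have "(\<lambda>x. F x y) \<in> borel_measurable borel" unfolding F_def by measurable
    then show "(\<integral>x. F x y \<partial>lborel) = (\<integral>z. G z y \<partial>lborel)"
      using integral_lborel_translate(1)[of "\<lambda>x. F x y" y] by (simp add: FG[symmetric] add.commute)
  qed
  also have "\<dots> = (\<integral>z. (\<integral>x. G z x \<partial>lborel) \<partial>lborel)"
    by (rule lborel_pair.Fubini_integral[OF iG'])
  also have "\<dots> = (\<integral>z. (\<integral>x. second_diff m x z * frac_kernel s z * h x \<partial>lborel) \<partial>lborel)"
  proof (rule Bochner_Integration.integral_cong[OF refl])
    fix z
    have "(\<integral>x. G z x \<partial>lborel) = (\<integral>x. (m (x + z) - m x) * (h (x + z) - h x) \<partial>lborel) * frac_kernel s z"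
      unfolding G_def by simp
    also have "\<dots> = (\<integral>x. (second_diff m x z * h x) * frac_kernel s z \<partial>lborel)"
      unfolding integral_diff_mult_diff[OF m h] by simp
    finally show "(\<integral>x. G z x \<partial>lborel) = (\<integral>x. second_diff m x z * frac_kernel s z * h x \<partial>lborel)"
      by (simp add: ac_simps)
  qed
  also have "\<dots> = (\<integral>x. (\<integral>z. second_diff m x z * frac_kernel s z * h x \<partial>lborel) \<partial>lborel)"
  proof (rule lborel_pair.Fubini_integral)
    obtain C where C: "C \<ge> 0" "\<And>x z. \<bar>second_diff m x z\<bar> \<le> C * min 1 ((norm z)\<^sup>2)"
      using second_diff_bound_real[OF m] by metis
    have ih: "integrable lborel (\<lambda>x. \<bar>h x\<bar>)"
    proof -
      have "integrable lborel (\<lambda>x. norm (complex_of_real (h x)))"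
        by (intro integrable_norm schwartz_integrable test_function_schwartz[OF h])
      then show ?thesis by simp
    qed
    have iw: "integrable lborel (\<lambda>z::real^'n. C * (min 1 ((norm z)\<^sup>2) * frac_kernel s z))"
      by (intro integrable_mult_right integrable_frac_kernel_weight s)
    note [measurable] = second_diff_measurable(2)
    have mm: "(\<lambda>p. second_diff m (fst p) (snd p) * frac_kernel s (snd p) * h (fst p)) \<in> borel_measurable PP" by measurable
    have "integrable PP (\<lambda>(x, z). second_diff m x z * frac_kernel s z * h x)"
    proof (rule Bochner_Integration.integrable_bound[OF integrable_pair_mult[OF ih iw]])
      show "(\<lambda>(x, z). second_diff m x z * frac_kernel s z * h x) \<in> borel_measurable PP" using mm by (simp add: case_prod_beta')
      show "AE p in PP. norm (case p of (x, z) \<Rightarrow> second_diff m x z * frac_kernel s z * h x) \<le>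
          norm (case p of (x, z) \<Rightarrow> \<bar>h x\<bar> * (C * (min 1 ((norm z)\<^sup>2) * frac_kernel s z)))"
      proof (rule AE_I2, clarify)
        fix x z :: "real^'n"
        have "\<bar>second_diff m x z\<bar> * (frac_kernel s z * \<bar>h x\<bar>) \<le> (C * min 1 ((norm z)\<^sup>2)) * (frac_kernel s z * \<bar>h x\<bar>)"
          by (intro mult_right_mono C mult_nonneg_nonneg) auto
        then show "norm (second_diff m x z * frac_kernel s z * h x) \<le> norm (\<bar>h x\<bar> * (C * (min 1 ((norm z)\<^sup>2) * frac_kernel s z)))"
          using C(1) by (simp add: abs_mult ac_simps)
      qed
    qed
    then show "integrable PP (\<lambda>(x, z). second_diff m x z * frac_kernel s z * h x)" .
  qed
  also have "\<dots> = (\<integral>x. second_diff_integral s m x * h x \<partial>lborel)"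
    unfolding second_diff_integral_def by simp
  finally show ?thesis .
qed

text \<open>
  The potential \<open>q\<close> compensates the term by which multiplication with \<open>a\<close> fails to commute with the
  difference quotients: $a(x)a(y)(v(x)-v(y))(w(x)-w(y))$ equals
  $(av(x)-av(y))(aw(x)-aw(y)) - (a(x)-a(y))(avw(x)-avw(y))$.
\<close>

lemma liouville_reduction:
  fixes m v w :: "real^'n::finite \<Rightarrow> real"
  assumes s: "0 < s" "s < 1" and m: "m \<in> test_functions U" and a: "smooth_multiplier (\<lambda>x. 1 + m x) B L"
    and v: "v \<in> Hs_tilde s UNIV" and w: "w \<in> Hs_tilde s UNIV"
  defines "q \<equiv> \<lambda>x. (1 + m x)\<^sup>2 + (1 + m x) * (frac_const TYPE('n) s / 2 * second_diff_integral s m x)"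
  shows "frac_const TYPE('n) s / 2 * (\<integral>p. ((1 + m (fst p)) * (1 + m (snd p)) * gag_diff s v p) * gag_diff s w p \<partial>PP)
       + (\<integral>x. q x * v x * w x \<partial>lborel)
     = energy_form s (\<lambda>x. (1 + m x) * v x) (\<lambda>x. (1 + m x) * w x)"
proof -
  let ?C = "frac_const TYPE('n) s" and ?a = "\<lambda>x. 1 + m x"
  let ?L = "\<lambda>v w. ?C / 2 * (\<integral>p. ((1 + m (fst p)) * (1 + m (snd p)) * gag_diff s v p) * gag_diff s w p \<partial>PP) + (\<integral>x. q x * v x * w x \<partial>lborel)"
  let ?R = "\<lambda>v w. energy_form s (\<lambda>x. (1 + m x) * v x) (\<lambda>x. (1 + m x) * w x)"
  have [measurable]: "m \<in> borel_measurable borel" by (rule test_function_measurable[OF m])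
  have sa: "smooth ?a" and aB: "\<And>x. \<bar>?a x\<bar> \<le> B" using a by (auto simp: smooth_multiplier_def)
  obtain D where D: "D \<ge> 0" "\<And>x. \<bar>second_diff_integral s m x\<bar> \<le> D" using second_diff_integral_bounded[OF m s] by metis
  have qm[measurable]: "q \<in> borel_measurable borel" unfolding q_def by measurable
  have B: "B \<ge> 0" using aB[of 0] by linarith
  \<comment> \<open>A bound on q makes v \<mapsto> q v continuous in L^2, as the passage to the
    limit requires.\<close>
  have qB: "\<bar>q x\<bar> \<le> B\<^sup>2 + B * (\<bar>?C / 2\<bar> * D)" for x
  proof -
    have "\<bar>q x\<bar> \<le> \<bar>?a x\<bar>\<^sup>2 + \<bar>?a x\<bar> * (\<bar>?C / 2\<bar> * \<bar>second_diff_integral s m x\<bar>)"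
      unfolding q_def by (rule order_trans[OF abs_triangle_ineq]) (simp add: abs_mult)
    also have "\<dots> \<le> B\<^sup>2 + B * (\<bar>?C / 2\<bar> * D)"
      using B D by (intro add_mono power_mono mult_mono aB) (auto intro!: mult_nonneg_nonneg)
    finally show ?thesis .
  qed
  have aa: "\<bar>?a (fst p) * ?a (snd p)\<bar> \<le> B * B" for p
    unfolding abs_mult using B by (intro mult_mono aB) auto
  have am: "(\<lambda>p. ?a (fst p) * ?a (snd p)) \<in> borel_measurable PP" by measurable
  have test: "?L v w = ?R v w" if v: "v \<in> test_functions UNIV" and w: "w \<in> test_functions UNIV" for v w
  proof -
    let ?h = "\<lambda>x. ?a x * (v x * w x)"
    have av: "(\<lambda>x. ?a x * v x) \<in> test_functions UNIV" "(\<lambda>x. ?a x * w x) \<in> test_functions UNIV"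
      by (intro test_functions_mult v w sa)+
    have h: "?h \<in> test_functions UNIV"
      using test_functions_mult[OF test_functions_mult[OF w test_functionsD(1)[OF v]] sa] .
    have "((1 + m (fst p)) * (1 + m (snd p)) * gag_diff s v p) * gag_diff s w p =
      gag_diff s (\<lambda>x. ?a x * v x) p * gag_diff s (\<lambda>x. ?a x * w x) p - gag_diff s m p * gag_diff s ?h p" for p
      unfolding gag_diff_def by (simp add: algebra_simps)
    then have "(\<integral>p. ((1 + m (fst p)) * (1 + m (snd p)) * gag_diff s v p) * gag_diff s w p \<partial>PP)
       = (\<integral>p. gag_diff s (\<lambda>x. ?a x * v x) p * gag_diff s (\<lambda>x. ?a x * w x) p \<partial>PP) - (\<integral>p. gag_diff s m p * gag_diff s ?h p \<partial>PP)"
      using av h m by (simp add: Bochner_Integration.integral_diff l2_mult_integrable gag_diff_test_function(1)[OF _ s])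
    also have "(\<integral>p. gag_diff s m p * gag_diff s ?h p \<partial>PP) = (\<integral>x. second_diff_integral s m x * ?h x \<partial>lborel)"
      by (rule gag_inner_second_diff[OF m h s])
    finally have 1: "(\<integral>p. ((1 + m (fst p)) * (1 + m (snd p)) * gag_diff s v p) * gag_diff s w p \<partial>PP)
       = (\<integral>p. gag_diff s (\<lambda>x. ?a x * v x) p * gag_diff s (\<lambda>x. ?a x * w x) p \<partial>PP) - (\<integral>x. second_diff_integral s m x * ?h x \<partial>lborel)" .
    have i1: "integrable lborel (\<lambda>x. (?a x * v x) * (?a x * w x))"
      by (intro l2_mult_integrable test_function_l2[OF av(1)] test_function_l2[OF av(2)])
    have i2: "integrable lborel (\<lambda>x. second_diff_integral s m x * ?h x)"
    proof -
      have "integrable lborel ?h"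
        using schwartz_integrable[OF test_function_schwartz[OF h]] by (simp only: complex_of_real_integrable_eq)
      then show ?thesis by (rule integrable_bounded_mult[where C=D]) (use D in auto)
    qed
    have "(\<integral>x. q x * v x * w x \<partial>lborel) = (\<integral>x. (?a x * v x) * (?a x * w x) + ?C / 2 * (second_diff_integral s m x * ?h x) \<partial>lborel)"
      by (intro Bochner_Integration.integral_cong) (auto simp: q_def power2_eq_square algebra_simps)
    also have "\<dots> = (\<integral>x. (?a x * v x) * (?a x * w x) \<partial>lborel) + ?C / 2 * (\<integral>x. second_diff_integral s m x * ?h x \<partial>lborel)"
      by (subst Bochner_Integration.integral_add[OF i1 integrable_mult_right[OF i2]]) simp
    finally show ?thesis unfolding 1 energy_form_def by (simp add: algebra_simps)
  qed
  \<comment> \<open>Both sides are continuous under energy convergence, so the identity extends from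
    test functions to their closure.\<close>
  obtain \<phi> where \<phi>: "\<And>k. \<phi> k \<in> test_functions UNIV" "energy_tendsto s \<phi> v"
    by (rule Hs_tilde_energy_seq[OF v s]) blast
  obtain \<psi> where \<psi>: "\<And>k. \<psi> k \<in> test_functions UNIV" "energy_tendsto s \<psi> w"
    by (rule Hs_tilde_energy_seq[OF w s]) blast
  note fe = Hs_tilde_finite_energy[OF v s] Hs_tilde_finite_energy[OF w s]
    test_function_finite_energy[OF \<phi>(1) s] test_function_finite_energy[OF \<psi>(1) s]
  note fl = fe[unfolded finite_energy_def, simplified]
  have "(\<lambda>k. ?R (\<phi> k) (\<psi> k)) \<longlonglongrightarrow> ?R v w"
    using fl by (intro energy_form_tendsto finite_energy_mult[OF a s] fe energy_tendsto_mult[OF a s] \<phi>(2) \<psi>(2)) auto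
  moreover have "(\<lambda>k. ?L (\<phi> k) (\<psi> k)) \<longlonglongrightarrow> ?L v w"
  proof (intro tendsto_add tendsto_mult[OF tendsto_const] l2_inner_tendsto)
    show "(\<lambda>p. (1 + m (fst p)) * (1 + m (snd p)) * gag_diff s (\<phi> k) p) \<in> l2 PP" for k
      using fl by (intro l2_bounded_mult(1)[OF am aa]) auto
    show "(\<lambda>p. (1 + m (fst p)) * (1 + m (snd p)) * gag_diff s v p) \<in> l2 PP"
      using fl by (intro l2_bounded_mult(1)[OF am aa]) auto
    show "(\<lambda>x. q x * \<phi> k x) \<in> l2 lborel" for k
      using fl by (intro l2_bounded_mult(1)[OF _ qB]) auto
    show "(\<lambda>x. q x * v x) \<in> l2 lborel"
      using fl by (intro l2_bounded_mult(1)[OF _ qB]) auto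
    show "(\<lambda>k. l2_norm PP (\<lambda>p. (1 + m (fst p)) * (1 + m (snd p)) * gag_diff s (\<phi> k) p - (1 + m (fst p)) * (1 + m (snd p)) * gag_diff s v p)) \<longlonglongrightarrow> 0"
    proof (rule Lim_null_comparison)
      show "(\<lambda>k. B * B * l2_norm PP (\<lambda>p. gag_diff s (\<phi> k) p - gag_diff s v p)) \<longlonglongrightarrow> 0"
        using \<phi>(2) tendsto_mult[OF tendsto_const[of "B * B"]] unfolding energy_tendsto_def by fastforce
      show "\<forall>\<^sub>F k in sequentially. norm (l2_norm PP (\<lambda>p. (1 + m (fst p)) * (1 + m (snd p)) * gag_diff s (\<phi> k) p - (1 + m (fst p)) * (1 + m (snd p)) * gag_diff s v p)) \<le> B * B * l2_norm PP (\<lambda>p. gag_diff s (\<phi> k) p - gag_diff s v p)"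
        unfolding right_diff_distrib[symmetric]
        using l2_bounded_mult(2)[OF am aa l2_diff] fl by (intro always_eventually allI) simp
    qed
    show "(\<lambda>k. l2_norm lborel (\<lambda>x. q x * \<phi> k x - q x * v x)) \<longlonglongrightarrow> 0"
    proof (rule Lim_null_comparison)
      let ?Q = "B\<^sup>2 + B * (\<bar>?C / 2\<bar> * D)"
      show "(\<lambda>k. ?Q * l2_norm lborel (\<lambda>x. \<phi> k x - v x)) \<longlonglongrightarrow> 0"
        using \<phi>(2) tendsto_mult[OF tendsto_const[of ?Q]] unfolding energy_tendsto_def by fastforce
      show "\<forall>\<^sub>F k in sequentially. norm (l2_norm lborel (\<lambda>x. q x * \<phi> k x - q x * v x)) \<le> ?Q * l2_norm lborel (\<lambda>x. \<phi> k x - v x)"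
        unfolding right_diff_distrib[symmetric]
        using l2_bounded_mult(2)[where q=q and M=lborel, OF _ qB l2_diff] fl by (intro always_eventually allI) simp
    qed
  qed (use fl \<psi>(2) in \<open>auto simp: energy_tendsto_def\<close>)
  ultimately show ?thesis using test[OF \<phi>(1) \<psi>(1)] LIMSEQ_unique by (metis (no_types, lifting) LIMSEQ_unique ext)
qed

section \<open>Existence of weak solutions\<close>

lemma quadratic_vanishing:
  fixes b c :: real
  assumes "c \<ge> 0" "\<And>t. 0 \<le> 2 * t * b + t\<^sup>2 * c" shows "b = 0"
proof -
  \<comment> \<open>The minimizer of the quadratic would be -b/c; the denominator c + 1 also serves
    c = 0.\<close>
  define t where "t = - b / (c + 1)"
  have c: "c + 1 > 0" using assms(1) by simp
  then have tc: "t * (c + 1) = - b" by (simp add: t_def)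
  have "0 \<le> (2 * t * b + t\<^sup>2 * c) * (c + 1)\<^sup>2" by (intro mult_nonneg_nonneg assms(2)) simp
  also have "\<dots> = 2 * (t * (c + 1)) * b * (c + 1) + (t * (c + 1))\<^sup>2 * c"
    by (simp add: power2_eq_square algebra_simps)
  also have "\<dots> = - (b\<^sup>2 * (c + 2))"
    unfolding tc by (simp add: power2_eq_square algebra_simps)
  finally have "b\<^sup>2 \<le> 0" using assms(1) by (simp add: mult_le_0_iff)
  then show ?thesis by simp
qed

text \<open>Dirichlet principle. The energy of f + \<phi> is minimized over the test functions of
  \<Omega>: the parallelogram law makes a minimizing sequence Cauchy in energy, coercivity gives a
  limit in H^s, and the vanishing first variation is the weak equation.\<close>

lemma energy_minimizer:
  fixes f :: "real^'n::finite \<Rightarrow> real"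
  assumes s: "0 < s" "s < 1" and f: "f \<in> test_functions UNIV"
  obtains w where "w \<in> Hs_tilde s \<Omega>" "\<And>\<phi>. \<phi> \<in> Hs_tilde s \<Omega> \<Longrightarrow> energy_form s (\<lambda>x. f x + w x) \<phi> = 0"
proof -
  let ?E = "energy_form s" and ?K = "levy_const TYPE('n) s" and ?C = "frac_const TYPE('n) s"
  have s0: "s \<ge> 0" using s by simp
  have K: "?K > 0" by (rule levy_const_pos[OF s])
  have C: "?C > 0" by (rule frac_const_pos[OF s])
  have ff: "f \<in> finite_energy s" by (rule test_function_finite_energy[OF f s])
  have tf: "\<phi> \<in> finite_energy s" if "\<phi> \<in> test_functions \<Omega>" for \<phi> by (rule test_function_finite_energy[OF that s])
  define e where "e \<phi> = ?E (\<lambda>x. f x + \<phi> x) (\<lambda>x. f x + \<phi> x)" for \<phi>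
  let ?d = "Inf (e ` test_functions \<Omega>)"
  have bdd: "bdd_below (e ` test_functions \<Omega>)"
    unfolding e_def by (rule bdd_belowI2[of _ 0]) (rule energy_form_nonneg[OF s])
  have d: "?d \<le> e \<phi>" if "\<phi> \<in> test_functions \<Omega>" for \<phi>
    using bdd that by (intro cInf_lower) auto
  have z: "(\<lambda>x. 0) \<in> test_functions \<Omega>" by (rule test_functionsI[where K="{}"]) auto
  have "\<exists>\<phi>\<in>test_functions \<Omega>. e \<phi> < ?d + 1 / (real k + 1)" for k :: nat
    using cInf_lessD[of "e ` test_functions \<Omega>" "?d + 1 / (real k + 1)"] z by auto
  then obtain \<phi> where \<phi>: "\<And>k. \<phi> k \<in> test_functions \<Omega>" "\<And>k. e (\<phi> k) < ?d + 1 / (real k + 1)" by metis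
  \<comment> \<open>Parallelogram law: half the sum of the two competitors is f plus the midpoint of
    \<phi> k and \<phi> l, and its energy is at least the infimum.\<close>
  have para: "?E (\<lambda>x. \<phi> k x - \<phi> l x) (\<lambda>x. \<phi> k x - \<phi> l x) \<le> 2 / (real k + 1) + 2 / (real l + 1)" for k l
  proof -
    let ?x = "\<lambda>x. f x + \<phi> k x" and ?y = "\<lambda>x. f x + \<phi> l x" and ?m = "\<lambda>x. (1/2) * (\<phi> k x + \<phi> l x)"
    have xy: "?x \<in> finite_energy s" "?y \<in> finite_energy s" by (intro finite_energy_add ff tf \<phi>)+
    have D: "?E (\<lambda>x. ?x x - ?y x) (\<lambda>x. ?x x - ?y x) = ?E ?x ?x - 2 * ?E ?x ?y + ?E ?y ?y"
      using energy_form_diff[OF xy finite_energy_diff[OF xy]] energy_form_diff[OF xy xy(1)] energy_form_diff[OF xy xy(2)]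
        energy_form_commute[of s ?x "\<lambda>x. ?x x - ?y x"] energy_form_commute[of s ?y "\<lambda>x. ?x x - ?y x"] energy_form_commute[of s ?y ?x]
      by linarith
    have A: "?E (\<lambda>x. ?x x + ?y x) (\<lambda>x. ?x x + ?y x) = ?E ?x ?x + 2 * ?E ?x ?y + ?E ?y ?y"
      using energy_form_add[OF xy finite_energy_add[OF xy]] energy_form_add[OF xy xy(1)] energy_form_add[OF xy xy(2)]
        energy_form_commute[of s ?x "\<lambda>x. ?x x + ?y x"] energy_form_commute[of s ?y "\<lambda>x. ?x x + ?y x"] energy_form_commute[of s ?y ?x]
      by linarith
    have "(\<lambda>x. ?x x + ?y x) = (\<lambda>x. 2 * (f x + ?m x))" by (simp add: fun_eq_iff)
    then have "?E (\<lambda>x. ?x x + ?y x) (\<lambda>x. ?x x + ?y x) = 4 * e ?m"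
      unfolding e_def using energy_form_cmult[of s 2 "\<lambda>x. f x + ?m x"] energy_form_commute[of s _ "\<lambda>x. 2 * (f x + ?m x)"] by simp
    moreover have "?d \<le> e ?m" by (intro d test_functions_cmult test_functions_add \<phi>)
    moreover have "(\<lambda>x. ?x x - ?y x) = (\<lambda>x. \<phi> k x - \<phi> l x)" by simp
    ultimately show ?thesis
      using D A \<phi>(2)[of k] \<phi>(2)[of l] unfolding e_def by simp
  qed
  have Hs_le: "(Hs_norm s (\<lambda>x. \<phi> k x - \<phi> l x))\<^sup>2 \<le> (2 + 2 / (?C * ?K)) * ?E (\<lambda>x. \<phi> k x - \<phi> l x) (\<lambda>x. \<phi> k x - \<phi> l x)" for k l
  proof -
    let ?u = "\<lambda>x. \<phi> k x - \<phi> l x"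
    let ?g = "(l2_norm PP (gag_diff s ?u))\<^sup>2" and ?n = "(l2_norm lborel ?u)\<^sup>2"
    have "(Hs_norm s ?u)\<^sup>2 \<le> 2 * ?n + ?g / ?K"
      by (rule Hs_norm_le_energy[OF test_functions_diff[OF \<phi>(1) \<phi>(1)] s])
    also have "\<dots> \<le> 2 * (?C / 2 * ?g + ?n) + 2 / (?C * ?K) * (?C / 2 * ?g + ?n)"
    proof (rule add_mono)
      show "2 * ?n \<le> 2 * (?C / 2 * ?g + ?n)" using C by simp
      have "?g / ?K = 2 / (?C * ?K) * (?C / 2 * ?g)" using C K by (simp add: field_simps)
      also have "\<dots> \<le> 2 / (?C * ?K) * (?C / 2 * ?g + ?n)" using C K by (intro mult_left_mono) auto
      finally show "?g / ?K \<le> 2 / (?C * ?K) * (?C / 2 * ?g + ?n)" .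
    qed
    finally show ?thesis unfolding energy_form_square distrib_right .
  qed
  define M where "M = 2 + 2 / (?C * ?K)"
  have M: "M > 0" using C K by (simp add: M_def add_pos_pos)
  have "\<exists>N. \<forall>k\<ge>N. \<forall>l\<ge>N. Hs_norm s (\<lambda>x. \<phi> k x - \<phi> l x) < r" if r: "r > 0" for r
  proof -
    obtain N :: nat where N: "4 * M / r\<^sup>2 < real N" using reals_Archimedean2 by blast
    have "Hs_norm s (\<lambda>x. \<phi> k x - \<phi> l x) < r" if "k \<ge> N" "l \<ge> N" for k l
    proof (rule power2_less_imp_less)
      have le: "1 / (real j + 1) \<le> 1 / (real N + 1)" if "j \<ge> N" for j
        using that by (simp add: frac_le)
      have "(Hs_norm s (\<lambda>x. \<phi> k x - \<phi> l x))\<^sup>2 \<le> M * ?E (\<lambda>x. \<phi> k x - \<phi> l x) (\<lambda>x. \<phi> k x - \<phi> l x)"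
        using Hs_le by (simp add: M_def)
      also have "\<dots> \<le> M * (2 * (1 / (real k + 1)) + 2 * (1 / (real l + 1)))"
        using para[of k l] M by (intro mult_left_mono) auto
      also have "\<dots> \<le> M * (2 * (1 / (real N + 1)) + 2 * (1 / (real N + 1)))"
        using M le[OF that(1)] le[OF that(2)] by (intro mult_left_mono add_mono) auto
      also have "\<dots> = 4 * M / (real N + 1)" by simp
      also have "\<dots> < r\<^sup>2"
      proof -
        have "4 * M < real N * r\<^sup>2" using N r by (simp add: divide_less_eq)
        also have "\<dots> \<le> (real N + 1) * r\<^sup>2" by (intro mult_right_mono) auto
        finally show ?thesis by (simp add: divide_less_eq mult.commute)
      qed
      finally show "(Hs_norm s (\<lambda>x. \<phi> k x - \<phi> l x))\<^sup>2 < r\<^sup>2" .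
    qed (use r in simp)
    then show ?thesis by blast
  qed
  then obtain w where w: "w \<in> Hs s" "(\<lambda>k. Hs_norm s (\<lambda>x. \<phi> k x - w x)) \<longlonglongrightarrow> 0"
    using Hs_complete[of s \<phi>] s0 test_function_Hs[OF s0 \<phi>(1)] by blast
  have wl: "(\<lambda>k. Hs_norm s (\<lambda>x. w x - \<phi> k x)) \<longlonglongrightarrow> 0"
    using w(2) Hs_norm_minus_commute[OF s0 w(1) test_function_Hs[OF s0 \<phi>(1)]] by simp
  have wt: "w \<in> Hs_tilde s \<Omega>" by (rule Hs_tildeI_seq[OF w(1) \<phi>(1) wl])
  have wf: "w \<in> finite_energy s" by (rule Hs_tilde_finite_energy[OF wt s])
  have uf: "(\<lambda>x. f x + w x) \<in> finite_energy s" by (intro finite_energy_add ff wf)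
  have lim: "energy_tendsto s (\<lambda>k x. f x + \<phi> k x) (\<lambda>x. f x + w x)"
    by (rule energy_tendsto_add_const[OF Hs_tendsto_energy[OF wt s \<phi>(1) wl]])
  have pf: "(\<lambda>x. f x + \<phi> k x) \<in> finite_energy s" for k by (intro finite_energy_add ff tf \<phi>)
  have "(\<lambda>k. e (\<phi> k)) \<longlonglongrightarrow> e w" unfolding e_def by (rule energy_form_tendsto[OF pf uf lim pf uf lim])
  moreover have "(\<lambda>k. e (\<phi> k)) \<longlonglongrightarrow> ?d"
  proof (rule tendsto_sandwich[OF _ _ tendsto_const])
    show "\<forall>\<^sub>F k in sequentially. ?d \<le> e (\<phi> k)" using d \<phi>(1) by (intro always_eventually allI) blast
    show "\<forall>\<^sub>F k in sequentially. e (\<phi> k) \<le> ?d + 1 / (real k + 1)" using \<phi>(2) by (intro always_eventually allI less_imp_le)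
    have "(\<lambda>k. 1 / (real k + 1)) \<longlonglongrightarrow> 0" using LIMSEQ_inverse_real_of_nat by (simp add: inverse_eq_divide add.commute)
    from tendsto_add[OF tendsto_const this] show "(\<lambda>k. ?d + 1 / (real k + 1)) \<longlonglongrightarrow> ?d" by simp
  qed
  ultimately have ew: "e w = ?d" using LIMSEQ_unique by blast
  have test: "?E (\<lambda>x. f x + w x) \<psi> = 0" if \<psi>: "\<psi> \<in> test_functions \<Omega>" for \<psi>
  proof (rule quadratic_vanishing[where c="?E \<psi> \<psi>"])
    show "?E \<psi> \<psi> \<ge> 0" by (rule energy_form_nonneg[OF s])
    fix t :: real
    have t\<psi>: "(\<lambda>x. t * \<psi> x) \<in> finite_energy s" by (intro finite_energy_cmult tf \<psi>)
    have q: "?E (\<lambda>x. g x + t * \<psi> x) (\<lambda>x. g x + t * \<psi> x) = ?E g g + 2 * t * ?E g \<psi> + t\<^sup>2 * ?E \<psi> \<psi>" if g: "g \<in> finite_energy s" for g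
    proof -
      have gt: "(\<lambda>x. g x + t * \<psi> x) \<in> finite_energy s" by (intro finite_energy_add g t\<psi>)
      let ?gt = "\<lambda>x. g x + t * \<psi> x"
      have 1: "?E g ?gt = ?E g g + t * ?E g \<psi>"
        using energy_form_add[OF g t\<psi> g] energy_form_cmult[of s t \<psi> g] energy_form_commute[of s g ?gt] energy_form_commute[of s \<psi> g]
        by simp
      have 2: "?E \<psi> ?gt = ?E g \<psi> + t * ?E \<psi> \<psi>"
        using energy_form_add[OF g t\<psi> tf[OF \<psi>]] energy_form_cmult[of s t \<psi> \<psi>] energy_form_commute[of s \<psi> ?gt]
        by simp
      have "?E ?gt ?gt = ?E g ?gt + t * ?E \<psi> ?gt"
        using energy_form_add[OF g t\<psi> gt] energy_form_cmult[of s t \<psi> ?gt] by simp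
      then show ?thesis unfolding 1 2 by (simp add: power2_eq_square algebra_simps)
    qed
    \<comment> \<open>The infimum is over test functions and w need not be one. The competitors are
      therefore \<phi> k + t \<psi>, and k tends to infinity afterwards.\<close>
    have "?d \<le> ?E (\<lambda>x. f x + \<phi> k x) (\<lambda>x. f x + \<phi> k x) + 2 * t * ?E (\<lambda>x. f x + \<phi> k x) \<psi> + t\<^sup>2 * ?E \<psi> \<psi>" for k
    proof -
      have "?d \<le> e (\<lambda>x. \<phi> k x + t * \<psi> x)" by (intro d test_functions_add test_functions_cmult \<phi> \<psi>)
      also have "\<dots> = ?E (\<lambda>x. (f x + \<phi> k x) + t * \<psi> x) (\<lambda>x. (f x + \<phi> k x) + t * \<psi> x)"
        by (simp add: e_def add.assoc)
      finally show ?thesis unfolding q[OF pf] .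
    qed
    moreover have "(\<lambda>k. ?E (\<lambda>x. f x + \<phi> k x) (\<lambda>x. f x + \<phi> k x) + 2 * t * ?E (\<lambda>x. f x + \<phi> k x) \<psi> + t\<^sup>2 * ?E \<psi> \<psi>)
       \<longlonglongrightarrow> ?E (\<lambda>x. f x + w x) (\<lambda>x. f x + w x) + 2 * t * ?E (\<lambda>x. f x + w x) \<psi> + t\<^sup>2 * ?E \<psi> \<psi>"
      by (intro tendsto_add tendsto_mult tendsto_const energy_form_tendsto pf uf lim tf \<psi> energy_tendsto_const)
    ultimately have "?d \<le> ?E (\<lambda>x. f x + w x) (\<lambda>x. f x + w x) + 2 * t * ?E (\<lambda>x. f x + w x) \<psi> + t\<^sup>2 * ?E \<psi> \<psi>"
      by (intro LIMSEQ_le_const) auto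
    then show "0 \<le> 2 * t * ?E (\<lambda>x. f x + w x) \<psi> + t\<^sup>2 * ?E \<psi> \<psi>" using ew unfolding e_def by simp
  qed
  have "?E (\<lambda>x. f x + w x) \<psi> = 0" if \<psi>: "\<psi> \<in> Hs_tilde s \<Omega>" for \<psi>
  proof -
    obtain \<theta> where \<theta>: "\<And>k. \<theta> k \<in> test_functions \<Omega>" "energy_tendsto s \<theta> \<psi>"
      by (rule Hs_tilde_energy_seq[OF \<psi> s]) blast
    have "(\<lambda>k. ?E (\<lambda>x. f x + w x) (\<theta> k)) \<longlonglongrightarrow> ?E (\<lambda>x. f x + w x) \<psi>"
      by (intro energy_form_tendsto uf energy_tendsto_const tf \<theta> Hs_tilde_finite_energy[OF \<psi> s])
    then show ?thesis unfolding test[OF \<theta>(1)] by (simp add: LIMSEQ_const_iff)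
  qed
  then show ?thesis using that wt by blast
qed

section \<open>Bounded potentials as multipliers\<close>

lemma bounded_dist_test_function:
  fixes q :: "real^'n::finite \<Rightarrow> real"
  assumes q: "q \<in> borel_measurable borel" "\<And>x. \<bar>q x\<bar> \<le> Q" and \<phi>: "\<phi> \<in> test_functions U"
  shows "integrable lborel (\<lambda>x. q x * \<phi> x)"
proof (rule integrable_bounded_mult[where C=Q])
  show "integrable lborel \<phi>"
    using schwartz_integrable[OF test_function_schwartz[OF \<phi>]] by (simp only: complex_of_real_integrable_eq)
qed (use q in auto)

text \<open>A distribution of order 0: on a compact set the supremum of the test function controls
  the pairing, so the sum over derivatives is taken with N = 0.\<close>

lemma bounded_dist_distribution:
  fixes q :: "real^'n::finite \<Rightarrow> real"
  assumes q: "q \<in> borel_measurable borel" "\<And>x. \<bar>q x\<bar> \<le> Q"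
  shows "bounded_dist q \<in> distributions"
  unfolding distributions_def
proof (intro CollectI conjI ballI allI impI)
  have Q: "Q \<ge> 0" using q(2)[of 0] by linarith
  fix \<phi> \<psi> :: "real^'n \<Rightarrow> real" assume *: "\<phi> \<in> test_functions UNIV" "\<psi> \<in> test_functions UNIV"
  show "bounded_dist q (\<lambda>x. \<phi> x + \<psi> x) = bounded_dist q \<phi> + bounded_dist q \<psi>"
    unfolding bounded_dist_def distrib_left
    by (intro Bochner_Integration.integral_add bounded_dist_test_function[OF q *(1)] bounded_dist_test_function[OF q *(2)])
next
  fix \<phi> :: "real^'n \<Rightarrow> real" and c
  have "q x * (c * \<phi> x) = c * (q x * \<phi> x)" for x by simp
  then show "bounded_dist q (\<lambda>x. c * \<phi> x) = c * bounded_dist q \<phi>"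
    unfolding bounded_dist_def by (simp only: integral_mult_right_zero)
next
  have Q: "Q \<ge> 0" using q(2)[of 0] by linarith
  fix K :: "(real^'n) set" assume K: "compact K"
  obtain R where R: "K \<subseteq> cball 0 R"
    using bounded_subset_ballD[OF compact_imp_bounded[OF K], of 0] ball_subset_cball by blast
  let ?\<mu> = "\<integral>x. indicator (cball 0 R) x \<partial>(lborel :: (real^'n) measure)"
  show "\<exists>N C. \<forall>\<phi>\<in>test_functions K. \<bar>bounded_dist q \<phi>\<bar> \<le> C * (\<Sum>\<alpha> | length \<alpha> \<le> N. SUP x. \<bar>partial_derivs \<alpha> \<phi> x\<bar>)"
  proof (intro exI ballI)
    fix \<phi> :: "real^'n \<Rightarrow> real" assume \<phi>: "\<phi> \<in> test_functions K"
    obtain M where M: "\<And>x. \<bar>\<phi> x\<bar> \<le> M" using test_function_bounded[OF \<phi>] by metis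
    have bdd: "bdd_above (range (\<lambda>x. \<bar>\<phi> x\<bar>))" using M by (auto simp: bdd_above_def)
    let ?S = "SUP x. \<bar>\<phi> x\<bar>"
    have S: "\<bar>\<phi> x\<bar> \<le> ?S" for x using bdd by (intro cSUP_upper) auto
    have le: "norm (q x * \<phi> x) \<le> Q * ?S * indicator (cball 0 R) x" for x
    proof (cases "x \<in> cball 0 R")
      case True
      have "\<bar>q x\<bar> * \<bar>\<phi> x\<bar> \<le> Q * ?S" using Q by (intro mult_mono q(2) S) auto
      then show ?thesis using True by (simp add: abs_mult)
    next
      case False
      then have "\<phi> x = 0" using R test_functions_eq_0[OF \<phi>, of x] by blast
      then show ?thesis using False by simp
    qed
    have "norm (bounded_dist q \<phi>) \<le> (\<integral>x. norm (q x * \<phi> x) \<partial>lborel)"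
      unfolding bounded_dist_def by (rule integral_norm_bound)
    also have "\<dots> \<le> (\<integral>x. Q * ?S * indicator (cball 0 R) (x::real^'n) \<partial>lborel)"
    proof (rule Bochner_Integration.integral_mono)
      show "integrable lborel (\<lambda>x::real^'n. Q * ?S * indicator (cball 0 R) x)"
        by (intro integrable_mult_right integrable_real_indicator) (auto simp: emeasure_lborel_cball_finite[unfolded infinity_ennreal_def])
    qed (use bounded_dist_test_function[OF q \<phi>] le in auto)
    also have "\<dots> = (Q * ?\<mu>) * ?S" by simp
    also have "?S = (\<Sum>\<alpha> | length \<alpha> \<le> 0. SUP x. \<bar>partial_derivs \<alpha> \<phi> x\<bar>)"
    proof -
      have "{\<alpha> :: 'n list. length \<alpha> \<le> 0} = {[]}" by auto
      then show ?thesis by simp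
    qed
    finally show "\<bar>bounded_dist q \<phi>\<bar> \<le> (Q * ?\<mu>) * (\<Sum>\<alpha> | length \<alpha> \<le> 0. SUP x. \<bar>partial_derivs \<alpha> \<phi> x\<bar>)" by simp
  qed
qed

text \<open>Cauchy-Schwarz, with L^2 norms bounded by H^s norms.\<close>

lemma bounded_dist_multiplier:
  fixes q :: "real^'n::finite \<Rightarrow> real"
  assumes q: "q \<in> borel_measurable borel" "\<And>x. \<bar>q x\<bar> \<le> Q" and s: "s \<ge> 0"
  shows "bounded_dist q \<in> multipliers s"
proof -
  have Q: "Q \<ge> 0" using q(2)[of 0] by linarith
  have "y \<le> Q" if y: "y \<in> multiplier_values s (bounded_dist q)" for y
  proof -
    obtain u v :: "real^'n \<Rightarrow> real" where uv: "y = \<bar>bounded_dist q (\<lambda>x. u x * v x)\<bar>" "u \<in> test_functions UNIV" "v \<in> test_functions UNIV"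
      "Hs_norm s u = 1" "Hs_norm s v = 1" using y unfolding multiplier_values_def by blast
    note u = test_function_l2[OF uv(2)] and v = test_function_l2[OF uv(3)]
    have n: "l2_norm lborel u \<le> 1" "l2_norm lborel v \<le> 1"
      using l2_norm_le_Hs_norm[OF s test_function_Hs[OF s uv(2)]] l2_norm_le_Hs_norm[OF s test_function_Hs[OF s uv(3)]] uv(4,5) by auto
    have qm: "q \<in> borel_measurable lborel" using q(1) by simp
    have "y \<le> l2_norm lborel (\<lambda>x. q x * u x) * l2_norm lborel v"
      unfolding uv(1) bounded_dist_def mult.assoc[symmetric]
      by (intro l2_cauchy_schwarz l2_bounded_mult(1)[OF qm q(2)] u v)
    also have "\<dots> \<le> (Q * l2_norm lborel u) * l2_norm lborel v"
      by (intro mult_right_mono l2_bounded_mult(2)[OF qm q(2)] u) simp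
    also have "\<dots> \<le> (Q * 1) * 1"
      using n Q by (intro mult_mono mult_left_mono) (auto intro!: mult_nonneg_nonneg)
    finally show ?thesis by simp
  qed
  then show ?thesis
    using bounded_dist_distribution[OF q] by (auto simp: multipliers_def bdd_above_def)
qed

text \<open>Ensures that \<open>multiplier_values\<close> is nonempty: the multiplier norm is a real
  \<open>Sup\<close>, whose value on the empty set carries no information.\<close>

lemma exists_test_function_Hs_norm_1:
  assumes s: "s \<ge> 0" shows "\<exists>u::real^'n::finite \<Rightarrow> real. u \<in> test_functions UNIV \<and> Hs_norm s u = 1"
proof -
  let ?b = "bump (0::real^'n) 1"
  have b: "?b \<in> test_functions UNIV" by (rule bump_test_function) auto
  have "Hs_norm s ?b \<noteq> 0"
  proof
    assume "Hs_norm s ?b = 0"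
    then have "l2_norm lborel ?b = 0"
      using l2_norm_le_Hs_norm[OF s test_function_Hs[OF s b]] l2_norm_nonneg[of lborel ?b] by linarith
    then have "AE x in lborel. ?b x = 0" by (rule l2_norm_eq_0[OF test_function_l2[OF b]])
    then obtain x where "x \<in> ball (0::real^'n) 1" "?b x = 0" using AE_lborel_openD[of "\<lambda>x. ?b x = 0" "ball 0 1"] by auto
    then show False using bump_pos[of x 0 1] by (simp add: dist_norm)
  qed
  then have "Hs_norm s (\<lambda>x. (1 / Hs_norm s ?b) * ?b x) = 1"
    using Hs_norm_cmult[OF s test_function_Hs[OF s b], of "1 / Hs_norm s ?b"] Hs_norm_nonneg[of s ?b] by simp
  then show ?thesis using test_functions_cmult[OF b] by blast
qed

text \<open>Decompose as 0 + q. The zero functional has norm 0, below every positive \<delta>, and q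
  is the nonnegative part.\<close>

lemma nonneg_bounded_dist_small_plus_nonneg:
  fixes q :: "real^'n::finite \<Rightarrow> real"
  assumes q: "q \<in> borel_measurable borel" "\<And>x. \<bar>q x\<bar> \<le> Q" "\<And>x. q x \<ge> 0" and s: "s \<ge> 0" and \<delta>: "\<delta> > 0"
  shows "bounded_dist q \<in> small_plus_nonneg_multipliers \<delta> s"
proof -
  let ?z = "\<lambda>\<phi> :: real^'n \<Rightarrow> real. 0 :: real"
  have z: "?z = bounded_dist (\<lambda>x. 0)" by (simp add: bounded_dist_def fun_eq_iff)
  have "?z \<in> multipliers s" unfolding z by (rule bounded_dist_multiplier[where Q=0]) (use s in auto)
  moreover obtain u :: "real^'n \<Rightarrow> real" where u: "u \<in> test_functions UNIV" "Hs_norm s u = 1"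
    using exists_test_function_Hs_norm_1[OF s] by blast
  have "multiplier_values s ?z = {0}"
    unfolding multiplier_values_def using u by auto
  ultimately have "?z \<in> small_multipliers \<delta> s"
    using \<delta> by (simp add: small_multipliers_def multiplier_norm_def)
  moreover have "bounded_dist q \<in> nonneg_multipliers s"
    using bounded_dist_multiplier[OF q(1,2) s] q(3)
    by (auto simp: nonneg_multipliers_def bounded_dist_def intro!: Bochner_Integration.integral_nonneg)
  ultimately show ?thesis
    unfolding small_plus_nonneg_multipliers_def by (intro CollectI bexI[of _ ?z] bexI[of _ "bounded_dist q"]) auto
qed

section \<open>The two pairs of coefficients\<close>

text \<open>The substitution v = a u is used in both directions. For the inverse, |1/a(x) - 1/a(y)|
  \<le> |m(x) - m(y)| because a \<ge> 1.\<close>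

lemma smooth_multiplier_one_plus:
  fixes m :: "real^'n::finite \<Rightarrow> real"
  assumes m: "m \<in> test_functions U" "\<And>x. m x \<ge> 0"
  obtains B L where "smooth_multiplier (\<lambda>x. 1 + m x) B L" "smooth_multiplier (\<lambda>x. inverse (1 + m x)) B L"
proof -
  obtain B where B: "B \<ge> 0" "\<And>x. \<bar>m x\<bar> \<le> B" using test_function_bounded[OF m(1)] by metis
  obtain L where L: "L \<ge> 0" "\<And>x y. \<bar>m x - m y\<bar> \<le> L * min 1 (norm (x - y))" using test_function_lipschitz[OF m(1)] by metis
  have sm: "smooth (\<lambda>x. 1 + m x)" by (intro smooth_add smooth_const test_functionsD[OF m(1)])
  have p: "1 + m x \<ge> 1" for x using m(2)[of x] by simp
  have "smooth_multiplier (\<lambda>x. 1 + m x) (1 + B) L"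
    using sm B L m(2) unfolding smooth_multiplier_def by (auto simp: abs_le_iff)
  moreover have "smooth_multiplier (\<lambda>x. inverse (1 + m x)) (1 + B) L"
    unfolding smooth_multiplier_def
  proof (intro conjI allI)
    show "smooth (\<lambda>x. inverse (1 + m x))"
      by (rule smooth_inverse[OF sm]) (use p in \<open>smt (verit)\<close>)
    have i: "0 \<le> inverse (1 + m x)" "inverse (1 + m x) \<le> 1" for x
      using p[of x] by (auto simp: inverse_le_1_iff)
    show "\<bar>inverse (1 + m x)\<bar> \<le> 1 + B" for x using i[of x] B(1) by simp
    show "\<bar>inverse (1 + m x) - inverse (1 + m y)\<bar> \<le> L * min 1 (norm (x - y))" for x y
    proof -
      have "inverse (1 + m x) - inverse (1 + m y) = (m y - m x) * (inverse (1 + m x) * inverse (1 + m y))"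
        using p[of x] p[of y] by (simp add: field_simps)
      then have "\<bar>inverse (1 + m x) - inverse (1 + m y)\<bar> = \<bar>m x - m y\<bar> * (inverse (1 + m x) * inverse (1 + m y))"
        using i[of x] i[of y] by (simp add: abs_mult abs_minus_commute)
      also have "\<dots> \<le> \<bar>m x - m y\<bar> * (1 * 1)"
        by (intro mult_left_mono mult_mono i) auto
      finally show ?thesis using L(2)[of x y] by simp
    qed
  qed
  ultimately show ?thesis using that by blast
qed

lemma second_diff_integral_cmult:
  "second_diff_integral s (\<lambda>x. c * m x) x = c * second_diff_integral s m x"
proof -
  have "second_diff (\<lambda>x. c * m x) x z * frac_kernel s z = c * (second_diff m x z * frac_kernel s z)" for z
    by (simp add: second_diff_def algebra_simps)
  then show ?thesis unfolding second_diff_integral_def by (simp only: integral_mult_right_zero)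
qed

lemma conductivity_form_1:
  "conductivity_form s (\<lambda>x. 1) u v + (\<integral>x. 1 * u x * v x \<partial>lborel) = energy_form s u v"
  by (simp add: conductivity_form_eq energy_form_def)

lemma continuous_L_infinity:
  "continuous_on UNIV \<gamma> \<Longrightarrow> (\<And>x. \<bar>\<gamma> x\<bar> \<le> C) \<Longrightarrow> \<gamma> \<in> Lp \<infinity> UNIV"
  by (auto simp: Lp_def set_borel_measurable_def intro!: exI[of _ C] borel_measurable_continuous_onI)

lemma bounded_Lp_loc_infinity:
  assumes "g \<in> borel_measurable borel" "\<And>x. \<bar>g x\<bar> \<le> C" shows "g \<in> Lp_loc \<infinity> W"
  unfolding Lp_loc_def Lp_def set_borel_measurable_def
proof (intro CollectI allI impI conjI)
  fix K :: "(real^'a) set" assume "compact K \<and> K \<subseteq> W"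
  then have [measurable]: "K \<in> sets borel" by (simp add: borel_compact)
  have [measurable]: "g \<in> borel_measurable borel" by fact
  show "(\<lambda>x. indicator K x *\<^sub>R g x) \<in> borel_measurable lborel" by measurable
  show "if \<infinity> = \<infinity> then \<exists>C. AE x in lborel. x \<in> K \<longrightarrow> \<bar>g x\<bar> \<le> C
        else set_integrable lborel K (\<lambda>x. \<bar>g x\<bar> powr real_of_ereal \<infinity>)"
    using assms(2) by auto
qed

theorem theorem1p4:
  fixes \<Omega> W :: "(real^'n::finite) set" and s :: real
  assumes "0 < s" and "s < min 1 (real CARD('n) / 2)"
    and "open \<Omega>" and "connected \<Omega>" and "\<Omega> \<noteq> {}"
    and "bounded_in_one_direction \<Omega>"
    and "measurement_set \<Omega> W"
  shows "\<exists>(\<gamma>1 :: real^'n \<Rightarrow> real) (\<gamma>2 :: real^'n \<Rightarrow> real)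
          (q1 :: (real^'n \<Rightarrow> real) \<Rightarrow> real) (q2 :: (real^'n \<Rightarrow> real) \<Rightarrow> real)
          (\<gamma>0 :: real) (p :: ereal).
     \<not> same_pair (\<gamma>1, q1) (\<gamma>2, q2) \<and>
     \<gamma>1 \<in> Lp \<infinity> UNIV \<and> \<gamma>2 \<in> Lp \<infinity> UNIV \<and>
     background_deviation \<gamma>1 \<in> sobolev s (real CARD('n) / s) \<and>
     background_deviation \<gamma>2 \<in> sobolev s (real CARD('n) / s) \<and>
     q1 \<in> distributions \<and> q2 \<in> distributions \<and>
     \<gamma>0 > 0 \<and> uniformly_elliptic \<gamma>0 \<gamma>1 \<and> uniformly_elliptic \<gamma>0 \<gamma>2 \<and>
     ae_continuous_in W \<gamma>1 \<and> ae_continuous_in W \<gamma>2 \<and>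
     q1 \<in> small_plus_nonneg_multipliers (\<gamma>0 / delta0 s \<Omega>) s \<and>
     q2 \<in> small_plus_nonneg_multipliers (\<gamma>0 / delta0 s \<Omega>) s \<and>
     ereal (real CARD('n) / (2 * s)) < p \<and>
     (\<forall>f\<in>test_functions W. \<forall>g\<in>test_functions W.
        dn_map s \<Omega> \<gamma>1 q1 f g = dn_map s \<Omega> \<gamma>2 q2 f g) \<and>
     (\<exists>g1\<in>Lp_loc p W. \<exists>g2\<in>Lp_loc p W. represents_on W g1 q1 \<and> represents_on W g2 q2 \<and>
        (\<forall>x\<in>W. g1 x \<noteq> g2 x))"
proof -
  let ?C = "frac_const TYPE('n) s"
  have s: "0 < s" "s < 1" and s0: "s \<ge> 0" using assms(1,2) by auto
  have p: "real CARD('n) / s \<ge> 1" using assms(1,2) by (simp add: pos_le_divide_eq)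
  have C: "?C > 0" by (rule frac_const_pos[OF s])
  have W: "open W" "W \<subseteq> - closure \<Omega>" using assms(7) by (auto simp: measurement_set_def)
  have disj: "x \<notin> \<Omega>" if "x \<in> W" for x using that W(2) closure_subset by blast
  obtain c where "c \<in> \<Omega>" using assms(5) by blast
  then obtain r where r: "r > 0" "cball c r \<subseteq> \<Omega>" using assms(3) open_contains_cball by blast
  let ?\<eta> = "bump c r"
  have \<eta>: "?\<eta> \<in> test_functions \<Omega>" by (rule bump_test_function) (use r in auto)
  obtain D where D: "D \<ge> 0" "\<And>x. \<bar>second_diff_integral s ?\<eta> x\<bar> \<le> D"
    using second_diff_integral_bounded[OF \<eta> s] by metis
  \<comment> \<open>Chosen to give |(-\<Delta>)^s m| \<le> 1/2; the 1 in the denominator covers D =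
    0.\<close>
  define \<epsilon> where "\<epsilon> = 1 / (1 + ?C * D)"
  have \<epsilon>: "\<epsilon> > 0" "?C / 2 * (\<epsilon> * D) \<le> 1 / 2"
  proof -
    have "?C * D \<ge> 0" using C D by simp
    then show "\<epsilon> > 0" "?C / 2 * (\<epsilon> * D) \<le> 1 / 2"
      unfolding \<epsilon>_def by (auto simp: field_simps)
  qed
  define m where "m x = \<epsilon> * ?\<eta> x" for x
  define a where "a x = 1 + m x" for x
  \<comment> \<open>This is (-\<Delta>)^s m.\<close>
  define Q where "Q x = ?C / 2 * second_diff_integral s m x" for x
  define q where "q x = (a x)\<^sup>2 + a x * Q x" for x
  have m: "m \<in> test_functions \<Omega>" unfolding m_def by (rule test_functions_cmult[OF \<eta>])
  have m0: "m x \<ge> 0" for x using \<epsilon>(1) by (simp add: m_def bump_nonneg)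
  have m1: "m x \<le> \<epsilon>" for x using mult_left_mono[OF bump_le_1[of c r x], of \<epsilon>] \<epsilon>(1) by (simp add: m_def)
  have a1: "a x \<ge> 1" and a2: "a x \<le> 1 + \<epsilon>" for x using m0[of x] m1[of x] by (auto simp: a_def)
  have aW: "a x = 1" "m x = 0" if "x \<in> W" for x
    using test_functions_eq_0[OF m disj[OF that]] by (auto simp: a_def)
  have Q: "\<bar>Q x\<bar> \<le> 1 / 2" for x
  proof -
    have "\<bar>Q x\<bar> = ?C / 2 * (\<epsilon> * \<bar>second_diff_integral s ?\<eta> x\<bar>)"
      using C \<epsilon>(1) unfolding Q_def m_def[abs_def] second_diff_integral_cmult by (simp add: abs_mult)
    also have "\<dots> \<le> ?C / 2 * (\<epsilon> * D)" using C \<epsilon>(1) D(2) by (intro mult_left_mono) auto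
    finally show ?thesis using \<epsilon>(2) by simp
  qed
  \<comment> \<open>m is nonnegative, vanishes at x because x lies outside \<Omega>, and is positive
    at the centre c.\<close>
  have QW: "Q x < 0" if "x \<in> W" for x
  proof -
    have "m c > 0" using bump_pos[of c c r] r(1) \<epsilon>(1) by (simp add: m_def)
    from integral_second_diff_neg[OF m s m0 aW(2)[OF that] this]
    show ?thesis using C by (simp add: Q_def second_diff_integral_def mult_pos_neg)
  qed
  have mm: "m \<in> borel_measurable borel" by (rule test_function_measurable[OF m])
  have Qm: "Q \<in> borel_measurable borel"
    using second_diff_integral_measurable[OF mm, of s] unfolding Q_def[abs_def] by simp
  have am: "a \<in> borel_measurable borel" unfolding a_def[abs_def] using mm by simp
  have qm: "q \<in> borel_measurable borel" unfolding q_def[abs_def] using am Qm by simp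
  \<comment> \<open>Since a \<ge> 1 and |Q| \<le> 1/2, both factors are positive.\<close>
  have q_factor: "q x = a x * (a x + Q x)" for x by (simp add: q_def power2_eq_square distrib_left)
  have aQ: "1 / 2 \<le> a x + Q x" "a x + Q x \<le> 2 + \<epsilon>" for x
    using a1[of x] a2[of x] Q[of x] by (auto simp: abs_le_iff)
  have q0: "q x \<ge> 0" for x
    unfolding q_factor using a1[of x] aQ[of x] by (intro mult_nonneg_nonneg) auto
  have qB: "\<bar>q x\<bar> \<le> (1 + \<epsilon>) * (2 + \<epsilon>)" for x
  proof -
    have "q x \<le> (1 + \<epsilon>) * (2 + \<epsilon>)"
      unfolding q_factor using a1[of x] aQ[of x] \<epsilon>(1) by (intro mult_mono a2 aQ) auto
    then show ?thesis using q0[of x] by simp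
  qed
  obtain B L where mult: "smooth_multiplier (\<lambda>x. 1 + m x) B L" "smooth_multiplier (\<lambda>x. inverse (1 + m x)) B L"
    using smooth_multiplier_one_plus[OF m m0] by metis
  then have ma: "smooth_multiplier a B L" and mi: "smooth_multiplier (\<lambda>x. inverse (a x)) B L"
    by (simp_all add: a_def[abs_def])
  have sma: "smooth a" using ma by (simp add: smooth_multiplier_def)
  let ?\<gamma>1 = "\<lambda>x::real^'n. 1::real" and ?\<gamma>2 = "\<lambda>x. (a x)\<^sup>2"
  let ?q1 = "bounded_dist (\<lambda>x::real^'n. 1)" and ?q2 = "bounded_dist q"
  have sq: "sqrt ((a x)\<^sup>2) = a x" for x using a1[of x] by simp
  have a_inv: "a x * (inverse (a x) * t) = t" "inverse (a x) * (a x * t) = t" for x t using a1[of x] by auto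
  have f1: "full_form s ?\<gamma>1 ?q1 u v = energy_form s u v" if "u \<in> Hs_tilde s UNIV" "v \<in> Hs_tilde s UNIV" for u v
    unfolding full_form_def conductivity_form_1[symmetric]
    by (subst multiplier_form_bounded[where Q=1, OF _ _ s0 that]) auto
  \<comment> \<open>The Liouville reduction applies because a is positive, so the square root of the
    conductivity a^2 is a.\<close>
  have f2: "full_form s ?\<gamma>2 ?q2 u v = energy_form s (\<lambda>x. a x * u x) (\<lambda>x. a x * v x)" if "u \<in> Hs_tilde s UNIV" "v \<in> Hs_tilde s UNIV" for u v
    unfolding full_form_def conductivity_form_eq multiplier_form_bounded[OF qm qB s0 that] sq
    using liouville_reduction[OF s m mult(1) that] unfolding a_def Q_def q_def .
  have tW: "f \<in> test_functions UNIV" if "f \<in> test_functions W" for f using that by (rule test_functions_UNIV)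
  \<comment> \<open>a = 1 on W and f vanishes off W, so the substitution v = a u leaves exterior
    data unchanged.\<close>
  have aft: "a x * f x = f x" if "f \<in> test_functions W" for f x
    using aW(1)[of x] test_functions_eq_0[OF that, of x] by (cases "x \<in> W") auto
  have dn: "dn_map s \<Omega> ?\<gamma>1 ?q1 f g = dn_map s \<Omega> ?\<gamma>2 ?q2 f g" if f: "f \<in> test_functions W" and g: "g \<in> test_functions W" for f g
  proof -
    have fV: "f \<in> Hs_tilde s UNIV" and gV: "g \<in> Hs_tilde s UNIV"
      using test_function_Hs_tilde[OF s0] tW f g by auto
    have V: "u \<in> Hs_tilde s UNIV" if "(\<lambda>x. u x - f x) \<in> Hs_tilde s \<Omega>" for u
      using Hs_tilde_add[OF s0 Hs_tilde_UNIV[OF that] fV] by simp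
    have HU: "\<phi> \<in> Hs_tilde s UNIV" if "\<phi> \<in> Hs_tilde s \<Omega>" for \<phi> using that by (rule Hs_tilde_UNIV)
    \<comment> \<open>Membership of u in H^s is implied, as u is f plus an element of
      \<open>Hs_tilde s \<Omega>\<close>.\<close>
    have w1: "weak_solution s \<Omega> ?\<gamma>1 ?q1 f u \<longleftrightarrow> (\<lambda>x. u x - f x) \<in> Hs_tilde s \<Omega> \<and> (\<forall>\<phi>\<in>Hs_tilde s \<Omega>. energy_form s u \<phi> = 0)" for u
      unfolding weak_solution_def using Hs_tilde_Hs[OF V] by (auto simp: f1[OF V HU])
    have w2: "weak_solution s \<Omega> ?\<gamma>2 ?q2 f u \<longleftrightarrow> (\<lambda>x. u x - f x) \<in> Hs_tilde s \<Omega> \<and> (\<forall>\<phi>\<in>Hs_tilde s \<Omega>. energy_form s (\<lambda>x. a x * u x) (\<lambda>x. a x * \<phi> x) = 0)" for u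
      unfolding weak_solution_def using Hs_tilde_Hs[OF V] by (auto simp: f2[OF V HU])
    obtain w where w: "w \<in> Hs_tilde s \<Omega>" "\<And>\<phi>. \<phi> \<in> Hs_tilde s \<Omega> \<Longrightarrow> energy_form s (\<lambda>x. f x + w x) \<phi> = 0"
      using energy_minimizer[OF s tW[OF f]] by metis
    have ex1: "weak_solution s \<Omega> ?\<gamma>1 ?q1 f (\<lambda>x. f x + w x)" unfolding w1 using w by simp
    \<comment> \<open>Undoes the substitution. The boundary condition holds because a^(-1) (f + w) -
      f = a^(-1) w, by a f = f.\<close>
    have ex2: "weak_solution s \<Omega> ?\<gamma>2 ?q2 f (\<lambda>x. inverse (a x) * (f x + w x))"
      unfolding w2 a_inv
    proof (intro conjI ballI)
      have "inverse (a x) * (f x + w x) - f x = inverse (a x) * w x" for x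
        using a_inv(2)[of x "f x"] aft[OF f, of x] by (simp add: algebra_simps)
      then show "(\<lambda>x. inverse (a x) * (f x + w x) - f x) \<in> Hs_tilde s \<Omega>" using Hs_tilde_mult[OF mi s w(1)] by simp
      show "energy_form s (\<lambda>x. f x + w x) (\<lambda>x. a x * \<phi> x) = 0" if "\<phi> \<in> Hs_tilde s \<Omega>" for \<phi>
        by (rule w(2)[OF Hs_tilde_mult[OF ma s that]])
    qed
    \<comment> \<open>The solutions are those returned by the choice operator inside
      \<open>dn_map\<close>; only their boundary conditions and weak equations are
      available.\<close>
    define u1 where "u1 = (SOME u. weak_solution s \<Omega> ?\<gamma>1 ?q1 f u)"
    define u2 where "u2 = (SOME u. weak_solution s \<Omega> ?\<gamma>2 ?q2 f u)"
    have "weak_solution s \<Omega> ?\<gamma>1 ?q1 f u1" unfolding u1_def by (rule someI[of "weak_solution s \<Omega> ?\<gamma>1 ?q1 f", OF ex1])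
    then have u1: "(\<lambda>x. u1 x - f x) \<in> Hs_tilde s \<Omega>" "\<And>\<phi>. \<phi> \<in> Hs_tilde s \<Omega> \<Longrightarrow> energy_form s u1 \<phi> = 0"
      unfolding w1 by auto
    have "weak_solution s \<Omega> ?\<gamma>2 ?q2 f u2" unfolding u2_def by (rule someI[of "weak_solution s \<Omega> ?\<gamma>2 ?q2 f", OF ex2])
    then have u2: "(\<lambda>x. u2 x - f x) \<in> Hs_tilde s \<Omega>"
      "\<And>\<phi>. \<phi> \<in> Hs_tilde s \<Omega> \<Longrightarrow> energy_form s (\<lambda>x. a x * u2 x) (\<lambda>x. a x * \<phi> x) = 0"
      unfolding w2 by auto
    let ?v = "\<lambda>x. a x * u2 x"
    have vV: "?v \<in> Hs_tilde s UNIV" by (rule Hs_tilde_mult[OF ma s V[OF u2(1)]])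
    \<comment> \<open>Every \<phi> in \<open>Hs_tilde s \<Omega>\<close> has the form a times an
      admissible function, namely a^(-1) \<phi>.\<close>
    have v0: "energy_form s ?v \<phi> = 0" if "\<phi> \<in> Hs_tilde s \<Omega>" for \<phi>
      using u2(2)[OF Hs_tilde_mult[OF mi s that]] unfolding a_inv .
    \<comment> \<open>By a f = f this function is a u2 - u1, so the difference is itself admissible
      in both weak equations.\<close>
    have "(\<lambda>x. a x * (u2 x - f x) - (u1 x - f x)) \<in> Hs_tilde s \<Omega>"
      by (intro Hs_tilde_diff s0 Hs_tilde_mult[OF ma s u2(1)] u1(1))
    then have d: "(\<lambda>x. ?v x - u1 x) \<in> Hs_tilde s \<Omega>"
      by (simp add: right_diff_distrib aft[OF f])
    note fin = Hs_tilde_finite_energy[OF vV s] Hs_tilde_finite_energy[OF V[OF u1(1)] s]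
    note fd = Hs_tilde_finite_energy[OF d s] and fg = Hs_tilde_finite_energy[OF gV s]
    \<comment> \<open>Tested with itself the difference has energy 0, and so its pairing with the
      exterior function g vanishes too.\<close>
    have "energy_form s (\<lambda>x. ?v x - u1 x) (\<lambda>x. ?v x - u1 x) = 0"
      using energy_form_diff[OF fin fd] v0[OF d] u1(2)[OF d] by simp
    then have "energy_form s (\<lambda>x. ?v x - u1 x) g = 0" by (rule energy_form_eq_0[OF s fd _ fg])
    then have eq: "energy_form s ?v g = energy_form s u1 g" using energy_form_diff[OF fin fg] by simp
    have "dn_map s \<Omega> ?\<gamma>2 ?q2 f g = energy_form s ?v (\<lambda>x. a x * g x)"
      unfolding dn_map_def u2_def[symmetric] by (rule f2[OF V[OF u2(1)] gV])
    also have "\<dots> = energy_form s u1 g" unfolding aft[OF g] by (rule eq)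
    also have "\<dots> = dn_map s \<Omega> ?\<gamma>1 ?q1 f g"
      unfolding dn_map_def u1_def[symmetric] by (rule f1[OF V[OF u1(1)] gV, symmetric])
    finally show ?thesis ..
  qed
  \<comment> \<open>The conductivities already differ, on the ball where the bump is
    positive.\<close>
  have ne: "\<not> same_pair (?\<gamma>1, ?q1) (?\<gamma>2, ?q2)"
  proof
    assume "same_pair (?\<gamma>1, ?q1) (?\<gamma>2, ?q2)"
    then have "AE x in lborel. 1 = (a x)\<^sup>2" by (simp add: same_pair_def)
    then obtain x where x: "x \<in> ball c r" "1 = (a x)\<^sup>2"
      using AE_lborel_openD[of "\<lambda>x. 1 = (a x)\<^sup>2" "ball c r"] r(1) by auto
    have "m x > 0" using x(1) \<epsilon>(1) bump_pos[of x c r] by (simp add: m_def dist_norm norm_minus_commute)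
    then have "a x > 1" by (simp add: a_def)
    then show False using x(2) one_less_power[of "a x" 2] by simp
  qed
  have ca: "continuous_on UNIV a" by (rule smooth_continuous_on[OF sma])
  have L1: "?\<gamma>1 \<in> Lp \<infinity> UNIV" by (rule continuous_L_infinity[where C=1]) auto
  have L2: "?\<gamma>2 \<in> Lp \<infinity> UNIV"
  proof (rule continuous_L_infinity[where C="(1 + \<epsilon>)\<^sup>2"])
    show "continuous_on UNIV ?\<gamma>2" by (intro continuous_intros ca)
    show "\<bar>(a x)\<^sup>2\<bar> \<le> (1 + \<epsilon>)\<^sup>2" for x using power_mono[OF a2[of x], of 2] a1[of x] by simp
  qed
  have z: "(\<lambda>x::real^'n. 0) \<in> test_functions UNIV" by (rule test_functionsI[where K="{}"]) auto
  have B1: "background_deviation ?\<gamma>1 \<in> sobolev s (real CARD('n) / s)"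
    using test_function_sobolev[OF z p] by (simp add: background_deviation_def[abs_def])
  have "background_deviation ?\<gamma>2 = m"
    by (rule ext, unfold background_deviation_def sq) (simp add: a_def)
  then have B2: "background_deviation ?\<gamma>2 \<in> sobolev s (real CARD('n) / s)"
    using test_function_sobolev[OF m p] by simp
  \<comment> \<open>The common ellipticity bound \<gamma>0 is 1, because a \<ge> 1.\<close>
  have d0: "1 / delta0 s \<Omega> > 0" by (simp add: delta0_def)
  have S1: "?q1 \<in> small_plus_nonneg_multipliers (1 / delta0 s \<Omega>) s"
    by (rule nonneg_bounded_dist_small_plus_nonneg[where Q=1, OF _ _ _ s0 d0]) auto
  have S2: "?q2 \<in> small_plus_nonneg_multipliers (1 / delta0 s \<Omega>) s"
    by (rule nonneg_bounded_dist_small_plus_nonneg[OF qm qB q0 s0 d0])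
  have D1: "?q1 \<in> distributions" by (rule bounded_dist_distribution[where Q=1]) auto
  have D2: "?q2 \<in> distributions" by (rule bounded_dist_distribution[OF qm qB])
  have E1: "uniformly_elliptic 1 ?\<gamma>1" by (simp add: uniformly_elliptic_def)
  have E2: "uniformly_elliptic 1 ?\<gamma>2" using a1 by (simp add: uniformly_elliptic_def)
  have A1: "ae_continuous_in W ?\<gamma>1" by (simp add: ae_continuous_in_def)
  have A2: "ae_continuous_in W ?\<gamma>2"
    using ca by (auto simp: ae_continuous_in_def continuous_on_eq_continuous_at intro!: AE_I2 continuous_intros)
  have P1: "(\<lambda>x::real^'n. 1) \<in> Lp_loc \<infinity> W" by (rule bounded_Lp_loc_infinity[where C=1]) auto
  have P2: "q \<in> Lp_loc \<infinity> W" by (rule bounded_Lp_loc_infinity[OF qm qB])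
  have R1: "represents_on W (\<lambda>x. 1) ?q1"
    unfolding represents_on_def by (intro ballI conjI bounded_dist_test_function[where Q=1]) (auto simp: bounded_dist_def)
  have R2: "represents_on W q ?q2"
    unfolding represents_on_def by (intro ballI conjI bounded_dist_test_function[OF qm qB]) (auto simp: bounded_dist_def)
  \<comment> \<open>On W the representative q equals 1 + Q with Q < 0, at every point and not only
    almost everywhere.\<close>
  have N: "\<forall>x\<in>W. 1 \<noteq> q x"
  proof
    fix x assume x: "x \<in> W"
    then show "1 \<noteq> q x" using QW[OF x] aW(1)[OF x] by (simp add: q_def)
  qed
  \<comment> \<open>The exponent p is \<infinity>, both potentials being bounded.\<close>
  have final: "ereal (real CARD('n) / (2 * s)) < \<infinity>" by simp
  show ?thesis
    by (intro exI[of _ ?\<gamma>1] exI[of _ ?\<gamma>2] exI[of _ ?q1] exI[of _ ?q2] exI[of _ "1::real"] exI[of _ "\<infinity>::ereal"] conjI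
        ne L1 L2 B1 B2 D1 D2 zero_less_one E1 E2 A1 A2 S1 S2 final ballI dn
        bexI[of _ "\<lambda>x. 1"] bexI[of _ q] R1 R2 P1 P2 N[rule_format])
qed

end
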